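(* Let $\{\mathcal{A},\mathcal{G},\mathcal{G}',\chi\}$ be a reliable Long-Moody system such that the groups $H_0$ and $H$ are free, and let $d\in\mathbb{N}$. Then the associated Long-Moody functor induces a functor $$\mathcal{P}ol_{d}(\mathfrak{U}\mathcal{G},R\text{-}\mathfrak{Mod})/\mathcal{P}ol_{d-1}(\mathfrak{U}\mathcal{G},R\text{-}\mathfrak{Mod})\longrightarrow\mathcal{P}ol_{d+1}(\mathfrak{U}\mathcal{G},R\text{-}\mathfrak{Mod})/\mathcal{P}ol_{d}(\mathfrak{U}\mathcal{G},R\text{-}\mathfrak{Mod}).$$
   Context: $R$ is a fixed non-trivial commutative ring; $\mathfrak{Gr}$ is the category of groups, $*$ the free product; $\mathbf{Fct}(\mathfrak{C},\mathfrak{D})$ is the category of functors. For a group $G$, $\mathcal{I}_{R[G]}$ is the augmentation ideal (a right $R[G]$-module), functorial in $G$ via $\mathcal{I}_{R[-]}$. Quillen's bracket construction. For a strict monoidal groupoid $(\mathcal{G}',\natural,0)$, $\mathfrak{U}\mathcal{G}'$ has the same objects; a morphism $A\to B$ is a class $[X,f]$ of pairs with $f:X\natural A\to B$ in $\mathcal{G}'$, where $(X,f)\sim(X',f')$ iff there is an isomorphism $\psi:X\to X'$ with $f'\circ(\psi\natural id_A)=f$; $[Y,g]\circ[X,f]=[Y\natural X,g\circ(id_Y\natural f)]$; identities $[0,id]$. A morphism $\varphi$ of $\mathcal{G}'$ is identified with $[0,\varphi]$; $0$ is initial in $\mathfrak{U}\mathcal{G}'$ and $\iota_X:0\to X$ is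 the unique morphism. If $\mathcal{G}'$ has a braiding $b$, $\mathfrak{U}\mathcal{G}'$ is strict monoidal with $[X,f]\natural[Y,g]=[X\natural Y,(f\natural g)\circ(id_X\natural b_{A,Y}^{-1}\natural id_C)]$ for $[X,f]:A\to B$, $[Y,g]:C\to D$. Setting. $(\mathcal{G}',\natural,0,b)$ is a locally small strict braided monoidal groupoid with no zero divisors ($A\natural B\cong0$ iff $A\cong B\cong 0$) and $\mathrm{Aut}(0)=\{id_0\}$; $\underline{0},1$ are fixed objects with $1\not\cong 0$; $\underline{n}=1^{\natural n}\natural\underline{0}$, and $n$ also denotes $1^{\natural n}$. $\mathcal{G}$ is the full subgroupoid of $\mathcal{G}'$ on $\{\underline{n}\}_{n\in\mathbb{N}}$, $G_n=\mathrm{Aut}(\underline{n})$, and $\mathfrak{U}\mathcal{G}$ is the full subcategory of $\mathfrak{U}\mathcal{G}'$ on $\{\underline{n}\}_{n\in\mathbb{N}}$. Convention: every morphism $\underline{n}\to\underline{n'}$ of $\mathfrak{U}\mathcal{G}$ is of the form $[1^{\natural(n'-n)},g]$ with $n'\ge n$, $g\in G_{n'}$. Long-Moody systems. For $\mathcal{A}:\mathfrak{U}\mathcal{G}\to\mathfrak{Gr}$, the Grothendieck construction $\int^{\mathfrak{U}\mathcal{G}}\mathcal{A}$ has objects $\underline{n}$, morphisms $\underline{n}\to\underline{n'}$ the pairs $(h,\varphi)$ with $\varphi\in\mathrm{Hom}_{\mathfrak{U}\mathcal{G}}(\underline n,\underline n')$, $h\in\mathcal{A}(\underline{n'})$, and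 composition $(h',\varphi')\circ(h,\varphi)=(h'\mathcal{A}(\varphi')(h),\varphi'\varphi)$; $\mathfrak{s}_{\mathcal{A}}(\varphi)=(e,\varphi)$; similarly over $\mathcal{G}$. $\{\mathcal{A},\mathcal{G},\mathcal{G}',\chi\}$ is a coherent Long-Moody system if $\chi:\int^{\mathcal{G}}\mathcal{A}\to\mathcal{G}$ is a functor with $\chi\circ\mathfrak{s}_{\mathcal{A}}=1\natural-$ which extends to a functor $\chi:\int^{\mathfrak{U}\mathcal{G}}\mathcal{A}\to\mathfrak{U}\mathcal{G}$ with $\chi\circ\mathfrak{s}_{\mathcal{A}}=1\natural-$. Put $\chi_n(h)=\chi(h,id_{\underline{n}})$, $\chi_n:\mathcal{A}(\underline{n})\to G_{n+1}$. Its Long-Moody functor is the endofunctor $\mathbf{LM}$ of $\mathbf{Fct}(\mathfrak{U}\mathcal{G},R\text{-}\mathfrak{Mod})$ with $\mathbf{LM}(F)(\underline{n})=\mathcal{I}_{R[\mathcal{A}(\underline{n})]}\otimes_{R[\mathcal{A}(\underline{n})]}F(\underline{n+1})$ ($F(\underline{n+1})$ a left module via $F\circ\chi_n$), $\mathbf{LM}(F)(\varphi)(i\otimes v)=\mathcal{I}_{R[-]}(\mathcal{A}(\varphi))(i)\otimes F(id_1\natural\varphi)(v)$, and $\mathbf{LM}(\eta)_{\underline{n}}=id\otimes\eta_{\underline{n+1}}$. Reliable. A coherent Long-Moody system is reliable if: $\mathcal{A}$ is the restriction of a functor $\mathfrak{U}\mathcal{G}'\to\mathfrak{Gr}$ (still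 denoted $\mathcal{A}$); there are groups $H_0$ and $H$, with $H$ non-trivial, such that $\mathcal{A}(1^{\natural m})=H^{*m}$ and $\mathcal{A}(\underline{n})=H_n:=H^{*n}*H_0$ for all $m,n$; for all finite monoidal products $X,Y$ of the objects $0,\underline{0},1$ one has $\mathcal{A}(\iota_X\natural id_Y)=\iota_{\mathcal{A}(X)}*id_{\mathcal{A}(Y)}$ and $\mathcal{A}(id_Y\natural\iota_X)=id_{\mathcal{A}(Y)}*\iota_{\mathcal{A}(X)}$ (in particular $\mathcal{A}(X\natural Y)=\mathcal{A}(X)*\mathcal{A}(Y)$; $\iota_G$ is the morphism from the trivial group to $G$); and for all $n$ and $h\in H_n$, in $G_{n+2}$: $(b_{1,1}^{-1}\natural id_{\underline{n}})\circ(id_1\natural\chi_n(h))=\chi_{n+1}((\iota_H*id_{H_n})(h))\circ(b_{1,1}^{-1}\natural id_{\underline{n}})$. Weak polynomiality. Let $\mathrm{Obj}_\natural$ be the set of objects $m$ of $\mathfrak{U}\mathcal{G}'$ such that $m\natural\underline{n}$ is an object of $\mathfrak{U}\mathcal{G}$ for all $n$. For $m\in\mathrm{Obj}_\natural$, $\tau_m(F)=F(m\natural-)$, $i_m:Id\to\tau_m$ is induced by $\iota_m\natural id$, $\delta_m=\mathrm{coker}(i_m)$, $\kappa_m=\ker(i_m)$. Put $\kappa(F)=\sum_{m\in\mathrm{Obj}_\natural}\kappa_m(F)\subseteq F$; $K$ is the full subcategory of $F$ with $\kappa(F)=F$, a thick (Serre) subcategory; $\mathbf{St}(\mathfrak{U}\mathcal{G},R\text{-}\mathfrak{Mod})=\mathbf{Fct}(\mathfrak{U}\mathcal{G},R\text{-}\mathfrak{Mod})/K$;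 $\delta_m$ induces an exact endofunctor of $\mathbf{St}$. $\mathcal{P}ol_d(\mathfrak{U}\mathcal{G},R\text{-}\mathfrak{Mod})$ is the full subcategory of $\mathbf{St}$ consisting of zero objects if $d<0$ and, if $d\ge0$, of those $F$ with $\delta_m(F)\in\mathcal{P}ol_{d-1}$ for all $m\in\mathrm{Obj}_\natural$; these are thick subcategories, and the quotients are quotients of abelian categories by thick subcategories. "$\mathbf{LM}$ induces" means: $\mathbf{LM}$ preserves $K$, hence induces an endofunctor $\mathbf{LM}_{\mathbf{St}}$ of $\mathbf{St}$, which restricts to $\mathcal{P}ol_d\to\mathcal{P}ol_{d+1}$ and passes to the quotients. *)

theory Defs
  imports "HOL-Algebra.Module" "HOL-Algebra.AbelCoset" "HOL-Library.Equipollence"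
begin

section \<open>Categories and functors\<close>

record ('o, 'm) cat =
  Obj :: "'o set"
  Arr :: "'m set"
  Dom :: "'m \<Rightarrow> 'o"
  Cod :: "'m \<Rightarrow> 'o"
  Id :: "'o \<Rightarrow> 'm"
  Comp :: "'m \<Rightarrow> 'm \<Rightarrow> 'm"  (infixl \<open>\<bullet>\<index>\<close> 70)

definition Homs :: "('o, 'm, 'z) cat_scheme \<Rightarrow> 'o \<Rightarrow> 'o \<Rightarrow> 'm set" where
  "Homs C X Y = {f \<in> Arr C. Dom C f = X \<and> Cod C f = Y}"

locale category =
  fixes C :: "('o, 'm, 'z) cat_scheme" (structure)
  assumes dom_in_Obj: "f \<in> Arr C \<Longrightarrow> Dom C f \<in> Obj C"
    and cod_in_Obj: "f \<in> Arr C \<Longrightarrow> Cod C f \<in> Obj C"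
    and Id_in_Homs: "X \<in> Obj C \<Longrightarrow> Id C X \<in> Homs C X X"
    and Comp_in_Homs: "\<lbrakk>f \<in> Homs C X Y; g \<in> Homs C Y Z\<rbrakk> \<Longrightarrow> g \<bullet> f \<in> Homs C X Z"
    and Comp_assoc: "\<lbrakk>f \<in> Homs C W X; g \<in> Homs C X Y; h \<in> Homs C Y Z\<rbrakk>
      \<Longrightarrow> (h \<bullet> g) \<bullet> f = h \<bullet> (g \<bullet> f)"
    and Comp_Id_right: "f \<in> Homs C X Y \<Longrightarrow> f \<bullet> Id C X = f"
    and Comp_Id_left: "f \<in> Homs C X Y \<Longrightarrow> Id C Y \<bullet> f = f"

record ('a, 'f, 'b, 'g) ftor =
  FO :: "'a \<Rightarrow> 'b"
  FA :: "'f \<Rightarrow> 'g"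

locale cfunctor = source: category C + target: category D
  for C :: "('a, 'f, 'y) cat_scheme" and D :: "('b, 'g, 'z) cat_scheme" +
  fixes F :: "('a, 'f, 'b, 'g) ftor"
  assumes FO_in_Obj: "X \<in> Obj C \<Longrightarrow> FO F X \<in> Obj D"
    and FA_in_Homs: "f \<in> Homs C X Y \<Longrightarrow> FA F f \<in> Homs D (FO F X) (FO F Y)"
    and FA_Id: "X \<in> Obj C \<Longrightarrow> FA F (Id C X) = Id D (FO F X)"
    and FA_Comp: "\<lbrakk>f \<in> Homs C X Y; g \<in> Homs C Y Z\<rbrakk>
      \<Longrightarrow> FA F (g \<bullet>\<^bsub>C\<^esub> f) = FA F g \<bullet>\<^bsub>D\<^esub> FA F f"

definition ftor_comp :: "('b, 'g, 'c, 'h) ftor \<Rightarrow> ('a, 'f, 'b, 'g) ftor \<Rightarrow> ('a, 'f, 'c, 'h) ftor" where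
  "ftor_comp G F = \<lparr>FO = FO G \<circ> FO F, FA = FA G \<circ> FA F\<rparr>"

definition agree_on :: "('a, 'f, 'z) cat_scheme \<Rightarrow>
    ('a, 'f, 'b, 'g) ftor \<Rightarrow> ('a, 'f, 'b, 'g) ftor \<Rightarrow> bool" where
  "agree_on C F G \<longleftrightarrow> (\<forall>X \<in> Obj C. FO F X = FO G X) \<and> (\<forall>f \<in> Arr C. FA F f = FA G f)"

definition full :: "('o, 'm, 'z) cat_scheme \<Rightarrow> 'o set \<Rightarrow> ('o, 'm) cat" where
  "full C S = \<lparr>Obj = Obj C \<inter> S, Arr = {f \<in> Arr C. Dom C f \<in> S \<and> Cod C f \<in> S},
    Dom = Dom C, Cod = Cod C, Id = Id C, Comp = Comp C\<rparr>"

definition inverse_arrows :: "('o, 'm, 'z) cat_scheme \<Rightarrow> 'm \<Rightarrow> 'm \<Rightarrow> bool" where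
  "inverse_arrows C f g \<longleftrightarrow> f \<in> Arr C \<and> g \<in> Homs C (Cod C f) (Dom C f) \<and>
    g \<bullet>\<^bsub>C\<^esub> f = Id C (Dom C f) \<and> f \<bullet>\<^bsub>C\<^esub> g = Id C (Cod C f)"

definition Inv :: "('o, 'm, 'z) cat_scheme \<Rightarrow> 'm \<Rightarrow> 'm" where
  "Inv C f = (THE g. inverse_arrows C f g)"

definition isomorphic_objects :: "('o, 'm, 'z) cat_scheme \<Rightarrow> 'o \<Rightarrow> 'o \<Rightarrow> bool" where
  "isomorphic_objects C X Y \<longleftrightarrow> (\<exists>f \<in> Homs C X Y. \<exists>g. inverse_arrows C f g)"

text \<open>Natural transformations carry their source and target functors. Functors and components
  are extensional, so that equality of arrows of the functor category is equality on \<open>C\<close>.\<close>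

definition Fct :: "('a, 'f, 'y) cat_scheme \<Rightarrow> ('b, 'g, 'z) cat_scheme \<Rightarrow>
    (('a, 'f, 'b, 'g) ftor,
     ('a, 'f, 'b, 'g) ftor \<times> ('a \<Rightarrow> 'g) \<times> ('a, 'f, 'b, 'g) ftor) cat" where
  "Fct C D = (let Ob = {F. cfunctor C D F \<and> FO F \<in> extensional (Obj C) \<and> FA F \<in> extensional (Arr C)} in
    \<lparr>Obj = Ob,
     Arr = {(F, \<eta>, G). F \<in> Ob \<and> G \<in> Ob \<and> \<eta> \<in> extensional (Obj C) \<and>
       (\<forall>X \<in> Obj C. \<eta> X \<in> Homs D (FO F X) (FO G X)) \<and>
       (\<forall>X \<in> Obj C. \<forall>Y \<in> Obj C. \<forall>f \<in> Homs C X Y. FA G f \<bullet>\<^bsub>D\<^esub> \<eta> X = \<eta> Y \<bullet>\<^bsub>D\<^esub> FA F f)},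
     Dom = (\<lambda>(F, \<eta>, G). F),
     Cod = (\<lambda>(F, \<eta>, G). G),
     Id = (\<lambda>F. (F, \<lambda>X \<in> Obj C. Id D (FO F X), F)),
     Comp = (\<lambda>(_, \<theta>, H) (F, \<eta>, _). (F, \<lambda>X \<in> Obj C. \<theta> X \<bullet>\<^bsub>D\<^esub> \<eta> X, H))\<rparr>)"


section \<open>Quotient of an abelian category by a thick subcategory\<close>

definition zero_object :: "('o, 'm, 'z) cat_scheme \<Rightarrow> 'o \<Rightarrow> bool" where
  "zero_object C Z \<longleftrightarrow> Z \<in> Obj C \<and>
    (\<forall>X \<in> Obj C. (\<exists>!f. f \<in> Homs C X Z) \<and> (\<exists>!f. f \<in> Homs C Z X))"

definition zero_arrow :: "('o, 'm, 'z) cat_scheme \<Rightarrow> 'm \<Rightarrow> bool" where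
  "zero_arrow C f \<longleftrightarrow> (\<exists>Z u v. zero_object C Z \<and> u \<in> Homs C (Dom C f) Z \<and>
    v \<in> Homs C Z (Cod C f) \<and> f = v \<bullet>\<^bsub>C\<^esub> u)"

definition is_kernel :: "('o, 'm, 'z) cat_scheme \<Rightarrow> 'm \<Rightarrow> 'm \<Rightarrow> bool" where
  "is_kernel C f k \<longleftrightarrow> k \<in> Arr C \<and> Cod C k = Dom C f \<and> zero_arrow C (f \<bullet>\<^bsub>C\<^esub> k) \<and>
    (\<forall>g \<in> Arr C. Cod C g = Dom C f \<and> zero_arrow C (f \<bullet>\<^bsub>C\<^esub> g) \<longrightarrow>
      (\<exists>!u. u \<in> Homs C (Dom C g) (Dom C k) \<and> k \<bullet>\<^bsub>C\<^esub> u = g))"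

definition is_cokernel :: "('o, 'm, 'z) cat_scheme \<Rightarrow> 'm \<Rightarrow> 'm \<Rightarrow> bool" where
  "is_cokernel C f c \<longleftrightarrow> c \<in> Arr C \<and> Dom C c = Cod C f \<and> zero_arrow C (c \<bullet>\<^bsub>C\<^esub> f) \<and>
    (\<forall>g \<in> Arr C. Dom C g = Cod C f \<and> zero_arrow C (g \<bullet>\<^bsub>C\<^esub> f) \<longrightarrow>
      (\<exists>!u. u \<in> Homs C (Cod C c) (Cod C g) \<and> u \<bullet>\<^bsub>C\<^esub> c = g))"

text \<open>The arrows that become invertible modulo \<open>T\<close>: kernel and cokernel lie in \<open>T\<close>.\<close>

definition isos_mod :: "('o, 'm, 'z) cat_scheme \<Rightarrow> 'o set \<Rightarrow> 'm set" where
  "isos_mod C T = {f \<in> Arr C. (\<exists>k. is_kernel C f k \<and> Dom C k \<in> T) \<and>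
    (\<exists>c. is_cokernel C f c \<and> Cod C c \<in> T)}"

text \<open>The quotient \<open>C / T\<close> is the localisation of \<open>C\<close> at \<open>isos_mod C T\<close>. Its objects are those of
  \<open>C\<close>; its arrows are zigzags modulo the congruence generated by the composition of \<open>C\<close> and by
  the relations making each \<open>s \<in> isos_mod C T\<close> invertible. In a zigzag, listed in the order in
  which it is travelled, \<open>Inl f\<close> is \<open>f\<close> forwards and \<open>Inr s\<close> is the formal inverse of \<open>s\<close>.\<close>

inductive zigzag :: "('o, 'm, 'z) cat_scheme \<Rightarrow> 'm set \<Rightarrow> 'o \<Rightarrow> ('m + 'm) list \<Rightarrow> 'o \<Rightarrow> bool"
  for C S where
  zz_nil: "X \<in> Obj C \<Longrightarrow> zigzag C S X [] X"
| zz_fwd: "\<lbrakk>f \<in> Homs C X Y; zigzag C S Y w Z\<rbrakk> \<Longrightarrow> zigzag C S X (Inl f # w) Z"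
| zz_bwd: "\<lbrakk>s \<in> S; s \<in> Homs C Y X; zigzag C S Y w Z\<rbrakk> \<Longrightarrow> zigzag C S X (Inr s # w) Z"

inductive zigzag_step :: "('o, 'm, 'z) cat_scheme \<Rightarrow> 'm set \<Rightarrow> ('m + 'm) list \<Rightarrow> ('m + 'm) list \<Rightarrow> bool"
  for C S where
  "X \<in> Obj C \<Longrightarrow> zigzag_step C S (u @ [Inl (Id C X)] @ v) (u @ v)"
| "\<lbrakk>f \<in> Homs C X Y; g \<in> Homs C Y Z\<rbrakk>
    \<Longrightarrow> zigzag_step C S (u @ [Inl f, Inl g] @ v) (u @ [Inl (g \<bullet>\<^bsub>C\<^esub> f)] @ v)"
| "s \<in> S \<Longrightarrow> zigzag_step C S (u @ [Inl s, Inr s] @ v) (u @ v)"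
| "s \<in> S \<Longrightarrow> zigzag_step C S (u @ [Inr s, Inl s] @ v) (u @ v)"

definition zigzag_equiv ::
    "('o, 'm, 'z) cat_scheme \<Rightarrow> 'm set \<Rightarrow> 'o \<Rightarrow> 'o \<Rightarrow> ('m + 'm) list \<Rightarrow> ('m + 'm) list \<Rightarrow> bool" where
  "zigzag_equiv C S X Y = equivclp (\<lambda>u v. zigzag C S X u Y \<and> zigzag C S X v Y \<and> zigzag_step C S u v)"

definition zigzag_class ::
    "('o, 'm, 'z) cat_scheme \<Rightarrow> 'm set \<Rightarrow> 'o \<Rightarrow> ('m + 'm) list \<Rightarrow> 'o \<Rightarrow> 'o \<times> ('m + 'm) list set \<times> 'o" where
  "zigzag_class C S X w Y = (X, {w'. zigzag_equiv C S X Y w w'}, Y)"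

definition localisation ::
    "('o, 'm, 'z) cat_scheme \<Rightarrow> 'm set \<Rightarrow> ('o, 'o \<times> ('m + 'm) list set \<times> 'o) cat" where
  "localisation C S =
    \<lparr>Obj = Obj C,
     Arr = {zigzag_class C S X w Y | X w Y. zigzag C S X w Y},
     Dom = (\<lambda>(X, c, Y). X),
     Cod = (\<lambda>(X, c, Y). Y),
     Id = (\<lambda>X. zigzag_class C S X [] X),
     Comp = (\<lambda>(Y', d, Z) (X, c, Y). (X, {w. \<exists>u \<in> c. \<exists>v \<in> d. zigzag_equiv C S X Z (u @ v) w}, Z))\<rparr>"

definition quotient_cat ::
    "('o, 'm, 'z) cat_scheme \<Rightarrow> 'o set \<Rightarrow> ('o, 'o \<times> ('m + 'm) list set \<times> 'o) cat" where
  "quotient_cat C T = localisation C (isos_mod C T)"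

definition quotient_functor ::
    "('o, 'm, 'z) cat_scheme \<Rightarrow> 'o set \<Rightarrow> ('o, 'm, 'o, 'o \<times> ('m + 'm) list set \<times> 'o) ftor" where
  "quotient_functor C T =
    \<lparr>FO = (\<lambda>X. X), FA = (\<lambda>f. zigzag_class C (isos_mod C T) (Dom C f) [Inl f] (Cod C f))\<rparr>"


section \<open>Groups\<close>

abbreviation arrow_map :: "'a \<times> 'f \<times> 'b \<Rightarrow> 'f" where
  "arrow_map a \<equiv> fst (snd a)"

definition Gr :: "('g monoid, 'g monoid \<times> ('g \<Rightarrow> 'g) \<times> 'g monoid) cat" where
  "Gr = \<lparr>Obj = {G. group G},
    Arr = {(G, f, G'). group G \<and> group G' \<and> f \<in> hom G G' \<inter> extensional (carrier G)},
    Dom = (\<lambda>(G, f, G'). G),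
    Cod = (\<lambda>(G, f, G'). G'),
    Id = (\<lambda>G. (G, \<lambda>x \<in> carrier G. x, G)),
    Comp = (\<lambda>(_, g, G'') (G, f, _). (G, compose (carrier G) g f, G''))\<rparr>"

text \<open>The free product of a family of groups: reduced words whose letters \<open>(i, x)\<close> are
  non-trivial elements \<open>x\<close> of the \<open>i\<close>-th factor.\<close>

definition reduced_words :: "'i set \<Rightarrow> ('i \<Rightarrow> ('a, 'z) monoid_scheme) \<Rightarrow> ('i \<times> 'a) list set" where
  "reduced_words I G = {w. (\<forall>(i, x) \<in> set w. i \<in> I \<and> x \<in> carrier (G i) \<and> x \<noteq> \<one>\<^bsub>G i\<^esub>) \<and>
    successively (\<lambda>p q. fst p \<noteq> fst q) w}"

fun cons_reduced :: "('i \<Rightarrow> ('a, 'z) monoid_scheme) \<Rightarrow> 'i \<times> 'a \<Rightarrow> ('i \<times> 'a) list \<Rightarrow> ('i \<times> 'a) list" where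
  "cons_reduced G (i, x) [] = [(i, x)]"
| "cons_reduced G (i, x) ((j, y) # w) =
    (if i \<noteq> j then (i, x) # (j, y) # w
     else if x \<otimes>\<^bsub>G i\<^esub> y = \<one>\<^bsub>G i\<^esub> then w
     else (i, x \<otimes>\<^bsub>G i\<^esub> y) # w)"

definition free_product :: "'i set \<Rightarrow> ('i \<Rightarrow> ('a, 'z) monoid_scheme) \<Rightarrow> ('i \<times> 'a) list monoid" where
  "free_product I G =
    \<lparr>carrier = reduced_words I G, monoid.mult = foldr (cons_reduced G), one = []\<rparr>"

definition from_free_product ::
    "('k, 'z) monoid_scheme \<Rightarrow> ('i \<Rightarrow> 'a \<Rightarrow> 'k) \<Rightarrow> ('i \<times> 'a) list \<Rightarrow> 'k" where
  "from_free_product K f w = foldr (\<lambda>(i, x) y. f i x \<otimes>\<^bsub>K\<^esub> y) w \<one>\<^bsub>K\<^esub>"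

text \<open>\<open>G = A * B\<close>, where \<open>i\<close> plays the role of \<open>id\<^sub>A * \<iota>\<^sub>B\<close> and \<open>j\<close> that of \<open>\<iota>\<^sub>A * id\<^sub>B\<close>: the
  homomorphism from the free product to \<open>G\<close> defined by \<open>i\<close> and \<open>j\<close> is an isomorphism.\<close>

definition is_free_product ::
    "('a, 'y) monoid_scheme \<Rightarrow> ('a, 'y) monoid_scheme \<Rightarrow> ('k, 'z) monoid_scheme \<Rightarrow>
      ('a \<Rightarrow> 'k) \<Rightarrow> ('a \<Rightarrow> 'k) \<Rightarrow> bool" where
  "is_free_product A B G i j \<longleftrightarrow> i \<in> hom A G \<and> j \<in> hom B G \<and>
    from_free_product G (\<lambda>b. if b then j else i)
      \<in> iso (free_product UNIV (\<lambda>b. if b then B else A)) G"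

text \<open>Reduced words in the letters \<open>s\<close>, coded \<open>(s, True)\<close>, and \<open>s\<inverse>\<close>, coded \<open>(s, False)\<close>.\<close>

definition free_reduced_words :: "'g set \<Rightarrow> ('g \<times> bool) list set" where
  "free_reduced_words S = {w. set w \<subseteq> S \<times> UNIV \<and>
    successively (\<lambda>p q. \<not> (fst p = fst q \<and> snd p \<noteq> snd q)) w}"

definition word_value :: "('g, 'z) monoid_scheme \<Rightarrow> ('g \<times> bool) list \<Rightarrow> 'g" where
  "word_value G w = foldr (\<lambda>(s, e) x. (if e then s else inv\<^bsub>G\<^esub> s) \<otimes>\<^bsub>G\<^esub> x) w \<one>\<^bsub>G\<^esub>"

definition free_group :: "('g, 'z) monoid_scheme \<Rightarrow> bool" where
  "free_group G \<longleftrightarrow> group G \<and> (\<exists>S \<subseteq> carrier G.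
    bij_betw (word_value G) (free_reduced_words S) (carrier G))"


section \<open>Modules\<close>

definition linear_maps :: "('r, 'y) ring_scheme \<Rightarrow> ('r, 'a) module \<Rightarrow> ('r, 'b) module \<Rightarrow> ('a \<Rightarrow> 'b) set" where
  "linear_maps R M N = {f \<in> carrier M \<rightarrow>\<^sub>E carrier N.
    (\<forall>x \<in> carrier M. \<forall>y \<in> carrier M. f (x \<oplus>\<^bsub>M\<^esub> y) = f x \<oplus>\<^bsub>N\<^esub> f y) \<and>
    (\<forall>r \<in> carrier R. \<forall>x \<in> carrier M. f (r \<odot>\<^bsub>M\<^esub> x) = r \<odot>\<^bsub>N\<^esub> f x)}"

text \<open>The type \<open>'u\<close> of the elements of the modules plays the role of a universe. For the constructions
  below to stay inside it, it has to be infinite and at least as large as \<open>R\<close> and the groups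
  involved; no such bound is part of the definitions.\<close>

type_synonym ('r, 'u) rmod_arr = "('r, 'u) module \<times> ('u \<Rightarrow> 'u) \<times> ('r, 'u) module"

definition RMod :: "'r ring \<Rightarrow> (('r, 'u) module, ('r, 'u) rmod_arr) cat" where
  "RMod R = \<lparr>Obj = {M. module R M},
    Arr = {(M, f, N). module R M \<and> module R N \<and> f \<in> linear_maps R M N},
    Dom = (\<lambda>(M, f, N). M),
    Cod = (\<lambda>(M, f, N). N),
    Id = (\<lambda>M. (M, \<lambda>x \<in> carrier M. x, M)),
    Comp = (\<lambda>(_, g, N) (M, f, _). (M, compose (carrier M) g f, N))\<rparr>"

text \<open>Constructions such as quotients and tensor products are first carried out on sets of cosets
  and then transported to \<open>'u\<close> along an arbitrary injection, which exists when \<open>'u\<close> is large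
  enough. The multiplicative fields of the record \<open>module\<close> have no meaning for modules.\<close>

definition embed :: "('r, 'a) module \<Rightarrow> 'a \<Rightarrow> 'u" where
  "embed M = (SOME e. inj_on e (carrier M))"

definition realise :: "('r, 'a) module \<Rightarrow> ('r, 'u) module" where
  "realise M = (let e = embed M; d = inv_into (carrier M) e in
    \<lparr>carrier = e ` carrier M, monoid.mult = undefined, one = undefined, zero = e \<zero>\<^bsub>M\<^esub>,
     add = (\<lambda>x y. e (d x \<oplus>\<^bsub>M\<^esub> d y)), smult = (\<lambda>r x. e (r \<odot>\<^bsub>M\<^esub> d x))\<rparr>)"

definition module_span :: "('r, 'y) ring_scheme \<Rightarrow> ('r, 'a) module \<Rightarrow> 'a set \<Rightarrow> 'a set" where
  "module_span R M S = \<Inter> {N. submodule N R M \<and> S \<subseteq> N}"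

definition quotient_module :: "('r, 'a) module \<Rightarrow> 'a set \<Rightarrow> ('r, 'a set) module" where
  "quotient_module M N =
    \<lparr>carrier = a_rcosets\<^bsub>M\<^esub> N, monoid.mult = undefined, one = undefined, zero = N,
     add = (\<lambda>X Y. X <+>\<^bsub>M\<^esub> Y), smult = (\<lambda>r X. \<Union>x \<in> X. N +>\<^bsub>M\<^esub> (r \<odot>\<^bsub>M\<^esub> x))\<rparr>"

definition free_module :: "('r, 'y) ring_scheme \<Rightarrow> 'x set \<Rightarrow> ('r, 'x \<Rightarrow> 'r) module" where
  "free_module R X =
    \<lparr>carrier = {c. (\<forall>x. c x \<in> carrier R) \<and> finite {x. c x \<noteq> \<zero>\<^bsub>R\<^esub>} \<and> {x. c x \<noteq> \<zero>\<^bsub>R\<^esub>} \<subseteq> X},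
     monoid.mult = undefined, one = undefined, zero = (\<lambda>_. \<zero>\<^bsub>R\<^esub>),
     add = (\<lambda>c d x. c x \<oplus>\<^bsub>R\<^esub> d x), smult = (\<lambda>r c x. r \<otimes>\<^bsub>R\<^esub> c x)\<rparr>"

definition basis_elt :: "('r, 'y) ring_scheme \<Rightarrow> 'x \<Rightarrow> 'x \<Rightarrow> 'r" where
  "basis_elt R x = (\<lambda>y. if y = x then \<one>\<^bsub>R\<^esub> else \<zero>\<^bsub>R\<^esub>)"

definition group_ring :: "('r, 'y) ring_scheme \<Rightarrow> ('g, 'z) monoid_scheme \<Rightarrow> ('r, 'g \<Rightarrow> 'r) module" where
  "group_ring R G = (free_module R (carrier G))
    \<lparr>monoid.mult := (\<lambda>a b x. if x \<in> carrier G
        then \<Oplus>\<^bsub>R\<^esub>g \<in> {g. a g \<noteq> \<zero>\<^bsub>R\<^esub>}. a g \<otimes>\<^bsub>R\<^esub> b (inv\<^bsub>G\<^esub> g \<otimes>\<^bsub>G\<^esub> x) else \<zero>\<^bsub>R\<^esub>),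
     one := basis_elt R \<one>\<^bsub>G\<^esub>\<rparr>"

definition augmentation_ideal :: "('r, 'y) ring_scheme \<Rightarrow> ('g, 'z) monoid_scheme \<Rightarrow> ('g \<Rightarrow> 'r) set" where
  "augmentation_ideal R G =
    {a \<in> carrier (group_ring R G). (\<Oplus>\<^bsub>R\<^esub>g \<in> {g. a g \<noteq> \<zero>\<^bsub>R\<^esub>}. a g) = \<zero>\<^bsub>R\<^esub>}"

definition group_ring_map :: "('r, 'y) ring_scheme \<Rightarrow> ('g \<Rightarrow> 'h) \<Rightarrow> ('g \<Rightarrow> 'r) \<Rightarrow> 'h \<Rightarrow> 'r" where
  "group_ring_map R f a = (\<lambda>y. \<Oplus>\<^bsub>R\<^esub>x \<in> {x. a x \<noteq> \<zero>\<^bsub>R\<^esub> \<and> f x = y}. a x)"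

text \<open>The left action of the group ring on an \<open>R\<close>-module \<open>V\<close> given by an action \<open>\<rho>\<close> of the group.\<close>

definition group_ring_act :: "('r, 'y) ring_scheme \<Rightarrow> ('r, 'u) module \<Rightarrow> ('g \<Rightarrow> 'u \<Rightarrow> 'u) \<Rightarrow>
    ('g \<Rightarrow> 'r) \<Rightarrow> 'u \<Rightarrow> 'u" where
  "group_ring_act R V \<rho> a v = (\<Oplus>\<^bsub>V\<^esub>g \<in> {g. a g \<noteq> \<zero>\<^bsub>R\<^esub>}. a g \<odot>\<^bsub>V\<^esub> \<rho> g v)"

text \<open>The \<open>R\<close>-module \<open>I \<otimes>\<^sub>R\<^sub>[\<^sub>G\<^sub>] V\<close>, for \<open>I\<close> the augmentation ideal: the free \<open>R\<close>-module on
  \<open>I \<times> V\<close> modulo \<open>R\<close>-bilinearity and \<open>(i \<cdot> a) \<otimes> v = i \<otimes> (a \<cdot> v)\<close> for \<open>a \<in> R[G]\<close>. Linearity in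
  the second variable with respect to scalars is the case of a scalar \<open>a\<close>.\<close>

definition tensor_relations :: "'r ring \<Rightarrow> 'g monoid \<Rightarrow> ('r, 'u) module \<Rightarrow> ('g \<Rightarrow> 'u \<Rightarrow> 'u) \<Rightarrow>
    (('g \<Rightarrow> 'r) \<times> 'u \<Rightarrow> 'r) set" where
  "tensor_relations R G V \<rho> = (let A = group_ring R G; I = augmentation_ideal R G;
      L = free_module R (I \<times> carrier V); e = basis_elt R in
    {e (i \<oplus>\<^bsub>A\<^esub> j, v) \<ominus>\<^bsub>L\<^esub> (e (i, v) \<oplus>\<^bsub>L\<^esub> e (j, v)) | i j v. i \<in> I \<and> j \<in> I \<and> v \<in> carrier V} \<union>
    {e (i, v \<oplus>\<^bsub>V\<^esub> w) \<ominus>\<^bsub>L\<^esub> (e (i, v) \<oplus>\<^bsub>L\<^esub> e (i, w)) | i v w. i \<in> I \<and> v \<in> carrier V \<and> w \<in> carrier V} \<union>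
    {e (r \<odot>\<^bsub>A\<^esub> i, v) \<ominus>\<^bsub>L\<^esub> (r \<odot>\<^bsub>L\<^esub> e (i, v)) | r i v. r \<in> carrier R \<and> i \<in> I \<and> v \<in> carrier V} \<union>
    {e (i \<otimes>\<^bsub>A\<^esub> a, v) \<ominus>\<^bsub>L\<^esub> e (i, group_ring_act R V \<rho> a v) | i a v.
      i \<in> I \<and> a \<in> carrier A \<and> v \<in> carrier V})"

definition coset_tensor_module :: "'r ring \<Rightarrow> 'g monoid \<Rightarrow> ('r, 'u) module \<Rightarrow> ('g \<Rightarrow> 'u \<Rightarrow> 'u) \<Rightarrow>
    ('r, (('g \<Rightarrow> 'r) \<times> 'u \<Rightarrow> 'r) set) module" where
  "coset_tensor_module R G V \<rho> = (let L = free_module R (augmentation_ideal R G \<times> carrier V) in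
    quotient_module L (module_span R L (tensor_relations R G V \<rho>)))"

definition tensor_module :: "'r ring \<Rightarrow> 'g monoid \<Rightarrow> ('r, 'u) module \<Rightarrow> ('g \<Rightarrow> 'u \<Rightarrow> 'u) \<Rightarrow>
    ('r, 'u) module" where
  "tensor_module R G V \<rho> = realise (coset_tensor_module R G V \<rho>)"

definition pure_tensor :: "'r ring \<Rightarrow> 'g monoid \<Rightarrow> ('r, 'u) module \<Rightarrow> ('g \<Rightarrow> 'u \<Rightarrow> 'u) \<Rightarrow>
    ('g \<Rightarrow> 'r) \<Rightarrow> 'u \<Rightarrow> 'u" where
  "pure_tensor R G V \<rho> i v = (let L = free_module R (augmentation_ideal R G \<times> carrier V) in
    embed (coset_tensor_module R G V \<rho>)
      (module_span R L (tensor_relations R G V \<rho>) +>\<^bsub>L\<^esub> basis_elt R (i, v)))"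


section \<open>Braided groupoids and Quillen's bracket construction\<close>

record ('o, 'm) braided = "('o, 'm) cat" +
  tensO :: "'o \<Rightarrow> 'o \<Rightarrow> 'o"  (infixr \<open>\<natural>\<index>\<close> 75)
  tensA :: "'m \<Rightarrow> 'm \<Rightarrow> 'm"  (infixr \<open>\<sharp>\<index>\<close> 75)
  unitO :: 'o
  braid :: "'o \<Rightarrow> 'o \<Rightarrow> 'm"

locale strict_braided_groupoid = category B
  for B :: "('o, 'm, 'z) braided_scheme" (structure) +
  assumes all_invertible: "f \<in> Arr B \<Longrightarrow> \<exists>g. inverse_arrows B f g"
    and tensO_in_Obj: "\<lbrakk>X \<in> Obj B; Y \<in> Obj B\<rbrakk> \<Longrightarrow> X \<natural> Y \<in> Obj B"
    and unitO_in_Obj: "unitO B \<in> Obj B"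
    and tensO_assoc: "\<lbrakk>X \<in> Obj B; Y \<in> Obj B; Z \<in> Obj B\<rbrakk> \<Longrightarrow> (X \<natural> Y) \<natural> Z = X \<natural> (Y \<natural> Z)"
    and tensO_unit_left: "X \<in> Obj B \<Longrightarrow> unitO B \<natural> X = X"
    and tensO_unit_right: "X \<in> Obj B \<Longrightarrow> X \<natural> unitO B = X"
    and tensA_in_Homs: "\<lbrakk>f \<in> Homs B X X'; g \<in> Homs B Y Y'\<rbrakk> \<Longrightarrow> f \<sharp> g \<in> Homs B (X \<natural> Y) (X' \<natural> Y')"
    and tensA_Id: "\<lbrakk>X \<in> Obj B; Y \<in> Obj B\<rbrakk> \<Longrightarrow> Id B X \<sharp> Id B Y = Id B (X \<natural> Y)"
    and tensA_Comp: "\<lbrakk>f \<in> Homs B X X'; f' \<in> Homs B X' X''; g \<in> Homs B Y Y'; g' \<in> Homs B Y' Y''\<rbrakk>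
      \<Longrightarrow> (f' \<bullet> f) \<sharp> (g' \<bullet> g) = (f' \<sharp> g') \<bullet> (f \<sharp> g)"
    and tensA_assoc: "\<lbrakk>f \<in> Arr B; g \<in> Arr B; h \<in> Arr B\<rbrakk> \<Longrightarrow> (f \<sharp> g) \<sharp> h = f \<sharp> (g \<sharp> h)"
    and tensA_unit_left: "f \<in> Arr B \<Longrightarrow> Id B (unitO B) \<sharp> f = f"
    and tensA_unit_right: "f \<in> Arr B \<Longrightarrow> f \<sharp> Id B (unitO B) = f"
    and braid_in_Homs: "\<lbrakk>X \<in> Obj B; Y \<in> Obj B\<rbrakk> \<Longrightarrow> braid B X Y \<in> Homs B (X \<natural> Y) (Y \<natural> X)"
    and braid_natural: "\<lbrakk>f \<in> Homs B X X'; g \<in> Homs B Y Y'\<rbrakk>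
      \<Longrightarrow> braid B X' Y' \<bullet> (f \<sharp> g) = (g \<sharp> f) \<bullet> braid B X Y"
    and hexagon_right: "\<lbrakk>X \<in> Obj B; Y \<in> Obj B; Z \<in> Obj B\<rbrakk>
      \<Longrightarrow> braid B X (Y \<natural> Z) = (Id B Y \<sharp> braid B X Z) \<bullet> (braid B X Y \<sharp> Id B Z)"
    and hexagon_left: "\<lbrakk>X \<in> Obj B; Y \<in> Obj B; Z \<in> Obj B\<rbrakk>
      \<Longrightarrow> braid B (X \<natural> Y) Z = (braid B X Z \<sharp> Id B Y) \<bullet> (Id B X \<sharp> braid B Y Z)"

text \<open>An arrow \<open>P \<rightarrow> Q\<close> of \<open>\<UU>B\<close> is \<open>(P, [X, f], Q)\<close>, with \<open>[X, f]\<close> the set of all pairs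
  equivalent to \<open>(X, f)\<close>.\<close>

type_synonym ('o, 'm) bracket_arr = "'o \<times> ('o \<times> 'm) set \<times> 'o"

definition bracket ::
    "('o, 'm, 'z) braided_scheme \<Rightarrow> 'o \<Rightarrow> 'o \<Rightarrow> 'm \<Rightarrow> 'o \<Rightarrow> ('o, 'm) bracket_arr" where
  "bracket B P X f Q = (P, {(X', f'). X' \<in> Obj B \<and> f' \<in> Homs B (X' \<natural>\<^bsub>B\<^esub> P) Q \<and>
    (\<exists>\<psi> \<in> Homs B X X'. f' \<bullet>\<^bsub>B\<^esub> (\<psi> \<sharp>\<^bsub>B\<^esub> Id B P) = f)}, Q)"

definition UG' :: "('o, 'm, 'z) braided_scheme \<Rightarrow> ('o, ('o, 'm) bracket_arr) cat" where
  "UG' B = \<lparr>Obj = Obj B,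
    Arr = {bracket B P X f Q | P X f Q. P \<in> Obj B \<and> X \<in> Obj B \<and> Q \<in> Obj B \<and>
      f \<in> Homs B (X \<natural>\<^bsub>B\<^esub> P) Q},
    Dom = (\<lambda>(P, c, Q). P),
    Cod = (\<lambda>(P, c, Q). Q),
    Id = (\<lambda>P. bracket B P (unitO B) (Id B P) P),
    Comp = (\<lambda>(_, d, S) (P, c, _).
      (P, \<Union>(Y, g) \<in> d. \<Union>(X, f) \<in> c. arrow_map (bracket B P (Y \<natural>\<^bsub>B\<^esub> X) (g \<bullet>\<^bsub>B\<^esub> (Id B Y \<sharp>\<^bsub>B\<^esub> f)) S), S))\<rparr>"

definition bracket_tens ::
    "('o, 'm, 'z) braided_scheme \<Rightarrow> ('o, 'm) bracket_arr \<Rightarrow> ('o, 'm) bracket_arr \<Rightarrow> ('o, 'm) bracket_arr" where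
  "bracket_tens B = (\<lambda>(P, c, Q) (S, d, T).
    (P \<natural>\<^bsub>B\<^esub> S, \<Union>(X, f) \<in> c. \<Union>(Y, g) \<in> d. arrow_map (bracket B (P \<natural>\<^bsub>B\<^esub> S) (X \<natural>\<^bsub>B\<^esub> Y)
       ((f \<sharp>\<^bsub>B\<^esub> g) \<bullet>\<^bsub>B\<^esub> (Id B X \<sharp>\<^bsub>B\<^esub> Inv B (braid B P Y) \<sharp>\<^bsub>B\<^esub> Id B S)) (Q \<natural>\<^bsub>B\<^esub> T)), Q \<natural>\<^bsub>B\<^esub> T))"

text \<open>The arrow \<open>[0, \<phi>]\<close> with which an arrow \<open>\<phi>\<close> of \<open>B\<close> is identified, and the unique arrow
  \<open>\<iota>\<^sub>X = [X, id\<^sub>X]\<close> from \<open>0\<close> to \<open>X\<close>.\<close>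

definition lift_arr :: "('o, 'm, 'z) braided_scheme \<Rightarrow> 'm \<Rightarrow> ('o, 'm) bracket_arr" where
  "lift_arr B \<phi> = bracket B (Dom B \<phi>) (unitO B) \<phi> (Cod B \<phi>)"

definition init_arr :: "('o, 'm, 'z) braided_scheme \<Rightarrow> 'o \<Rightarrow> ('o, 'm) bracket_arr" where
  "init_arr B X = bracket B (unitO B) X (Id B X) X"


section \<open>The setting\<close>

text \<open>\<open>obj1\<close> is the object \<open>1\<close> and \<open>obj0\<close> the object \<open>0\<close> with an underline.\<close>

record ('o, 'm) pointed_braided = "('o, 'm) braided" +
  obj1 :: 'o
  obj0 :: 'o

primrec power1 :: "('o, 'm) pointed_braided \<Rightarrow> nat \<Rightarrow> 'o" where
  "power1 B 0 = unitO B"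
| "power1 B (Suc n) = obj1 B \<natural>\<^bsub>B\<^esub> power1 B n"

definition uobj :: "('o, 'm) pointed_braided \<Rightarrow> nat \<Rightarrow> 'o" where
  "uobj B n = power1 B n \<natural>\<^bsub>B\<^esub> obj0 B"

definition GG :: "('o, 'm) pointed_braided \<Rightarrow> ('o, 'm) cat" where
  "GG B = full B (range (uobj B))"

definition UG :: "('o, 'm) pointed_braided \<Rightarrow> ('o, ('o, 'm) bracket_arr) cat" where
  "UG B = full (UG' B) (range (uobj B))"

definition GG_to_UG :: "('o, 'm) pointed_braided \<Rightarrow> ('o, 'm, 'o, ('o, 'm) bracket_arr) ftor" where
  "GG_to_UG B = \<lparr>FO = (\<lambda>X. X), FA = lift_arr B\<rparr>"

locale long_moody_setting = strict_braided_groupoid B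
  for B :: "('o, 'm) pointed_braided" (structure) +
  assumes no_zero_divisors: "\<lbrakk>X \<in> Obj B; Y \<in> Obj B\<rbrakk> \<Longrightarrow>
      isomorphic_objects B (X \<natural> Y) (unitO B) \<longleftrightarrow>
      isomorphic_objects B X (unitO B) \<and> isomorphic_objects B Y (unitO B)"
    and Aut_unit: "Homs B (unitO B) (unitO B) = {Id B (unitO B)}"
    and obj1_in_Obj: "obj1 B \<in> Obj B"
    and obj0_in_Obj: "obj0 B \<in> Obj B"
    and obj1_not_unit: "\<not> isomorphic_objects B (obj1 B) (unitO B)"
    and UG_arrows: "\<phi> \<in> Homs (UG B) (uobj B n) (uobj B n') \<Longrightarrow>
      n \<le> n' \<and> (\<exists>g \<in> Homs B (uobj B n') (uobj B n').
        \<phi> = bracket B (uobj B n) (power1 B (n' - n)) g (uobj B n'))"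


section \<open>Long-Moody systems\<close>

definition grothendieck ::
    "('o, 'm, 'z) cat_scheme \<Rightarrow> ('o, 'm, 'g monoid, 'g monoid \<times> ('g \<Rightarrow> 'g) \<times> 'g monoid) ftor \<Rightarrow>
      ('o, 'g \<times> 'm) cat" where
  "grothendieck C \<A> = \<lparr>Obj = Obj C,
    Arr = {(h, \<phi>). \<phi> \<in> Arr C \<and> h \<in> carrier (FO \<A> (Cod C \<phi>))},
    Dom = (\<lambda>(h, \<phi>). Dom C \<phi>),
    Cod = (\<lambda>(h, \<phi>). Cod C \<phi>),
    Id = (\<lambda>X. (\<one>\<^bsub>FO \<A> X\<^esub>, Id C X)),
    Comp = (\<lambda>(h', \<phi>') (h, \<phi>).
      (h' \<otimes>\<^bsub>FO \<A> (Cod C \<phi>')\<^esub> arrow_map (FA \<A> \<phi>') h, \<phi>' \<bullet>\<^bsub>C\<^esub> \<phi>))\<rparr>"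

definition grothendieck_section ::
    "('o, 'm, 'z) cat_scheme \<Rightarrow> ('o, 'm, 'g monoid, 'g monoid \<times> ('g \<Rightarrow> 'g) \<times> 'g monoid) ftor \<Rightarrow>
      ('o, 'm, 'o, 'g \<times> 'm) ftor" where
  "grothendieck_section C \<A> = \<lparr>FO = (\<lambda>X. X), FA = (\<lambda>\<phi>. (\<one>\<^bsub>FO \<A> (Cod C \<phi>)\<^esub>, \<phi>))\<rparr>"

definition shift_GG :: "('o, 'm) pointed_braided \<Rightarrow> ('o, 'm, 'o, 'm) ftor" where
  "shift_GG B = \<lparr>FO = (\<lambda>X. obj1 B \<natural>\<^bsub>B\<^esub> X), FA = (\<lambda>\<phi>. Id B (obj1 B) \<sharp>\<^bsub>B\<^esub> \<phi>)\<rparr>"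

definition shift_UG :: "('o, 'm) pointed_braided \<Rightarrow>
    ('o, ('o, 'm) bracket_arr, 'o, ('o, 'm) bracket_arr) ftor" where
  "shift_UG B = \<lparr>FO = (\<lambda>X. obj1 B \<natural>\<^bsub>B\<^esub> X),
    FA = (\<lambda>\<phi>. bracket_tens B (Id (UG' B) (obj1 B)) \<phi>)\<rparr>"

type_synonym ('o, 'm, 'g) group_ftor =
  "('o, ('o, 'm) bracket_arr, 'g monoid, 'g monoid \<times> ('g \<Rightarrow> 'g) \<times> 'g monoid) ftor"

text \<open>The groupoid \<open>GG B\<close> is regarded as a subcategory of \<open>UG B\<close> via \<open>\<phi> \<mapsto> [0, \<phi>]\<close>.\<close>

definition coherent_long_moody_system :: "('o, 'm) pointed_braided \<Rightarrow> ('o, 'm, 'g) group_ftor \<Rightarrow>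
    ('o, 'g \<times> 'm, 'o, 'm) ftor \<Rightarrow> bool" where
  "coherent_long_moody_system B \<A> \<chi> \<longleftrightarrow>
    cfunctor (UG B) Gr \<A> \<and>
    (let \<A>' = ftor_comp \<A> (GG_to_UG B) in
      cfunctor (grothendieck (GG B) \<A>') (GG B) \<chi> \<and>
      agree_on (GG B) (ftor_comp \<chi> (grothendieck_section (GG B) \<A>')) (shift_GG B) \<and>
      (\<exists>\<chi>U. cfunctor (grothendieck (UG B) \<A>) (UG B) \<chi>U \<and>
        agree_on (UG B) (ftor_comp \<chi>U (grothendieck_section (UG B) \<A>)) (shift_UG B) \<and>
        (\<forall>X \<in> Obj (GG B). FO \<chi>U X = FO \<chi> X) \<and>
        (\<forall>(h, \<phi>) \<in> Arr (grothendieck (GG B) \<A>').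
          FA \<chi>U (h, lift_arr B \<phi>) = lift_arr B (FA \<chi> (h, \<phi>)))))"

definition chi_at :: "('o, 'm) pointed_braided \<Rightarrow> ('o, 'g \<times> 'm, 'o, 'm) ftor \<Rightarrow> 'o \<Rightarrow> 'g \<Rightarrow> 'm" where
  "chi_at B \<chi> X h = FA \<chi> (h, Id B X)"

inductive_set monoidal_words :: "('o, 'm) pointed_braided \<Rightarrow> 'o set" for B where
  "unitO B \<in> monoidal_words B"
| "obj0 B \<in> monoidal_words B"
| "obj1 B \<in> monoidal_words B"
| "\<lbrakk>X \<in> monoidal_words B; Y \<in> monoidal_words B\<rbrakk> \<Longrightarrow> X \<natural>\<^bsub>B\<^esub> Y \<in> monoidal_words B"

text \<open>The equality \<open>\<A>(X \<natural> Y) = \<A>(X) * \<A>(Y)\<close> is the identification of \<open>\<A>(X \<natural> Y)\<close> with the free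
  product under which \<open>\<A>(id\<^sub>X \<natural> \<iota>\<^sub>Y)\<close> and \<open>\<A>(\<iota>\<^sub>X \<natural> id\<^sub>Y)\<close> are the two canonical inclusions.
  Starting from \<open>\<A>(0) = H\<^sup>*\<^sup>0\<close>, \<open>\<A>(1) = H\<close> and \<open>\<A>(obj0) = H\<^sub>0\<close> it yields, by iteration, the
  identifications of \<open>\<A>(power1 B m)\<close> with \<open>H\<^sup>*\<^sup>m\<close> and of \<open>\<A>(uobj B n)\<close> with \<open>H\<^sup>*\<^sup>n * H\<^sub>0\<close>, and
  \<open>\<iota>\<^sub>H * id\<close> on the latter is \<open>\<A>(\<iota>\<^sub>1 \<natural> id)\<close>.\<close>

definition reliable :: "('o, 'm) pointed_braided \<Rightarrow> ('o, 'm, 'g) group_ftor \<Rightarrow>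
    ('o, 'g \<times> 'm, 'o, 'm) ftor \<Rightarrow> 'g monoid \<Rightarrow> 'g monoid \<Rightarrow> bool" where
  "reliable B \<A> \<chi> H H0 \<longleftrightarrow>
    coherent_long_moody_system B \<A> \<chi> \<and>
    group H \<and> group H0 \<and> carrier H \<noteq> {\<one>\<^bsub>H\<^esub>} \<and>
    (\<exists>\<B>. cfunctor (UG' B) Gr \<B> \<and> agree_on (UG B) \<A> \<B> \<and>
      carrier (FO \<B> (unitO B)) = {\<one>\<^bsub>FO \<B> (unitO B)\<^esub>} \<and>
      FO \<B> (obj1 B) = H \<and> FO \<B> (obj0 B) = H0 \<and>
      (\<forall>X \<in> monoidal_words B. \<forall>Y \<in> monoidal_words B.
        is_free_product (FO \<B> X) (FO \<B> Y) (FO \<B> (X \<natural>\<^bsub>B\<^esub> Y))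
          (arrow_map (FA \<B> (bracket_tens B (Id (UG' B) X) (init_arr B Y))))
          (arrow_map (FA \<B> (bracket_tens B (init_arr B X) (Id (UG' B) Y)))))) \<and>
    (\<forall>n. \<forall>h \<in> carrier (FO \<A> (uobj B n)).
      let \<beta> = Inv B (braid B (obj1 B) (obj1 B)) \<sharp>\<^bsub>B\<^esub> Id B (uobj B n);
          inc = arrow_map (FA \<A> (bracket_tens B (init_arr B (obj1 B)) (Id (UG' B) (uobj B n))))
      in \<beta> \<bullet>\<^bsub>B\<^esub> (Id B (obj1 B) \<sharp>\<^bsub>B\<^esub> chi_at B \<chi> (uobj B n) h) =
         chi_at B \<chi> (uobj B (Suc n)) (inc h) \<bullet>\<^bsub>B\<^esub> \<beta>)"


section \<open>The Long-Moody functor\<close>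

type_synonym ('o, 'm, 'r, 'u) rep =
  "('o, ('o, 'm) bracket_arr, ('r, 'u) module, ('r, 'u) rmod_arr) ftor"

type_synonym ('o, 'm, 'r, 'u) rep_arr =
  "('o, 'm, 'r, 'u) rep \<times> ('o \<Rightarrow> ('r, 'u) rmod_arr) \<times> ('o, 'm, 'r, 'u) rep"

abbreviation Reps :: "'r ring \<Rightarrow> ('o, 'm) pointed_braided \<Rightarrow>
    (('o, 'm, 'r, 'u) rep, ('o, 'm, 'r, 'u) rep_arr) cat" where
  "Reps R B \<equiv> Fct (UG B) (RMod R)"

definition chi_action :: "('o, 'm) pointed_braided \<Rightarrow> ('o, 'g \<times> 'm, 'o, 'm) ftor \<Rightarrow>
    ('o, 'm, 'r, 'u) rep \<Rightarrow> 'o \<Rightarrow> 'g \<Rightarrow> 'u \<Rightarrow> 'u" where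
  "chi_action B \<chi> F X h = arrow_map (FA F (lift_arr B (chi_at B \<chi> X h)))"

definition LM_module :: "'r ring \<Rightarrow> ('o, 'm) pointed_braided \<Rightarrow> ('o, 'm, 'g) group_ftor \<Rightarrow>
    ('o, 'g \<times> 'm, 'o, 'm) ftor \<Rightarrow> ('o, 'm, 'r, 'u) rep \<Rightarrow> 'o \<Rightarrow> ('r, 'u) module" where
  "LM_module R B \<A> \<chi> F X =
    tensor_module R (FO \<A> X) (FO F (obj1 B \<natural>\<^bsub>B\<^esub> X)) (chi_action B \<chi> F X)"

definition LM_tensor :: "'r ring \<Rightarrow> ('o, 'm) pointed_braided \<Rightarrow> ('o, 'm, 'g) group_ftor \<Rightarrow>
    ('o, 'g \<times> 'm, 'o, 'm) ftor \<Rightarrow> ('o, 'm, 'r, 'u) rep \<Rightarrow> 'o \<Rightarrow> ('g \<Rightarrow> 'r) \<Rightarrow> 'u \<Rightarrow> 'u" where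
  "LM_tensor R B \<A> \<chi> F X =
    pure_tensor R (FO \<A> X) (FO F (obj1 B \<natural>\<^bsub>B\<^esub> X)) (chi_action B \<chi> F X)"

definition LM_obj :: "'r ring \<Rightarrow> ('o, 'm) pointed_braided \<Rightarrow> ('o, 'm, 'g) group_ftor \<Rightarrow>
    ('o, 'g \<times> 'm, 'o, 'm) ftor \<Rightarrow> ('o, 'm, 'r, 'u) rep \<Rightarrow> ('o, 'm, 'r, 'u) rep" where
  "LM_obj R B \<A> \<chi> F =
    \<lparr>FO = (\<lambda>X \<in> Obj (UG B). LM_module R B \<A> \<chi> F X),
     FA = (\<lambda>\<phi> \<in> Arr (UG B). let X = Dom (UG B) \<phi>; Y = Cod (UG B) \<phi> in
       (LM_module R B \<A> \<chi> F X,
        THE f. f \<in> linear_maps R (LM_module R B \<A> \<chi> F X) (LM_module R B \<A> \<chi> F Y) \<and>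
          (\<forall>i \<in> augmentation_ideal R (FO \<A> X). \<forall>v \<in> carrier (FO F (obj1 B \<natural>\<^bsub>B\<^esub> X)).
            f (LM_tensor R B \<A> \<chi> F X i v) =
            LM_tensor R B \<A> \<chi> F Y (group_ring_map R (arrow_map (FA \<A> \<phi>)) i)
              (arrow_map (FA F (FA (shift_UG B) \<phi>)) v)),
        LM_module R B \<A> \<chi> F Y))\<rparr>"

definition LM :: "'r ring \<Rightarrow> ('o, 'm) pointed_braided \<Rightarrow> ('o, 'm, 'g) group_ftor \<Rightarrow>
    ('o, 'g \<times> 'm, 'o, 'm) ftor \<Rightarrow>
    (('o, 'm, 'r, 'u) rep, ('o, 'm, 'r, 'u) rep_arr, ('o, 'm, 'r, 'u) rep, ('o, 'm, 'r, 'u) rep_arr) ftor" where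
  "LM R B \<A> \<chi> =
    \<lparr>FO = LM_obj R B \<A> \<chi>,
     FA = (\<lambda>(F, \<eta>, G). (LM_obj R B \<A> \<chi> F,
       \<lambda>X \<in> Obj (UG B). (LM_module R B \<A> \<chi> F X,
        THE f. f \<in> linear_maps R (LM_module R B \<A> \<chi> F X) (LM_module R B \<A> \<chi> G X) \<and>
          (\<forall>i \<in> augmentation_ideal R (FO \<A> X). \<forall>v \<in> carrier (FO F (obj1 B \<natural>\<^bsub>B\<^esub> X)).
            f (LM_tensor R B \<A> \<chi> F X i v) =
            LM_tensor R B \<A> \<chi> G X i (arrow_map (\<eta> (obj1 B \<natural>\<^bsub>B\<^esub> X)) v)),
        LM_module R B \<A> \<chi> G X),
       LM_obj R B \<A> \<chi> G))\<rparr>"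


section \<open>Weak polynomiality\<close>

definition Obj_nat :: "('o, 'm) pointed_braided \<Rightarrow> 'o set" where
  "Obj_nat B = {m \<in> Obj (UG' B). \<forall>n. m \<natural>\<^bsub>B\<^esub> uobj B n \<in> Obj (UG B)}"

definition i_arr :: "('o, 'm) pointed_braided \<Rightarrow> 'o \<Rightarrow> 'o \<Rightarrow> ('o, 'm) bracket_arr" where
  "i_arr B m X = bracket_tens B (init_arr B m) (Id (UG' B) X)"

definition kappa_at :: "('o, 'm) pointed_braided \<Rightarrow> 'o \<Rightarrow> ('o, 'm, 'r, 'u) rep \<Rightarrow> 'o \<Rightarrow> 'u set" where
  "kappa_at B m F X =
    {x \<in> carrier (FO F X). arrow_map (FA F (i_arr B m X)) x = \<zero>\<^bsub>FO F (m \<natural>\<^bsub>B\<^esub> X)\<^esub>}"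

definition kappa :: "'r ring \<Rightarrow> ('o, 'm) pointed_braided \<Rightarrow> ('o, 'm, 'r, 'u) rep \<Rightarrow> 'o \<Rightarrow> 'u set" where
  "kappa R B F X = module_span R (FO F X) (\<Union>m \<in> Obj_nat B. kappa_at B m F X)"

definition K_objs :: "'r ring \<Rightarrow> ('o, 'm) pointed_braided \<Rightarrow> ('o, 'm, 'r, 'u) rep set" where
  "K_objs R B = {F \<in> Obj (Reps R B). \<forall>X \<in> Obj (UG B). kappa R B F X = carrier (FO F X)}"

text \<open>\<open>\<delta>\<^sub>m\<close>, the cokernel of \<open>i\<^sub>m : F \<rightarrow> F(m \<natural> -)\<close>, with values transported to \<open>'u\<close>;
  \<open>delta_proj\<close> is the projection \<open>F(m \<natural> X) \<rightarrow> \<delta>\<^sub>m(F)(X)\<close>.\<close>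

definition i_image :: "('o, 'm) pointed_braided \<Rightarrow> 'o \<Rightarrow> ('o, 'm, 'r, 'u) rep \<Rightarrow> 'o \<Rightarrow> 'u set" where
  "i_image B m F X = arrow_map (FA F (i_arr B m X)) ` carrier (FO F X)"

definition delta_module :: "('o, 'm) pointed_braided \<Rightarrow> 'o \<Rightarrow> ('o, 'm, 'r, 'u) rep \<Rightarrow> 'o \<Rightarrow> ('r, 'u) module" where
  "delta_module B m F X = realise (quotient_module (FO F (m \<natural>\<^bsub>B\<^esub> X)) (i_image B m F X))"

definition delta_proj :: "('o, 'm) pointed_braided \<Rightarrow> 'o \<Rightarrow> ('o, 'm, 'r, 'u) rep \<Rightarrow> 'o \<Rightarrow> 'u \<Rightarrow> 'u" where
  "delta_proj B m F X x =
    (let M = FO F (m \<natural>\<^bsub>B\<^esub> X); N = i_image B m F X in embed (quotient_module M N) (N +>\<^bsub>M\<^esub> x))"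

definition delta :: "'r ring \<Rightarrow> ('o, 'm) pointed_braided \<Rightarrow> 'o \<Rightarrow>
    ('o, 'm, 'r, 'u) rep \<Rightarrow> ('o, 'm, 'r, 'u) rep" where
  "delta R B m F =
    \<lparr>FO = (\<lambda>X \<in> Obj (UG B). delta_module B m F X),
     FA = (\<lambda>\<phi> \<in> Arr (UG B). let X = Dom (UG B) \<phi>; Y = Cod (UG B) \<phi> in
       (delta_module B m F X,
        THE f. f \<in> linear_maps R (delta_module B m F X) (delta_module B m F Y) \<and>
          (\<forall>x \<in> carrier (FO F (m \<natural>\<^bsub>B\<^esub> X)).
            f (delta_proj B m F X x) =
            delta_proj B m F Y (arrow_map (FA F (bracket_tens B (Id (UG' B) m) \<phi>)) x)),
        delta_module B m F Y))\<rparr>"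

abbreviation St :: "'r ring \<Rightarrow> ('o, 'm) pointed_braided \<Rightarrow>
    (('o, 'm, 'r, 'u) rep,
     ('o, 'm, 'r, 'u) rep \<times> (('o, 'm, 'r, 'u) rep_arr + ('o, 'm, 'r, 'u) rep_arr) list set
       \<times> ('o, 'm, 'r, 'u) rep) cat" where
  "St R B \<equiv> quotient_cat (Reps R B) (K_objs R B)"

text \<open>As \<open>St R B\<close> has the objects of \<open>Reps R B\<close>, the endofunctor that \<open>\<delta>\<^sub>m\<close> induces on it is
  \<open>delta R B m\<close> on objects.\<close>

function Pol :: "'r ring \<Rightarrow> ('o, 'm) pointed_braided \<Rightarrow> int \<Rightarrow> ('o, 'm, 'r, 'u) rep set" where
  "Pol R B d = (if d < 0 then {F. zero_object (St R B) F}
    else {F \<in> Obj (St R B). \<forall>m \<in> Obj_nat B. delta R B m F \<in> Pol R B (d - 1)})"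
  by auto
termination by (relation "measure (\<lambda>(R, B, d). nat (d + 1))") auto

declare Pol.simps [simp del]

abbreviation Pol_cat where
  "Pol_cat R B d \<equiv> full (St R B) (Pol R B d)"

abbreviation Pol_quotient where
  "Pol_quotient R B d \<equiv> quotient_cat (Pol_cat R B d) (Pol R B (d - 1))"

abbreviation Pol_quotient_functor where
  "Pol_quotient_functor R B d \<equiv> quotient_functor (Pol_cat R B d) (Pol R B (d - 1))"

end

theory Submission imports Defs "HOL-Algebra.Bij" begin

text \<open>An arrow becomes invertible in the stable category iff its kernel and cokernel die under the
canonical maps \<open>X \<rightarrow> 1\<^sup>k \<natural> X\<close>, so arrows of the stable category are germs of natural maps along these.
As \<open>H\<close> and \<open>H0\<close> are free, Fox derivatives give a basis of each augmentation ideal, hence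
\<open>LM\<close> is exact, and it preserves the stably zero functors. The reliability relation makes \<open>\<delta>\<^sub>1(LM F)\<close> jointly
generated by the images of \<open>\<tau>\<^sub>1\<^sup>2 F\<close> and \<open>LM(\<delta>\<^sub>1 F)\<close>, which by induction yields
\<open>LM(Pol d) \<subseteq> Pol (d+1)\<close>. By exactness \<open>LM\<close> carries the arrows inverted modulo \<open>Pol (d-1)\<close> to
arrows inverted modulo \<open>Pol d\<close>, and the universal property of localisations applies.\<close>

section \<open>Notation\<close>

text \<open>The quotient categories are given by zigzags, and the presentation alone does not decide
  when two stable arrows are equal or what a stable kernel is. The germ functor supplies this: the
  elements of a representation over the objects \<open>uobj B n\<close>, compared along
  stabilisation, form a model on which stable arrows act faithfully, and injectivity and
  surjectivity on germs take the place of mono and epi. Germs are kept as partial equivalence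
  relations instead of being quotiented. Two more obstacles shape the proof. The definition of
  degree quantifies over all admissible m, while inductions are feasible for m = 1 only; every
  admissible m is isomorphic to a power of 1, which closes the gap. The maps that generate \<delta>
  of \<open>LM F\<close> are indexed by all elements of H, possibly infinitely many; instead of
  forming a direct sum inside the universe \<open>'u\<close>, degree is bounded directly from a
  jointly generating family. The tensor products do fit into \<open>'u\<close>, because each element
  is a finite sum of terms (g - 1) tensor v.\<close>

abbreviation (input) add_in (\<open>_ +[_] _\<close> [65, 0, 66] 65) where "x +[M] y \<equiv> x \<oplus>\<^bsub>M\<^esub> y"
abbreviation (input) mult_in (\<open>_ *[_] _\<close> [70, 0, 71] 70) where "x *[G] y \<equiv> x \<otimes>\<^bsub>G\<^esub> y"
abbreviation (input) smult_in (\<open>_ .[_] _\<close> [70, 0, 71] 70) where "r .[M] x \<equiv> r \<odot>\<^bsub>M\<^esub> x"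
abbreviation (input) comp_in (\<open>_ o[_] _\<close> [70, 0, 71] 70) where "g o[C] f \<equiv> g \<bullet>\<^bsub>C\<^esub> f"
abbreviation (input) zero_in (\<open>0[_]\<close>) where "0[M] \<equiv> \<zero>\<^bsub>M\<^esub>"
abbreviation (input) one_in (\<open>1[_]\<close>) where "1[G] \<equiv> \<one>\<^bsub>G\<^esub>"
abbreviation (input) uminus_in (\<open>-[_] _\<close> [0, 81] 80) where "-[M] x \<equiv> \<ominus>\<^bsub>M\<^esub> x"
abbreviation (input) minus_in (\<open>_ -[_] _\<close> [65, 0, 66] 65) where "x -[M] y \<equiv> x \<ominus>\<^bsub>M\<^esub> y"
abbreviation (input) inv_in (\<open>inv[_] _\<close> [0, 81] 80) where "inv[G] x \<equiv> inv\<^bsub>G\<^esub> x"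
abbreviation (input) iff_in (infixr \<open><->\<close> 25) where "A <-> B \<equiv> A = B"
abbreviation (input) "cr \<equiv> carrier"
abbreviation (input) "belt \<equiv> basis_elt"

section \<open>Categories\<close>

lemma HomsD: "f : Homs C X Y ==> f : Arr C & Dom C f = X & Cod C f = Y" by (simp add: Homs_def)

lemma Arr_Homs: "f : Arr C ==> f : Homs C (Dom C f) (Cod C f)" by (simp add: Homs_def)

definition invble :: "('o, 'm, 'z) cat_scheme => 'm => bool" where
 "invble C f <-> (EX g. inverse_arrows C f g)"

lemma Obj_full [simp]: "Obj (full C P) = Obj C \<inter> P" and Id_full [simp]: "Id (full C P) = Id C"
 and Comp_full [simp]: "Comp (full C P) = Comp C" and Dom_full [simp]: "Dom (full C P) = Dom C"
 and Cod_full [simp]: "Cod (full C P) = Cod C" by (simp_all add: full_def)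

context category
begin

lemmas Comp_in = Comp_in_Homs

lemma ends: "f : Homs C X Y ==> X : Obj C & Y : Obj C" using dom_in_Obj cod_in_Obj by (auto simp: Homs_def)

lemma inverse_iff:
 "f : Homs C X Y ==> inverse_arrows C f g <->
 g : Homs C Y X & g \<bullet> f = Id C X & f \<bullet> g = Id C Y" by (auto simp: inverse_arrows_def Homs_def)

lemma inverse_arrows_sym: "inverse_arrows C f g ==> inverse_arrows C g f" by (auto simp: inverse_arrows_def Homs_def)

lemma inverse_arrows_unique: assumes "inverse_arrows C f g" "inverse_arrows C f h" shows "g = h"
proof -
 let ?X = "Dom C f" and ?Y = "Cod C f"
 have f: "f : Homs C ?X ?Y" and g: "g : Homs C ?Y ?X" and h: "h : Homs C ?Y ?X" using assms by (auto simp: inverse_arrows_def Homs_def)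
 have "g = g \<bullet> (f \<bullet> h)" using assms g by (simp add: inverse_arrows_def Comp_Id_right)
 also have "... = h" using Comp_assoc[OF h f g] assms h by (simp add: inverse_arrows_def Comp_Id_left) finally show ?thesis .
qed

lemma Inv_eq: "inverse_arrows C f g ==> Inv C f = g" unfolding Inv_def using inverse_arrows_unique by blast

lemma invertible_Inv: "invble C f ==> inverse_arrows C f (Inv C f)" unfolding invble_def using Inv_eq by blast

lemma Inv_Homs: "invble C f ==> f : Homs C X Y ==> Inv C f : Homs C Y X" using invertible_Inv inverse_iff by blast

lemma Inv_left: "invble C f ==> f : Homs C X Y ==> Inv C f \<bullet> f = Id C X" using invertible_Inv inverse_iff by blast

lemma Inv_right: "invble C f ==> f : Homs C X Y ==> f \<bullet> Inv C f = Id C Y" using invertible_Inv inverse_iff by blast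

lemma inverse_arrows_Comp: assumes f: "f : Homs C X Y" and g: "g : Homs C Y Z"
 and "inverse_arrows C f f'" "inverse_arrows C g g'" shows "inverse_arrows C (g \<bullet> f) (f' \<bullet> g')"
proof -
 have f': "f' : Homs C Y X" and g': "g' : Homs C Z Y"
 and e: "f' \<bullet> f = Id C X" "f \<bullet> f' = Id C Y" "g' \<bullet> g = Id C Y" "g \<bullet> g' = Id C Z" using assms inverse_iff by blast+
 have gf: "g \<bullet> f : Homs C X Z" and fg': "f' \<bullet> g' : Homs C Z X" using f g f' g' Comp_in by blast+
 have "(f' \<bullet> g') \<bullet> (g \<bullet> f) = f' \<bullet> ((g' \<bullet> g) \<bullet> f)" by (simp only: Comp_assoc[OF gf g' f'] Comp_assoc[OF f g g'])
 moreover have "(g \<bullet> f) \<bullet> (f' \<bullet> g') = g \<bullet> ((f \<bullet> f') \<bullet> g')"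
 by (simp only: Comp_assoc[OF fg' f g] Comp_assoc[OF g' f' f])
 ultimately show ?thesis using e f g' fg' Comp_Id_left[OF f] Comp_Id_left[OF g'] by (simp add: inverse_iff[OF gf])
qed

lemma invertible_Comp:
 "[|f : Homs C X Y; g : Homs C Y Z; invble C f; invble C g|]
 ==> invble C (g \<bullet> f)" unfolding invble_def using inverse_arrows_Comp by blast

lemma invertible_Inv_invertible: "invble C f ==> invble C (Inv C f)" unfolding invble_def using inverse_arrows_sym Inv_eq by metis

lemma invertible_cancel_right:
 assumes "invble C s" "s : Homs C X Y" "f : Homs C Y Z" "g : Homs C Y Z" "f \<bullet> s = g \<bullet> s" shows "f = g"
proof -
 have i: "Inv C s : Homs C Y X" "s \<bullet> Inv C s = Id C Y" using Inv_Homs[OF assms(1,2)] Inv_right[OF assms(1,2)] .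
 have c: "(h \<bullet> s) \<bullet> Inv C s = h" if "h : Homs C Y Z" for h by (simp only: Comp_assoc[OF i(1) assms(2) that] i(2) Comp_Id_right[OF that])
 show ?thesis using c[OF assms(3)] c[OF assms(4)] unfolding assms(5) by (rule trans[OF sym])
qed

lemma invertible_cancel_left:
 assumes "invble C s" "s : Homs C Y Z" "f : Homs C X Y" "g : Homs C X Y" "s \<bullet> f = s \<bullet> g" shows "f = g"
proof -
 have i: "Inv C s : Homs C Z Y" "Inv C s \<bullet> s = Id C Y" using Inv_Homs[OF assms(1,2)] Inv_left[OF assms(1,2)] .
 have c: "Inv C s \<bullet> (s \<bullet> h) = h" if "h : Homs C X Y" for h
 by (simp only: Comp_assoc[OF that assms(2) i(1), symmetric] i(2) Comp_Id_left[OF that])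
 show ?thesis using c[OF assms(3)] c[OF assms(4)] unfolding assms(5) by (rule trans[OF sym])
qed

lemma category_full: "category (full C P)"
proof -
 have H: "f : Homs (full C P) X Y <-> f : Homs C X Y & X : P & Y : P" for f X Y by (auto simp: full_def Homs_def)
 show ?thesis
 proof (unfold_locales, goal_cases)
 case (1 f) thus ?case using dom_in_Obj by (simp add: full_def)
 next
 case (2 f) thus ?case using cod_in_Obj by (simp add: full_def)
 next
 case (3 X) thus ?case by (simp add: H Id_in_Homs)
 next
 case (4 f X Y g Z) thus ?case using Comp_in[of f X Y g Z] by (simp add: H)
 next
 case (5 f W X g Y h Z) thus ?case using Comp_assoc[of f W X g Y h Z] by (simp add: H)
 next
 case (6 f X Y) thus ?case using Comp_Id_right[of f X Y] by (simp add: H)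
 next
 case (7 f X Y) thus ?case using Comp_Id_left[of f X Y] by (simp add: H) qed
qed

end

lemma Homs_full: "X : P ==> Y : P ==> Homs (full C P) X Y = Homs C X Y" by (auto simp: full_def Homs_def)

lemma Arr_full_iff: "f : Arr (full C P) <-> f : Arr C & Dom C f : P & Cod C f : P" by (auto simp: full_def)

lemma inverse_arrows_full: assumes "f : Arr (full C P)" shows "inverse_arrows (full C P) f g <-> inverse_arrows C f g"
 using assms Homs_full[of "Cod C f" P "Dom C f" C] by (simp add: inverse_arrows_def Arr_full_iff)

context cfunctor
begin

lemma FA_inverse_arrows: assumes "inverse_arrows C f g" shows "inverse_arrows D (FA F f) (FA F g)"
proof -
 let ?X = "Dom C f" and ?Y = "Cod C f"
 have f: "f : Homs C ?X ?Y" and g: "g : Homs C ?Y ?X" using assms by (auto simp: inverse_arrows_def Homs_def)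
 have e: "g o[C] f = Id C ?X" "f o[C] g = Id C ?Y" using assms by (auto simp: inverse_arrows_def)
 have XY: "?X : Obj C" "?Y : Obj C" using source.ends[OF f] by auto
 show ?thesis unfolding target.inverse_iff[OF FA_in_Homs[OF f]] using FA_in_Homs[OF g] FA_Comp[OF f g] FA_Comp[OF g f] FA_Id XY e by metis
qed

lemma FA_invertible: "invble C f ==> invble D (FA F f)" unfolding invble_def using FA_inverse_arrows by blast

lemma cfunctor_full: assumes "!!X. X : P ==> X : Obj C ==> FO F X : Q" shows "cfunctor (full C P) (full D Q) F"
proof -
 interpret c: category "full C P" by (rule source.category_full)
 interpret d: category "full D Q" by (rule target.category_full)
 show ?thesis
 proof (unfold_locales, goal_cases)
 case (1 X) thus ?case using FO_in_Obj assms by simp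
 next
 case (2 f X Y) hence "X : P" "Y : P" "f : Homs C X Y" by (auto simp: Homs_def full_def)
 thus ?case using FA_in_Homs assms Homs_full source.ends by metis
 next
 case (3 X) thus ?case using FA_Id by simp
 next
 case (4 f X Y g Z) hence "f : Homs C X Y" "g : Homs C Y Z" by (auto simp: Homs_def full_def) thus ?case using FA_Comp by simp qed
qed

end

lemma FO_ftor_comp [simp]: "FO (ftor_comp G F) X = FO G (FO F X)"
 and FA_ftor_comp [simp]: "FA (ftor_comp G F) f = FA G (FA F f)" by (simp_all add: ftor_comp_def)

lemma cfunctor_ftor_comp: assumes "cfunctor C D F" "cfunctor D E G" shows "cfunctor C E (ftor_comp G F)"
proof -
 interpret F: cfunctor C D F by fact
 interpret G: cfunctor D E G by fact
 show ?thesis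
 proof (unfold_locales, goal_cases)
 case (1 X) thus ?case by (simp add: F.FO_in_Obj G.FO_in_Obj)
 next
 case (2 f X Y) thus ?case by (simp add: F.FA_in_Homs G.FA_in_Homs)
 next
 case (3 X) thus ?case by (simp add: F.FA_Id G.FA_Id F.FO_in_Obj)
 next
 case (4 f X Y g Z) thus ?case by (simp add: F.FA_Comp[OF 4] G.FA_Comp[OF F.FA_in_Homs[OF 4(1)] F.FA_in_Homs[OF 4(2)]]) qed
qed

section \<open>Localisation\<close>

inductive_simps zigzag_simps:
 "zigzag C S X [] Z" "zigzag C S X (Inl f # w) Z" "zigzag C S X (Inr s # w) Z"

lemma zigzag_Obj:
 assumes "category C" "zigzag C S X w Y" shows "X : Obj C & Y : Obj C" using assms(2) by induction (use category.ends[OF assms(1)] in blast)+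

lemma zigzag_append: "zigzag C S X u Y ==> zigzag C S Y v Z ==> zigzag C S X (u @ v) Z" by (induction rule: zigzag.induct) (auto intro: zigzag.intros)

lemma zigzag_append_split: assumes "category C" "zigzag C S X (u @ v) Z" shows "EX Y. zigzag C S X u Y & zigzag C S Y v Z" using assms(2)
proof (induction u arbitrary: X)
 case Nil
 have "zigzag C S X [] X" using zigzag_Obj[OF assms(1) Nil] by (intro zz_nil) simp thus ?case using Nil by auto
next
 case (Cons a u)
 from Cons.prems have "zigzag C S X (a # (u @ v)) Z" by simp
 thus ?case by (cases rule: zigzag.cases) (use Cons.IH in \<open>blast intro: zigzag.intros\<close>)+
qed

lemma zigzag_step_append: "zigzag_step C S u v ==> zigzag_step C S (a @ u @ b) (a @ v @ b)"
proof (induction rule: zigzag_step.induct)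
 case (1 X u v) thus ?case using zigzag_step.intros(1)[of X C S "a @ u" "v @ b"] by simp
next
 case (2 f X Y g Z u v) thus ?case using zigzag_step.intros(2)[of f C X Y g Z S "a @ u" "v @ b"] by simp
next
 case (3 s u v) thus ?case using zigzag_step.intros(3)[of s S C "a @ u" "v @ b"] by simp
next
 case (4 s u v) thus ?case using zigzag_step.intros(4)[of s S C "a @ u" "v @ b"] by simp
qed

lemma zigzag_equiv_refl: "zigzag_equiv C S X Y u u" by (simp add: zigzag_equiv_def)

lemma zigzag_equiv_sym: "zigzag_equiv C S X Y u v ==> zigzag_equiv C S X Y v u" unfolding zigzag_equiv_def by (rule equivclp_sym)

lemma zigzag_equiv_trans:
 "zigzag_equiv C S X Y u v ==> zigzag_equiv C S X Y v w ==> zigzag_equiv C S X Y u w" unfolding zigzag_equiv_def by (rule equivclp_trans)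

lemma zigzag_equiv_step:
 "[|zigzag C S X u Y; zigzag C S X v Y; zigzag_step C S u v|] ==> zigzag_equiv C S X Y u v" unfolding zigzag_equiv_def by (rule r_into_equivclp) simp

text \<open>Elementary steps are undirected here: the generated equivalence is symmetric, so a
  single case covers a step read in either direction. All intermediate words keep the same
  endpoints.\<close>

lemma zigzag_equiv_induct [consumes 1, case_names refl step]: assumes "zigzag_equiv C S X Y u v" "!!u. P u u"
 and "!!u v w. [|zigzag_equiv C S X Y u v; P u v; zigzag C S X v Y; zigzag C S X w Y;
 zigzag_step C S v w | zigzag_step C S w v|] ==> P u w" shows "P u v" using assms(1) unfolding zigzag_equiv_def
 by (induction rule: equivclp_induct) (use assms(2,3) in \<open>auto simp: zigzag_equiv_def\<close>)

lemma zigzag_equiv_zigzag: "zigzag_equiv C S X Y u v ==> zigzag C S X u Y ==> zigzag C S X v Y" by (induction rule: zigzag_equiv_induct) auto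

lemma zigzag_equiv_append:
 assumes "zigzag_equiv C S X Y u v" "zigzag C S W a X" "zigzag C S Y b Z" shows "zigzag_equiv C S W Z (a @ u @ b) (a @ v @ b)" using assms(1)
proof (induction rule: zigzag_equiv_induct)
 case (refl u) thus ?case by (rule zigzag_equiv_refl)
next
 case (step u v w)
 have "zigzag C S W (a @ v @ b) Z" "zigzag C S W (a @ w @ b) Z" using step assms zigzag_append by metis+
 hence "zigzag_equiv C S W Z (a @ v @ b) (a @ w @ b)" using step.hyps(4) zigzag_step_append[of C S v w a b] zigzag_step_append[of C S w v a b]
 zigzag_equiv_step[of C S W "a @ v @ b" Z "a @ w @ b"]
 zigzag_equiv_sym[OF zigzag_equiv_step[of C S W "a @ w @ b" Z "a @ v @ b"]] by blast
 with step.IH show ?case by (rule zigzag_equiv_trans)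
qed

lemma zigzag_class_eq_iff:
 "zigzag_class C S X u Y = zigzag_class C S X v Y <-> zigzag_equiv C S X Y u v"
proof
 assume "zigzag_class C S X u Y = zigzag_class C S X v Y"
 thus "zigzag_equiv C S X Y u v" using zigzag_equiv_refl[of C S X Y v] by (auto simp: zigzag_class_def set_eq_iff)
next
 assume "zigzag_equiv C S X Y u v"
 hence "zigzag_equiv C S X Y u w <-> zigzag_equiv C S X Y v w" for w using zigzag_equiv_sym zigzag_equiv_trans by metis
 thus "zigzag_class C S X u Y = zigzag_class C S X v Y" by (simp add: zigzag_class_def)
qed

lemma loc_simps:
 "Obj (localisation C S) = Obj C"
 "Id (localisation C S) X = zigzag_class C S X [] X"
 "Homs (localisation C S) X Y = {zigzag_class C S X w Y | w. zigzag C S X w Y}" by (auto simp: localisation_def Homs_def zigzag_class_def)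

text \<open>\<open>localisation\<close> composes classes by collecting everything equivalent to some
  concatenation of representatives. Concatenation respects the equivalence on both sides, so one
  pair of representatives suffices. Words are read in travelling order, hence \<open>u @ v\<close>
  for v after u.\<close>

lemma loc_Comp: assumes "category C" and u: "zigzag C S X u Y" and v: "zigzag C S Y v Z"
 shows "zigzag_class C S Y v Z o[localisation C S] zigzag_class C S X u Y = zigzag_class C S X (u @ v) Z"
proof -
 have *: "zigzag_equiv C S X Z (u @ v) (u' @ v')"
 if "zigzag_equiv C S X Y u u'" "zigzag_equiv C S Y Z v v'" for u' v'
 proof -
 have u': "zigzag C S X u' Y" using that u zigzag_equiv_zigzag by metis
 have XZ: "X : Obj C" "Z : Obj C" using zigzag_Obj assms by metis+
 have "zigzag_equiv C S X Z (u @ v) (u' @ v)" using zigzag_equiv_append[OF that(1) zz_nil[OF XZ(1)] v] by simp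
 moreover have "zigzag_equiv C S X Z (u' @ v) (u' @ v')" using zigzag_equiv_append[OF that(2) u' zz_nil[OF XZ(2)]] by simp
 ultimately show ?thesis by (rule zigzag_equiv_trans) qed
 hence "(EX u'. zigzag_equiv C S X Y u u' & (EX v'. zigzag_equiv C S Y Z v v' & zigzag_equiv C S X Z (u' @ v') w))
 <-> zigzag_equiv C S X Z (u @ v) w" for w using zigzag_equiv_refl zigzag_equiv_trans by metis
 thus ?thesis by (simp add: localisation_def zigzag_class_def)
qed

lemma category_loc: assumes C: "category C" shows "category (localisation C S)"
proof (unfold_locales, goal_cases)
 case (1 f) thus ?case using zigzag_Obj[OF C] by (auto simp: localisation_def zigzag_class_def)
next
 case (2 f) thus ?case using zigzag_Obj[OF C] by (auto simp: localisation_def zigzag_class_def)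
next
 case (3 X) thus ?case by (auto simp: loc_simps intro: zigzag.intros)
next
 case (4 f X Y g Z) thus ?case by (auto simp: loc_simps loc_Comp[OF C] intro: zigzag_append)
next
 case (5 f W X g Y h Z)
 then obtain u v w where "f = zigzag_class C S W u X" "g = zigzag_class C S X v Y" "h = zigzag_class C S Y w Z"
 and z: "zigzag C S W u X" "zigzag C S X v Y" "zigzag C S Y w Z" by (auto simp: loc_simps)
 thus ?case using zigzag_append by (simp add: loc_Comp[OF C, OF z(1) z(2)] loc_Comp[OF C, OF z(2) z(3)]
 loc_Comp[OF C, OF z(1) zigzag_append[OF z(2,3)]] loc_Comp[OF C, OF zigzag_append[OF z(1,2)] z(3)])
next
 case (6 f X Y)
 then obtain u where u: "f = zigzag_class C S X u Y" "zigzag C S X u Y" by (auto simp: loc_simps)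
 thus ?case using loc_Comp[OF C zz_nil u(2)] zigzag_Obj[OF C] by (simp add: loc_simps)
next
 case (7 f X Y)
 then obtain u where u: "f = zigzag_class C S X u Y" "zigzag C S X u Y" by (auto simp: loc_simps)
 thus ?case using loc_Comp[OF C u(2) zz_nil] zigzag_Obj[OF C] by (simp add: loc_simps)
qed

definition localisation_functor ::
 "('o, 'm, 'z) cat_scheme => 'm set => ('o, 'm, 'o, 'o \<times> ('m + 'm) list set \<times> 'o) ftor" where
 "localisation_functor C S = \<lparr>FO = (%X. X), FA = (%f. zigzag_class C S (Dom C f) [Inl f] (Cod C f))\<rparr>"

lemma FO_localisation_functor [simp]: "FO (localisation_functor C S) X = X" by (simp add: localisation_functor_def)

lemma quotient_functor_eq: "quotient_functor C T = localisation_functor C (isos_mod C T)" by (simp add: quotient_functor_def localisation_functor_def)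

lemma FA_loc:
 "f : Homs C X Y ==> FA (localisation_functor C S) f = zigzag_class C S X [Inl f] Y" by (auto simp: localisation_functor_def Homs_def)

lemma zigzag_fwd1: "category C ==> f : Homs C X Y ==> zigzag C S X [Inl f] Y" by (metis category.ends zz_fwd zz_nil)

lemma zigzag_bwd1: "category C ==> s : S ==> s : Homs C Y X ==> zigzag C S X [Inr s] Y" by (metis category.ends zz_bwd zz_nil)

lemma cfunctor_localisation_functor: assumes C: "category C" shows "cfunctor C (localisation C S) (localisation_functor C S)"
proof -
 interpret c: category C by fact
 interpret d: category "localisation C S" by (rule category_loc[OF C])
 show ?thesis
 proof (unfold_locales, goal_cases)
 case (1 X) thus ?case by (simp add: loc_simps)
 next
 case (2 f X Y) thus ?case by (auto simp: loc_simps FA_loc intro: zigzag_fwd1[OF C])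
 next
 case (3 X) hence "Id C X : Homs C X X" by (rule c.Id_in_Homs)
 moreover have "zigzag_step C S ([] @ [Inl (Id C X)] @ []) ([] @ [])" using 3 by (rule zigzag_step.intros)
 ultimately show ?case using 3 zigzag_fwd1[OF C] by (simp add: loc_simps FA_loc zigzag_class_eq_iff zigzag_equiv_step zz_nil)
 next
 case (4 f X Y g Z)
 have "zigzag_step C S ([] @ [Inl f, Inl g] @ []) ([] @ [Inl (g o[C] f)] @ [])" using 4 by (rule zigzag_step.intros)
 moreover have gf: "g o[C] f : Homs C X Z" using 4 c.Comp_in by blast
 moreover have "zigzag C S X ([Inl f] @ [Inl g]) Z" using 4 zigzag_append zigzag_fwd1[OF C] by metis
 ultimately show ?case using 4 by (simp add: FA_loc[OF gf] FA_loc loc_Comp[OF C zigzag_fwd1[OF C] zigzag_fwd1[OF C]]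
 zigzag_class_eq_iff zigzag_equiv_sym zigzag_equiv_step zigzag_fwd1[OF C]) qed
qed

lemma localisation_inverse: assumes C: "category C" and s: "s : S" "s : Homs C Y X"
 shows "inverse_arrows (localisation C S) (FA (localisation_functor C S) s) (zigzag_class C S X [Inr s] Y)"
proof -
 interpret d: category "localisation C S" by (rule category_loc[OF C])
 have z: "zigzag C S Y [Inl s] X" "zigzag C S X [Inr s] Y" using s zigzag_fwd1[OF C] zigzag_bwd1[OF C] by metis+
 have O: "X : Obj C" "Y : Obj C" using zigzag_Obj[OF C z(1)] by auto
 have "zigzag_step C S ([] @ [Inl s, Inr s] @ []) ([] @ [])" "zigzag_step C S ([] @ [Inr s, Inl s] @ []) ([] @ [])" by (rule zigzag_step.intros(3,4)[OF s(1)])+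
 hence "zigzag_equiv C S Y Y [Inl s, Inr s] []" "zigzag_equiv C S X X [Inr s, Inl s] []"
 using zigzag_append[OF z] zigzag_append[OF z(2,1)] O by (auto intro!: zigzag_equiv_step zz_nil)
 thus ?thesis using z s by (subst d.inverse_iff[of _ Y X])
 (auto simp: loc_simps FA_loc loc_Comp[OF C z] loc_Comp[OF C z(2,1)] zigzag_class_eq_iff
 intro: zigzag_equiv_refl)
qed

lemma localisation_invertible:
 assumes "category C" "s : S" "S <= Arr C" shows "invble (localisation C S) (FA (localisation_functor C S) s)" unfolding invble_def
 by (rule exI, rule localisation_inverse[OF assms(1,2) Arr_Homs]) (use assms in blast)

text \<open>Peels off the first letter of a zigzag, so arrows of the localisation can be treated by
  precomposition with an honest arrow or with the inverse of an inverted one.\<close>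

lemma localisation_induct [consumes 2, case_names id fwd bwd]: assumes C: "category C" and al: "al : Homs (localisation C S) X Y"
 and id: "!!X. X : Obj C ==> P X (Id (localisation C S) X) X"
 and fwd: "!!X Y Z f al. [|f : Homs C X Y; al : Homs (localisation C S) Y Z; P Y al Z|]
 ==> P X (al o[localisation C S] FA (localisation_functor C S) f) Z"
 and bwd: "!!X Y Z s al. [|s : S; s : Homs C Y X; al : Homs (localisation C S) Y Z; P Y al Z|]
 ==> P X (al o[localisation C S] Inv (localisation C S) (FA (localisation_functor C S) s)) Z" shows "P X al Y"
proof -
 interpret d: category "localisation C S" by (rule category_loc[OF C])
 obtain w where w: "al = zigzag_class C S X w Y" "zigzag C S X w Y" using al by (auto simp: loc_simps)
 from w(2) have "P X (zigzag_class C S X w Y) Y"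
 proof (induction rule: zigzag.induct)
 case (zz_nil X) thus ?case using id by (simp add: loc_simps)
 next
 case (zz_fwd f X Y w Z) thus ?case using fwd[of f X Y "zigzag_class C S Y w Z" Z] loc_Comp[OF C zigzag_fwd1[OF C zz_fwd(1)] zz_fwd(2)]
 by (auto simp: loc_simps FA_loc)
 next
 case (zz_bwd s Y X w Z) thus ?case using bwd[of s Y X "zigzag_class C S Y w Z" Z] loc_Comp[OF C zigzag_bwd1[OF C zz_bwd(1,2)] zz_bwd(3)]
 d.Inv_eq[OF localisation_inverse[OF C zz_bwd(1,2)]] by (auto simp: loc_simps) qed thus ?thesis using w by simp
qed

section \<open>Universal property of the localisation\<close>

context cfunctor
begin

text \<open>The starting object matters only for the empty word, whose value must be some identity;
  elsewhere the endpoints are read off the letters.\<close>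

fun zz_val :: "'a => ('f + 'f) list => 'g" where
 "zz_val X [] = Id D (FO F X)"
| "zz_val X (Inl f # w) = zz_val (Cod C f) w o[D] FA F f"
| "zz_val X (Inr s # w) = zz_val (Dom C s) w o[D] Inv D (FA F s)"

context fixes S assumes inv: "!!s. s : S ==> invble D (FA F s)" and S: "S <= Arr C"
begin

lemma zigzag_value_Homs: "zigzag C S X w Y ==> zz_val X w : Homs D (FO F X) (FO F Y)"
proof (induction rule: zigzag.induct)
 case (zz_nil X) thus ?case by (simp add: target.Id_in_Homs FO_in_Obj)
next
 case (zz_fwd f X Y w Z) thus ?case using FA_in_Homs HomsD target.Comp_in by fastforce
next
 case (zz_bwd s Y X w Z) hence "Inv D (FA F s) : Homs D (FO F X) (FO F Y)" using inv target.Inv_Homs FA_in_Homs by blast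
 thus ?case using zz_bwd HomsD target.Comp_in by fastforce
qed

lemma zigzag_value_append:
 "[|zigzag C S X u Y; zigzag C S Y v Z|] ==> zz_val X (u @ v) = zz_val Y v o[D] zz_val X u"
proof (induction rule: zigzag.induct)
 case (zz_nil X) thus ?case using zigzag_value_Homs target.Comp_Id_right by fastforce
next
 case (zz_fwd f X Y w W)
 have "zz_val Y (w @ v) = zz_val W v o[D] zz_val Y w" using zz_fwd by blast thus ?case using zz_fwd HomsD[OF zz_fwd(1)]
 target.Comp_assoc[OF FA_in_Homs[OF zz_fwd(1)] zigzag_value_Homs[OF zz_fwd(2)] zigzag_value_Homs[OF zz_fwd(4)]] by simp
next
 case (zz_bwd s Y X w W)
 have i: "Inv D (FA F s) : Homs D (FO F X) (FO F Y)" using zz_bwd inv target.Inv_Homs FA_in_Homs by blast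
 have "zz_val Y (w @ v) = zz_val W v o[D] zz_val Y w" using zz_bwd by blast thus ?case using zz_bwd HomsD[OF zz_bwd(2)]
 target.Comp_assoc[OF i zigzag_value_Homs[OF zz_bwd(3)] zigzag_value_Homs[OF zz_bwd(5)]] by simp
qed

lemma zigzag_value_step: assumes "zigzag_step C S a b" "zigzag C S X a Y" "zigzag C S X b Y" shows "zz_val X a = zz_val X b"
proof -
 \<comment> \<open>Every elementary step replaces a factor p by r inside a context. Cutting the
   zigzag at both ends of p reduces the invariance to the factor itself.\<close>
 have key: "zz_val X (u @ p @ v) = zz_val X (u @ r @ v)"
 if z: "zigzag C S X (u @ p @ v) Y" and e: "!!P Q. zigzag C S P p Q ==> zigzag C S P r Q & zz_val P p = zz_val P r" for u p r v
 proof -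
 obtain P where P: "zigzag C S X u P" "zigzag C S P (p @ v) Y" using zigzag_append_split[OF source.category_axioms z] by blast
 obtain Q where Q: "zigzag C S P p Q" "zigzag C S Q v Y" using zigzag_append_split[OF source.category_axioms P(2)] by blast
 have r: "zigzag C S P r Q" using e Q(1) by blast
 show ?thesis using e[OF Q(1)] zigzag_value_append[OF P(1) zigzag_append[OF Q]]
 zigzag_value_append[OF P(1) zigzag_append[OF r Q(2)]]
 zigzag_value_append[OF Q] zigzag_value_append[OF r Q(2)] by simp qed
 show ?thesis using assms
 proof (cases rule: zigzag_step.cases)
 case (1 X' u v)
 have "zigzag C S P [] Q & zz_val P [Inl (Id C X')] = zz_val P []" if "zigzag C S P [Inl (Id C X')] Q" for P Q using that
 proof (cases rule: zigzag.cases)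
 case (zz_fwd Y) hence "Q = Y" by (auto elim: zigzag.cases)
 moreover have "P = X'" "Y = X'" using HomsD[OF zz_fwd(1)] HomsD[OF source.Id_in_Homs[OF 1(3)]] by auto
 ultimately show ?thesis using 1 HomsD[OF source.Id_in_Homs[OF 1(3)]]
 target.Comp_Id_left[OF target.Id_in_Homs[OF FO_in_Obj[OF 1(3)]]] by (auto intro: zz_nil simp: FA_Id) qed
 thus ?thesis using key[of u "[Inl (Id C X')]" v "[]"] assms 1 by simp
 next
 case (2 f X' Y' g Z' u v)
 have "zigzag C S P [Inl (g o[C] f)] Q & zz_val P [Inl f, Inl g] = zz_val P [Inl (g o[C] f)]"
 if "zigzag C S P [Inl f, Inl g] Q" for P Q
 proof -
 have e: "P = X'" "Q = Z'" using that 2 by (auto simp: zigzag_simps Homs_def)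
 have gf: "g o[C] f : Homs C X' Z'" using 2 source.Comp_in by blast
 have "zz_val P [Inl f, Inl g] = FA F g o[D] FA F f" using HomsD[OF 2(4)] target.Comp_Id_left[OF FA_in_Homs[OF 2(4)]] by simp
 also have "... = zz_val P [Inl (g o[C] f)]" using HomsD[OF gf] target.Comp_Id_left[OF FA_in_Homs[OF gf]] FA_Comp[OF 2(3,4)] by simp
 finally show ?thesis using e zigzag_fwd1[OF source.category_axioms gf] by simp qed
 thus ?thesis using key[of u "[Inl f, Inl g]" v "[Inl (g o[C] f)]"] assms 2 by simp
 next
 case (3 s u v)
 have "zigzag C S P [] Q & zz_val P [Inl s, Inr s] = zz_val P []" if "zigzag C S P [Inl s, Inr s] Q" for P Q
 proof -
 have s: "s : Homs C (Dom C s) (Cod C s)" by (rule Arr_Homs[OF subsetD[OF S 3(3)]])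
 have "P = Dom C s" "Q = Dom C s" using that by (auto simp: zigzag_simps Homs_def)
 moreover have "Inv D (FA F s) o[D] FA F s = Id D (FO F (Dom C s))" using target.Inv_left[OF inv[OF 3(3)] FA_in_Homs[OF s]] .
 moreover have "Inv D (FA F s) : Homs D (FO F (Cod C s)) (FO F (Dom C s))" using target.Inv_Homs[OF inv[OF 3(3)] FA_in_Homs[OF s]] .
 ultimately show ?thesis using source.ends[OF s] by (simp add: zigzag_simps target.Comp_Id_left) qed
 thus ?thesis using key[of u "[Inl s, Inr s]" v "[]"] assms 3 by simp
 next
 case (4 s u v)
 have "zigzag C S P [] Q & zz_val P [Inr s, Inl s] = zz_val P []" if "zigzag C S P [Inr s, Inl s] Q" for P Q
 proof -
 have s: "s : Homs C (Dom C s) (Cod C s)" by (rule Arr_Homs[OF subsetD[OF S 4(3)]])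
 have "P = Cod C s" "Q = Cod C s" using that by (auto simp: zigzag_simps Homs_def)
 moreover have "FA F s o[D] Inv D (FA F s) = Id D (FO F (Cod C s))" using target.Inv_right[OF inv[OF 4(3)] FA_in_Homs[OF s]] .
 ultimately show ?thesis using source.ends[OF s] FA_in_Homs[OF s] by (simp add: zigzag_simps target.Comp_Id_left) qed
 thus ?thesis using key[of u "[Inr s, Inl s]" v "[]"] assms 4 by simp qed
qed

lemma zigzag_value_equiv: assumes "zigzag_equiv C S X Y u v" shows "zz_val X u = zz_val X v"
 using assms by (induction rule: zigzag_equiv_induct) (use zigzag_value_step in metis)+

text \<open>A class is sent to the value of an arbitrarily chosen representative; values are
  constant on classes by \<open>zigzag_value_equiv\<close>, which also gives functoriality.\<close>

lemma loc_universal: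
 "EX \<Phi>. cfunctor (localisation C S) D \<Phi> & agree_on C (ftor_comp \<Phi> (localisation_functor C S)) F"
proof -
 define \<Phi> :: "('a, 'a \<times> ('f + 'f) list set \<times> 'a, 'b, 'g) ftor"
 where "\<Phi> = \<lparr>FO = FO F, FA = (%(X, c, Y). zz_val X (SOME w. w : c))\<rparr>"
 have \<Phi>: "FA \<Phi> (zigzag_class C S X w Y) = zz_val X w" for X w Y
 proof -
 have "zigzag_equiv C S X Y w (SOME w'. zigzag_equiv C S X Y w w')" using zigzag_equiv_refl by (rule someI)
 thus ?thesis using zigzag_value_equiv by (simp add: \<Phi>_def zigzag_class_def) qed
 interpret l: category "localisation C S" by (rule category_loc[OF source.category_axioms])
 have "cfunctor (localisation C S) D \<Phi>"
 proof (unfold_locales, goal_cases)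
 case (1 X) thus ?case by (simp add: loc_simps \<Phi>_def FO_in_Obj)
 next
 case (2 f X Y) thus ?case using zigzag_value_Homs by (auto simp: loc_simps \<Phi>) (simp add: \<Phi>_def)
 next
 case (3 X) thus ?case by (simp add: loc_simps \<Phi>) (simp add: \<Phi>_def)
 next
 case (4 f X Y g Z) thus ?case using zigzag_value_append by (auto simp: loc_simps \<Phi> loc_Comp[OF source.category_axioms]) qed
 moreover have "agree_on C (ftor_comp \<Phi> (localisation_functor C S)) F"
 proof -
 have "FA \<Phi> (FA (localisation_functor C S) f) = FA F f" if "f : Arr C" for f
 proof -
 have f: "f : Homs C (Dom C f) (Cod C f)" using that by (rule Arr_Homs)
 show ?thesis using FA_in_Homs[OF f] by (simp add: FA_loc[OF f] \<Phi> target.Comp_Id_left) qed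
 thus ?thesis by (simp add: agree_on_def \<Phi>_def) qed ultimately show ?thesis by blast
qed

end

end

section \<open>Modules\<close>

text \<open>Linearity without the extensionality built into \<open>linear_maps\<close>, so that
  composites and plain lambda terms qualify; \<open>restrict_linear_maps\<close> converts.\<close>

definition lin :: "('r, 'y) ring_scheme => ('r, 'a) module => ('r, 'b) module => ('a => 'b) => bool" where
 "lin R M N f <-> (ALL x : cr M. f x : cr N) &
 (ALL x : cr M. ALL y : cr M. f (x +[M] y) = f x +[N] f y) &
 (ALL r : cr R. ALL x : cr M. f (r .[M] x) = r .[N] f x)"

lemma lin_cl: "lin R M N f ==> x : cr M ==> f x : cr N" and lin_add: "lin R M N f ==> x : cr M ==> y : cr M ==> f (x +[M] y) = f x +[N] f y"
 and lin_smult: "lin R M N f ==> r : cr R ==> x : cr M ==> f (r .[M] x) = r .[N] f x" by (simp_all add: lin_def)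

lemma linI: assumes "!!x. x : cr M ==> f x : cr N"
 "!!x y. [|x : cr M; y : cr M|] ==> f (x +[M] y) = f x +[N] f y"
 "!!r x. [|r : cr R; x : cr M|] ==> f (r .[M] x) = r .[N] f x" shows "lin R M N f" using assms by (simp add: lin_def)

lemma lmaps_iff: "f : linear_maps R M N <-> lin R M N f & f : extensional (cr M)" by (auto simp: linear_maps_def lin_def PiE_def Pi_def)

locale rmod = module R M for R :: "'r ring" (structure) and M :: "('r, 'a) module"

lemma rmodI: "module R M ==> rmod R M" by (rule rmod.intro)

context rmod
begin

lemma neg_smult: "x : cr M ==> (\<ominus> \<one>) .[M] x = -[M] x" using smult_l_minus[of \<one> x] by simp

lemma lin_zero: assumes "module R N" "lin R M N f" shows "f 0[M] = 0[N]"
proof -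
 interpret N: rmod R N by (rule rmodI) fact
 have "f (\<zero> .[M] 0[M]) = \<zero> .[N] f 0[M]" by (rule lin_smult[OF assms(2)]) simp_all thus ?thesis using lin_cl[OF assms(2)] by simp
qed

lemma lin_neg: assumes "module R N" "lin R M N f" "x : cr M" shows "f (-[M] x) = -[N] f x"
proof -
 interpret N: rmod R N by (rule rmodI) fact
 have "f ((\<ominus> \<one>) .[M] x) = (\<ominus> \<one>) .[N] f x" by (rule lin_smult[OF assms(2)]) (simp_all add: assms)
 thus ?thesis using lin_cl[OF assms(2,3)] assms(3) by (simp add: neg_smult N.neg_smult)
qed

lemma lin_diff: assumes "module R N" "lin R M N f" "x : cr M" "y : cr M" shows "f (x -[M] y) = f x -[N] f y"
 using assms by (simp add: a_minus_def lin_add lin_neg)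

lemma lin_const_zero: assumes "module R N" shows "lin R M N (%_. 0[N])"
proof -
 interpret N: rmod R N by (rule rmodI) fact
 show ?thesis by (rule linI) simp_all
qed

lemma diff_zero_iff: "x : cr M ==> y : cr M ==> x -[M] y = 0[M] <-> x = y"
 by (metis M.add.inv_closed M.add.inv_inv M.add.inv_unique' M.minus_equality M.r_neg a_minus_def M.a_comm)

lemma diff_add: "x : cr M ==> y : cr M ==> (x -[M] y) +[M] y = x" by (simp add: a_minus_def M.a_assoc M.l_neg)

lemma submodule_zero: "submodule N R M ==> 0[M] : N" using subgroup.one_closed[OF submodule.axioms(1)] by fastforce

lemma submodule_kernel: assumes "module R N" "lin R M N f" shows "submodule {x : cr M. f x = 0[N]} R M"
proof -
 interpret N: rmod R N by (rule rmodI) fact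
 show ?thesis by (rule submoduleI) (auto simp: lin_zero[OF assms] lin_neg[OF assms] lin_add[OF assms(2)] lin_smult[OF assms(2)])
qed

lemma submodule_image: assumes "module R N" "lin R M N f" shows "submodule (f ` cr M) R N"
proof -
 interpret N: rmod R N by (rule rmodI) fact
 show ?thesis
 proof (rule N.submoduleI)
 show "f ` cr M <= cr N" using lin_cl[OF assms(2)] by blast
 show "0[N] : f ` cr M" using lin_zero[OF assms] by (metis M.zero_closed imageI)
 show "-[N] a : f ` cr M" if "a : f ` cr M" for a using that lin_neg[OF assms] M.a_inv_closed by (metis (no_types, lifting) imageE imageI)
 show "a +[N] b : f ` cr M" if ab: "a : f ` cr M" "b : f ` cr M" for a b
 proof -
 obtain x y where "a = f x" "b = f y" "x : cr M" "y : cr M" using ab by blast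
 thus ?thesis using lin_add[OF assms(2), of x y] by (metis M.a_closed imageI) qed
 show "a .[N] x : f ` cr M" if ax: "a : cr R" "x : f ` cr M" for a x
 proof -
 obtain y where "x = f y" "y : cr M" using ax by blast thus ?thesis using ax lin_smult[OF assms(2), of a y] by (metis smult_closed imageI)
 qed qed
qed

lemma module_span_least: "submodule N R M ==> S <= N ==> module_span R M S <= N" by (auto simp: module_span_def)

lemma module_span_superset: "S <= module_span R M S" by (auto simp: module_span_def)

lemma submodule_module_span: assumes "S <= cr M" shows "submodule (module_span R M S) R M" unfolding module_span_def
proof (rule submoduleI)
 show "\<Inter> {N. submodule N R M & S <= N} <= cr M" using carrier_is_submodule assms by blast
qed (auto simp: submodule_zero submoduleE)

text \<open>The module axioms are equations, so they pass along any surjection that respects the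
  operations. This serves both for cosets and for the transport of a module along an injection into
  the universe.\<close>

lemma module_surj_image: assumes s: "p ` cr M = cr Q" and z: "p 0[M] = 0[Q]"
 and a: "!!x y. [|x : cr M; y : cr M|] ==> p (x +[M] y) = p x +[Q] p y"
 and m: "!!r x. [|r : cr R; x : cr M|] ==> p (r .[M] x) = r .[Q] p x" shows "module R Q & lin R M Q p"
proof -
 have ob: "EX y : cr M. x = p y" if "x : cr Q" for x using that s by auto
 have cl: "p x : cr Q" if "x : cr M" for x using that s by auto
 have a': "p x +[Q] p y = p (x +[M] y)" if "x : cr M" "y : cr M" for x y using a that by simp
 have m': "r .[Q] p x = p (r .[M] x)" if "r : cr R" "x : cr M" for r x using m that by simp
 have "abelian_group Q"
 proof (rule abelian_groupI)
 show "x +[Q] y : cr Q" if "x : cr Q" "y : cr Q" for x y using ob[OF that(1)] ob[OF that(2)] by (auto simp: a' cl)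
 show "0[Q] : cr Q" using cl z by (metis M.zero_closed)
 show "(x +[Q] y) +[Q] w = x +[Q] (y +[Q] w)" if "x : cr Q" "y : cr Q" "w : cr Q" for x y w
 using ob[OF that(1)] ob[OF that(2)] ob[OF that(3)] by (auto simp: a' M.a_assoc)
 show "x +[Q] y = y +[Q] x" if "x : cr Q" "y : cr Q" for x y using ob[OF that(1)] ob[OF that(2)] by (auto simp: a' M.a_comm)
 show "0[Q] +[Q] x = x" if "x : cr Q" for x using ob[OF that] by (auto simp: a' z[symmetric])
 show "EX y : cr Q. y +[Q] x = 0[Q]" if x: "x : cr Q" for x
 proof -
 obtain y where y: "y : cr M" "x = p y" using ob[OF x] by blast
 thus ?thesis using a'[of "-[M] y" y] z cl[of "-[M] y"] by (auto simp: M.l_neg) qed qed hence "module R Q"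
 proof (rule moduleI[OF R.is_cring], goal_cases)
 case (1 a x) thus ?case using ob[OF 1(2)] by (auto simp: m' cl)
 next
 case (2 a b x) thus ?case using ob[OF 2(3)] by (auto simp: m' a' smult_l_distr)
 next
 case (3 a x y) thus ?case using ob[OF 3(2)] ob[OF 3(3)] by (auto simp: m' a' smult_r_distr)
 next
 case (4 a b x) thus ?case using ob[OF 4(3)] by (auto simp: m' smult_assoc1)
 next
 case (5 x) thus ?case using ob[OF 5] by (auto simp: m') qed moreover have "lin R M Q p" by (rule linI) (simp_all add: cl a m)
 ultimately show ?thesis ..
qed

text \<open>The induced map is computed on an arbitrary preimage; two preimages differ by an element
  of the kernel of p, on which f vanishes. Uniqueness is included because induced maps are later
  named by definite description.\<close>

lemma lin_factor: assumes N: "module R N" and P: "module R P" and p: "lin R M N p" and s: "p ` cr M = cr N"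
 and f: "lin R M P f" and k: "!!x. x : cr M ==> p x = 0[N] ==> f x = 0[P]" shows "EX! g. g : linear_maps R N P & (ALL x : cr M. g (p x) = f x)"
proof -
 interpret N: rmod R N by (rule rmodI) fact
 interpret P: rmod R P by (rule rmodI) fact
 define g where "g = (\<lambda>y \<in> cr N. f (SOME x. x : cr M & p x = y))"
 have g: "g (p x) = f x" if "x : cr M" for x
 proof -
 define x' where "x' = (SOME x'. x' : cr M & p x' = p x)"
 have x': "x' : cr M & p x' = p x" unfolding x'_def by (rule someI[of _ x]) (simp add: that)
 have "p (x' -[M] x) = 0[N]" using x' that lin_cl[OF p] by (simp add: lin_diff[OF N p] N.diff_zero_iff)
 hence "f (x' -[M] x) = 0[P]" using k x' that by simp
 hence "f x' = f x" using x' that lin_cl[OF f] by (simp add: lin_diff[OF P f] P.diff_zero_iff)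
 thus ?thesis using that lin_cl[OF p] by (simp add: g_def x'_def) qed
 have ob: "EX y : cr M. x = p y" if "x : cr N" for x using that s by auto
 have "lin R N P g"
 proof (rule linI)
 show "g x : cr P" if "x : cr N" for x using ob[OF that] lin_cl[OF f] by (auto simp: g)
 show "g (x +[N] y) = g x +[P] g y" if "x : cr N" "y : cr N" for x y
 using ob[OF that(1)] ob[OF that(2)] lin_add[OF f] by (auto simp: g lin_add[OF p, symmetric])
 show "g (r .[N] x) = r .[P] g x" if "r : cr R" "x : cr N" for r x
 using that ob[OF that(2)] lin_smult[OF f] by (auto simp: g lin_smult[OF p, symmetric]) qed
 hence 1: "g : linear_maps R N P" by (simp add: lmaps_iff g_def)
 show ?thesis
 proof (rule ex1I[of _ g])
 show "g : linear_maps R N P & (ALL x : cr M. g (p x) = f x)" using 1 g by blast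
 fix h assume h: "h : linear_maps R N P & (ALL x : cr M. h (p x) = f x)"
 show "h = g"
 proof (rule extensionalityI)
 show "h : extensional (cr N)" "g : extensional (cr N)" using h 1 by (simp_all add: lmaps_iff)
 show "h x = g x" if "x : cr N" for x using ob[OF that] h g by auto qed qed
qed

end

lemma lin_id: "lin R M M (%x. x)" by (simp add: lin_def)

lemma lin_comp: "lin R M N f ==> lin R N P g ==> lin R M P (%x. g (f x))" by (simp add: lin_def)

lemma lin_cong: "module R M ==> (!!x. x : cr M ==> f x = g x) ==> lin R M N f <-> lin R M N g"
 by (simp add: lin_def module.smult_closed abelian_monoid.a_closed abelian_group.axioms(1) module.axioms(2))

lemma lin_restrict: "module R M ==> lin R M N (restrict f (cr M)) <-> lin R M N f" by (rule lin_cong) simp_all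

lemma restrict_linear_maps: "module R M ==> lin R M N f ==> restrict f (cr M) : linear_maps R M N" by (simp add: lmaps_iff lin_restrict)

subsection \<open>Sums of generators\<close>

text \<open>Finite sums without scalars. The generating sets to which it is applied are stable under
  scalars (brackets, images of linear maps), so nothing is lost, and every element is coded by a
  list of generators, which gives a cardinality bound.\<close>

inductive_set aspan :: "('r, 'a) module => 'a set => 'a set" for M S where
 aspan_zero: "0[M] : aspan M S"
| aspan_add: "x : S ==> y : aspan M S ==> x +[M] y : aspan M S"

lemma aspan_lists: "aspan M S <= (%l. foldr (%x y. x +[M] y) l 0[M]) ` lists S"
proof
 fix x assume "x : aspan M S" thus "x : (%l. foldr (%x y. x +[M] y) l 0[M]) ` lists S"
 proof induction
 case aspan_zero show ?case by (rule image_eqI[of _ _ "[]"]) simp_all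
 next
 case (aspan_add x y)
 then obtain l where "y = foldr (%x y. x +[M] y) l 0[M]" "l : lists S" by blast
 thus ?case using aspan_add by (intro image_eqI[of _ _ "x # l"]) simp_all qed
qed

context rmod
begin

lemma aspan_closed: "S <= cr M ==> x : aspan M S ==> x : cr M" by (rotate_tac, induction rule: aspan.induct) auto

lemma aspan_base: "S <= cr M ==> x : S ==> x : aspan M S" using aspan_add[OF _ aspan_zero, of x S M] by (metis M.r_zero subsetD)

lemma aspan_plus: assumes "S <= cr M" "x : aspan M S" "y : aspan M S" shows "x +[M] y : aspan M S" using assms(2)
proof induction
 case aspan_zero thus ?case using aspan_closed[OF assms(1,3)] assms(3) by simp
next
 case (aspan_add x z) hence "(x +[M] z) +[M] y = x +[M] (z +[M] y)" using aspan_closed[OF assms(1)] assms by (intro M.a_assoc) auto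
 thus ?case using aspan_add aspan.aspan_add by metis
qed

lemma aspan_subset: assumes "S <= T" "0[M] : T" "!!x y. [|x : T; y : T|] ==> x +[M] y : T" shows "aspan M S <= T"
proof
 fix x assume "x : aspan M S" thus "x : T" by induction (use assms in auto)
qed

lemma aspan_lin_image: assumes "S <= cr M" "module R N" "lin R M N f" "x : aspan M S" "f ` S <= T" shows "f x : aspan N T" using assms(4)
proof induction
 case aspan_zero thus ?case using lin_zero[OF assms(2,3)] aspan.aspan_zero[of N T] by simp
next
 case (aspan_add x y)
 have "x : cr M" "y : cr M" using aspan_add assms(1) aspan_closed[OF assms(1)] by blast+
 hence "f (x +[M] y) = f x +[N] f y" using lin_add[OF assms(3)] by blast moreover have "f x : T" using aspan_add assms(5) by blast
 ultimately show ?case using aspan_add.IH aspan.aspan_add[of "f x" T "f y" N] by simp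
qed

lemma lin_eq_on_aspan:
 assumes "S <= cr M" "module R N" "lin R M N f" "lin R M N g" "!!x. x : S ==> f x = g x" "x : aspan M S" shows "f x = g x" using assms(6)
proof induction
 case aspan_zero thus ?case using lin_zero[OF assms(2,3)] lin_zero[OF assms(2,4)] by simp
next
 case (aspan_add x y)
 have "x : cr M" "y : cr M" using aspan_add assms(1) aspan_closed[OF assms(1)] by blast+
 thus ?case using lin_add[OF assms(3)] lin_add[OF assms(4)] assms(5)[OF aspan_add(1)] aspan_add.IH by simp
qed

end

subsection \<open>Transport to the universe and quotients\<close>

lemma embed_inj: fixes M :: "('r, 'a) module" assumes "cr M \<lesssim> (UNIV :: 'u set)" shows "inj_on (embed M :: 'a => 'u) (cr M)"
proof -
 obtain e :: "'a => 'u" where "inj_on e (cr M)" using assms by (auto simp: lepoll_def)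
 thus ?thesis unfolding embed_def by (rule someI[of "%e. inj_on e (cr M)"])
qed

lemma realise: fixes M :: "('r, 'a) module" and R :: "'r ring"
 assumes "module R M" "cr M \<lesssim> (UNIV :: 'u set)" shows "module R (realise M :: ('r, 'u) module)" "lin R M (realise M :: ('r, 'u) module) (embed M)"
 "(embed M :: 'a => 'u) ` cr M = cr (realise M)"
proof -
 interpret rmod R M by (rule rmodI) fact
 note inj = inv_into_f_f[OF embed_inj[OF assms(2)]]
 show c: "(embed M :: 'a => 'u) ` cr M = cr (realise M)" by (simp add: realise_def Let_def)
 have "module R (realise M :: ('r, 'u) module) & lin R M (realise M :: ('r, 'u) module) (embed M)"
 by (rule module_surj_image[OF c]) (simp_all add: realise_def Let_def inj)
 thus "module R (realise M :: ('r, 'u) module)" "lin R M (realise M :: ('r, 'u) module) (embed M)" by auto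
qed

lemma embed_zero_iff: fixes M :: "('r, 'a) module" and R :: "'r ring"
 assumes "module R M" "cr M \<lesssim> (UNIV :: 'u set)" "x : cr M" shows "(embed M x :: 'u) = 0[realise M] <-> x = 0[M]"
proof -
 interpret rmod R M by (rule rmodI) fact
 show ?thesis using inj_onD[OF embed_inj[OF assms(2)], of x "0[M]"] assms(3) by (auto simp: realise_def Let_def)
qed

context rmod
begin

lemma quotient_module:
 assumes N: "submodule N R M" shows "module R (quotient_module M N)" "lin R M (quotient_module M N) (%x. N +>\<^bsub>M\<^esub> x)"
 "(%x. N +>\<^bsub>M\<^esub> x) ` cr M = cr (quotient_module M N)"
 "x : cr M ==> N +>\<^bsub>M\<^esub> x = 0[quotient_module M N] <-> x : N"
proof -
 have sg: "subgroup N (add_monoid M)" using N by (rule submodule.axioms)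
 interpret S: abelian_subgroup N M by (rule abelian_subgroupI3[OF additive_subgroupI[OF sg] M.abelian_group_axioms])
 have sub: "N <= cr M" using submoduleE(1)[OF N] .
 show c: "(%x. N +>\<^bsub>M\<^esub> x) ` cr M = cr (quotient_module M N)" by (auto simp: quotient_module_def A_RCOSETS_def' image_iff)
 show z: "N +>\<^bsub>M\<^esub> x = 0[quotient_module M N] <-> x : N" if "x : cr M" for x
 using that M.a_coset_join1[OF _ that sg] M.a_coset_join2[OF that sg] by (auto simp: quotient_module_def)
 have ab: "N +>\<^bsub>M\<^esub> (n +[M] x) = N +>\<^bsub>M\<^esub> x" if "n : N" "x : cr M" for n x
 using M.a_coset_add_assoc[OF sub, of n x] M.a_coset_join2[OF _ sg, of n] that sub by auto
 have "module R (quotient_module M N) & lin R M (quotient_module M N) (%x. N +>\<^bsub>M\<^esub> x)"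
 proof (rule module_surj_image[OF c], goal_cases)
 case 1 thus ?case using z submodule_zero[OF N] by simp
 next
 case (2 x y) thus ?case by (simp add: quotient_module_def S.a_rcos_sum)
 next
 case (3 r x)
 \<comment> \<open>The scalar multiple of a coset is defined as a union over its elements; all
   members of the union coincide.\<close>
 have "N +>\<^bsub>M\<^esub> (r .[M] y) = N +>\<^bsub>M\<^esub> (r .[M] x)" if y: "y : N +>\<^bsub>M\<^esub> x" for y
 proof -
 obtain n where n: "n : N" "y = n +[M] x" using y unfolding a_r_coset_def' by blast
 have "n : cr M" using n sub by blast hence "r .[M] y = r .[M] n +[M] r .[M] x" using n 3 by (simp add: smult_r_distr)
 thus ?thesis using ab[of "r .[M] n" "r .[M] x"] submoduleE(4)[OF N 3(1) n(1)] 3 by simp qed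
 moreover have "x : N +>\<^bsub>M\<^esub> x" using 3 S.a_rcos_self by simp
 ultimately have "(\<Union>y \<in> N +>\<^bsub>M\<^esub> x. N +>\<^bsub>M\<^esub> (r .[M] y)) = N +>\<^bsub>M\<^esub> (r .[M] x)" by blast
 thus ?case by (simp add: quotient_module_def) qed
 thus "module R (quotient_module M N)" "lin R M (quotient_module M N) (%x. N +>\<^bsub>M\<^esub> x)" by auto
qed

end

text \<open>With \<open>qproj\<close>, the same expressions as the bodies of
  \<open>delta_module\<close> and \<open>delta_proj\<close>, so that difference functors become an
  instance of quotient representations.\<close>

definition qmod :: "('r, 'a) module => 'a set => ('r, 'u) module" where
 "qmod M N = realise (quotient_module M N)"

definition qproj :: "('r, 'a) module => 'a set => 'a => 'u" where
 "qproj M N x = embed (quotient_module M N) (N +>\<^bsub>M\<^esub> x)"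

lemma (in rmod) qmod_small: assumes N: "submodule N R M" and "cr (quotient_module M N) \<lesssim> (UNIV :: 'u set)"
 shows "module R (qmod M N :: ('r, 'u) module)" "lin R M (qmod M N :: ('r, 'u) module) (qproj M N)"
 "(qproj M N :: _ => 'u) ` cr M = cr (qmod M N)"
 "x : cr M ==> (qproj M N x :: 'u) = 0[qmod M N] <-> x : N"
proof -
 note q = quotient_module[OF N]
 note r = realise[OF q(1) assms(2)]
 show "module R (qmod M N :: ('r, 'u) module)" unfolding qmod_def by (rule r)
 show "lin R M (qmod M N :: ('r, 'u) module) (qproj M N)" unfolding qmod_def qproj_def by (rule lin_comp[OF q(2) r(2)])
 show "(qproj M N :: _ => 'u) ` cr M = cr (qmod M N)" unfolding qmod_def qproj_def using q(3) r(3) by (metis image_image)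
 show "(qproj M N x :: 'u) = 0[qmod M N] <-> x : N" if "x : cr M"
 unfolding qmod_def qproj_def using q(3) q(4)[OF that] embed_zero_iff[OF q(1) assms(2)] that by blast
qed

lemma (in rmod) quotient_module_lepoll: "submodule N R M ==> cr (quotient_module M N) \<lesssim> cr M"
 using quotient_module(3) image_lepoll by metis

text \<open>A quotient is never larger than the module, so a quotient of a module over
  \<open>'a\<close> always fits into \<open>'a\<close> again.\<close>

lemma (in rmod) qmod: fixes N :: "'a set"
 assumes N: "submodule N R M" shows "module R (qmod M N :: ('r, 'a) module)" "lin R M (qmod M N :: ('r, 'a) module) (qproj M N)"
 "(qproj M N :: _ => 'a) ` cr M = cr (qmod M N)"
 "x : cr M ==> (qproj M N x :: 'a) = 0[qmod M N] <-> x : N"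
 using qmod_small[OF N lepoll_trans[OF quotient_module_lepoll[OF N] subset_imp_lepoll[OF subset_UNIV]]] by auto

definition prod_module :: "('r, 'a) module => ('r, 'b) module => ('r, 'a \<times> 'b) module" where
 "prod_module M N = \<lparr>carrier = cr M \<times> cr N, monoid.mult = undefined, one = undefined,
 zero = (0[M], 0[N]), add = (%(x, y) (x', y'). (x +[M] x', y +[N] y')),
 smult = (%r (x, y). (r .[M] x, r .[N] y))\<rparr>"

lemma (in rmod) module_prod_module: assumes "module R N" shows "module R (prod_module M N)"
proof -
 interpret N: rmod R N by (rule rmodI) fact
 have "abelian_group (prod_module M N)"
 proof (rule abelian_groupI)
 show "EX y : cr (prod_module M N). y +[prod_module M N] x = 0[prod_module M N]"
 if "x : cr (prod_module M N)" for x using that by (intro bexI[of _ "(-[M] fst x, -[N] snd x)"])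
 (auto simp: prod_module_def M.l_neg N.M.l_neg) qed (auto simp: prod_module_def M.a_assoc N.M.a_assoc, auto simp: M.a_comm N.M.a_comm)
 thus ?thesis by (rule moduleI[OF R.is_cring])
 (auto simp: prod_module_def smult_l_distr N.smult_l_distr smult_r_distr N.smult_r_distr smult_assoc1 N.smult_assoc1)
qed

subsection \<open>Free modules\<close>

lemma (in cring) module_fm: "module R (free_module R X)"
proof -
 let ?L = "free_module R X"
 have cl: "(%x. c x \<oplus> d x) : cr ?L" if "c : cr ?L" "d : cr ?L" for c d
 proof -
 have s: "{x. c x \<oplus> d x ~= \<zero>} <= {x. c x ~= \<zero>} \<union> {x. d x ~= \<zero>}" by auto
 hence "finite {x. c x \<oplus> d x ~= \<zero>}" by (rule finite_subset) (use that in \<open>simp add: free_module_def\<close>)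
 thus ?thesis using that subset_trans[OF s] by (simp add: free_module_def) qed
 have sc: "(%x. r \<otimes> c x) : cr ?L" if "r : cr R" "c : cr ?L" for r c
 proof -
 have s: "{x. r \<otimes> c x ~= \<zero>} <= {x. c x ~= \<zero>}" using that by auto
 hence "finite {x. r \<otimes> c x ~= \<zero>}" by (rule finite_subset) (use that in \<open>simp add: free_module_def\<close>)
 thus ?thesis using that s by (auto simp: free_module_def) qed
 have pt: "c x : cr R" if "c : cr ?L" for c x using that by (simp add: free_module_def)
 have ops: "c +[?L] d = (%x. c x \<oplus> d x)" "0[?L] = (%_. \<zero>)" "r .[?L] c = (%x. r \<otimes> c x)" for c d r by (simp_all add: free_module_def)
 have "abelian_group ?L"
 proof (rule abelian_groupI)
 show "0[?L] : cr ?L" by (simp add: free_module_def)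
 show "EX y : cr ?L. y +[?L] x = 0[?L]" if "x : cr ?L" for x using sc[OF _ that, of "\<ominus> \<one>"] pt[OF that]
 by (intro bexI[of _ "%z. \<ominus> \<one> \<otimes> x z"]) (simp_all add: ops l_minus l_neg)
 qed (simp_all add: ops cl pt a_assoc, simp add: a_comm pt)
 thus ?thesis by (rule moduleI[OF is_cring]) (simp_all add: ops sc pt l_distr r_distr m_assoc)
qed

text \<open>The linear extension to a free module of a map \<open>be\<close> prescribed on the
  basis.\<close>

definition flift :: "('r, 'y) ring_scheme => ('r, 'a) module => ('x => 'a) => ('x => 'r) => 'a" where
 "flift R W be c = (\<Oplus>\<^bsub>W\<^esub>x \<in> {x. c x ~= 0[R]}. c x .[W] be x)"

lemma fm_simps:
 "c +[free_module R X] d = (%x. c x +[R] d x)" "0[free_module R X] = (%_. 0[R])"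
 "r .[free_module R X] c = (%x. r *[R] c x)" by (simp_all add: free_module_def)

lemma fmD: assumes "c : cr (free_module R X)" shows "c x : cr R" "finite {x. c x ~= 0[R]}" "{x. c x ~= 0[R]} <= X"
 using assms by (simp_all add: free_module_def)

context rmod
begin

lemma basis_elt_closed: "x : X ==> belt R x : cr (free_module R X)"
proof -
 assume "x : X" moreover have "finite {y. belt R x y ~= \<zero>}" by (rule finite_subset[of _ "{x}"]) (auto simp: basis_elt_def)
 ultimately show ?thesis by (auto simp: free_module_def basis_elt_def)
qed

text \<open>Coefficient vectors have different supports; summing over a common finite superset makes
  their sums comparable.\<close>

lemma free_lift_superset: assumes "c : cr (free_module R X)" "finite A" "{x. c x ~= \<zero>} <= A" "A <= X"
 "!!x. x : X ==> be x : cr M" shows "flift R M be c = (\<Oplus>\<^bsub>M\<^esub>x \<in> A. c x .[M] be x)" unfolding flift_def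
 by (rule M.add.finprod_mono_neutral_cong_left) (use assms fmD(1)[OF assms(1)] in auto)

lemma lin_free_lift: assumes b: "!!x. x : X ==> be x : cr M" shows "lin R (free_module R X) M (flift R M be)"
proof -
 interpret L: rmod R "free_module R X" by (rule rmodI, rule R.module_fm)
 show ?thesis
 proof (rule linI)
 fix c assume c: "c : cr (free_module R X)"
 note D = fmD[OF c]
 show "flift R M be c : cr M" unfolding flift_def by (rule M.finsum_closed) (use D b in auto)
 show "flift R M be (r .[free_module R X] c) = r .[M] flift R M be c" if r: "r : cr R" for r
 proof -
 have "flift R M be (r .[free_module R X] c) = (\<Oplus>\<^bsub>M\<^esub>x \<in> {x. c x ~= \<zero>}. (r \<otimes> c x) .[M] be x)"
 by (subst free_lift_superset[OF L.smult_closed[OF r c], of "{x. c x ~= \<zero>}"])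
 (use r D b in \<open>auto simp: fm_simps(3)\<close>)
 also have "... = (\<Oplus>\<^bsub>M\<^esub>x \<in> {x. c x ~= \<zero>}. r .[M] (c x .[M] be x))"
 by (rule M.finsum_cong') (use D b r in \<open>auto simp: smult_assoc1\<close>)
 also have "... = r .[M] flift R M be c" unfolding flift_def by (rule finsum_smult_ldistr[symmetric]) (use D b r in auto)
 finally show ?thesis . qed
 fix d assume d: "d : cr (free_module R X)"
 note E = fmD[OF d]
 let ?A = "{x. c x ~= \<zero>} \<union> {x. d x ~= \<zero>}"
 have A: "finite ?A" "?A <= X" using D E by auto
 have "flift R M be (c +[free_module R X] d) = (\<Oplus>\<^bsub>M\<^esub>x \<in> ?A. (c x \<oplus> d x) .[M] be x)"
 by (subst free_lift_superset[OF L.M.a_closed[OF c d], of ?A]) (use A b in \<open>auto simp: fm_simps(1)\<close>)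
 also have "... = (\<Oplus>\<^bsub>M\<^esub>x \<in> ?A. c x .[M] be x +[M] d x .[M] be x)"
 by (rule M.finsum_cong') (use A D E b in \<open>auto simp: smult_l_distr\<close>)
 also have "... = (\<Oplus>\<^bsub>M\<^esub>x \<in> ?A. c x .[M] be x) +[M] (\<Oplus>\<^bsub>M\<^esub>x \<in> ?A. d x .[M] be x)"
 by (rule M.finsum_addf) (use A D E b in auto)
 also have "... = flift R M be c +[M] flift R M be d" using free_lift_superset[OF c A(1) _ A(2) b] free_lift_superset[OF d A(1) _ A(2) b] by simp
 finally show "flift R M be (c +[free_module R X] d) = flift R M be c +[M] flift R M be d" . qed
qed

lemma free_lift_basis: assumes "x : X" "!!x. x : X ==> be x : cr M" shows "flift R M be (belt R x) = be x"
proof -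
 have "flift R M be (belt R x) = (\<Oplus>\<^bsub>M\<^esub>y \<in> {x}. belt R x y .[M] be y)"
 by (rule free_lift_superset[OF basis_elt_closed[of x X]]) (use assms in \<open>auto simp: basis_elt_def\<close>)
 also have "... = be x" using assms by (simp add: basis_elt_def) finally show ?thesis .
qed

end

lemma (in cring) fm_induct [consumes 1, case_names zero add]: assumes c: "c : cr (free_module R X)" and 0: "P (%_. \<zero>)"
 and add: "!!c r x. [|c : cr (free_module R X); P c; r : cr R; x : X|]
 ==> P (r .[free_module R X] belt R x +[free_module R X] c)" shows "P c"
proof -
 have "P c" if "finite A" "{x. c x ~= \<zero>} <= A" "c : cr (free_module R X)" for A c using that
 proof (induction A arbitrary: c rule: finite_induct)
 case empty hence "c = (%_. \<zero>)" by auto thus ?case using 0 by simp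
 next
 case (insert x A)
 note D = fmD[OF insert.prems(2)]
 show ?case
 proof (cases "c x = \<zero>")
 case True thus ?thesis using insert by (intro insert.IH) auto
 next
 case False
 let ?d = "c(x := \<zero>)"
 have sub: "{y. ?d y ~= \<zero>} <= {y. c y ~= \<zero>}" by auto
 have d: "?d : cr (free_module R X)" using D sub finite_subset[OF sub] by (auto simp: free_module_def)
 have "P ?d" by (rule insert.IH[OF _ d]) (use insert.prems(1) in auto) moreover have "x : X" using False D by auto
 moreover have "c x .[free_module R X] belt R x +[free_module R X] ?d = c" using D(1) by (auto simp: fm_simps basis_elt_def)
 ultimately show ?thesis using add[OF d _ D(1)[of x]] by metis qed qed thus ?thesis using fmD(2)[OF c] c by blast
qed

lemma (in rmod) free_lin_eq: assumes "lin R (free_module R X) M f" "lin R (free_module R X) M g" "c : cr (free_module R X)"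
 "!!x. x : X ==> f (belt R x) = g (belt R x)" shows "f c = g c"
proof -
 interpret L: rmod R "free_module R X" by (rule rmodI, rule R.module_fm)
 note z = L.lin_zero[OF module_axioms assms(1)] L.lin_zero[OF module_axioms assms(2)]
 have c: "c : cr (free_module R X)" by fact
 show ?thesis using c
 proof (induction c rule: R.fm_induct)
 case zero thus ?case using z by (simp add: fm_simps)
 next
 case (add c r x) hence "belt R x : cr (free_module R X)" by (simp add: basis_elt_closed)
 thus ?case using add assms(4)[of x] by (simp add: lin_add[OF assms(1)] lin_add[OF assms(2)] lin_smult[OF assms(1)] lin_smult[OF assms(2)])
 qed
qed

section \<open>The tensor product with the augmentation ideal\<close>

text \<open>The pairing of a finitely supported function with a weight. Augmentation (weight 1),
  push-forward (indicator of a fibre) and convolution (a translate of the second factor) are all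
  instances, so their linearity is proved once.\<close>

definition rsum :: "'r ring => ('x => 'r) => ('x => 'r) => 'r" where
 "rsum R c w = (\<Oplus>\<^bsub>R\<^esub>x \<in> {x. c x ~= 0[R]}. c x *[R] w x)"

locale rcring = cring R for R :: "'r ring" (structure)
begin

lemma rsum_superset: assumes "c : cr (free_module R X)" "finite A" "{x. c x ~= \<zero>} <= A" "!!x. x : X ==> w x : cr R" "A <= X"
 shows "rsum R c w = (\<Oplus>x \<in> A. c x \<otimes> w x)" unfolding rsum_def
 by (rule add.finprod_mono_neutral_cong_left) (use assms fmD(1)[OF assms(1)] in auto)

lemma rsum_closed: assumes "c : cr (free_module R X)" "!!x. x : X ==> w x : cr R" shows "rsum R c w : cr R"
 unfolding rsum_def by (rule finsum_closed) (use assms fmD[OF assms(1)] in auto)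

lemma rsum_add: assumes c: "c : cr (free_module R X)" and d: "d : cr (free_module R X)"
 and w: "!!x. x : X ==> w x : cr R" shows "rsum R (%x. c x \<oplus> d x) w = rsum R c w \<oplus> rsum R d w"
proof -
 interpret L: module R "free_module R X" by (rule module_fm)
 let ?A = "{x. c x ~= \<zero>} \<union> {x. d x ~= \<zero>}"
 note D = fmD[OF c] and E = fmD[OF d]
 have A: "finite ?A" "?A <= X" using D E by auto
 have "rsum R (%x. c x \<oplus> d x) w = (\<Oplus>x \<in> ?A. (c x \<oplus> d x) \<otimes> w x)"
 by (rule rsum_superset[of _ X]) (use L.M.a_closed[OF c d] A w in \<open>auto simp: fm_simps\<close>)
 also have "... = (\<Oplus>x \<in> ?A. c x \<otimes> w x \<oplus> d x \<otimes> w x)" by (rule finsum_cong') (use A D E w in \<open>auto simp: l_distr\<close>)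
 also have "... = (\<Oplus>x \<in> ?A. c x \<otimes> w x) \<oplus> (\<Oplus>x \<in> ?A. d x \<otimes> w x)" by (rule finsum_addf) (use A D E w in auto)
 finally show ?thesis using rsum_superset[OF c A(1) _ w A(2)] rsum_superset[OF d A(1) _ w A(2)] by simp
qed

lemma rsum_smult: assumes c: "c : cr (free_module R X)" and r: "r : cr R"
 and w: "!!x. x : X ==> w x : cr R" shows "rsum R (%x. r \<otimes> c x) w = r \<otimes> rsum R c w"
proof -
 interpret L: module R "free_module R X" by (rule module_fm)
 note D = fmD[OF c]
 have "rsum R (%x. r \<otimes> c x) w = (\<Oplus>x \<in> {x. c x ~= \<zero>}. (r \<otimes> c x) \<otimes> w x)"
 by (rule rsum_superset[of _ X]) (use L.smult_closed[OF r c] D r w in \<open>auto simp: fm_simps\<close>)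
 also have "... = (\<Oplus>x \<in> {x. c x ~= \<zero>}. r \<otimes> (c x \<otimes> w x))"
 by (rule finsum_cong') (use D r w in \<open>auto simp: m_assoc\<close>)
 also have "... = r \<otimes> rsum R c w" unfolding rsum_def by (rule finsum_rdistr[symmetric]) (use D r w in auto) finally show ?thesis .
qed

lemma rsum_add_right: assumes c: "c : cr (free_module R X)" and "!!x. x : X ==> v x : cr R" "!!x. x : X ==> w x : cr R"
 shows "rsum R c (%x. v x \<oplus> w x) = rsum R c v \<oplus> rsum R c w"
proof -
 note D = fmD[OF c]
 have "rsum R c (%x. v x \<oplus> w x) = (\<Oplus>x \<in> {x. c x ~= \<zero>}. c x \<otimes> v x \<oplus> c x \<otimes> w x)"
 unfolding rsum_def by (rule finsum_cong') (use D assms in \<open>auto simp: r_distr\<close>)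
 also have "... = rsum R c v \<oplus> rsum R c w" unfolding rsum_def by (rule finsum_addf) (use D assms in auto) finally show ?thesis .
qed

lemma rsum_smult_right: assumes c: "c : cr (free_module R X)" and r: "r : cr R" and w: "!!x. x : X ==> w x : cr R"
 shows "rsum R c (%x. r \<otimes> w x) = r \<otimes> rsum R c w"
proof -
 note D = fmD[OF c]
 have "rsum R c (%x. r \<otimes> w x) = (\<Oplus>x \<in> {x. c x ~= \<zero>}. r \<otimes> (c x \<otimes> w x))"
 unfolding rsum_def by (rule finsum_cong') (use D r w in \<open>auto simp: m_lcomm\<close>)
 also have "... = r \<otimes> rsum R c w" unfolding rsum_def by (rule finsum_rdistr[symmetric]) (use D r w in auto) finally show ?thesis .
qed

lemma basis_free: "x : X ==> belt R x : cr (free_module R X)"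
proof -
 assume "x : X" moreover have "finite {y. belt R x y ~= \<zero>}" by (rule finite_subset[of _ "{x}"]) (auto simp: basis_elt_def)
 ultimately show ?thesis by (auto simp: free_module_def basis_elt_def)
qed

lemma rsum_basis: assumes "x : X" "!!x. x : X ==> w x : cr R" shows "rsum R (belt R x) w = w x"
proof -
 have "rsum R (belt R x) w = (\<Oplus>y \<in> {x}. belt R x y \<otimes> w y)"
 by (rule rsum_superset[OF basis_free[of x X]]) (use assms in \<open>auto simp: basis_elt_def\<close>)
 thus ?thesis using assms by (simp add: basis_elt_def)
qed

definition aug :: "('x => 'r) => 'r" where
 "aug c = rsum R c (%_. \<one>)"

lemma aug_eq: "c : cr (free_module R X) ==> aug c = (\<Oplus>x \<in> {x. c x ~= \<zero>}. c x)"
 unfolding aug_def rsum_def by (rule finsum_cong') (auto simp: fmD(1))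

lemma aug_zero: "aug (%_. \<zero>) = \<zero>" by (simp add: aug_def rsum_def)

lemma aug_closed: "c : cr (free_module R X) ==> aug c : cr R" unfolding aug_def by (rule rsum_closed) simp_all

lemma aug_add: "[|c : cr (free_module R X); d : cr (free_module R X)|] ==> aug (%x. c x \<oplus> d x) = aug c \<oplus> aug d"
 unfolding aug_def by (rule rsum_add) simp_all

lemma aug_smult: "[|c : cr (free_module R X); r : cr R|] ==> aug (%x. r \<otimes> c x) = r \<otimes> aug c"
 unfolding aug_def by (rule rsum_smult) simp_all

lemma aug_basis: "aug (belt R x) = \<one>" unfolding aug_def by (rule rsum_basis[of _ UNIV]) simp_all

lemma aideal_eq:
 "augmentation_ideal R G = {a : cr (free_module R (cr G)). aug a = \<zero>}" unfolding augmentation_ideal_def group_ring_def using aug_eq by fastforce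

lemma group_ring_map_eq:
 assumes "a : cr (free_module R X)" shows "group_ring_map R f a y = rsum R a (%x. if f x = y then \<one> else \<zero>)"
 unfolding group_ring_map_def rsum_def by (rule add.finprod_mono_neutral_cong_left) (use fmD[OF assms] in auto)

lemma lin_group_ring_map: assumes f: "!!x. x : X ==> f x : Y" shows "lin R (free_module R X) (free_module R Y) (group_ring_map R f)"
 "x : X ==> group_ring_map R f (belt R x) = belt R (f x)"
proof -
 interpret LX: module R "free_module R X" by (rule module_fm)
 interpret LY: module R "free_module R Y" by (rule module_fm)
 have b: "group_ring_map R f (belt R x) = belt R (f x)" if "x : X" for x
 proof (rule ext)
 fix y
 have "group_ring_map R f (belt R x) y = (if f x = y then \<one> else \<zero>)"
 unfolding group_ring_map_eq[OF basis_free[OF that]] by (rule rsum_basis[OF that]) simp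
 thus "group_ring_map R f (belt R x) y = belt R (f x) y" by (auto simp: basis_elt_def) qed
 have a: "group_ring_map R f (c +[free_module R X] d) = group_ring_map R f c +[free_module R Y] group_ring_map R f d"
 if cd: "c : cr (free_module R X)" "d : cr (free_module R X)" for c d
 proof (rule ext)
 fix y
 show "group_ring_map R f (c +[free_module R X] d) y = (group_ring_map R f c +[free_module R Y] group_ring_map R f d) y"
 using rsum_add[OF cd, of "%x. if f x = y then \<one> else \<zero>"]
 group_ring_map_eq[OF LX.M.a_closed[OF cd], unfolded fm_simps, of f y]
 group_ring_map_eq[OF cd(1), of f y] group_ring_map_eq[OF cd(2), of f y] by (simp add: fm_simps) qed
 have m: "group_ring_map R f (r .[free_module R X] c) = r .[free_module R Y] group_ring_map R f c"
 if c: "c : cr (free_module R X)" "r : cr R" for c r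
 proof (rule ext)
 fix y
 show "group_ring_map R f (r .[free_module R X] c) y = (r .[free_module R Y] group_ring_map R f c) y"
 using rsum_smult[OF c, of "%x. if f x = y then \<one> else \<zero>"]
 group_ring_map_eq[OF LX.smult_closed[OF c(2,1)], unfolded fm_simps, of f y]
 group_ring_map_eq[OF c(1), of f y] by (simp add: fm_simps) qed
 have "group_ring_map R f c : cr (free_module R Y)" if "c : cr (free_module R X)" for c using that
 proof (induction c rule: fm_induct)
 case zero
 have "group_ring_map R f (%_. \<zero>) = (%_. \<zero>)" by (simp add: group_ring_map_def fun_eq_iff)
 thus ?case by (simp add: free_module_def)
 next
 case (add c r x) thus ?case using a[OF LX.smult_closed[OF add(2) basis_free[OF add(3)]] add(1)]
 m[OF basis_free[OF add(3)] add(2)] b[OF add(3)] basis_free[OF f[OF add(3)]] by simp qed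
 thus "lin R (free_module R X) (free_module R Y) (group_ring_map R f)" using a m by (simp add: linI)
 show "x : X ==> group_ring_map R f (belt R x) = belt R (f x)" by (rule b)
qed

lemma aug_group_ring_map: assumes f: "!!x. x : X ==> f x : Y" and c: "c : cr (free_module R X)" shows "aug (group_ring_map R f c) = aug c"
proof -
 have l: "lin R (free_module R X) (free_module R Y) (group_ring_map R f)"
 "!!x. x : X ==> group_ring_map R f (belt R x) = belt R (f x)" using lin_group_ring_map[of X f Y] f by blast+
 interpret LX: module R "free_module R X" by (rule module_fm)
 interpret LY: module R "free_module R Y" by (rule module_fm)
 show ?thesis using c
 proof (induction c rule: fm_induct)
 case zero thus ?case by (simp add: group_ring_map_def aug_zero)
 next
 case (add c r x)
 let ?g = "group_ring_map R f"
 note e = basis_free[OF add(3)] and e' = basis_free[OF f[OF add(3)]]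
 have "aug (?g (r .[free_module R X] belt R x +[free_module R X] c))
 = aug (r .[free_module R Y] belt R (f x) +[free_module R Y] ?g c)"
 using lin_add[OF l(1) LX.smult_closed[OF add(2) e] add(1)] lin_smult[OF l(1) add(2) e] l(2)[OF add(3)] by simp
 also have "... = r \<otimes> aug (belt R (f x)) \<oplus> aug (?g c)"
 using aug_add[OF LY.smult_closed[OF add(2) e'] lin_cl[OF l(1) add(1)]] aug_smult[OF e' add(2)] by (simp add: fm_simps)
 also have "... = r \<otimes> aug (belt R x) \<oplus> aug c" using add by (simp add: aug_basis)
 also have "... = aug (r .[free_module R X] belt R x +[free_module R X] c)" using aug_add[OF LX.smult_closed[OF add(2) e] add(1)] aug_smult[OF e add(2)]
 by (simp add: fm_simps) finally show ?case . qed
qed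

lemma group_ring_map_aug_ideal:
 assumes "!!x. x : cr G ==> f x : cr G'" "i : augmentation_ideal R G" shows "group_ring_map R f i : augmentation_ideal R G'"
 using assms lin_cl[OF lin_group_ring_map(1)[of "cr G" f "cr G'"]] aug_group_ring_map[of "cr G" f "cr G'"] by (simp add: aideal_eq)

end

lemma group_ring_simps:
 "cr (group_ring R G) = cr (free_module R (cr G))"
 "c +[group_ring R G] d = (%x. c x +[R] d x)"
 "r .[group_ring R G] c = (%x. r *[R] c x)" by (simp_all add: group_ring_def free_module_def)

text \<open>The data of a linear map out of the tensor product: \<open>D g v\<close> is the
  prescribed value on (g - 1) tensor v, and the identity is what gh - 1 = (g - 1)h + (h - 1)
  together with balancing imposes.\<close>

definition crossed :: "'r ring => 'g monoid => ('r, 'v) module => ('g => 'v => 'v) => ('r, 'w) module =>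
 ('g => 'v => 'w) => bool" where
 "crossed R G V rh W D <-> (ALL g : cr G. lin R V W (D g)) &
 (ALL g : cr G. ALL h : cr G. ALL v : cr V. D (g *[G] h) v = D g (rh h v) +[W] D h v)"

section \<open>The group ring of a group acting on a module\<close>

locale gaction = rmod R V + G: group G
 for R :: "'r ring" (structure) and V :: "('r, 'u) module" and G :: "'g monoid" + fixes rh :: "'g => 'u => 'u"
 assumes act_lin: "g : cr G ==> lin R V V (rh g)" and act_one: "v : cr V ==> rh 1[G] v = v"
 and act_mult: "[|g : cr G; h : cr G; v : cr V|] ==> rh (g *[G] h) v = rh g (rh h v)"
begin

sublocale R: rcring R by (rule rcring.intro) (rule R.is_cring)

abbreviation "FG == free_module R (cr G)"
abbreviation "aideal == augmentation_ideal R G"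

sublocale FG: rmod R FG by (rule rmodI) (rule R.module_fm)

lemma act_cl: "g : cr G ==> v : cr V ==> rh g v : cr V" using lin_cl[OF act_lin] .

abbreviation gmul :: "('g => 'r) => ('g => 'r) => 'g => 'r" where
 "gmul c a == c *[group_ring R G] a"

lemma gmul_eq: "gmul c a x = (if x : cr G then rsum R c (%g. a (inv[G] g *[G] x)) else \<zero>)" by (simp add: group_ring_def rsum_def)

lemma gmul_basis: assumes "g : cr G" "h : cr G" shows "gmul (belt R g) (belt R h) = belt R (g *[G] h)"
proof (rule ext)
 fix x
 have "inv[G] g *[G] x = h <-> x = g *[G] h" if "x : cr G" using assms that by (metis G.inv_solve_left)
 thus "gmul (belt R g) (belt R h) x = belt R (g *[G] h) x"
 using assms G.m_closed[OF assms] R.rsum_basis[OF assms(1), of "%g. belt R h (inv[G] g *[G] x)"] by (auto simp: gmul_eq basis_elt_def)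
qed

lemma gmul_add_left:
 "[|c : cr FG; d : cr FG; a : cr FG|] ==> gmul (%x. c x \<oplus> d x) a = (%x. gmul c a x \<oplus> gmul d a x)"
 using R.rsum_add[of c "cr G" d] by (auto simp: gmul_eq fun_eq_iff fmD(1))

lemma gmul_smult_left:
 "[|c : cr FG; r : cr R; a : cr FG|] ==> gmul (%x. r \<otimes> c x) a = (%x. r \<otimes> gmul c a x)"
 using R.rsum_smult[of c "cr G" r] by (auto simp: gmul_eq fun_eq_iff fmD(1))

lemma gmul_add_right:
 "[|c : cr FG; a : cr FG; b : cr FG|] ==> gmul c (%x. a x \<oplus> b x) = (%x. gmul c a x \<oplus> gmul c b x)"
 using R.rsum_add_right[of c "cr G"] by (auto simp: gmul_eq fun_eq_iff fmD(1))

lemma gmul_smult_right: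
 "[|c : cr FG; r : cr R; a : cr FG|] ==> gmul c (%x. r \<otimes> a x) = (%x. r \<otimes> gmul c a x)"
 using R.rsum_smult_right[of c "cr G" r] by (auto simp: gmul_eq fun_eq_iff fmD(1))

lemma zero_free: "(%_. \<zero>) : cr (free_module R X)" by (simp add: free_module_def)

text \<open>Convolution is bilinear, so both claims reduce to products of group elements: the inner
  fact treats a group element on the left by induction on the right factor, the outer induction the
  general left factor.\<close>

lemma gmul_closed_aug: assumes c: "c : cr FG" and a: "a : cr FG" shows "gmul c a : cr FG & R.aug (gmul c a) = R.aug c \<otimes> R.aug a"
proof -
 have 1: "gmul (belt R g) a : cr FG & R.aug (gmul (belt R g) a) = R.aug a" if g: "g : cr G" for g using a
 proof (induction a rule: R.fm_induct)
 case zero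
 have "gmul (belt R g) (%_. \<zero>) = (%_. \<zero>)" using R.rsum_basis[OF g] by (auto simp: gmul_eq)
 thus ?case by (simp add: zero_free R.aug_zero)
 next
 case (add a r h)
 note e = R.basis_free[OF add(3)] and eg = R.basis_free[OF g] and egh = R.basis_free[OF G.m_closed[OF g add(3)]]
 note re = FG.smult_closed[OF add(2) e, unfolded fm_simps]
 note regh = FG.smult_closed[OF add(2) egh, unfolded fm_simps]
 let ?z = "%x. r \<otimes> belt R (g *[G] h) x \<oplus> gmul (belt R g) a x"
 have "gmul (belt R g) (%x. r \<otimes> belt R h x \<oplus> a x)
 = (%x. r \<otimes> belt R (g *[G] h) x \<oplus> gmul (belt R g) a x)"
 by (simp add: gmul_add_right[OF eg re add(1)] gmul_smult_right[OF eg add(2) e] gmul_basis[OF g add(3)])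
 moreover have "?z : cr FG" using FG.M.a_closed[OF regh conjunct1[OF add.IH]] by (simp add: fm_simps)
 moreover have "R.aug ?z = R.aug (%x. r \<otimes> belt R h x \<oplus> a x)"
 using add.IH by (simp add: R.aug_add[OF regh conjunct1[OF add.IH]] R.aug_add[OF re add(1)] R.aug_smult[OF e add(2)]
 R.aug_smult[OF egh add(2)] R.aug_basis) ultimately show ?case by (simp add: fm_simps) qed
 show ?thesis using c
 proof (induction c rule: R.fm_induct)
 case zero
 have "gmul (%_. \<zero>) a = (%_. \<zero>)" by (auto simp: gmul_eq rsum_def)
 thus ?case using R.aug_closed[OF a] by (simp add: zero_free R.aug_zero)
 next
 case (add c r g)
 note e = R.basis_free[OF add(3)]
 note re = FG.smult_closed[OF add(2) e, unfolded fm_simps]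
 note g1 = conjunct1[OF 1[OF add(3)]] conjunct2[OF 1[OF add(3)]]
 note rg = FG.smult_closed[OF add(2) g1(1), unfolded fm_simps]
 let ?z = "%x. r \<otimes> gmul (belt R g) a x \<oplus> gmul c a x"
 have "gmul (%x. r \<otimes> belt R g x \<oplus> c x) a
 = (%x. r \<otimes> gmul (belt R g) a x \<oplus> gmul c a x)" by (simp add: gmul_add_left[OF re add(1) a] gmul_smult_left[OF e add(2) a])
 moreover have "?z : cr FG" using FG.M.a_closed[OF rg conjunct1[OF add.IH]] by (simp add: fm_simps)
 moreover have "R.aug ?z = r \<otimes> R.aug a \<oplus> R.aug c \<otimes> R.aug a"
 using add.IH g1 by (simp add: R.aug_add[OF rg conjunct1[OF add.IH]] R.aug_smult[OF g1(1) add(2)])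
 moreover have "r \<otimes> R.aug a \<oplus> R.aug c \<otimes> R.aug a = R.aug (%x. r \<otimes> belt R g x \<oplus> c x) \<otimes> R.aug a"
 using R.aug_closed[OF a] R.aug_closed[OF add(1)] add(2) by (simp add: R.aug_add[OF re add(1)] R.aug_smult[OF e add(2)] R.aug_basis R.l_distr)
 ultimately show ?case by (simp add: fm_simps) qed
qed

lemma gmul_aideal: "i : aideal ==> a : cr FG ==> gmul i a : aideal"
 using gmul_closed_aug[of i a] R.aug_closed[of a "cr G"] by (simp add: R.aideal_eq)

lemma aideal_free: "i : aideal ==> i : cr FG" by (simp add: R.aideal_eq)

lemma aideal_add: "i : aideal ==> j : aideal ==> (%x. i x \<oplus> j x) : aideal"
 using FG.M.a_closed[of i j] R.aug_add[of i "cr G" j] by (simp add: R.aideal_eq fm_simps)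

lemma aideal_smult: "i : aideal ==> r : cr R ==> (%x. r \<otimes> i x) : aideal"
 using FG.smult_closed[of r i] R.aug_smult[of i "cr G" r] by (simp add: R.aideal_eq fm_simps)

text \<open>\<open>c \<mapsto> c - \<epsilon>(c)\<close> is the projection of the group ring onto the augmentation ideal.\<close>

definition aproj :: "('g => 'r) => 'g => 'r" where
 "aproj c = (%x. c x \<oplus> (\<ominus> R.aug c) \<otimes> belt R 1[G] x)"

lemma aproj_aideal: assumes c: "c : cr FG" shows "aproj c : aideal"
proof -
 note e = R.basis_free[OF G.one_closed]
 have r: "\<ominus> R.aug c : cr R" using R.aug_closed[OF c] by simp
 note re = FG.smult_closed[OF r e, unfolded fm_simps]
 have "aproj c : cr FG" using FG.M.a_closed[OF c re] by (simp add: aproj_def fm_simps)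
 moreover have "R.aug (aproj c) = \<zero>" unfolding aproj_def
 using R.aug_closed[OF c] r by (simp add: R.aug_add[OF c re] R.aug_smult[OF e r] R.aug_basis R.r_neg)
 ultimately show ?thesis by (simp add: R.aideal_eq)
qed

lemma basis_in: "g : cr G ==> belt R g x : cr R" by (simp add: basis_elt_def)

lemma aproj_add: assumes "c : cr FG" "d : cr FG" shows "aproj (%x. c x \<oplus> d x) = (%x. aproj c x \<oplus> aproj d x)"
proof (rule ext)
 fix x
 have "c x : cr R" "d x : cr R" "R.aug c : cr R" "R.aug d : cr R" "belt R 1[G] x : cr R"
 by (simp_all add: fmD(1)[OF assms(1)] fmD(1)[OF assms(2)] R.aug_closed[OF assms(1)]
 R.aug_closed[OF assms(2)] basis_in)
 thus "aproj (%x. c x \<oplus> d x) x = aproj c x \<oplus> aproj d x" unfolding aproj_def R.aug_add[OF assms] by (simp add: R.minus_add R.l_distr R.a_ac)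
qed

lemma aproj_smult: assumes "c : cr FG" "r : cr R" shows "aproj (%x. r \<otimes> c x) = (%x. r \<otimes> aproj c x)"
proof (rule ext)
 fix x
 have "c x : cr R" "R.aug c : cr R" "belt R 1[G] x : cr R" by (simp_all add: fmD(1)[OF assms(1)] R.aug_closed[OF assms(1)] basis_in)
 thus "aproj (%x. r \<otimes> c x) x = r \<otimes> aproj c x"
 unfolding aproj_def R.aug_smult[OF assms] using assms(2) by (simp add: R.r_distr R.l_minus R.r_minus R.m_assoc)
qed

lemma aproj_ideal: "i : aideal ==> aproj i = i" using fmD(1)[of i R "cr G"] by (auto simp: aproj_def R.aideal_eq basis_elt_def)

text \<open>The element g - 1 of the augmentation ideal.\<close>

definition adiff :: "'g => 'g => 'r" where
 "adiff g = aproj (belt R g)"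

lemma adiff_aideal: "g : cr G ==> adiff g : aideal" unfolding adiff_def by (rule aproj_aideal) (rule R.basis_free)

lemma adiff_mult: assumes g: "g : cr G" and h: "h : cr G" shows "adiff (g *[G] h) = (%x. gmul (adiff g) (belt R h) x \<oplus> adiff h x)"
proof -
 note e = R.basis_free[OF G.one_closed] R.basis_free[OF g] R.basis_free[OF h]
 have r: "\<ominus> \<one> : cr R" by simp
 note re = FG.smult_closed[OF r e(1), unfolded fm_simps]
 have "gmul (adiff g) (belt R h) = (%x. belt R (g *[G] h) x \<oplus> (\<ominus> \<one>) \<otimes> belt R h x)"
 unfolding adiff_def aproj_def R.aug_basis by (simp add: gmul_add_left[OF e(2) re e(3)] gmul_smult_left[OF e(1) r e(3)] gmul_basis g h)
 moreover have "(a \<oplus> \<ominus> \<one> \<otimes> b) \<oplus> (b \<oplus> \<ominus> \<one> \<otimes> c) = a \<oplus> \<ominus> \<one> \<otimes> c"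
 if "a : cr R" "b : cr R" "c : cr R" for a b c using that by (simp add: R.l_minus R.a_assoc R.r_neg1)
 ultimately show ?thesis unfolding adiff_def aproj_def R.aug_basis using basis_in G.m_closed[OF g h] g h by (simp add: fun_eq_iff)
qed

text \<open>A scalar acts like right multiplication by that multiple of the unit; this is how
  linearity in the second tensor factor is extracted from the balancing relation.\<close>

lemma gmul_scalar: assumes i: "i : cr FG" and r: "r : cr R" shows "gmul i (%x. r \<otimes> belt R 1[G] x) = (%x. r \<otimes> i x)"
proof -
 note e = R.basis_free[OF G.one_closed]
 have "gmul i (belt R 1[G]) = i" using i
 proof (induction i rule: R.fm_induct)
 case zero thus ?case by (auto simp: gmul_eq rsum_def)
 next
 case (add c r g)
 note eg = R.basis_free[OF add(3)]
 note re = FG.smult_closed[OF add(2) eg, unfolded fm_simps]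
 show ?case using add by (simp add: fm_simps gmul_add_left[OF re add(1) e] gmul_smult_left[OF eg add(2) e] gmul_basis) qed
 thus ?thesis using gmul_smult_right[OF i r e] by simp
qed

lemma group_ring_act_eq: "group_ring_act R V rh a v = flift R V (%g. rh g v) a" by (simp add: group_ring_act_def flift_def)

lemma lin_group_ring_act: "v : cr V ==> lin R FG V (%a. group_ring_act R V rh a v)" unfolding group_ring_act_eq by (rule lin_free_lift) (rule act_cl)

lemma group_ring_act_basis: "v : cr V ==> g : cr G ==> group_ring_act R V rh (belt R g) v = rh g v"
 unfolding group_ring_act_eq by (rule free_lift_basis[where X = "cr G"]) (simp_all add: act_cl)

section \<open>The tensor product by generators and relations\<close>

abbreviation "FT == free_module R (aideal \<times> cr V)"
abbreviation "rels == tensor_relations R G V rh"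
abbreviation "ctens == coset_tensor_module R G V rh"
abbreviation "cproj == (%x. module_span R FT rels +>\<^bsub>FT\<^esub> x)"

sublocale FT: rmod R FT by (rule rmodI) (rule R.module_fm)

definition ctp :: "('g => 'r) => 'u => (('g => 'r) \<times> 'u => 'r) set" where
 "ctp i v = cproj (belt R (i, v))"

lemma FT_basis: "i : aideal ==> v : cr V ==> belt R (i, v) : cr FT" by (rule R.basis_free) simp

lemma act_ring_closed: "a : cr FG ==> v : cr V ==> group_ring_act R V rh a v : cr V" using lin_cl[OF lin_group_ring_act] .

lemma rels_cases: assumes "x : rels"
 obtains (add_left) i j v where "i : aideal" "j : aideal" "v : cr V"
 "x = belt R (%x. i x \<oplus> j x, v) -[FT] (belt R (i, v) +[FT] belt R (j, v))"
 | (add_right) i v w where "i : aideal" "v : cr V" "w : cr V"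
 "x = belt R (i, v +[V] w) -[FT] (belt R (i, v) +[FT] belt R (i, w))"
 | (smult) r i v where "r : cr R" "i : aideal" "v : cr V"
 "x = belt R (%x. r \<otimes> i x, v) -[FT] r .[FT] belt R (i, v)"
 | (balanced) i a v where "i : aideal" "a : cr FG" "v : cr V"
 "x = belt R (gmul i a, v) -[FT] belt R (i, group_ring_act R V rh a v)"
 using assms unfolding tensor_relations_def Let_def Un_iff mem_Collect_eq group_ring_simps
 apply (elim disjE exE conjE)
 apply (rule that(1); assumption)
 apply (rule that(2); assumption)
 apply (rule that(3); assumption)
 apply (rule that(4); assumption)
 done

lemma rels_closed: "rels <= cr FT"
proof
 fix x assume "x : rels"
 thus "x : cr FT" by (cases rule: rels_cases) (simp_all add: FT_basis aideal_add aideal_smult gmul_aideal act_ring_closed)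
qed

lemmas submodule_rels = FT.submodule_module_span[OF rels_closed]
lemmas ctens_facts = FT.quotient_module[OF submodule_rels, folded coset_tensor_module_def[unfolded Let_def]]

sublocale ctens: rmod R ctens by (rule rmodI) (rule ctens_facts)

lemma cproj_rel: assumes "x -[FT] y : rels" "x : cr FT" "y : cr FT" shows "cproj x = cproj y"
proof -
 have "cproj (x -[FT] y) = 0[ctens]" using ctens_facts(4)[of "x -[FT] y"] FT.module_span_superset[of rels] assms by auto
 hence "cproj x -[ctens] cproj y = 0[ctens]" using FT.lin_diff[OF ctens_facts(1,2) assms(2,3)] by simp
 thus ?thesis using ctens.diff_zero_iff lin_cl[OF ctens_facts(2)] assms by blast
qed

lemma ctp_closed: "i : aideal ==> v : cr V ==> ctp i v : cr ctens" unfolding ctp_def using lin_cl[OF ctens_facts(2)] FT_basis by blast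

lemma ctp_add_left: assumes "i : aideal" "j : aideal" "v : cr V" shows "ctp (%x. i x \<oplus> j x) v = ctp i v +[ctens] ctp j v"
proof -
 have "belt R (%x. i x \<oplus> j x, v) -[FT] (belt R (i, v) +[FT] belt R (j, v)) : rels"
 unfolding tensor_relations_def Let_def group_ring_simps using assms by blast
 hence "ctp (%x. i x \<oplus> j x) v = cproj (belt R (i, v) +[FT] belt R (j, v))"
 unfolding ctp_def by (rule cproj_rel) (simp_all add: FT_basis assms aideal_add)
 also have "... = ctp i v +[ctens] ctp j v" unfolding ctp_def by (rule lin_add[OF ctens_facts(2)]) (simp_all add: FT_basis assms)
 finally show ?thesis .
qed

lemma ctp_add_right: assumes "i : aideal" "v : cr V" "w : cr V" shows "ctp i (v +[V] w) = ctp i v +[ctens] ctp i w"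
proof -
 have "belt R (i, v +[V] w) -[FT] (belt R (i, v) +[FT] belt R (i, w)) : rels"
 unfolding tensor_relations_def Let_def group_ring_simps using assms by blast
 hence "ctp i (v +[V] w) = cproj (belt R (i, v) +[FT] belt R (i, w))" unfolding ctp_def by (rule cproj_rel) (simp_all add: FT_basis assms)
 also have "... = ctp i v +[ctens] ctp i w" unfolding ctp_def by (rule lin_add[OF ctens_facts(2)]) (simp_all add: FT_basis assms)
 finally show ?thesis .
qed

lemma ctp_smult_left: assumes "r : cr R" "i : aideal" "v : cr V" shows "ctp (%x. r \<otimes> i x) v = r .[ctens] ctp i v"
proof -
 have "belt R (%x. r \<otimes> i x, v) -[FT] r .[FT] belt R (i, v) : rels"
 unfolding tensor_relations_def Let_def group_ring_simps using assms by blast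
 hence "ctp (%x. r \<otimes> i x) v = cproj (r .[FT] belt R (i, v))" unfolding ctp_def by (rule cproj_rel) (simp_all add: FT_basis assms aideal_smult)
 also have "... = r .[ctens] ctp i v" unfolding ctp_def by (rule lin_smult[OF ctens_facts(2)]) (simp_all add: FT_basis assms)
 finally show ?thesis .
qed

lemma ctp_balanced: assumes "i : aideal" "a : cr FG" "v : cr V" shows "ctp (gmul i a) v = ctp i (group_ring_act R V rh a v)"
proof -
 have "belt R (gmul i a, v) -[FT] belt R (i, group_ring_act R V rh a v) : rels"
 unfolding tensor_relations_def Let_def group_ring_simps using assms by blast
 thus ?thesis unfolding ctp_def by (rule cproj_rel) (simp_all add: FT_basis assms gmul_aideal act_ring_closed)
qed

text \<open>No relation mentions scalars in the second variable: balancing by r times the unit moves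
  r to the first factor, where a relation exists.\<close>

lemma ctp_smult_right: assumes r: "r : cr R" and i: "i : aideal" and v: "v : cr V" shows "ctp i (r .[V] v) = r .[ctens] ctp i v"
proof -
 note e = R.basis_free[OF G.one_closed]
 note re = FG.smult_closed[OF r e, unfolded fm_simps]
 have "group_ring_act R V rh (%x. r \<otimes> belt R 1[G] x) v = r .[V] v"
 using lin_smult[OF lin_group_ring_act[OF v] r e] group_ring_act_basis[OF v G.one_closed] act_one[OF v] by (simp add: fm_simps)
 thus ?thesis using ctp_balanced[OF i re v] gmul_scalar[OF aideal_free[OF i] r] ctp_smult_left[OF r i v] by simp
qed

lemma lin_ctp: "i : aideal ==> lin R V ctens (ctp i)" by (rule linI) (simp_all add: ctp_closed ctp_add_right ctp_smult_right)

abbreviation cbr :: "'g => 'u => (('g => 'r) \<times> 'u => 'r) set" where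
 "cbr g == ctp (adiff g)"

lemma cbr_mult: assumes "g : cr G" "h : cr G" "v : cr V" shows "cbr (g *[G] h) v = cbr g (rh h v) +[ctens] cbr h v"
proof -
 note e = R.basis_free[OF assms(2)]
 show ?thesis unfolding adiff_mult[OF assms(1,2)] by (simp add: ctp_add_left gmul_aideal adiff_aideal assms e ctp_balanced group_ring_act_basis)
qed

text \<open>An element i of the augmentation ideal equals the sum of i(g)(g - 1), because
  subtracting its augmentation does not change it. Both sides are linear in i and agree on group
  elements after projection.\<close>

lemma ctp_expand: assumes i: "i : aideal" and v: "v : cr V" shows "ctp i v = flift R ctens (%g. cbr g v) i"
proof -
 have c: "cbr g v : cr ctens" if "g : cr G" for g by (rule ctp_closed[OF adiff_aideal[OF that] v])
 have "lin R FG ctens (%c. ctp (aproj c) v)" by (rule linI)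
 (simp_all add: fm_simps aproj_add aproj_smult ctp_add_left ctp_smult_left aproj_aideal v ctp_closed)
 hence "ctp (aproj i) v = flift R ctens (%g. cbr g v) i" using ctens.lin_free_lift[of "cr G" "%g. cbr g v", OF c] aideal_free[OF i]
 proof (rule ctens.free_lin_eq)
 fix g assume g: "g : cr G"
 show "ctp (aproj (belt R g)) v = flift R ctens (%g. cbr g v) (belt R g)"
 using ctens.free_lift_basis[of g "cr G" "%g. cbr g v", OF g c] by (simp add: adiff_def) qed thus ?thesis using aproj_ideal[OF i] by simp
qed

definition "cbrs = {cbr g v | g v. g : cr G & v : cr V}"

lemma cbrs_closed: "cbrs <= cr ctens" unfolding cbrs_def using ctp_closed adiff_aideal by blast

lemma cbrs_smult: "r : cr R ==> x : cbrs ==> r .[ctens] x : cbrs"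
proof -
 assume r: "r : cr R" and "x : cbrs"
 then obtain g v where "x = cbr g v" "g : cr G" "v : cr V" by (auto simp: cbrs_def)
 thus "r .[ctens] x : cbrs" using ctp_smult_right[OF r adiff_aideal, of g v] smult_closed[OF r, of v] unfolding cbrs_def by force
qed

lemma ctp_aspan: assumes i: "i : aideal" and v: "v : cr V" shows "ctp i v : aspan ctens cbrs"
proof -
 have c: "cbr g v : cr ctens" if "g : cr G" for g by (rule ctp_closed[OF adiff_aideal[OF that] v])
 note l = ctens.lin_free_lift[of "cr G" "%g. cbr g v", OF c]
 have "flift R ctens (%g. cbr g v) a : aspan ctens cbrs" if "a : cr FG" for a using that
 proof (induction a rule: R.fm_induct)
 case zero thus ?case using FG.lin_zero[OF ctens_facts(1) l] aspan_zero[of ctens cbrs] by (simp add: fm_simps)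
 next
 case (add a r g)
 note e = R.basis_free[OF add(3)]
 have "flift R ctens (%g. cbr g v) (r .[FG] belt R g +[FG] a)
 = r .[ctens] cbr g v +[ctens] flift R ctens (%g. cbr g v) a" using lin_add[OF l FG.smult_closed[OF add(2) e] add(1)] lin_smult[OF l add(2) e]
 ctens.free_lift_basis[of g "cr G" "%g. cbr g v", OF add(3) c] by simp
 moreover have "r .[ctens] cbr g v : cbrs" by (rule cbrs_smult[OF add(2)]) (use add(3) v in \<open>auto simp: cbrs_def\<close>)
 ultimately show ?case using add.IH by (simp add: aspan_add) qed thus ?thesis using ctp_expand[OF i v] aideal_free[OF i] by simp
qed

text \<open>Scalars are absorbed into v, so sums of terms (g - 1) tensor v exhaust the tensor
  product. This yields uniqueness of maps out of it and the bound on its size.\<close>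

lemma ctens_aspan: "cr ctens = aspan ctens cbrs"
proof
 show "aspan ctens cbrs <= cr ctens" using ctens.aspan_closed[OF cbrs_closed] by blast
 have "cproj c : aspan ctens cbrs" if "c : cr FT" for c using that
 proof (induction c rule: R.fm_induct)
 case zero thus ?case using FT.lin_zero[OF ctens_facts(1,2)] aspan_zero[of ctens cbrs] by (simp add: fm_simps)
 next
 case (add c r p)
 obtain i v where p: "p = (i, v)" "i : aideal" "v : cr V" using add(3) by blast
 note e = R.basis_free[OF add(3)]
 have "cproj (r .[FT] belt R p +[FT] c) = r .[ctens] ctp i v +[ctens] cproj c"
 using lin_add[OF ctens_facts(2) FT.smult_closed[OF add(2) e] add(1)] lin_smult[OF ctens_facts(2) add(2) e] by (simp add: ctp_def p)
 also have "r .[ctens] ctp i v = ctp i (r .[V] v)" using ctp_smult_right[OF add(2) p(2,3)] by simp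
 finally show ?case using ctens.aspan_plus[OF cbrs_closed ctp_aspan[OF p(2) smult_closed[OF add(2) p(3)]] add.IH] by simp qed
 thus "cr ctens <= aspan ctens cbrs" unfolding ctens_facts(3)[symmetric] by (rule image_subsetI)
qed

text \<open>Extend D linearly from group elements to the whole group ring. The resulting pairing is
  bilinear, and balanced on the augmentation ideal, so it kills all relations.\<close>

lemma ctens_universal: fixes W :: "('r, 'w) module"
 assumes W: "module R W" and D: "crossed R G V rh W D" shows "EX f. lin R ctens W f & (ALL g : cr G. ALL v : cr V. f (cbr g v) = D g v)"
proof -
 interpret W: rmod R W by (rule rmodI) fact
 have Dl: "lin R V W (D g)" if "g : cr G" for g using D that by (simp add: crossed_def)
 have Dc: "D g v : cr W" if "g : cr G" "v : cr V" for g v using lin_cl[OF Dl] that by blast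
 have Dm: "D (g *[G] h) v = D g (rh h v) +[W] D h v" if "g : cr G" "h : cr G" "v : cr V" for g h v using D that by (simp add: crossed_def)
 \<comment> \<open>The crossed identity at g = h = 1, after cancelling. It removes the summand -1
   when the pairing is evaluated at g - 1.\<close>
 have D1: "D 1[G] v = 0[W]" if v: "v : cr V" for v using Dm[OF G.one_closed G.one_closed v] act_one[OF v] Dc[OF G.one_closed v] by simp
 define be where "be i v = flift R W (%g. D g v) i" for i v
 have b1: "lin R FG W (%i. be i v)" if "v : cr V" for v unfolding be_def by (rule W.lin_free_lift) (rule Dc[OF _ that])
 have be: "be (belt R g) v = D g v" if "g : cr G" "v : cr V" for g v
 unfolding be_def by (rule W.free_lift_basis[OF that(1)]) (rule Dc[OF _ that(2)])
 have step: "be (r .[FG] belt R g +[FG] c) v = r .[W] D g v +[W] be c v"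
 if "c : cr FG" "r : cr R" "g : cr G" "v : cr V" for c r g v
 proof -
 note e = R.basis_free[OF that(3)]
 show ?thesis using lin_add[OF b1[OF that(4)] FG.smult_closed[OF that(2) e] that(1)]
 lin_smult[OF b1[OF that(4)] that(2) e] be[OF that(3,4)] by simp qed
 have bz: "be (%_. \<zero>) v = 0[W]" for v by (simp add: be_def flift_def)
 have bcl: "be i v : cr W" if "i : cr FG" "v : cr V" for i v using lin_cl[OF b1[OF that(2)] that(1)] .
 have b2: "lin R V W (be i)" if "i : cr FG" for i using that
 proof (induction i rule: R.fm_induct)
 case zero thus ?case using lin_const_zero[OF W] by (simp add: bz[abs_def])
 next
 case (add c r g)
 note l = Dl[OF add(3)] add.IH
 have "lin R V W (%v. r .[W] D g v +[W] be c v)"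
 proof (rule linI, goal_cases)
 case (1 x) thus ?case using lin_cl[OF l(1)] lin_cl[OF l(2)] add(2) by simp
 next
 case (2 x y)
 thus ?case using lin_cl[OF l(1)] lin_cl[OF l(2)] add(2) by (simp add: lin_add[OF l(1)] lin_add[OF l(2)] W.smult_r_distr W.M.a_ac)
 next
 case (3 s x) thus ?case using lin_cl[OF l(1)] lin_cl[OF l(2)] add(2)
 by (simp add: lin_smult[OF l(1)] lin_smult[OF l(2)] W.smult_r_distr W.smult_assoc1[symmetric] R.m_comm) qed
 moreover have "lin R V W (be (r .[FG] belt R g +[FG] c)) <-> lin R V W (%v. r .[W] D g v +[W] be c v)"
 by (rule lin_cong[OF module_axioms]) (simp add: step add) ultimately show ?case by simp qed
 \<comment> \<open>On the whole group ring balancing fails, by exactly the augmentation of c times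
   \<open>D h v\<close>; the defect disappears when the augmentation is zero.\<close>
 have mulh: "be (gmul c (belt R h)) v = be c (rh h v) +[W] R.aug c .[W] D h v"
 if c: "c : cr FG" and h: "h : cr G" and v: "v : cr V" for c h v
 proof -
 note eh = R.basis_free[OF h]
 have l1: "lin R FG W (%c. be (gmul c (belt R h)) v)"
 proof (rule lin_comp[OF _ b1[OF v]])
 show "lin R FG FG (%c. gmul c (belt R h))" by (rule linI) (simp_all add: gmul_closed_aug eh fm_simps gmul_add_left gmul_smult_left) qed
 have l2: "lin R FG W (%c. be c (rh h v) +[W] R.aug c .[W] D h v)"
 proof (rule linI, goal_cases)
 case (1 x) thus ?case using bcl[OF 1 act_cl[OF h v]] Dc[OF h v] R.aug_closed[OF 1] by simp
 next
 case (2 x y) thus ?case using lin_add[OF b1[OF act_cl[OF h v]] 2] bcl[OF 2(1) act_cl[OF h v]] bcl[OF 2(2) act_cl[OF h v]]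
 Dc[OF h v] R.aug_closed[OF 2(1)] R.aug_closed[OF 2(2)] R.aug_add[OF 2] by (simp add: fm_simps W.smult_l_distr W.M.a_ac)
 next
 case (3 s x) thus ?case using lin_smult[OF b1[OF act_cl[OF h v]] 3] bcl[OF 3(2) act_cl[OF h v]]
 Dc[OF h v] R.aug_closed[OF 3(2)] R.aug_smult[OF 3(2,1)] by (simp add: fm_simps W.smult_r_distr W.smult_assoc1) qed
 show ?thesis by (rule W.free_lin_eq[OF l1 l2 c])
 (simp add: gmul_basis h v be act_cl Dm R.aug_basis Dc) qed
 have bal: "be (gmul i a) v = be i (group_ring_act R V rh a v)"
 if i: "i : aideal" and a: "a : cr FG" and v: "v : cr V" for i a v
 proof -
 note iF = aideal_free[OF i]
 have l1: "lin R FG W (%a. be (gmul i a) v)"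
 proof (rule lin_comp[OF _ b1[OF v]])
 show "lin R FG FG (%a. gmul i a)" by (rule linI) (simp_all add: gmul_closed_aug iF fm_simps gmul_add_right gmul_smult_right) qed
 have l2: "lin R FG W (%a. be i (group_ring_act R V rh a v))" by (rule lin_comp[OF lin_group_ring_act[OF v] b2[OF iF]])
 have "R.aug i = \<zero>" using i by (simp add: R.aideal_eq)
 thus ?thesis by (intro W.free_lin_eq[OF l1 l2 a]) (simp add: mulh iF v group_ring_act_basis Dc bcl act_cl) qed
 define ph where "ph = flift R W (%(i, v). be i v)"
 have cl: "(case p of (i, v) => be i v) : cr W" if "p : aideal \<times> cr V" for p using that bcl aideal_free by auto
 have l: "lin R FT W ph" unfolding ph_def by (rule W.lin_free_lift) (rule cl)
 have pb: "ph (belt R (i, v)) = be i v" if "i : aideal" "v : cr V" for i v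
 unfolding ph_def using W.free_lift_basis[of "(i, v)" "aideal \<times> cr V" "%(i, v). be i v"] cl that by auto
 have rel0: "ph x = 0[W]" if "x : rels" for x using that
 proof (cases rule: rels_cases)
 case (add_left i j v)
 thus ?thesis using lin_add[OF b1[OF add_left(3)] aideal_free[OF add_left(1)] aideal_free[OF add_left(2)], unfolded fm_simps]
 by (simp add: FT.lin_diff[OF W l] lin_add[OF l] FT_basis aideal_add pb W.diff_zero_iff bcl aideal_free)
 next
 case (add_right i v w) thus ?thesis using lin_add[OF b2[OF aideal_free[OF add_right(1)]] add_right(2,3)]
 by (simp add: FT.lin_diff[OF W l] lin_add[OF l] FT_basis pb W.diff_zero_iff bcl aideal_free)
 next
 case (smult r i v) thus ?thesis using lin_smult[OF b1[OF smult(3)] smult(1) aideal_free[OF smult(2)], unfolded fm_simps]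
 by (simp add: FT.lin_diff[OF W l] lin_smult[OF l] FT_basis aideal_smult pb W.diff_zero_iff bcl aideal_free)
 next
 case (balanced i a v)
 thus ?thesis by (simp add: FT.lin_diff[OF W l] FT_basis gmul_aideal act_ring_closed pb bal W.diff_zero_iff bcl aideal_free) qed
 have "module_span R FT rels <= {x : cr FT. ph x = 0[W]}" by (rule FT.module_span_least[OF FT.submodule_kernel[OF W l]]) (use rel0 rels_closed in blast)
 hence k: "ph x = 0[W]" if "x : cr FT" "cproj x = 0[ctens]" for x using ctens_facts(4)[OF that(1)] that(2) by blast
 obtain f where f: "f : linear_maps R ctens W" "ALL x : cr FT. f (cproj x) = ph x"
 using ex1_implies_ex[OF FT.lin_factor[OF ctens_facts(1) W ctens_facts(2,3) l k]] by blast
 have "f (cbr g v) = D g v" if gv: "g : cr G" "v : cr V" for g v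
 proof -
 have "f (cbr g v) = be (adiff g) v" unfolding ctp_def using f(2) FT_basis[OF adiff_aideal[OF gv(1)] gv(2)] pb[OF adiff_aideal[OF gv(1)] gv(2)] by simp
 also have "... = D g v"
 proof -
 note e1 = R.basis_free[OF G.one_closed] and eg = R.basis_free[OF gv(1)]
 have r: "\<ominus> \<one> : cr R" by simp
 note re = FG.smult_closed[OF r e1]
 have "be (adiff g) v = be (belt R g) v +[W] (\<ominus> \<one>) .[W] be (belt R 1[G]) v"
 using lin_add[OF b1[OF gv(2)] eg re] lin_smult[OF b1[OF gv(2)] r e1] by (simp add: adiff_def aproj_def R.aug_basis fm_simps)
 thus ?thesis using D1[OF gv(2)] Dc[OF gv] by (simp add: be gv) qed finally show ?thesis . qed
 moreover have "lin R ctens W f" using f(1) by (simp add: lmaps_iff) ultimately show ?thesis by blast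
qed

end

section \<open>Cardinality bounds and transport of the tensor product to the universe\<close>

lemma pairs_lepoll: assumes "infinite (UNIV :: 'u set)" shows "(UNIV :: ('u \<times> 'u) set) \<lesssim> (UNIV :: 'u set)"
proof -
 have "(card_of (UNIV \<times> UNIV :: ('u \<times> 'u) set), card_of (UNIV :: 'u set)) : ordLeq"
 using card_of_Times_same_infinite[OF assms] ordIso_imp_ordLeq by blast thus ?thesis by (simp add: lepoll_def card_of_ordLeq[symmetric])
qed

lemma times_lepoll:
 assumes "infinite (UNIV :: 'u set)" "A \<lesssim> (UNIV :: 'u set)" "B \<lesssim> (UNIV :: 'u set)" shows "A \<times> B \<lesssim> (UNIV :: 'u set)"
 using lepoll_trans[OF times_lepoll_mono[OF assms(2,3)]] pairs_lepoll[OF assms(1)] by simp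

text \<open>Lists of each fixed length inject by induction; recording the length next to the code
  gives an injection into pairs of a natural number and an element of \<open>'u\<close>.\<close>

lemma lists_lepoll:
 assumes inf: "infinite (UNIV :: 'u set)" and A: "A \<lesssim> (UNIV :: 'u set)" shows "lists A \<lesssim> (UNIV :: 'u set)"
proof -
 have "{l : lists A. length l = n} \<lesssim> (UNIV :: 'u set)" for n
 proof (induction n)
 case 0
 have "{l : lists A. length l = 0} = {[]}" by auto thus ?case by (simp add: lepoll_def)
 next
 case (Suc n)
 have "{l : lists A. length l = Suc n} <= (%(x, l). x # l) ` (A \<times> {l : lists A. length l = n})" by (auto simp: length_Suc_conv image_iff)
 hence "{l : lists A. length l = Suc n} \<lesssim> A \<times> {l : lists A. length l = n}" by (rule subset_image_lepoll)
 thus ?case using times_lepoll[OF inf A Suc] lepoll_trans by blast qed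
 hence "EX f. inj_on f {l : lists A. length l = n} & range f <= (UNIV :: 'u set)" for n by (auto simp: lepoll_def)
 then obtain f :: "nat => _ => 'u" where f: "!!n. inj_on (f n) {l : lists A. length l = n}" by metis
 have "inj_on (%l. (length l, f (length l) l)) (lists A)"
 proof (rule inj_onI)
 fix x y assume xy: "x : lists A" "y : lists A" "(length x, f (length x) x) = (length y, f (length y) y)"
 hence l: "length x = length y" "f (length y) x = f (length y) y" by auto
 show "x = y" by (rule inj_onD[OF f[of "length y"] l(2)]) (use xy l in auto) qed
 hence "lists A \<lesssim> (UNIV :: (nat \<times> 'u) set)" by (auto simp: lepoll_def)
 moreover have "(UNIV :: (nat \<times> 'u) set) \<lesssim> (UNIV :: 'u set)"
 proof -
 have n: "(UNIV :: nat set) \<lesssim> (UNIV :: 'u set)" using inf by (simp only: infinite_le_lepoll)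
 show ?thesis using times_lepoll[OF inf n lepoll_refl] by simp qed ultimately show ?thesis by (rule lepoll_trans)
qed

locale sgaction = gaction + assumes inf: "infinite (UNIV :: 'b set)" and smallG: "cr G \<lesssim> (UNIV :: 'b set)"
begin

abbreviation "tens == tensor_module R G V rh"
abbreviation "pt == pure_tensor R G V rh"

text \<open>The tensor (g - 1) tensor v, transported to the universe.\<close>

definition br :: "'c => 'b => 'b" where "br g v = pt (adiff g) v"

text \<open>The elements are cosets of functions, but each is the sum of a finite list of terms (g -
  1) tensor v, and the pairs (g, v) fit into the universe.\<close>

lemma ctens_small: "cr ctens \<lesssim> (UNIV :: 'b set)"
proof -
 have "cr ctens \<lesssim> lists cbrs" using aspan_lists[of ctens cbrs] ctens_aspan subset_image_lepoll by metis
 also have "lists cbrs \<lesssim> (UNIV :: 'b set)"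
 proof (rule lists_lepoll[OF inf])
 have "cbrs <= (%(g, v). cbr g v) ` (cr G \<times> cr V)" by (auto simp: cbrs_def)
 hence "cbrs \<lesssim> cr G \<times> cr V" by (rule subset_image_lepoll)
 thus "cbrs \<lesssim> (UNIV :: 'b set)" using times_lepoll[OF inf smallG subset_imp_lepoll[OF subset_UNIV]] lepoll_trans by blast qed
 finally show ?thesis .
qed

lemmas tens_facts = realise[OF ctens_facts(1) ctens_small, folded tensor_module_def]

sublocale tens: rmod R tens by (rule rmodI) (rule tens_facts)

lemma pt_eq: "pt i v = embed ctens (ctp i v)" by (simp add: pure_tensor_def ctp_def Let_def)

lemma lin_br: "g : cr G ==> lin R V tens (br g)" unfolding br_def pt_eq[abs_def] by (rule lin_comp[OF lin_ctp[OF adiff_aideal] tens_facts(2)])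

lemma br_closed: "g : cr G ==> v : cr V ==> br g v : cr tens" using lin_cl[OF lin_br] .

lemma br_mult:
 assumes "g : cr G" "h : cr G" "v : cr V" shows "br (g *[G] h) v = br g (rh h v) +[tens] br h v" unfolding br_def pt_eq cbr_mult[OF assms]
 by (rule lin_add[OF tens_facts(2)]) (simp_all add: ctp_closed adiff_aideal assms act_cl)

lemma br_one: "v : cr V ==> br 1[G] v = 0[tens]" using br_mult[OF G.one_closed G.one_closed, of v] br_closed[OF G.one_closed, of v] by (simp add: act_one)

definition "brs = {br g v | g v. g : cr G & v : cr V}"

lemma brs_closed: "brs <= cr tens" using br_closed by (auto simp: brs_def)

lemma tens_aspan: "cr tens = aspan tens brs"
proof
 show "aspan tens brs <= cr tens" using tens.aspan_closed[OF brs_closed] by blast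
 have "embed ctens ` cbrs <= brs" by (auto simp: cbrs_def brs_def br_def pt_eq)
 hence "embed ctens x : aspan tens brs" if "x : cr ctens" for x using ctens.aspan_lin_image[OF cbrs_closed tens_facts(1,2)] that ctens_aspan by blast
 thus "cr tens <= aspan tens brs" unfolding tens_facts(3)[symmetric] by (rule image_subsetI)
qed

lemma pt_expand: assumes i: "i : aideal" and v: "v : cr V" shows "pt i v = flift R tens (%g. br g v) i"
proof -
 have c: "cbr g v : cr ctens" if "g : cr G" for g by (rule ctp_closed[OF adiff_aideal[OF that] v])
 have b: "br g v : cr tens" if "g : cr G" for g by (rule br_closed[OF that v])
 have "embed ctens (flift R ctens (%g. cbr g v) i) = flift R tens (%g. br g v) i"
 proof (rule tens.free_lin_eq[OF lin_comp[OF ctens.lin_free_lift[of "cr G"] tens_facts(2)]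
 tens.lin_free_lift[of "cr G"] aideal_free[OF i]])
 fix g assume g: "g : cr G"
 show "embed ctens (flift R ctens (%g. cbr g v) (belt R g)) = flift R tens (%g. br g v) (belt R g)"
 using ctens.free_lift_basis[of g "cr G" "%g. cbr g v"] tens.free_lift_basis[of g "cr G" "%g. br g v"] g c b by (simp add: br_def pt_eq)
 qed (use c b in auto) thus ?thesis by (simp add: pt_eq ctp_expand[OF i v])
qed

lemma tens_universal: fixes W :: "('a, 'w) module" assumes W: "module R W" and D: "crossed R G V rh W D"
 obtains f where "f : linear_maps R tens W" "!!g v. [|g : cr G; v : cr V|] ==> f (br g v) = D g v"
proof -
 obtain f where f: "lin R ctens W f" "ALL g : cr G. ALL v : cr V. f (cbr g v) = D g v" using ctens_universal[OF W D] by blast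
 interpret W: rmod R W by (rule rmodI) fact
 have k: "f x = 0[W]" if "x : cr ctens" "embed ctens x = 0[tens]" for x using that embed_zero_iff[OF ctens_facts(1) ctens_small] ctens.lin_zero[OF W f(1)]
 by (simp add: tensor_module_def)
 obtain f' where "f' : linear_maps R tens W" "ALL x : cr ctens. f' (embed ctens x) = f x"
 using ex1_implies_ex[OF ctens.lin_factor[OF tens_facts(1) W tens_facts(2,3) f(1) k]] by blast
 thus thesis using that f(2) ctp_closed adiff_aideal by (simp add: br_def pt_eq)
qed

end

text \<open>The map on the first factor is a parameter because \<open>LM\<close> has two
  descriptions of this shape: on arrows of the base it pushes forward along a homomorphism, on
  natural transformations it leaves i unchanged.\<close>

definition tens_map_spec where
 "tens_map_spec R G V rh G' V' rh' \<kappa> ps f <->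
 f : linear_maps R (tensor_module R G V rh) (tensor_module R G' V' rh') &
 (ALL i : augmentation_ideal R G. ALL v : cr V.
 f (pure_tensor R G V rh i v) = pure_tensor R G' V' rh' (\<kappa> i) (ps v))"

text \<open>The specification speaks of all tensors i tensor v, whereas the universal property
  controls only (g - 1) tensor v. Expanding i along group elements passes from one to the other, in
  both directions.\<close>

lemma tens_map: assumes "sgaction R V G rh" "sgaction R V' G' rh'" and ph: "ph : hom G G'" and ps: "lin R V V' ps"
 and eq: "!!g v. [|g : cr G; v : cr V|] ==> ps (rh g v) = rh' (ph g) (ps v)"
 and \<kappa>: "!!i. i : augmentation_ideal R G ==> \<kappa> i = group_ring_map R ph i" shows "EX! f. tens_map_spec R G V rh G' V' rh' \<kappa> ps f"
 "!!f g v. [|tens_map_spec R G V rh G' V' rh' \<kappa> ps f; g : cr G; v : cr V|] ==>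
 f (sgaction.br R V G rh g v) = sgaction.br R V' G' rh' (ph g) (ps v)"
proof -
 interpret S: sgaction R V G rh by fact
 interpret T: sgaction R V' G' rh' by fact
 have phc: "ph g : cr G'" if "g : cr G" for g using ph that by (auto simp: hom_def)
 have phm: "ph (g *[G] h) = ph g *[G'] ph h" if "g : cr G" "h : cr G" for g h using ph that by (auto simp: hom_def)
 note psc = lin_cl[OF ps]
 have D: "crossed R G V rh T.tens (%g v. T.br (ph g) (ps v))" unfolding crossed_def using lin_comp[OF ps T.lin_br[OF phc]] T.br_mult phc phm psc eq by simp
 have key: "T.pt (\<kappa> i) (ps v) = flift R T.tens (%g. T.br (ph g) (ps v)) i"
 if i: "i : S.aideal" and v: "v : cr V" for i v
 proof -
 have b: "T.br h (ps v) : cr T.tens" if "h : cr G'" for h using T.br_closed[OF that psc[OF v]] .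
 have "T.pt (\<kappa> i) (ps v) = flift R T.tens (%h. T.br h (ps v)) (group_ring_map R ph i)"
 using T.pt_expand[OF S.R.group_ring_map_aug_ideal[OF phc i] psc[OF v]] \<kappa>[OF i] by simp
 also have "... = flift R T.tens (%g. T.br (ph g) (ps v)) i"
 proof (rule T.tens.free_lin_eq[OF lin_comp[OF S.R.lin_group_ring_map(1)[of "cr G" ph "cr G'"]
 T.tens.lin_free_lift[of "cr G'"]] T.tens.lin_free_lift[of "cr G"] S.aideal_free[OF i]])
 fix g assume g: "g : cr G"
 show "flift R T.tens (%h. T.br h (ps v)) (group_ring_map R ph (belt R g)) =
 flift R T.tens (%g. T.br (ph g) (ps v)) (belt R g)" using S.R.lin_group_ring_map(2)[of "cr G" ph "cr G'" g]
 T.tens.free_lift_basis[of "ph g" "cr G'" "%h. T.br h (ps v)"]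
 T.tens.free_lift_basis[of g "cr G" "%g. T.br (ph g) (ps v)"] g phc b by simp qed (use phc b in auto) finally show ?thesis . qed
 have ext: "f (S.pt i v) = T.pt (\<kappa> i) (ps v)"
 if f: "lin R S.tens T.tens f" "!!g v. [|g : cr G; v : cr V|] ==> f (S.br g v) = T.br (ph g) (ps v)"
 and i: "i : S.aideal" and v: "v : cr V" for f i v
 proof -
 have "f (S.pt i v) = f (flift R S.tens (%g. S.br g v) i)" using S.pt_expand[OF i v] by simp
 also have "... = flift R T.tens (%g. T.br (ph g) (ps v)) i"
 proof (rule T.tens.free_lin_eq[OF lin_comp[OF S.tens.lin_free_lift[of "cr G"] f(1)]
 T.tens.lin_free_lift[of "cr G"] S.aideal_free[OF i]])
 fix g assume g: "g : cr G"
 show "f (flift R S.tens (%g. S.br g v) (belt R g)) = flift R T.tens (%g. T.br (ph g) (ps v)) (belt R g)"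
 using S.tens.free_lift_basis[of g "cr G" "%g. S.br g v"]
 T.tens.free_lift_basis[of g "cr G" "%g. T.br (ph g) (ps v)"] g phc S.br_closed[OF _ v] T.br_closed[OF _ psc[OF v]] f(2)[OF g v] by simp
 qed (use phc S.br_closed[OF _ v] T.br_closed[OF _ psc[OF v]] in auto) finally show ?thesis using key[OF i v] by simp qed
 show brf: "f (S.br g v) = T.br (ph g) (ps v)" if f: "tens_map_spec R G V rh G' V' rh' \<kappa> ps f" and g: "g : cr G" and v: "v : cr V" for f g v
 proof -
 have "f (S.br g v) = T.pt (\<kappa> (S.adiff g)) (ps v)" using f S.adiff_aideal[OF g] v by (simp add: tens_map_spec_def S.br_def)
 also have "... = flift R T.tens (%g. T.br (ph g) (ps v)) (S.adiff g)" by (rule key[OF S.adiff_aideal[OF g] v])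
 also have "... = T.br (ph g) (ps v)"
 proof -
 obtain f' where f': "f' : linear_maps R S.tens T.tens"
 "!!g v. [|g : cr G; v : cr V|] ==> f' (S.br g v) = T.br (ph g) (ps v)" using S.tens_universal[OF T.tens_facts(1) D] by metis
 show ?thesis using ext[OF _ f'(2) S.adiff_aideal[OF g] v] f'(1) key[OF S.adiff_aideal[OF g] v] f'(2)[OF g v] by (simp add: lmaps_iff S.br_def)
 qed finally show ?thesis . qed
 obtain f' where f': "f' : linear_maps R S.tens T.tens"
 "!!g v. [|g : cr G; v : cr V|] ==> f' (S.br g v) = T.br (ph g) (ps v)" using S.tens_universal[OF T.tens_facts(1) D] by metis
 show "EX! f. tens_map_spec R G V rh G' V' rh' \<kappa> ps f"
 proof (rule ex1I[of _ f'])
 show P': "tens_map_spec R G V rh G' V' rh' \<kappa> ps f'" using f' ext by (auto simp: tens_map_spec_def lmaps_iff)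
 fix f assume P: "tens_map_spec R G V rh G' V' rh' \<kappa> ps f"
 show "f = f'"
 proof (rule extensionalityI)
 show "f : extensional (cr S.tens)" "f' : extensional (cr S.tens)" using P f'(1) by (simp_all add: tens_map_spec_def lmaps_iff)
 fix x assume x: "x : cr S.tens"
 show "f x = f' x"
 proof (rule S.tens.lin_eq_on_aspan[OF S.brs_closed T.tens_facts(1)])
 show "lin R S.tens T.tens f" "lin R S.tens T.tens f'" using P f'(1) by (simp_all add: tens_map_spec_def lmaps_iff)
 show "x : aspan S.tens S.brs" using x S.tens_aspan by simp
 show "f y = f' y" if "y : S.brs" for y using that brf[OF P] f'(2) by (auto simp: S.brs_def) qed qed qed
qed

section \<open>Fox calculus\<close>

text \<open>Generation by S in the form in which it is used: induction on left multiplication by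
  generators and their inverses.\<close>

definition group_gen :: "'g monoid => 'g set => bool" where
 "group_gen G S <-> S <= cr G & (ALL P. P 1[G] -->
 (ALL s : S. ALL g : cr G. P g --> P (s *[G] g) & P (inv[G] s *[G] g)) --> (ALL g : cr G. P g))"

lemma group_gen_induct: assumes "group_gen G S" "g : cr G" "P 1[G]"
 "!!s g. [|s : S; g : cr G; P g|] ==> P (s *[G] g)"
 "!!s g. [|s : S; g : cr G; P g|] ==> P (inv[G] s *[G] g)" shows "P g"
proof -
 have "P 1[G] -->
 (ALL s : S. ALL g : cr G. P g --> P (s *[G] g) & P (inv[G] s *[G] g)) --> (ALL g : cr G. P g)"
 using assms(1) unfolding group_gen_def by blast thus ?thesis using assms(2-5) by blast
qed

text \<open>The universal property of a free basis, tested only against groups over one type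
  \<open>'e\<close>, since a definition cannot quantify over types; generation gives uniqueness.
  Below, \<open>'e\<close> is the type of self-maps of \<open>'u\<close> x \<open>'u\<close>, home
  of the group of permutations of V x V.\<close>

definition free_basis :: "'e itself => 'g monoid => 'g set => bool" where
 "free_basis U G S <-> group_gen G S & (ALL (E :: 'e monoid) t. group E --> t : S \<rightarrow> cr E -->
 (EX T : hom G E. ALL s : S. T s = t s))"

text \<open>A crossed homomorphism \<open>D\<close> is the same as an action \<open>g (v, w) = (g v, w + D g v)\<close> on
 \<open>V \<times> V\<close>, which may be prescribed on a basis.\<close>

lemma (in gaction) fox_derivative: assumes S: "free_basis TYPE('u \<times> 'u => 'u \<times> 'u) G S" and s: "s : S"
 shows "EX D. crossed R G V rh V D & (ALL s' : S. ALL v : cr V. D s' v = (if s' = s then v else 0[V]))"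
proof -
 let ?W = "cr V \<times> cr V"
 let ?E = "BijGroup ?W"
 \<comment> \<open>The map (v, w) to (g v, w + l v).\<close>
 define aff where "aff g l = (\<lambda>p \<in> ?W. (rh g (fst p), snd p +[V] l (fst p)))" for g and l :: "'u => 'u"
 interpret E: group ?E by (rule group_BijGroup)
 have gen: "group_gen G S" and SG: "S <= cr G" using S by (auto simp: free_basis_def group_gen_def)
 \<comment> \<open>This is the linear part of the inverse of \<open>aff g l\<close>.\<close>
 have neg: "lin R V V (%v. -[V] l (rh (inv[G] g) v))" if "g : cr G" "lin R V V l" for g l
 using lin_comp[OF act_lin[OF G.inv_closed[OF that(1)]] that(2)] by (auto simp: lin_def M.minus_add smult_r_minus)
 have comp: "compose ?W (aff g l) (aff h m) = aff (g *[G] h) (%v. l (rh h v) +[V] m v)"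
 if "g : cr G" "h : cr G" "lin R V V l" "lin R V V m" for g h l m
 using that by (auto simp: compose_def restrict_def aff_def act_mult act_cl lin_cl M.a_ac fun_eq_iff)
 have one: "aff 1[G] m = 1[?E]" if "!!v. v : cr V ==> m v = 0[V]" for m using that by (auto simp: aff_def BijGroup_def restrict_def act_one fun_eq_iff)
 have cancel: "compose ?W (aff (inv[G] g) (%v. -[V] l (rh (inv[G] g) v))) (aff g l) = 1[?E]"
 "compose ?W (aff g l) (aff (inv[G] g) (%v. -[V] l (rh (inv[G] g) v))) = 1[?E]"
 if "g : cr G" "lin R V V l" for g l using that neg by (auto simp: comp act_mult[symmetric] act_one act_cl lin_cl M.l_neg M.r_neg intro!: one)
 have bij: "aff g l : Bij ?W" if "g : cr G" "lin R V V l" for g l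
 proof -
 have m: "aff h k : ?W \<rightarrow> ?W" if "h : cr G" "lin R V V k" for h k using that by (auto simp: aff_def act_cl lin_cl)
 have c: "f (h p) = p" if "compose ?W f h = 1[?E]" "p : ?W" for f h p
 proof -
 have "f (h p) = compose ?W f h p" by (rule compose_eq[OF that(2), symmetric])
 also have "... = p" unfolding that(1) using that(2) by (simp add: BijGroup_def) finally show ?thesis . qed
 note c = c[OF cancel(1)[OF that]] c[OF cancel(2)[OF that]]
 have "bij_betw (aff g l) ?W ?W" by (rule bij_betwI[OF m[OF that] m[OF G.inv_closed[OF that(1)] neg[OF that]]]) (fact c)+
 thus ?thesis by (simp add: Bij_def aff_def) qed
 have mult: "aff g l *[?E] aff h m = aff (g *[G] h) (%v. l (rh h v) +[V] m v)"
 if "g : cr G" "h : cr G" "lin R V V l" "lin R V V m" for g h l m using bij[OF that(1,3)] bij[OF that(2,4)] comp[OF that] by (simp add: BijGroup_def)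
 have lin2: "lin R V V (%v. l (rh h v) +[V] m v)" if "h : cr G" "lin R V V l" "lin R V V m" for h l m
 using lin_comp[OF act_lin[OF that(1)] that(2)] that(3) by (auto simp: lin_def M.a_ac smult_r_distr)
 \<comment> \<open>The chosen s acts with linear part the identity, every other basis element with
   linear part zero: these are the values the derivative is to have on the basis.\<close>
 define t where "t s' = aff s' (if s' = s then (%v. v) else (%_. 0[V]))" for s'
 have tl: "lin R V V (if s' = s then (%v. v) else (%_. 0[V]))" for s' using lin_id[of R V] lin_const_zero[OF module_axioms] by simp
 have "t s' : cr ?E" if "s' : S" for s' using bij[OF subsetD[OF SG that] tl] unfolding t_def by (simp add: BijGroup_def)
 then obtain T where T: "T : hom G ?E" "!!s. s : S ==> T s = t s"
 using S[unfolded free_basis_def, THEN conjunct2, rule_format, OF E.group_axioms, of t] by blast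
 interpret T: group_hom G ?E T by unfold_locales (fact T(1))
 \<comment> \<open>Maps of the form \<open>aff\<close> are closed under composition and inversion,
   so generation keeps every \<open>T g\<close> in this form; its linear part is the derivative at
   g.\<close>
 have "EX l. lin R V V l & T g = aff g l" if "g : cr G" for g using gen that
 proof (rule group_gen_induct, goal_cases)
 case 1 show ?case by (rule exI, rule conjI[OF lin_const_zero[OF module_axioms] trans[OF T.hom_one one[OF refl, symmetric]]])
 next
 case (2 s g) hence s: "s : cr G" using SG by blast
 obtain l where l: "lin R V V l" "T g = aff g l" using 2(3) by blast
 note e = trans[OF T.hom_mult[OF s 2(2)], unfolded T(2)[OF 2(1)] l(2) t_def, OF mult[OF s 2(2) tl l(1)]]
 show ?case by (rule exI, rule conjI[OF lin2[OF 2(2) tl l(1)] e])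
 next
 case (3 s' g) hence s: "s' : cr G" "inv[G] s' : cr G" using SG by auto
 note n = neg[OF s(1) tl[of s']]
 have "aff (inv[G] s') (%v. -[V] (if s' = s then (%v. v) else (%_. 0[V])) (rh (inv[G] s') v)) *[?E] T s' = 1[?E]"
 using cancel(1)[OF s(1) tl[of s']] bij[OF s(1) tl[of s']] bij[OF s(2) n] unfolding T(2)[OF 3(1)] t_def by (simp add: BijGroup_def)
 from E.inv_equality[OF this T.hom_closed[OF s(1)]] bij[OF s(2) n]
 have "T (inv[G] s') = aff (inv[G] s') (%v. -[V] (if s' = s then (%v. v) else (%_. 0[V])) (rh (inv[G] s') v))"
 unfolding T.hom_inv[OF s(1)] by (simp add: BijGroup_def)
 note i = this
 obtain l where l: "lin R V V l" "T g = aff g l" using 3(3) by blast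
 note e = trans[OF T.hom_mult[OF s(2) 3(2)], unfolded i l(2), OF mult[OF s(2) 3(2) n l(1)]]
 show ?case by (rule exI, rule conjI[OF lin2[OF 3(2) n l(1)] e]) qed
 then obtain D where D: "!!g. g : cr G ==> lin R V V (D g)" "!!g. g : cr G ==> T g = aff g (D g)" by metis
 \<comment> \<open>The linear part is recovered from the second coordinate at (v, 0).\<close>
 have eq: "l v = m v" if "aff g l = aff h m" "lin R V V l" "lin R V V m" "v : cr V" for g h l m v
 using fun_cong[OF that(1), of "(v, 0[V])"] that(2-) by (simp add: aff_def lin_cl)
 have "D (g *[G] h) v = D g (rh h v) +[V] D h v" if "g : cr G" "h : cr G" "v : cr V" for g h v
 proof -
 have gh: "g *[G] h : cr G" using that by simp
 note e = T.hom_mult[OF that(1,2), unfolded D(2)[OF that(1)] D(2)[OF that(2)] D(2)[OF gh] mult[OF that(1,2) D(1)[OF that(1)] D(1)[OF that(2)]]]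
 show ?thesis by (rule eq[OF e D(1)[OF gh] lin2[OF that(2) D(1)[OF that(1)] D(1)[OF that(2)]] that(3)]) qed
 moreover have "D s' v = (if s' = s then v else 0[V])" if s': "s' : S" and v: "v : cr V" for s' v
 proof -
 have s'G: "s' : cr G" using s' SG by blast
 have "aff s' (D s') = aff s' (if s' = s then (%v. v) else (%_. 0[V]))" using T(2)[OF s'] unfolding D(2)[OF s'G] t_def .
 from eq[OF this D(1)[OF s'G] tl v] show ?thesis by simp qed ultimately show ?thesis using D(1) unfolding crossed_def by blast
qed

lemma (in rmod) lin_finsum: assumes "module R N" "lin R M N f" "finite A" "!!x. x : A ==> g x : cr M"
 shows "f (\<Oplus>\<^bsub>M\<^esub>x \<in> A. g x) = (\<Oplus>\<^bsub>N\<^esub>x \<in> A. f (g x))" using assms(3,4)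
proof (induction A rule: finite_induct)
 case empty
 interpret N: rmod R N by (rule rmodI) fact
 show ?case using lin_zero[OF assms(1,2)] by simp
next
 case (insert x A)
 interpret N: rmod R N by (rule rmodI) fact
 have "f (g x) : cr N" "!!y. y : A ==> f (g y) : cr N" "g x : cr M" "(\<Oplus>\<^bsub>M\<^esub>x \<in> A. g x) : cr M"
 using insert lin_cl[OF assms(2)] by (auto intro!: M.finsum_closed)
 thus ?case using insert lin_add[OF assms(2), of "g x" "\<Oplus>\<^bsub>M\<^esub>x \<in> A. g x"] by (simp add: Pi_def)
qed

text \<open>The generating half of the statement that the s - 1 form a basis of the augmentation
  ideal: g - 1 is rewritten along a word for g, and the coefficients of each s are collected in
  V.\<close>

lemma (in sgaction) tens_normal_form: assumes S: "group_gen G S" and x: "x : cr tens"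
 shows "EX F w. finite F & F <= S & (ALL s : F. w s : cr V) & x = (\<Oplus>\<^bsub>tens\<^esub>s \<in> F. br s (w s))"
proof -
 define P where "P x <-> (EX F w. finite F & F <= S & (ALL s : F. w s : cr V) &
 x = (\<Oplus>\<^bsub>tens\<^esub>s \<in> F. br s (w s)))" for x
 have SG: "S <= cr G" using S by (simp add: group_gen_def)
 have P0: "P 0[tens]" unfolding P_def by (rule exI[of _ "{}"]) simp
 have Pbr: "P (br s v)" if "s : S" "v : cr V" for s v unfolding P_def
 proof (intro exI conjI)
 have "s : cr G" using that SG by blast
 thus "br s v = (\<Oplus>\<^bsub>tens\<^esub>t \<in> {s}. br t ((%_. v) t))" using that br_closed[of s v] by simp qed (use that in auto)
 have Padd: "P (x +[tens] y)" if "P x" "P y" for x y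
 proof -
 obtain F w where F: "finite F" "F <= S" "ALL s : F. w s : cr V" "x = (\<Oplus>\<^bsub>tens\<^esub>s \<in> F. br s (w s))"
 using \<open>P x\<close> unfolding P_def by blast
 obtain F' w' where F': "finite F'" "F' <= S" "ALL s : F'. w' s : cr V" "y = (\<Oplus>\<^bsub>tens\<^esub>s \<in> F'. br s (w' s))"
 using \<open>P y\<close> unfolding P_def by blast
 \<comment> \<open>Coefficients are extended by zero to the union of the two supports, where they
   can be added.\<close>
 define u where "u s = (if s : F then w s else 0[V])" for s
 define u' where "u' s = (if s : F' then w' s else 0[V])" for s
 have uV: "u s : cr V" "u' s : cr V" for s using F F' by (auto simp: u_def u'_def)
 have U: "finite (F \<union> F')" "F \<union> F' <= cr G" using F F' SG by auto
 have b0: "br s 0[V] = 0[tens]" if "s : cr G" for s by (rule lin_zero[OF tens_facts(1) lin_br[OF that]])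
 have "x = (\<Oplus>\<^bsub>tens\<^esub>s \<in> F \<union> F'. br s (u s))" unfolding F(4)
 by (rule tens.M.add.finprod_mono_neutral_cong_left) (use U F(3) b0 br_closed in \<open>auto simp: u_def\<close>)
 moreover have "y = (\<Oplus>\<^bsub>tens\<^esub>s \<in> F \<union> F'. br s (u' s))" unfolding F'(4)
 by (rule tens.M.add.finprod_mono_neutral_cong_left) (use U F'(3) b0 br_closed in \<open>auto simp: u'_def\<close>)
 moreover have "(\<Oplus>\<^bsub>tens\<^esub>s \<in> F \<union> F'. br s (u s +[V] u' s)) =
 (\<Oplus>\<^bsub>tens\<^esub>s \<in> F \<union> F'. br s (u s) +[tens] br s (u' s))"
 by (rule tens.M.finsum_cong') (use U uV br_closed lin_add[OF lin_br] in auto)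
 moreover have "... = (\<Oplus>\<^bsub>tens\<^esub>s \<in> F \<union> F'. br s (u s)) +[tens] (\<Oplus>\<^bsub>tens\<^esub>s \<in> F \<union> F'. br s (u' s))"
 by (rule tens.M.finsum_addf) (use U uV br_closed in auto)
 ultimately have "x +[tens] y = (\<Oplus>\<^bsub>tens\<^esub>s \<in> F \<union> F'. br s (u s +[V] u' s))" by simp
 thus ?thesis unfolding P_def using U uV F F' by (intro exI[of _ "F \<union> F'"] exI[of _ "%s. u s +[V] u' s"]) auto qed
 \<comment> \<open>From 0 = s s' - 1 = (s - 1)s' + (s' - 1) with s' the inverse of s.\<close>
 have neg: "br (inv[G] s) v = br s (-[V] rh (inv[G] s) v)" if s: "s : S" and v: "v : cr V" for s v
 proof -
 have sG: "s : cr G" "inv[G] s : cr G" using s SG by auto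
 have "br s (rh (inv[G] s) v) +[tens] br (inv[G] s) v = 0[tens]" using br_mult[OF sG v] br_one[OF v] sG by simp
 hence "br (inv[G] s) v = -[tens] br s (rh (inv[G] s) v)"
 using br_closed[OF sG(1) act_cl[OF sG(2) v]] br_closed[OF sG(2) v] by (metis tens.M.a_comm tens.M.minus_equality)
 thus ?thesis using lin_neg[OF tens_facts(1) lin_br[OF sG(1)] act_cl[OF sG(2) v]] by simp qed
 have Pg: "ALL v : cr V. P (br g v)" if "g : cr G" for g using S that
 proof (rule group_gen_induct, goal_cases)
 case 1 thus ?case using br_one P0 by simp
 next
 case (2 s g) hence "s : cr G" using SG by blast thus ?case using 2 Pbr[OF 2(1) act_cl[OF 2(2)]] by (simp add: br_mult Padd)
 next
 case (3 s g) hence s: "s : cr G" "inv[G] s : cr G" using SG by auto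
 have "P (br (inv[G] s) (rh g v))" if "v : cr V" for v
 using Pbr[OF 3(1)] neg[OF 3(1) act_cl[OF 3(2) that]] act_cl[OF s(2) act_cl[OF 3(2) that]] by simp
 thus ?case using 3 s by (simp add: br_mult Padd) qed
 have "x : aspan tens brs" using x tens_aspan by simp hence "P x"
 proof induction
 case aspan_zero show ?case by (rule P0)
 next
 case (aspan_add x y) hence "P x" using Pg by (auto simp: brs_def) thus ?case using aspan_add Padd by blast qed
 thus ?thesis unfolding P_def .
qed

text \<open>Write x with one coefficient per basis element. Fox derivatives are the coordinate
  functionals, so each coefficient lies in the kernel of a separately and can be lifted along j
  separately.\<close>

lemma (in sgaction) tens_exact: fixes V2 V3 :: "('a, 'b) module" assumes "sgaction R V2 G rh2" and "sgaction R V3 G rh3"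
 and j: "lin R V V2 j" and a: "lin R V2 V3 a" and ex: "!!x. [|x : cr V2; a x = 0[V3]|] ==> x : j ` cr V"
 and S: "free_basis TYPE('b \<times> 'b => 'b \<times> 'b) G S" and fj: "lin R tens (tensor_module R G V2 rh2) fj"
 "!!g v. [|g : cr G; v : cr V|] ==> fj (br g v) = sgaction.br R V2 G rh2 g (j v)"
 and fa: "lin R (tensor_module R G V2 rh2) (tensor_module R G V3 rh3) fa"
 "!!g v. [|g : cr G; v : cr V2|] ==> fa (sgaction.br R V2 G rh2 g v) = sgaction.br R V3 G rh3 g (a v)"
 and x: "x : cr (tensor_module R G V2 rh2)" "fa x = 0[tensor_module R G V3 rh3]" shows "x : fj ` cr tens"
proof -
 interpret V2: sgaction R V2 G rh2 by fact
 interpret V3: sgaction R V3 G rh3 by fact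
 have gen: "group_gen G S" using S by (simp add: free_basis_def)
 obtain F w where F: "finite F" "F <= S" "!!s. s : F ==> w s : cr V2" and xe: "x = (\<Oplus>\<^bsub>V2.tens\<^esub>s \<in> F. V2.br s (w s))"
 using V2.tens_normal_form[OF gen x(1)] by blast
 have FG: "s : cr G" if "s : F" for s using that F(2) gen by (auto simp: group_gen_def)
 \<comment> \<open>The derivative dual to s, viewed as a linear map from the tensor product to V3,
   sends the image of x to the single term \<open>a (w s)\<close>.\<close>
 have aw: "a (w s) = 0[V3]" if s: "s : F" for s
 proof -
 obtain D where D: "crossed R G V3 rh3 V3 D" "ALL s' : S. ALL v : cr V3. D s' v = (if s' = s then v else 0[V3])"
 using V3.fox_derivative[OF S] s F(2) by blast
 obtain f where f: "f : linear_maps R V3.tens V3" "!!g v. [|g : cr G; v : cr V3|] ==> f (V3.br g v) = D g v"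
 using V3.tens_universal[OF V3.module_axioms D(1)] by metis
 have fl: "lin R V3.tens V3 f" using f(1) by (simp add: lmaps_iff)
 have ac: "a (w s') : cr V3" if "s' : F" for s' using lin_cl[OF a F(3)[OF that]] .
 have "fa x = (\<Oplus>\<^bsub>V3.tens\<^esub>s' \<in> F. fa (V2.br s' (w s')))"
 unfolding xe by (rule V2.tens.lin_finsum[OF V3.tens_facts(1) fa(1) F(1)]) (simp add: V2.br_closed FG F)
 also have "... = (\<Oplus>\<^bsub>V3.tens\<^esub>s' \<in> F. V3.br s' (a (w s')))" by (rule V3.tens.M.finsum_cong') (use V3.br_closed FG ac fa(2) F in auto)
 finally have "f (fa x) = (\<Oplus>\<^bsub>V3\<^esub>s' \<in> F. f (V3.br s' (a (w s'))))"
 using V3.tens.lin_finsum[OF V3.module_axioms fl F(1), of "%s'. V3.br s' (a (w s'))"] by (simp add: V3.br_closed FG ac)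
 also have "... = (\<Oplus>\<^bsub>V3\<^esub>s' \<in> F. if s = s' then a (w s') else 0[V3])" by (rule V3.M.finsum_cong') (use f(2) FG ac D(2) F(2) in auto)
 also have "... = a (w s)" using V3.M.add.finprod_singleton[of s F "%s'. a (w s')"] s F(1) ac by (simp add: Pi_def)
 finally show ?thesis using x(2) V3.tens.lin_zero[OF V3.module_axioms fl] by simp qed
 have "ALL s : F. EX u. u : cr V & w s = j u" using ex[OF F(3) aw] by blast
 then obtain u where u: "!!s. s : F ==> u s : cr V" "!!s. s : F ==> w s = j (u s)" by metis
 define y where "y = (\<Oplus>\<^bsub>tens\<^esub>s \<in> F. br s (u s))"
 have bc: "br s (u s) : cr tens" if "s : F" for s using br_closed FG u that by blast
 have "fj y = (\<Oplus>\<^bsub>V2.tens\<^esub>s \<in> F. fj (br s (u s)))" unfolding y_def by (rule tens.lin_finsum[OF V2.tens_facts(1) fj(1) F(1)]) (rule bc)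
 also have "... = x" unfolding xe by (rule V2.tens.M.finsum_cong') (use fj(2) FG u V2.br_closed F in auto) finally have "x = fj y" by simp
 moreover have "y : cr tens" unfolding y_def by (rule tens.M.finsum_closed) (use bc in auto) ultimately show ?thesis by blast
qed

lemma (in rcring) group_ring_map_id: assumes "i : cr (free_module R X)" shows "group_ring_map R (%x. x) i = i"
proof -
 interpret L: rmod R "free_module R X" by (rule rmodI) (rule module_fm)
 show ?thesis by (rule L.free_lin_eq[OF _ lin_id assms]) (use lin_group_ring_map[of X "%x. x" X] in auto)
qed

section \<open>Bases of free groups and of free products\<close>

lemma (in group) word_value_closed: "set w <= cr G \<times> UNIV ==> word_value G w : cr G" by (induction w) (auto simp: word_value_def)

lemma (in group) word_value_append:
 "set u <= cr G \<times> UNIV ==> set w <= cr G \<times> UNIV ==> word_value G (u @ w) = word_value G u \<otimes> word_value G w"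
proof (induction u)
 case Nil thus ?case using word_value_closed[of w] by (simp add: word_value_def)
next
 case (Cons p u) thus ?case using word_value_closed[of u] word_value_closed[of w] by (auto simp: word_value_def m_assoc split: prod.splits)
qed

lemma (in group) word_value_cancel:
 "t : cr G ==> set w <= cr G \<times> UNIV ==> word_value G ((t, e) # (t, ~ e) # w) = word_value G w"
 using word_value_closed[of w] by (auto simp: word_value_def m_assoc[symmetric])

text \<open>The extension of t evaluates the reduced word of g in E. It is multiplicative because
  reducing a word changes neither its value in G nor its value in E.\<close>

lemma free_basis_free_group: assumes G: "free_group G" shows "EX S. free_basis TYPE('e) G S"
proof -
 interpret G: group G using G by (simp add: free_group_def)
 obtain S where S: "S <= cr G" "bij_betw (word_value G) (free_reduced_words S) (cr G)" using G by (auto simp: free_group_def)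
 define nf where "nf = inv_into (free_reduced_words S) (word_value G)"
 have nf: "nf g : free_reduced_words S" "word_value G (nf g) = g" if "g : cr G" for g
 using that S(2) by (auto simp: nf_def bij_betw_def intro: inv_into_into f_inv_into_f)
 have nfw: "nf (word_value G w) = w" if "w : free_reduced_words S" for w using that S(2) by (auto simp: nf_def bij_betw_def)
 let ?X = "S \<times> (UNIV :: bool set)"
 have red: "set w <= ?X" if "w : free_reduced_words S" for w using that by (simp add: free_reduced_words_def)
 have wG: "set w <= cr G \<times> UNIV" if "set w <= ?X" for w using that S(1) by blast
 have gen: "group_gen G S" unfolding group_gen_def
 proof (intro conjI allI impI ballI)
 fix P g assume P: "P 1[G]" "ALL s : S. ALL g : cr G. P g --> P (s *[G] g) & P (inv[G] s *[G] g)" and g: "g : cr G"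
 have "P (word_value G w)" if "set w <= ?X" for w using that
 proof (induction w)
 case Nil thus ?case using P by (simp add: word_value_def)
 next
 case (Cons p w) thus ?case using P(2) G.word_value_closed[OF wG, of w] by (auto simp: word_value_def split: prod.splits) qed
 thus "P g" using nf[OF g] red by metis qed (fact S)
 have ext: "EX T : hom G E. ALL s : S. T s = t s" if E: "group E" and t: "t : S \<rightarrow> cr E" for E :: "'e monoid" and t
 proof -
 interpret E: group E by fact
 define val where "val w = word_value E (map (apfst t) w)" for w
 have wE: "set (map (apfst t) w) <= cr E \<times> UNIV" if "set w <= ?X" for w using that t by auto
 \<comment> \<open>A letter put in front of a reduced word can cancel only against the first letter,
   and the rest is still reduced.\<close>
 have reduce: "EX w' : free_reduced_words S. word_value G w' = word_value G w & val w' = val w" if "set w <= ?X" for w using that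
 proof (induction w)
 case Nil thus ?case by (intro bexI[of _ "[]"]) (simp_all add: free_reduced_words_def)
 next
 case (Cons p w)
 obtain a e where p: "p = (a, e)" by (cases p)
 have a: "a : S" using Cons.prems p by auto
 obtain w' where w': "w' : free_reduced_words S" "word_value G w' = word_value G w" "val w' = val w" using Cons by auto
 have eq: "word_value G (p # w') = word_value G (p # w)" "val (p # w') = val (p # w)" using w' by (simp_all add: word_value_def val_def)
 show ?case
 proof (cases "p # w' : free_reduced_words S")
 case True thus ?thesis using eq by blast
 next
 case False
 have "EX u. w' = (a, ~ e) # u"
 proof (cases w')
 case Nil thus ?thesis using False a p by (simp add: free_reduced_words_def)
 next
 case (Cons q u) thus ?thesis using False w'(1) a p by (cases q) (auto simp: free_reduced_words_def) qed
 then obtain u where u: "w' = (a, ~ e) # u" by blast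
 have r: "u : free_reduced_words S" using w'(1) u by (cases u) (auto simp: free_reduced_words_def)
 have "word_value G (p # w') = word_value G u" unfolding p u by (rule G.word_value_cancel) (use a S red[OF r] wG in auto)
 moreover have "val (p # w') = val u" unfolding p u val_def list.map apfst_conv by (rule E.word_value_cancel) (use a t wE[OF red[OF r]] in auto)
 ultimately show ?thesis using r eq by metis qed qed
 have hom: "(%g. val (nf g)) : hom G E"
 proof (rule homI)
 fix g assume g: "g : cr G"
 show "val (nf g) : cr E" unfolding val_def by (rule E.word_value_closed[OF wE[OF red[OF nf(1)[OF g]]]])
 fix h assume h: "h : cr G"
 note rg = red[OF nf(1)[OF g]] and rh = red[OF nf(1)[OF h]]
 obtain w' where w': "w' : free_reduced_words S" "word_value G w' = word_value G (nf g @ nf h)" "val w' = val (nf g @ nf h)"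
 using reduce[of "nf g @ nf h"] rg rh by auto
 \<comment> \<open>Distinct reduced words have distinct values in G, so a reduced word with value gh
   is the normal form of gh.\<close>
 have "w' = nf (g *[G] h)" using nfw[OF w'(1)] w'(2) G.word_value_append[OF wG[OF rg] wG[OF rh]] nf(2) g h by simp
 thus "val (nf (g *[G] h)) = val (nf g) *[E] val (nf h)" using w'(3) E.word_value_append[OF wE[OF rg] wE[OF rh]] by (simp add: val_def) qed
 have "val (nf s) = t s" if s: "s : S" for s
 proof -
 have "[(s, True)] : free_reduced_words S" "word_value G [(s, True)] = s" using s S(1) by (auto simp: free_reduced_words_def word_value_def)
 hence "nf s = [(s, True)]" using nfw by metis moreover have "t s : cr E" using t s by blast
 ultimately show ?thesis by (simp add: val_def word_value_def) qed thus ?thesis by (intro bexI[OF _ hom] ballI) qed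
 have "free_basis TYPE('e) G S" unfolding free_basis_def by (intro conjI allI impI) (fact gen, fact ext) thus ?thesis ..
qed

lemma cons_reduced_in:
 assumes F: "!!i. group (F i)" and x: "x : cr (F i)" "x ~= 1[F i]" and w: "w : reduced_words UNIV F" shows "cons_reduced F (i, x) w : reduced_words UNIV F"
proof (cases w)
 case Nil thus ?thesis using x by (simp add: reduced_words_def)
next
 case (Cons p u)
 obtain j y where p: "p = (j, y)" by (cases p)
 show ?thesis
 proof (cases "i = j")
 case False thus ?thesis using w x by (simp add: reduced_words_def Cons p)
 next
 case True
 have "y : cr (F i)" using w True by (simp add: reduced_words_def Cons p)
 hence "x *[F i] y : cr (F i)" using monoid.m_closed[OF group.is_monoid[OF F] x(1)] by simp
 thus ?thesis using w True by (cases u) (simp_all add: reduced_words_def Cons p) qed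
qed

lemma free_product_closed: assumes F: "!!i. group (F i)" and u: "u : cr (free_product UNIV F)" and w: "w : cr (free_product UNIV F)"
 shows "u *[free_product UNIV F] w : cr (free_product UNIV F)"
proof -
 have "foldr (cons_reduced F) u w : reduced_words UNIV F" if "ALL (i, x) : set u. x : cr (F i) & x ~= 1[F i]" using that
 proof (induction u)
 case Nil show ?case using w by (simp add: free_product_def)
 next
 case (Cons p u) thus ?case using cons_reduced_in[of F "snd p" "fst p", OF F] by (cases p) simp qed
 thus ?thesis using u by (simp add: free_product_def reduced_words_def)
qed

text \<open>\<open>cons_reduced\<close> never changes the value of a word. The induction runs over
  all words with letters in the factors, reduced or not, since trivial letters are harmless for
  evaluation.\<close>

lemma (in group) from_free_product_hom:
 assumes f: "!!i. f i : hom (F i) G" and F: "!!i. group (F i)" shows "from_free_product G f : hom (free_product UNIV F) G"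
proof -
 let ?X = "{(i, x). x : cr (F i)}" and ?v = "from_free_product G f"
 have v: "?v [] = \<one>" "?v ((i, x) # w) = f i x \<otimes> ?v w" for i x w by (simp_all add: from_free_product_def)
 have fc: "f i x : cr G" if "x : cr (F i)" for i x using f[of i] that by (auto simp: hom_def)
 have f1: "f i 1[F i] = \<one>" for i using hom_one[OF f F is_group] .
 have cl: "?v w : cr G" if "set w <= ?X" for w using that by (induction w) (auto simp: v fc)
 have cons: "set (cons_reduced F (i, x) w) <= ?X & ?v (cons_reduced F (i, x) w) = f i x \<otimes> ?v w"
 if x: "x : cr (F i)" and w: "set w <= ?X" for i x w
 proof (cases w)
 case Nil thus ?thesis using x by (simp add: v)
 next
 case (Cons p u)
 obtain j y where p: "p = (j, y)" by (cases p)
 have y: "y : cr (F j)" and u: "set u <= ?X" using w Cons p by auto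
 have "f i x \<otimes> (f j y \<otimes> ?v u) = f i (x *[F i] y) \<otimes> ?v u" if "i = j"
 using hom_mult[OF f x, of y] x y cl[OF u] fc that by (simp add: m_assoc)
 thus ?thesis using x y u monoid.m_closed[OF group.is_monoid[OF F] x, of y] cl[OF u] f1[of i] by (auto simp: Cons p v) qed
 have main: "set (foldr (cons_reduced F) u w) <= ?X & ?v (foldr (cons_reduced F) u w) = ?v u \<otimes> ?v w"
 if "set w <= ?X" "set u <= ?X" for u w using that(2)
 proof (induction u)
 case Nil thus ?case using that(1) cl[OF that(1)] by (simp add: v)
 next
 case (Cons p u)
 thus ?case using cons[of "snd p" "fst p" "foldr (cons_reduced F) u w"] cl[of u] cl[OF that(1)] fc[of "snd p" "fst p"] by (cases p) (auto simp: v m_assoc)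
 qed
 have "set w <= ?X" if "w : reduced_words UNIV F" for w using that by (auto simp: reduced_words_def)
 thus ?thesis using main cl unfolding free_product_def hom_def by auto
qed

text \<open>Surjectivity of the evaluation of words, as an induction over left multiplication by
  elements of the factors. It serves for bases of free products and again for the generation of the
  difference of \<open>LM F\<close>.\<close>

lemma free_product_gen: assumes fp: "is_free_product A B G i j" and G: "group G" and g: "g : cr G" and P1: "P 1[G]"
 and Pi: "!!a x. a : cr A ==> x : cr G ==> P x ==> P (i a *[G] x)"
 and Pj: "!!b x. b : cr B ==> x : cr G ==> P x ==> P (j b *[G] x)" shows "P g"
proof -
 interpret G: group G by fact
 let ?F = "%b. if b then B else A" and ?f = "%b. if b then j else i"
 have c: "i a : cr G" if "a : cr A" for a using fp that by (auto simp: is_free_product_def hom_def)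
 have c': "j b : cr G" if "b : cr B" for b using fp that by (auto simp: is_free_product_def hom_def)
 have main: "from_free_product G ?f w : cr G & P (from_free_product G ?f w)" if "ALL (b, x) : set w. x : cr (?F b)" for w using that
 proof (induction w)
 case Nil show ?case by (simp add: from_free_product_def P1)
 next
 case (Cons l w)
 obtain b x where l: "l = (b, x)" by (cases l)
 have e: "from_free_product G ?f (l # w) = ?f b x *[G] from_free_product G ?f w" by (simp add: from_free_product_def l)
 show ?case unfolding e using Cons Pi Pj c c' by (cases b) (auto simp: l) qed
 have "g : from_free_product G ?f ` reduced_words UNIV ?F" using fp g unfolding is_free_product_def iso_def bij_betw_def by (auto simp: free_product_def)
 then obtain w where w: "w : reduced_words UNIV ?F" "g = from_free_product G ?f w" by blast
 have "ALL (b, x) : set w. x : cr (?F b)" using w(1) unfolding reduced_words_def by blast thus ?thesis using main w(2) by blast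
qed

text \<open>Extend to each factor by its own basis, combine the two homomorphisms on words of the
  free product, and carry the result over to G along the given isomorphism.\<close>

lemma free_basis_free_product: assumes A: "group A" and B: "group B" and G: "group G" and fp: "is_free_product A B G i j"
 and SA: "free_basis TYPE('e) A SA" and SB: "free_basis TYPE('e) B SB" shows "free_basis TYPE('e) G (i ` SA \<union> j ` SB)"
proof -
 interpret G: group G by fact
 interpret i: group_hom A G i using fp A G by (simp add: is_free_product_def group_hom_def group_hom_axioms_def)
 interpret j: group_hom B G j using fp B G by (simp add: is_free_product_def group_hom_def group_hom_axioms_def)
 let ?F = "%b. if b then B else A"
 have F: "group (?F c)" for c using A B by simp
 have sub: "SA <= cr A" "SB <= cr B" using SA SB by (auto simp: free_basis_def group_gen_def)
 have gen: "group_gen G (i ` SA \<union> j ` SB)" unfolding group_gen_def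
 proof (intro conjI allI impI ballI)
 show "i ` SA \<union> j ` SB <= cr G" using sub by auto
 fix P g assume P: "P 1[G]"
 "ALL s : i ` SA \<union> j ` SB. ALL g : cr G. P g --> P (s *[G] g) & P (inv[G] s *[G] g)" and g: "g : cr G"
 \<comment> \<open>Closure under the basis elements of one factor is upgraded to closure under the
   whole factor, by the generation of that factor.\<close>
 have letter: "ALL h : cr G. P h --> P (f x *[G] h)"
 if f: "group_hom C G f" and C: "group_gen C S" and S: "f ` S <= i ` SA \<union> j ` SB" and x: "x : cr C" for C f S x
 proof -
 interpret f: group_hom C G f by fact
 have SC: "S <= cr C" using C by (simp add: group_gen_def)
 show ?thesis using C x
 proof (rule group_gen_induct, goal_cases)
 case (2 s x)
 have "s : cr C" "f s : i ` SA \<union> j ` SB" using 2(1) S SC by auto thus ?case using 2 P(2) by (simp add: G.m_assoc)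
 next
 case (3 s x)
 have "s : cr C" "f s : i ` SA \<union> j ` SB" using 3(1) S SC by auto thus ?case using 3 P(2) by (simp add: G.m_assoc) qed simp qed
 have SA': "group_gen A SA" and SB': "group_gen B SB" using SA SB by (simp_all add: free_basis_def)
 show "P g"
 proof (rule free_product_gen[OF fp G g, of P])
 show "P 1[G]" by (rule P(1))
 show "P (i a *[G] x)" if "a : cr A" "x : cr G" "P x" for a x using letter[OF i.group_hom_axioms SA' Un_upper1 that(1)] that by blast
 show "P (j b *[G] x)" if "b : cr B" "x : cr G" "P x" for b x using letter[OF j.group_hom_axioms SB' Un_upper2 that(1)] that by blast qed
 qed
 have ext: "EX T : hom G E. ALL s : i ` SA \<union> j ` SB. T s = t s"
 if E: "group E" and t: "t : i ` SA \<union> j ` SB \<rightarrow> cr E" for E :: "'e monoid" and t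
 proof -
 interpret E: group E by fact
 have "t \<circ> i : SA \<rightarrow> cr E" "t \<circ> j : SB \<rightarrow> cr E" using t by auto
 then obtain a b where a: "a : hom A E" "ALL s : SA. a s = t (i s)" and b: "b : hom B E" "ALL s : SB. b s = t (j s)"
 using SA SB E unfolding free_basis_def by (metis comp_apply)
 define ph where "ph = from_free_product G (%b. if b then j else i)"
 define f where "f = (%c. if c then b else a)"
 let ?W = "free_product UNIV ?F"
 let ?v = "from_free_product E f"
 have "f c : hom (?F c) E" for c using a b by (simp add: f_def) hence v: "?v : hom ?W E" using F by (rule E.from_free_product_hom)
 have iso: "ph : hom ?W G" "bij_betw ph (cr ?W) (cr G)" using fp by (simp_all add: is_free_product_def ph_def iso_def)
 define nf where "nf = inv_into (cr ?W) ph"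
 have nf: "nf g : cr ?W" "ph (nf g) = g" if "g : cr G" for g using that iso(2) by (auto simp: nf_def bij_betw_def intro: inv_into_into f_inv_into_f)
 have nfw: "nf (ph w) = w" if "w : cr ?W" for w using that iso(2) by (auto simp: nf_def bij_betw_def)
 have hom: "(%g. ?v (nf g)) : hom G E"
 proof (rule homI)
 fix g h assume g: "g : cr G" and h: "h : cr G"
 have "nf (g *[G] h) = nf g *[?W] nf h"
 using nfw[OF free_product_closed[OF F nf(1)[OF g] nf(1)[OF h]]] hom_mult[OF iso(1) nf(1)[OF g] nf(1)[OF h]] nf(2) g h by simp
 thus "?v (nf (g *[G] h)) = ?v (nf g) *[E] ?v (nf h)" using hom_mult[OF v nf(1)[OF g] nf(1)[OF h]] by simp
 qed (use v nf in \<open>auto simp: hom_def\<close>)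
 have "?v (nf (if c then j x else i x)) = f c x" if "x : cr (?F c)" for c x
 \<comment> \<open>A trivial element is not a letter of a reduced word: its normal form is the empty
   word, not a word of length one.\<close>
 proof (cases "x = 1[?F c]")
 case True
 have "[] : cr ?W" "ph [] = 1[G]" by (simp_all add: free_product_def reduced_words_def ph_def from_free_product_def)
 hence "nf 1[G] = []" using nfw by metis
 moreover have "f c x = 1[E]" using True hom_one[OF a(1) A E] hom_one[OF b(1) B E] by (simp add: f_def)
 ultimately show ?thesis using True by (simp add: from_free_product_def split: if_splits)
 next
 case False
 have "[(c, x)] : cr ?W" "ph [(c, x)] = (if c then j x else i x)"
 using that False by (auto simp: free_product_def reduced_words_def ph_def from_free_product_def split: if_splits)
 hence "nf (if c then j x else i x) = [(c, x)]" using nfw by metis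
 moreover have "f c x : cr E" using that a b by (auto simp: f_def hom_def split: if_splits)
 ultimately show ?thesis by (simp add: from_free_product_def) qed
 from this[of _ False] this[of _ True] have "ALL s : i ` SA \<union> j ` SB. ?v (nf s) = t s" using a b sub by (auto simp: f_def)
 thus ?thesis by (intro bexI[OF _ hom]) qed
 show ?thesis unfolding free_basis_def by (intro conjI allI impI) (fact gen, fact ext)
qed

section \<open>Quillen's bracket construction\<close>

context strict_braided_groupoid
begin

lemmas tensA_in = tensA_in_Homs

abbreviation tens_ob (infixr \<open>**\<close> 75) where "X ** Y == X \<natural> Y"
abbreviation tens_arr (infixr \<open>##\<close> 75) where "f ## g == f \<sharp> g"

lemma inv_arr: "f : Homs B X Y ==> invble B f" using all_invertible by (auto simp: Homs_def invble_def)

lemma Inv_in: "f : Homs B X Y ==> Inv B f : Homs B Y X" using Inv_Homs inv_arr by blast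

lemma Inv_l: "f : Homs B X Y ==> Inv B f \<bullet> f = Id B X" using Inv_left inv_arr by blast

lemma Inv_r: "f : Homs B X Y ==> f \<bullet> Inv B f = Id B Y" using Inv_right inv_arr by blast

lemma Inv_unique: "f : Homs B X Y ==> g : Homs B Y X ==> g \<bullet> f = Id B X ==> Inv B f = g"
 by (rule invertible_cancel_right[OF inv_arr, of f X Y]) (simp_all add: Inv_in Inv_l)

lemma Id_in: "X : Obj B ==> Id B X : Homs B X X" by (rule Id_in_Homs)

lemma tensA_assoc': "[|f : Homs B X X'; g : Homs B Y Y'; h : Homs B Z Z'|] ==> (f ## g) ## h = f ## (g ## h)" by (rule tensA_assoc) (simp_all add: Homs_def)

lemma unit_left': "f : Homs B X X' ==> Id B (unitO B) ## f = f" by (rule tensA_unit_left) (simp add: Homs_def)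

lemma unit_right': "f : Homs B X X' ==> f ## Id B (unitO B) = f" by (rule tensA_unit_right) (simp add: Homs_def)

lemma whisk_left:
 "[|Z : Obj B; f : Homs B X Y; g : Homs B Y W|] ==> Id B Z ## (g \<bullet> f) = (Id B Z ## g) \<bullet> (Id B Z ## f)"
 using tensA_Comp[OF Id_in Id_in, of Z f X Y g W] Comp_Id_left[OF Id_in] by simp

lemma whisk_right:
 "[|Z : Obj B; f : Homs B X Y; g : Homs B Y W|] ==> (g \<bullet> f) ## Id B Z = (g ## Id B Z) \<bullet> (f ## Id B Z)"
 using tensA_Comp[OF _ _ Id_in Id_in, of f X Y g W Z] Comp_Id_left[OF Id_in] by simp

lemma interchange:
 assumes "f : Homs B X X'" "g : Homs B Y Y'" shows "(f ## Id B Y') \<bullet> (Id B X ## g) = f ## g" "(Id B X' ## g) \<bullet> (f ## Id B Y) = f ## g"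
proof -
 have O: "X : Obj B" "X' : Obj B" "Y : Obj B" "Y' : Obj B" using assms ends by blast+
 show "(f ## Id B Y') \<bullet> (Id B X ## g) = f ## g"
 using tensA_Comp[OF Id_in[OF O(1)] assms(1,2) Id_in[OF O(4)]] Comp_Id_right[OF assms(1)] Comp_Id_left[OF assms(2)] by simp
 show "(Id B X' ## g) \<bullet> (f ## Id B Y) = f ## g"
 using tensA_Comp[OF assms(1) Id_in[OF O(2)] Id_in[OF O(3)] assms(2)] Comp_Id_left[OF assms(1)] Comp_Id_right[OF assms(2)] by simp
qed

lemma Inv_tens: assumes "f : Homs B X X'" "g : Homs B Y Y'" shows "Inv B (f ## g) = Inv B f ## Inv B g"
proof (rule Inv_unique[OF tensA_in[OF assms] tensA_in[OF Inv_in[OF assms(1)] Inv_in[OF assms(2)]]])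
 have O: "X : Obj B" "Y : Obj B" using assms ends by blast+
 show "(Inv B f ## Inv B g) \<bullet> (f ## g) = Id B (X ** Y)"
 using tensA_Comp[OF assms(1) Inv_in[OF assms(1)] assms(2) Inv_in[OF assms(2)]] Inv_l[OF assms(1)] Inv_l[OF assms(2)] by (simp add: tensA_Id O)
qed

lemma Inv_Id: "X : Obj B ==> Inv B (Id B X) = Id B X" using Inv_unique[OF Id_in Id_in] Comp_Id_left[OF Id_in] by simp

lemma Inv_Comp: "f : Homs B X Y ==> g : Homs B Y Z ==> Inv B (g \<bullet> f) = Inv B f \<bullet> Inv B g"
 using inverse_arrows_Comp[of f X Y g Z] invertible_Inv inv_arr Inv_eq by blast

abbreviation ibr :: "'o => 'o => 'm" where "ibr X Y == Inv B (braid B X Y)"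

lemma ibr_in: "X : Obj B ==> Y : Obj B ==> ibr X Y : Homs B (Y ** X) (X ** Y)" by (rule Inv_in[OF braid_in_Homs])

lemma ibr_natural: assumes f: "f : Homs B X X'" and g: "g : Homs B Y Y'" shows "ibr X' Y' \<bullet> (g ## f) = (f ## g) \<bullet> ibr X Y"
proof -
 have O: "X : Obj B" "X' : Obj B" "Y : Obj B" "Y' : Obj B" using assms ends by blast+
 note b = braid_in_Homs[OF O(1,3)] and b' = braid_in_Homs[OF O(2,4)]
 note i = Inv_in[OF b] and i' = Inv_in[OF b']
 note fg = tensA_in[OF f g] and gf = tensA_in[OF g f]
 have l: "ibr X' Y' \<bullet> (g ## f) : Homs B (Y ** X) (X' ** Y')" "(f ## g) \<bullet> ibr X Y : Homs B (Y ** X) (X' ** Y')"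
 using Comp_in[OF gf i'] Comp_in[OF i fg] .
 show ?thesis
 proof (rule invertible_cancel_right[OF inv_arr[OF b] b l])
 have "(ibr X' Y' \<bullet> (g ## f)) \<bullet> braid B X Y = ibr X' Y' \<bullet> (braid B X' Y' \<bullet> (f ## g))"
 unfolding braid_natural[OF f g] by (rule Comp_assoc[OF b gf i'])
 also have "... = f ## g" unfolding Comp_assoc[OF fg b' i', symmetric] Inv_l[OF b'] by (rule Comp_Id_left[OF fg])
 also have "... = ((f ## g) \<bullet> ibr X Y) \<bullet> braid B X Y" unfolding Comp_assoc[OF b i fg] Inv_l[OF b] by (rule Comp_Id_right[OF fg, symmetric])
 finally show "(ibr X' Y' \<bullet> (g ## f)) \<bullet> braid B X Y = ((f ## g) \<bullet> ibr X Y) \<bullet> braid B X Y" . qed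
qed

lemma ibr_hex_right: assumes "X : Obj B" "Y : Obj B" "Z : Obj B" shows "ibr X (Y ** Z) = (ibr X Y ## Id B Z) \<bullet> (Id B Y ## ibr X Z)"
proof -
 note b1 = braid_in_Homs[OF assms(1,2)] and b2 = braid_in_Homs[OF assms(1,3)]
 note t1 = tensA_in[OF b1 Id_in[OF assms(3)]] and t2 = tensA_in[OF Id_in[OF assms(2)] b2]
 have t2': "Id B Y ## braid B X Z : Homs B ((Y ** X) ** Z) (Y ** (Z ** X))" using t2 by (simp add: tensO_assoc assms)
 show ?thesis unfolding hexagon_right[OF assms] Inv_Comp[OF t1 t2'] Inv_tens[OF b1 Id_in[OF assms(3)]]
 Inv_tens[OF Id_in[OF assms(2)] b2] Inv_Id[OF assms(3)] Inv_Id[OF assms(2)] ..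
qed

lemma ibr_hex_left: assumes "X : Obj B" "Y : Obj B" "Z : Obj B" shows "ibr (X ** Y) Z = (Id B X ## ibr Y Z) \<bullet> (ibr X Z ## Id B Y)"
proof -
 note b1 = braid_in_Homs[OF assms(1,3)] and b2 = braid_in_Homs[OF assms(2,3)]
 note t1 = tensA_in[OF Id_in[OF assms(1)] b2] and t2 = tensA_in[OF b1 Id_in[OF assms(2)]]
 have t2': "braid B X Z ## Id B Y : Homs B (X ** (Z ** Y)) ((Z ** X) ** Y)" using t2 by (simp add: tensO_assoc assms)
 show ?thesis unfolding hexagon_left[OF assms] Inv_Comp[OF t1 t2'] Inv_tens[OF b1 Id_in[OF assms(2)]]
 Inv_tens[OF Id_in[OF assms(1)] b2] Inv_Id[OF assms(1)] Inv_Id[OF assms(2)] ..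
qed

text \<open>A bracket collects everything reachable from (X, f) by some \<psi>. All arrows are
  invertible, so one connecting \<psi> already makes two brackets equal.\<close>

lemma bracket_eqI: assumes X: "X : Obj B" and P: "P : Obj B" and ps: "ps : Homs B X X'" and f': "f' : Homs B (X' ** P) Q"
 and e: "f' \<bullet> (ps ## Id B P) = f" shows "bracket B P X f Q = bracket B P X' f' Q"
proof -
 note psP = tensA_in[OF ps Id_in[OF P]]
 note i = Inv_in[OF ps] and iP = tensA_in[OF Inv_in[OF ps] Id_in[OF P]]
 have f: "f : Homs B (X ** P) Q" using Comp_in[OF psP f'] e by simp
 have "(ps ## Id B P) \<bullet> (Inv B ps ## Id B P) = Id B (X' ** P)" using whisk_right[OF P i ps] Inv_r[OF ps] tensA_Id P ends[OF ps] by simp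
 hence e': "f \<bullet> (Inv B ps ## Id B P) = f'" unfolding e[symmetric] Comp_assoc[OF iP psP f'] using Comp_Id_right[OF f'] by simp
 have "(EX th : Homs B X Z. h \<bullet> (th ## Id B P) = f) <-> (EX th : Homs B X' Z. h \<bullet> (th ## Id B P) = f')"
 if h: "h : Homs B (Z ** P) Q" for Z h
 proof
 assume "EX th : Homs B X Z. h \<bullet> (th ## Id B P) = f"
 then obtain th where t: "th : Homs B X Z" "h \<bullet> (th ## Id B P) = f" by blast
 have "h \<bullet> ((th \<bullet> Inv B ps) ## Id B P) = f'"
 unfolding whisk_right[OF P i t(1)] Comp_assoc[OF iP tensA_in[OF t(1) Id_in[OF P]] h, symmetric] t(2) by (rule e')
 thus "EX th : Homs B X' Z. h \<bullet> (th ## Id B P) = f'" using Comp_in[OF i t(1)] by blast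
 next
 assume "EX th : Homs B X' Z. h \<bullet> (th ## Id B P) = f'"
 then obtain th where t: "th : Homs B X' Z" "h \<bullet> (th ## Id B P) = f'" by blast
 have "h \<bullet> ((th \<bullet> ps) ## Id B P) = f"
 unfolding whisk_right[OF P ps t(1)] Comp_assoc[OF psP tensA_in[OF t(1) Id_in[OF P]] h, symmetric] t(2) by (rule e)
 thus "EX th : Homs B X Z. h \<bullet> (th ## Id B P) = f" using Comp_in[OF ps t(1)] by blast qed
 thus ?thesis unfolding bracket_def by blast
qed

lemma bracket_self: assumes "X : Obj B" "P : Obj B" "f : Homs B (X ** P) Q" shows "(X, f) : fst (snd (bracket B P X f Q))"
proof -
 have "EX ps : Homs B X X. f \<bullet> (ps ## Id B P) = f"
 using Id_in[OF assms(1)] tensA_Id[OF assms(1,2)] Comp_Id_right[OF assms(3)] by (intro bexI[of _ "Id B X"]) simp_all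
 thus ?thesis using assms by (simp add: bracket_def)
qed

lemma bracket_memD:
 assumes "(X', f') : fst (snd (bracket B P X f Q))" shows "X' : Obj B & f' : Homs B (X' ** P) Q & (EX ps : Homs B X X'. f' \<bullet> (ps ## Id B P) = f)"
 using assms by (simp add: bracket_def)

lemma bracket_proj: "fst (bracket B P X f Q) = P" "snd (snd (bracket B P X f Q)) = Q" by (simp_all add: bracket_def)

lemma bracket_triple: "bracket B P X f Q = (P, fst (snd (bracket B P X f Q)), Q)" by (simp add: bracket_def)

text \<open>Composition in \<open>UG'\<close> is a union over representatives; changing them by
  \<psi> and \<theta> changes the composite pair by \<theta> tensored with \<psi>, so the union is a
  single bracket.\<close>

lemma bracket_Comp: assumes X: "X : Obj B" and Y: "Y : Obj B" and P: "P : Obj B"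
 and f: "f : Homs B (X ** P) Q" and g: "g : Homs B (Y ** Q) S"
 shows "bracket B Q Y g S o[UG' B] bracket B P X f Q = bracket B P (Y ** X) (g \<bullet> (Id B Y ## f)) S"
proof -
 have Q: "Q : Obj B" using ends[OF f] by simp
 have *: "bracket B P (Y' ** X') (g' \<bullet> (Id B Y' ## f')) S = bracket B P (Y ** X) (g \<bullet> (Id B Y ## f)) S"
 if xf: "(X', f') : fst (snd (bracket B P X f Q))" and yg: "(Y', g') : fst (snd (bracket B Q Y g S))" for X' f' Y' g'
 proof -
 obtain ps where ps: "X' : Obj B" "f' : Homs B (X' ** P) Q" "ps : Homs B X X'" "f' \<bullet> (ps ## Id B P) = f" using bracket_memD[OF xf] by blast
 obtain th where th: "Y' : Obj B" "g' : Homs B (Y' ** Q) S" "th : Homs B Y Y'" "g' \<bullet> (th ## Id B Q) = g" using bracket_memD[OF yg] by blast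
 note psP = tensA_in[OF ps(3) Id_in[OF P]]
 note Yf = tensA_in[OF Id_in[OF th(1)] ps(2)]
 have "(g' \<bullet> (Id B Y' ## f')) \<bullet> ((th ## ps) ## Id B P) = (g' \<bullet> (Id B Y' ## f')) \<bullet> (th ## (ps ## Id B P))"
 by (simp only: tensA_assoc'[OF th(3) ps(3) Id_in[OF P]])
 also have "... = g' \<bullet> ((Id B Y' ## f') \<bullet> (th ## (ps ## Id B P)))" by (rule Comp_assoc[OF tensA_in[OF th(3) psP] Yf th(2)])
 also have "(Id B Y' ## f') \<bullet> (th ## (ps ## Id B P)) = th ## f"
 using tensA_Comp[OF th(3) Id_in[OF th(1)] psP ps(2)] Comp_Id_left[OF th(3)] ps(4) by simp
 also have "th ## f = (th ## Id B Q) \<bullet> (Id B Y ## f)" by (rule interchange(1)[OF th(3) f, symmetric])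
 also have "g' \<bullet> ((th ## Id B Q) \<bullet> (Id B Y ## f)) = g \<bullet> (Id B Y ## f)"
 unfolding Comp_assoc[OF tensA_in[OF Id_in[OF Y] f] tensA_in[OF th(3) Id_in[OF Q]] th(2), symmetric] th(4) ..
 finally have e: "(g' \<bullet> (Id B Y' ## f')) \<bullet> ((th ## ps) ## Id B P) = g \<bullet> (Id B Y ## f)" .
 have "g' \<bullet> (Id B Y' ## f') : Homs B ((Y' ** X') ** P) S" using Comp_in[OF Yf th(2)] by (simp add: tensO_assoc th(1) ps(1) P)
 from bracket_eqI[OF tensO_in_Obj[OF Y X] P tensA_in[OF th(3) ps(3)] this e]
 show ?thesis .. qed
 let ?c = "fst (snd (bracket B P X f Q))" and ?d = "fst (snd (bracket B Q Y g S))"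
 let ?r = "bracket B P (Y ** X) (g \<bullet> (Id B Y ## f)) S"
 have "(\<Union>(Y', g') \<in> ?d. \<Union>(X', f') \<in> ?c. fst (snd (bracket B P (Y' ** X') (g' \<bullet> (Id B Y' ## f')) S))) = (\<Union>(Y', g') \<in> ?d. \<Union>(X', f') \<in> ?c. fst (snd ?r))"
 by (intro SUP_cong refl) (auto simp: *) also have "... = fst (snd ?r)" using bracket_self[OF X P f] bracket_self[OF Y Q g] by fastforce
 finally have "(P, (\<Union>(Y', g') \<in> ?d. \<Union>(X', f') \<in> ?c. fst (snd (bracket B P (Y' ** X') (g' \<bullet> (Id B Y' ## f')) S))), S) = ?r"
 by (rule trans[OF arg_cong[where f = "%U. (P, U, S)"] bracket_triple[symmetric]])
 thus ?thesis by (simp add: UG'_def case_prod_beta bracket_proj)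
qed

text \<open>As for composition, with naturality of the inverse braiding carrying the change of the
  second complement past P.\<close>

lemma bracket_tens: assumes X: "X : Obj B" and Y: "Y : Obj B" and P: "P : Obj B" and S: "S : Obj B"
 and f: "f : Homs B (X ** P) Q" and g: "g : Homs B (Y ** S) T" shows "bracket_tens B (bracket B P X f Q) (bracket B S Y g T) =
 bracket B (P ** S) (X ** Y) ((f ## g) \<bullet> (Id B X ## ibr P Y ## Id B S)) (Q ** T)"
proof -
 let ?m = "%X f Y g. (f ## g) \<bullet> (Id B X ## ibr P Y ## Id B S)"
 have *: "bracket B (P ** S) (X' ** Y') (?m X' f' Y' g') (Q ** T) = bracket B (P ** S) (X ** Y) (?m X f Y g) (Q ** T)"
 if xf: "(X', f') : fst (snd (bracket B P X f Q))" and yg: "(Y', g') : fst (snd (bracket B S Y g T))" for X' f' Y' g'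
 proof -
 obtain ps where ps: "X' : Obj B" "f' : Homs B (X' ** P) Q" "ps : Homs B X X'" "f' \<bullet> (ps ## Id B P) = f" using bracket_memD[OF xf] by blast
 obtain th where th: "Y' : Obj B" "g' : Homs B (Y' ** S) T" "th : Homs B Y Y'" "g' \<bullet> (th ## Id B S) = g" using bracket_memD[OF yg] by blast
 note iP = Id_in[OF P] and iS = Id_in[OF S] and iX = Id_in[OF X] and iX' = Id_in[OF ps(1)]
 note b = ibr_in[OF P Y] and b' = ibr_in[OF P th(1)]
 note thP = tensA_in[OF th(3) iP] and Pth = tensA_in[OF iP th(3)]
 note thS = tensA_in[OF th(3) iS] and psP = tensA_in[OF ps(3) iP]
 note m' = tensA_in[OF iX' tensA_in[OF b' iS]] and m = tensA_in[OF iX tensA_in[OF b iS]]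
 note fg' = tensA_in[OF ps(2) th(2)]
 have fg2: "f' ## g' : Homs B (X' ** ((P ** Y') ** S)) (Q ** T)" using fg' by (simp add: tensO_assoc tensO_in_Obj ps(1) th(1) P S)
 have "(ps ## th) ## Id B (P ** S) = ps ## ((th ## Id B P) ## Id B S)"
 unfolding tensA_Id[OF P S, symmetric] tensA_assoc'[OF ps(3) th(3) tensA_in[OF iP iS]] tensA_assoc'[OF th(3) iP iS] ..
 hence "?m X' f' Y' g' \<bullet> ((ps ## th) ## Id B (P ** S))
 = (f' ## g') \<bullet> ((Id B X' ## ibr P Y' ## Id B S) \<bullet> (ps ## ((th ## Id B P) ## Id B S)))"
 using Comp_assoc[OF tensA_in[OF ps(3) tensA_in[OF thP iS]] m' fg2] by simp
 also have "(Id B X' ## ibr P Y' ## Id B S) \<bullet> (ps ## ((th ## Id B P) ## Id B S))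
 = (Id B X' \<bullet> ps) ## ((ibr P Y' \<bullet> (th ## Id B P)) ## Id B S)"
 unfolding whisk_right[OF S thP b'] by (rule tensA_Comp[OF ps(3) iX' tensA_in[OF thP iS] tensA_in[OF b' iS], symmetric])
 also have "... = (ps \<bullet> Id B X) ## (((Id B P ## th) \<bullet> ibr P Y) ## Id B S)"
 unfolding ibr_natural[OF iP th(3)] Comp_Id_left[OF ps(3)] Comp_Id_right[OF ps(3)] ..
 also have "... = (ps ## ((Id B P ## th) ## Id B S)) \<bullet> (Id B X ## ibr P Y ## Id B S)"
 unfolding whisk_right[OF S b Pth] by (rule tensA_Comp[OF iX ps(3) tensA_in[OF b iS] tensA_in[OF Pth iS]])
 also have "ps ## ((Id B P ## th) ## Id B S) = (ps ## Id B P) ## (th ## Id B S)" unfolding tensA_assoc'[OF iP th(3) iS] tensA_assoc'[OF ps(3) iP thS] ..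
 also have "(f' ## g') \<bullet> (((ps ## Id B P) ## (th ## Id B S)) \<bullet> (Id B X ## ibr P Y ## Id B S))
 = ((f' ## g') \<bullet> ((ps ## Id B P) ## (th ## Id B S))) \<bullet> (Id B X ## ibr P Y ## Id B S)"
 proof (rule Comp_assoc[OF _ tensA_in[OF psP thS] fg', symmetric])
 show "Id B X ## ibr P Y ## Id B S : Homs B (X ** ((Y ** P) ** S)) ((X ** P) ** (Y ** S))" using m by (simp add: tensO_assoc tensO_in_Obj X Y P S)
 qed
 also have "(f' ## g') \<bullet> ((ps ## Id B P) ## (th ## Id B S)) = f ## g" using tensA_Comp[OF psP ps(2) thS th(2)] ps(4) th(4) by simp
 finally have e: "?m X' f' Y' g' \<bullet> ((ps ## th) ## Id B (P ** S)) = ?m X f Y g" .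
 have "?m X' f' Y' g' : Homs B ((X' ** Y') ** (P ** S)) (Q ** T)" using Comp_in[OF m' fg2] by (simp add: tensO_assoc tensO_in_Obj ps(1) th(1) P S)
 from bracket_eqI[OF tensO_in_Obj[OF X Y] tensO_in_Obj[OF P S] tensA_in[OF ps(3) th(3)] this e]
 show ?thesis .. qed
 let ?c = "fst (snd (bracket B P X f Q))" and ?d = "fst (snd (bracket B S Y g T))"
 let ?r = "bracket B (P ** S) (X ** Y) (?m X f Y g) (Q ** T)"
 have "(\<Union>(X', f') \<in> ?c. \<Union>(Y', g') \<in> ?d. fst (snd (bracket B (P ** S) (X' ** Y') (?m X' f' Y' g') (Q ** T)))) = (\<Union>(X', f') \<in> ?c. \<Union>(Y', g') \<in> ?d. fst (snd ?r))"
 by (intro SUP_cong refl) (auto simp: *) also have "... = fst (snd ?r)" using bracket_self[OF X P f] bracket_self[OF Y S g] by fastforce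
 finally have "(P ** S, (\<Union>(X', f') \<in> ?c. \<Union>(Y', g') \<in> ?d. fst (snd (bracket B (P ** S) (X' ** Y') (?m X' f' Y' g') (Q ** T)))), Q ** T) = ?r"
 by (rule trans[OF arg_cong[where f = "%U. (P ** S, U, Q ** T)"] bracket_triple[symmetric]])
 thus ?thesis by (simp add: bracket_tens_def case_prod_beta bracket_proj)
qed

section \<open>Translation and stabilisation in the bracket category\<close>

lemma UG'_simps: "Obj (UG' B) = Obj B" "Id (UG' B) X = bracket B X (unitO B) (Id B X) X" by (simp_all add: UG'_def)

lemma UG'_Homs:
 "ph : Homs (UG' B) P Q <-> P : Obj B & Q : Obj B & (EX X f. X : Obj B & f : Homs B (X ** P) Q & ph = bracket B P X f Q)"
 by (auto simp: Homs_def UG'_def bracket_def)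

lemma bracket_in:
 "[|P : Obj B; X : Obj B; f : Homs B (X ** P) Q|] ==> bracket B P X f Q : Homs (UG' B) P Q" using UG'_Homs ends by blast

text \<open>The functor m tensored on the left with -; for m = \<open>obj1 B\<close> it is
  \<open>shift_UG\<close> on arrows, and it underlies the translation \<open>tau\<close>.\<close>

definition sh :: "'o => ('o, 'm) bracket_arr => ('o, 'm) bracket_arr" where
 "sh m ph = bracket_tens B (Id (UG' B) m) ph"

text \<open>The identity of m has complement 0, so the only trace of the tensor product is the
  inverse braiding moving m past the complement Y.\<close>

lemma sh_bracket: assumes m: "m : Obj B" and Y: "Y : Obj B" and S: "S : Obj B" and g: "g : Homs B (Y ** S) T"
 shows "sh m (bracket B S Y g T) = bracket B (m ** S) Y ((Id B m ## g) \<bullet> (ibr m Y ## Id B S)) (m ** T)"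
 and "(Id B m ## g) \<bullet> (ibr m Y ## Id B S) : Homs B (Y ** (m ** S)) (m ** T)"
proof -
 have i: "Id B m : Homs B (unitO B ** m) m" using Id_in[OF m] by (simp add: tensO_unit_left m)
 note b = tensA_in[OF ibr_in[OF m Y] Id_in[OF S]]
 show "sh m (bracket B S Y g T) = bracket B (m ** S) Y ((Id B m ## g) \<bullet> (ibr m Y ## Id B S)) (m ** T)"
 unfolding sh_def UG'_simps using bracket_tens[OF unitO_in_Obj Y m S i g] unit_left'[OF b] by (simp add: tensO_unit_left Y)
 have "Id B m ## g : Homs B ((m ** Y) ** S) (m ** T)" using tensA_in[OF Id_in[OF m] g] by (simp add: tensO_assoc m Y S)
 from Comp_in[OF b this] show "(Id B m ## g) \<bullet> (ibr m Y ## Id B S) : Homs B (Y ** (m ** S)) (m ** T)" by (simp add: tensO_assoc m Y S)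
qed

lemma sh_in: "m : Obj B ==> ph : Homs (UG' B) P Q ==> sh m ph : Homs (UG' B) (m ** P) (m ** Q)" unfolding UG'_Homs using sh_bracket tensO_in_Obj by blast

lemma unit_bracket: "X : Obj B ==> f : Homs B X Y ==> f : Homs B (unitO B ** X) Y" by (simp add: tensO_unit_left)

lemma lift_arr_eq: "f : Homs B X Y ==> lift_arr B f = bracket B X (unitO B) f Y" by (simp add: lift_arr_def Homs_def)

lemma lift_in: "f : Homs B X Y ==> lift_arr B f : Homs (UG' B) X Y" using lift_arr_eq bracket_in[OF _ unitO_in_Obj unit_bracket] ends by metis

lemma lift_Id: "X : Obj B ==> lift_arr B (Id B X) = Id (UG' B) X" using lift_arr_eq[OF Id_in] by (simp add: UG'_simps)

lemma lift_bracket_Comp: assumes X: "X : Obj B" and P: "P : Obj B" and f: "f : Homs B (X ** P) Q" and g: "g : Homs B Q S"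
 shows "lift_arr B g o[UG' B] bracket B P X f Q = bracket B P X (g \<bullet> f) S"
proof -
 have Q: "Q : Obj B" using ends[OF f] by simp
 show ?thesis unfolding lift_arr_eq[OF g] using bracket_Comp[OF X unitO_in_Obj P f unit_bracket[OF Q g]] unit_left'[OF f] by (simp add: tensO_unit_left X)
qed

lemma bracket_lift_Comp: assumes X: "X : Obj B" and f: "f : Homs B P Q" and g: "g : Homs B (X ** Q) S"
 shows "bracket B Q X g S o[UG' B] lift_arr B f = bracket B P X (g \<bullet> (Id B X ## f)) S"
proof -
 have P: "P : Obj B" using ends[OF f] by simp
 show ?thesis unfolding lift_arr_eq[OF f] using bracket_Comp[OF unitO_in_Obj X P unit_bracket[OF P f] g] by (simp add: tensO_unit_right X)
qed

lemma lift_Comp: "f : Homs B X Y ==> g : Homs B Y Z ==> lift_arr B (g \<bullet> f) = lift_arr B g o[UG' B] lift_arr B f"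
 using lift_bracket_Comp[OF unitO_in_Obj _ unit_bracket, of X f Y g Z] ends lift_arr_eq Comp_in by metis

lemma sh_Id: "m : Obj B ==> X : Obj B ==> sh m (Id (UG' B) X) = Id (UG' B) (m ** X)"
proof -
 assume m: "m : Obj B" and X: "X : Obj B"
 have "Id B (m ** unitO B) : Homs B (m ** unitO B) m" using Id_in[OF m] by (simp add: tensO_unit_right m)
 \<comment> \<open>The hexagon at 0 makes the inverse braiding with 0 idempotent, and an invertible
   idempotent is an identity.\<close>
 have b: "ibr m (unitO B) = Id B m"
 proof -
 have "ibr m (unitO B ** unitO B) = (ibr m (unitO B) ## Id B (unitO B)) \<bullet> (Id B (unitO B) ## ibr m (unitO B))"
 by (rule ibr_hex_right[OF m unitO_in_Obj unitO_in_Obj])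
 moreover have i: "ibr m (unitO B) : Homs B m m" using ibr_in[OF m unitO_in_Obj] by (simp add: tensO_unit_left tensO_unit_right m)
 ultimately have "ibr m (unitO B) \<bullet> Id B m = ibr m (unitO B) \<bullet> ibr m (unitO B)"
 using unit_left'[OF i] unit_right'[OF i] Comp_Id_right[OF i] by (simp add: tensO_unit_left unitO_in_Obj)
 from invertible_cancel_left[OF inv_arr[OF i] i Id_in[OF m] i this] show ?thesis .. qed
 show ?thesis unfolding UG'_simps using sh_bracket(1)[OF m unitO_in_Obj X unit_bracket[OF X Id_in[OF X]]]
 by (simp add: b tensA_Id m X Comp_Id_left[OF Id_in] tensO_in_Obj)
qed

lemma ibr_unit: "m : Obj B ==> ibr m (unitO B) = Id B m"
proof -
 assume m: "m : Obj B"
 have "ibr m (unitO B ** unitO B) = (ibr m (unitO B) ## Id B (unitO B)) \<bullet> (Id B (unitO B) ## ibr m (unitO B))"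
 by (rule ibr_hex_right[OF m unitO_in_Obj unitO_in_Obj])
 moreover have i: "ibr m (unitO B) : Homs B m m" using ibr_in[OF m unitO_in_Obj] by (simp add: tensO_unit_left tensO_unit_right m)
 ultimately have "ibr m (unitO B) \<bullet> Id B m = ibr m (unitO B) \<bullet> ibr m (unitO B)"
 using unit_left'[OF i] unit_right'[OF i] Comp_Id_right[OF i] by (simp add: tensO_unit_left unitO_in_Obj)
 from invertible_cancel_left[OF inv_arr[OF i] i Id_in[OF m] i this] show ?thesis ..
qed

lemma sh_lift: assumes m: "m : Obj B" and f: "f : Homs B X Y" shows "sh m (lift_arr B f) = lift_arr B (Id B m ## f)"
proof -
 have X: "X : Obj B" using ends[OF f] by simp
 note mf = tensA_in[OF Id_in[OF m] f]
 show ?thesis unfolding lift_arr_eq[OF f] lift_arr_eq[OF mf]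
 using sh_bracket(1)[OF m unitO_in_Obj X unit_bracket[OF X f]] Comp_Id_right[OF mf] by (simp add: ibr_unit m tensA_Id X)
qed

text \<open>The composite has complement Y followed by X; moving m past both is moving it past each
  in turn, by the hexagon in the second variable.\<close>

lemma sh_Comp:
 assumes m: "m : Obj B" and ph: "ph : Homs (UG' B) P Q" and ph': "ph' : Homs (UG' B) Q S" shows "sh m (ph' o[UG' B] ph) = sh m ph' o[UG' B] sh m ph"
proof -
 obtain X f where X: "X : Obj B" and P: "P : Obj B" and f: "f : Homs B (X ** P) Q" and phe: "ph = bracket B P X f Q" using ph unfolding UG'_Homs by blast
 obtain Y g where Y: "Y : Obj B" and Q: "Q : Obj B" and g: "g : Homs B (Y ** Q) S" and phe': "ph' = bracket B Q Y g S" using ph' unfolding UG'_Homs by blast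
 note im = Id_in[OF m] and iY = Id_in[OF Y] and iX = Id_in[OF X] and iP = Id_in[OF P] and iQ = Id_in[OF Q]
 note bY = ibr_in[OF m Y] and bX = ibr_in[OF m X]
 note sf = sh_bracket[OF m X P f] and sg = sh_bracket[OF m Y Q g]
 have Yf: "Id B Y ## f : Homs B ((Y ** X) ** P) (Y ** Q)" using tensA_in[OF iY f] by (simp add: tensO_assoc X Y P)
 have YX: "Y ** X : Obj B" using tensO_in_Obj[OF Y X] .
 note gf = Comp_in[OF Yf g]
 note mf = tensA_in[OF im f] and mg = tensA_in[OF im g]
 note YmF = tensA_in[OF iY mf]
 note bXP = tensA_in[OF bX iP] and bYQ = tensA_in[OF bY iQ]
 have bXP': "ibr m X ## Id B P : Homs B (X ** (m ** P)) (m ** (X ** P))" using bXP by (simp add: tensO_assoc m X P)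
 note YbXP = tensA_in[OF iY bXP']
 have XP: "X ** P : Obj B" using tensO_in_Obj[OF X P] .
 note bYXP = tensA_in[OF bY Id_in[OF XP]]
 have mg': "Id B m ## g : Homs B ((m ** Y) ** Q) (m ** S)" using mg by (simp add: tensO_assoc m Y Q)
 have YmF': "Id B Y ## (Id B m ## f) : Homs B ((Y ** m) ** (X ** P)) ((Y ** m) ** Q)" using YmF by (simp add: tensO_assoc m Y Q XP)
 have YbXP2: "Id B Y ## (ibr m X ## Id B P) : Homs B (Y ** (X ** (m ** P))) ((Y ** m) ** (X ** P))" using YbXP by (simp add: tensO_assoc m Y XP)
 have bYQ': "ibr m Y ## Id B Q : Homs B ((Y ** m) ** Q) ((m ** Y) ** Q)" by (rule bYQ)
 have "((Id B m ## g) \<bullet> (ibr m Y ## Id B Q)) \<bullet> (Id B Y ## ((Id B m ## f) \<bullet> (ibr m X ## Id B P)))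
 = ((Id B m ## g) \<bullet> (ibr m Y ## Id B Q)) \<bullet> ((Id B Y ## (Id B m ## f)) \<bullet> (Id B Y ## (ibr m X ## Id B P)))"
 by (simp only: whisk_left[OF Y bXP' mf])
 also have "... = (Id B m ## g) \<bullet> ((ibr m Y ## Id B Q) \<bullet> ((Id B Y ## (Id B m ## f)) \<bullet> (Id B Y ## (ibr m X ## Id B P))))"
 by (rule Comp_assoc[OF Comp_in[OF YbXP2 YmF'] bYQ' mg'])
 also have "(ibr m Y ## Id B Q) \<bullet> ((Id B Y ## (Id B m ## f)) \<bullet> (Id B Y ## (ibr m X ## Id B P)))
 = ((ibr m Y ## Id B Q) \<bullet> (Id B Y ## (Id B m ## f))) \<bullet> (Id B Y ## (ibr m X ## Id B P))" by (rule Comp_assoc[OF YbXP2 YmF' bYQ', symmetric])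
 also have "(ibr m Y ## Id B Q) \<bullet> (Id B Y ## (Id B m ## f)) = (Id B m ## (Id B Y ## f)) \<bullet> (ibr m Y ## Id B (X ** P))"
 proof -
 have "Id B Y ## (Id B m ## f) = Id B (Y ** m) ## f" using tensA_assoc'[OF iY im f] tensA_Id[OF Y m] by simp
 moreover have "Id B m ## (Id B Y ## f) = Id B (m ** Y) ## f" using tensA_assoc'[OF im iY f] tensA_Id[OF m Y] by simp
 ultimately show ?thesis using interchange[OF bY f] by simp qed
 also have "(Id B m ## (Id B Y ## f)) \<bullet> (ibr m Y ## Id B (X ** P)) \<bullet> (Id B Y ## (ibr m X ## Id B P))
 = (Id B m ## (Id B Y ## f)) \<bullet> ((ibr m Y ## Id B (X ** P)) \<bullet> (Id B Y ## (ibr m X ## Id B P)))"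
 proof (rule Comp_assoc[OF YbXP2 bYXP])
 show "Id B m ## (Id B Y ## f) : Homs B ((m ** Y) ** (X ** P)) (m ** (Y ** Q))"
 using tensA_in[OF im tensA_in[OF iY f]] by (simp add: tensO_assoc m Y XP) qed
 also have "(ibr m Y ## Id B (X ** P)) \<bullet> (Id B Y ## (ibr m X ## Id B P)) = ibr m (Y ** X) ## Id B P"
 proof -
 have "ibr m Y ## Id B (X ** P) = (ibr m Y ## Id B X) ## Id B P" using tensA_assoc'[OF bY iX iP] tensA_Id[OF X P] by simp
 moreover have "Id B Y ## (ibr m X ## Id B P) = (Id B Y ## ibr m X) ## Id B P" using tensA_assoc'[OF iY bX iP] by simp
 moreover have "Id B Y ## ibr m X : Homs B (Y ** (X ** m)) ((Y ** m) ** X)" using tensA_in[OF iY bX] by (simp add: tensO_assoc m X Y)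
 ultimately show ?thesis unfolding ibr_hex_right[OF m Y X] using whisk_right[OF P _ tensA_in[OF bY iX]] by simp qed
 also have "(Id B m ## g) \<bullet> ((Id B m ## (Id B Y ## f)) \<bullet> (ibr m (Y ** X) ## Id B P))
 = ((Id B m ## g) \<bullet> (Id B m ## (Id B Y ## f))) \<bullet> (ibr m (Y ** X) ## Id B P)"
 proof (rule Comp_assoc[OF tensA_in[OF ibr_in[OF m YX] iP] _ mg, symmetric])
 show "Id B m ## (Id B Y ## f) : Homs B ((m ** (Y ** X)) ** P) (m ** (Y ** Q))" using tensA_in[OF im Yf] by (simp add: tensO_assoc m YX P)
 qed
 also have "(Id B m ## g) \<bullet> (Id B m ## (Id B Y ## f)) = Id B m ## (g \<bullet> (Id B Y ## f))" by (rule whisk_left[OF m Yf g, symmetric])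
 finally show ?thesis unfolding phe phe' bracket_Comp[OF X Y P f g] sf(1) sg(1) sh_bracket(1)[OF m YX P gf]
 using bracket_Comp[OF X Y tensO_in_Obj[OF m P] sf(2) sg(2)] by simp
qed

text \<open>The hexagon in the first variable: moving the product of m and m' past X is moving first
  m, then m'.\<close>

lemma sh_tensO: assumes m: "m : Obj B" and m': "m' : Obj B" and ph: "ph : Homs (UG' B) P Q" shows "sh (m ** m') ph = sh m (sh m' ph)"
proof -
 obtain X f where X: "X : Obj B" and P: "P : Obj B" and Q: "Q : Obj B" and f: "f : Homs B (X ** P) Q" and phe: "ph = bracket B P X f Q"
 using ph unfolding UG'_Homs by blast
 have mm: "m ** m' : Obj B" and m'P: "m' ** P : Obj B" using m m' P tensO_in_Obj by blast+
 note im = Id_in[OF m] and im' = Id_in[OF m'] and iP = Id_in[OF P]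
 note b = ibr_in[OF m X] and b' = ibr_in[OF m' X]
 note s' = sh_bracket[OF m' X P f]
 have bP': "ibr m' X ## Id B P : Homs B (X ** (m' ** P)) (m' ** (X ** P))" using tensA_in[OF b' iP] by (simp add: tensO_assoc m' X P)
 have t1: "Id B m ## (Id B m' ## f) : Homs B (m ** (m' ** (X ** P))) (m ** (m' ** Q))" by (rule tensA_in[OF im tensA_in[OF im' f]])
 have t2: "Id B m ## (ibr m' X ## Id B P) : Homs B (m ** (X ** (m' ** P))) (m ** (m' ** (X ** P)))" by (rule tensA_in[OF im bP'])
 have t3: "ibr m X ## Id B (m' ** P) : Homs B ((X ** m) ** (m' ** P)) (m ** (X ** (m' ** P)))"
 using tensA_in[OF b Id_in[OF m'P]] by (simp add: tensO_assoc m X m'P)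
 have "(Id B m ## ((Id B m' ## f) \<bullet> (ibr m' X ## Id B P))) \<bullet> (ibr m X ## Id B (m' ** P))
 = ((Id B m ## (Id B m' ## f)) \<bullet> (Id B m ## (ibr m' X ## Id B P))) \<bullet> (ibr m X ## Id B (m' ** P))"
 by (simp only: whisk_left[OF m bP' tensA_in[OF im' f]])
 also have "... = (Id B m ## (Id B m' ## f)) \<bullet> ((Id B m ## (ibr m' X ## Id B P)) \<bullet> (ibr m X ## Id B (m' ** P)))"
 by (rule Comp_assoc[OF t3 t2 t1])
 also have "(Id B m ## (ibr m' X ## Id B P)) \<bullet> (ibr m X ## Id B (m' ** P)) = ibr (m ** m') X ## Id B P"
 proof -
 have "Id B m ## (ibr m' X ## Id B P) = (Id B m ## ibr m' X) ## Id B P" using tensA_assoc'[OF im b' iP] by simp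
 moreover have "ibr m X ## Id B (m' ** P) = (ibr m X ## Id B m') ## Id B P" using tensA_assoc'[OF b im' iP] tensA_Id[OF m' P] by simp
 moreover have "ibr m X ## Id B m' : Homs B ((X ** m) ** m') (m ** (X ** m'))" using tensA_in[OF b im'] by (simp add: tensO_assoc m X m')
 ultimately show ?thesis unfolding ibr_hex_left[OF m m' X] using whisk_right[OF P _ tensA_in[OF im b']] by simp qed
 also have "Id B m ## (Id B m' ## f) = Id B (m ** m') ## f" using tensA_assoc'[OF im im' f] tensA_Id[OF m m'] by simp
 finally show ?thesis unfolding phe s'(1) sh_bracket(1)[OF m X m'P s'(2)] sh_bracket(1)[OF mm X P f] by (simp add: tensO_assoc m m' P Q)
qed

text \<open>The arrow obtained by adding m in front by \<iota>, in closed form;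
  \<open>i_arr_st\<close> identifies it with \<open>i_arr\<close>.\<close>

definition st :: "'o => 'o => ('o, 'm) bracket_arr" where
 "st m X = bracket B X m (Id B (m ** X)) (m ** X)"

lemma st_in: "m : Obj B ==> X : Obj B ==> st m X : Homs (UG' B) X (m ** X)" unfolding st_def by (rule bracket_in) (simp_all add: Id_in tensO_in_Obj)

text \<open>The two composites have complements X, m and m, X in opposite orders; the braiding of m
  with X connects them.\<close>

lemma st_natural: assumes m: "m : Obj B" and ph: "ph : Homs (UG' B) P Q" shows "sh m ph o[UG' B] st m P = st m Q o[UG' B] ph"
proof -
 obtain X f where X: "X : Obj B" and P: "P : Obj B" and Q: "Q : Obj B" and f: "f : Homs B (X ** P) Q" and phe: "ph = bracket B P X f Q"
 using ph unfolding UG'_Homs by blast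
 note s = sh_bracket[OF m X P f]
 note im = Id_in[OF m] and iP = Id_in[OF P]
 note b = braid_in_Homs[OF m X] and ib = ibr_in[OF m X]
 have mP: "m ** P : Obj B" and mQ: "m ** Q : Obj B" using tensO_in_Obj m P Q by blast+
 have mf: "Id B m ## f : Homs B ((m ** X) ** P) (m ** Q)" using tensA_in[OF im f] by (simp add: tensO_assoc m X P)
 have l: "sh m ph o[UG' B] st m P = bracket B P (X ** m) ((Id B m ## f) \<bullet> (ibr m X ## Id B P)) (m ** Q)"
 proof -
 have "(Id B m ## f) \<bullet> (ibr m X ## Id B P) \<bullet> (Id B X ## Id B (m ** P)) = (Id B m ## f) \<bullet> (ibr m X ## Id B P)"
 unfolding tensA_Id[OF X mP] by (rule Comp_Id_right[OF s(2)])
 thus ?thesis unfolding phe s(1) st_def using bracket_Comp[OF m X P Id_in[OF mP] s(2)] by simp qed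
 have r: "st m Q o[UG' B] ph = bracket B P (m ** X) (Id B m ## f) (m ** Q)"
 unfolding phe st_def using bracket_Comp[OF X m P f Id_in[OF mQ]] Comp_Id_left[OF mf] by simp
 have "((Id B m ## f) \<bullet> (ibr m X ## Id B P)) \<bullet> (braid B m X ## Id B P) = Id B m ## f"
 unfolding Comp_assoc[OF tensA_in[OF b iP] tensA_in[OF ib iP] mf] whisk_right[OF P b ib, symmetric] Inv_l[OF b]
 tensA_Id[OF tensO_in_Obj[OF m X] P] by (rule Comp_Id_right[OF mf])
 from bracket_eqI[OF tensO_in_Obj[OF m X] P b _ this]
 show ?thesis unfolding l r using s(2) by (simp add: tensO_assoc m X P)
qed

lemma lift_natural:
 assumes ps: "ps : Homs B m m'" and ph: "ph : Homs (UG' B) P Q" shows "lift_arr B (ps ## Id B Q) o[UG' B] sh m ph = sh m' ph o[UG' B] lift_arr B (ps ## Id B P)"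
proof -
 obtain X f where X: "X : Obj B" and P: "P : Obj B" and Q: "Q : Obj B" and f: "f : Homs B (X ** P) Q" and phe: "ph = bracket B P X f Q"
 using ph unfolding UG'_Homs by blast
 have m: "m : Obj B" "m' : Obj B" using ends[OF ps] by auto
 note s = sh_bracket[OF m(1) X P f] and s' = sh_bracket[OF m(2) X P f]
 note im = Id_in[OF m(1)] and im' = Id_in[OF m(2)] and iP = Id_in[OF P] and iQ = Id_in[OF Q] and iX = Id_in[OF X]
 note psQ = tensA_in[OF ps iQ] and psP = tensA_in[OF ps iP]
 note b = ibr_in[OF m(1) X] and b' = ibr_in[OF m(2) X]
 have XP: "X ** P : Obj B" and mP: "m ** P : Obj B" using tensO_in_Obj X P m by blast+
 have mf: "Id B m ## f : Homs B ((m ** X) ** P) (m ** Q)" using tensA_in[OF im f] by (simp add: tensO_assoc m X P)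
 have mf': "Id B m' ## f : Homs B ((m' ** X) ** P) (m' ** Q)" using tensA_in[OF im' f] by (simp add: tensO_assoc m X P)
 note bP = tensA_in[OF b iP] and b'P = tensA_in[OF b' iP]
 note psX = tensA_in[OF ps iX] and Xps = tensA_in[OF iX ps]
 note psXP = tensA_in[OF psX iP] and XpsP = tensA_in[OF Xps iP]
 have "(ps ## Id B Q) \<bullet> ((Id B m ## f) \<bullet> (ibr m X ## Id B P)) = ((ps ## Id B Q) \<bullet> (Id B m ## f)) \<bullet> (ibr m X ## Id B P)"
 by (rule Comp_assoc[OF bP mf psQ, symmetric])
 also have "(ps ## Id B Q) \<bullet> (Id B m ## f) = (Id B m' ## f) \<bullet> ((ps ## Id B X) ## Id B P)"
 using interchange[OF ps f] tensA_assoc'[OF ps iX iP] tensA_Id[OF X P] by simp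
 also have "... \<bullet> (ibr m X ## Id B P) = (Id B m' ## f) \<bullet> (((ps ## Id B X) ## Id B P) \<bullet> (ibr m X ## Id B P))"
 by (rule Comp_assoc[OF bP psXP mf'])
 also have "((ps ## Id B X) ## Id B P) \<bullet> (ibr m X ## Id B P) = (ibr m' X ## Id B P) \<bullet> ((Id B X ## ps) ## Id B P)"
 unfolding whisk_right[OF P b psX, symmetric] whisk_right[OF P Xps b', symmetric] ibr_natural[OF ps iX] ..
 also have "(Id B m' ## f) \<bullet> ((ibr m' X ## Id B P) \<bullet> ((Id B X ## ps) ## Id B P))
 = ((Id B m' ## f) \<bullet> (ibr m' X ## Id B P)) \<bullet> ((Id B X ## ps) ## Id B P)" by (rule Comp_assoc[OF XpsP b'P mf', symmetric])
 also have "(Id B X ## ps) ## Id B P = Id B X ## (ps ## Id B P)" by (rule tensA_assoc'[OF iX ps iP])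
 finally show ?thesis unfolding phe s(1) s'(1) lift_bracket_Comp[OF X mP s(2) psQ] bracket_lift_Comp[OF X psP s'(2)] by simp
qed

text \<open>An isomorphism of the added object is absorbed by the complement, so it disappears after
  stabilisation.\<close>

lemma lift_st: assumes ps: "ps : Homs B m m'" and X: "X : Obj B" shows "lift_arr B (ps ## Id B X) o[UG' B] st m X = st m' X"
proof -
 have m: "m : Obj B" "m' : Obj B" using ends[OF ps] by auto
 note psX = tensA_in[OF ps Id_in[OF X]]
 have mX: "m ** X : Obj B" "m' ** X : Obj B" using m X tensO_in_Obj by blast+
 have "lift_arr B (ps ## Id B X) o[UG' B] st m X = bracket B X m (ps ## Id B X) (m' ** X)"
 unfolding st_def lift_bracket_Comp[OF m(1) X Id_in[OF mX(1)] psX] Comp_Id_right[OF psX] ..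
 also have "... = st m' X" unfolding st_def by (rule bracket_eqI[OF m(1) X ps Id_in[OF mX(2)]]) (rule Comp_Id_left[OF psX])
 finally show ?thesis .
qed

text \<open>Adding a copy of m in second place instead of first differs by the inverse braiding of m
  with itself. This is where that braiding enters the proof.\<close>

lemma sh_st: assumes m: "m : Obj B" and X: "X : Obj B" shows "sh m (st m X) = lift_arr B (ibr m m ## Id B X) o[UG' B] st m (m ** X)"
proof -
 have mX: "m ** X : Obj B" "m ** (m ** X) : Obj B" using m X tensO_in_Obj by blast+
 have b: "ibr m m ## Id B X : Homs B (m ** (m ** X)) (m ** (m ** X))" using tensA_in[OF ibr_in[OF m m] Id_in[OF X]] by (simp add: tensO_assoc m X)
 show ?thesis unfolding st_def lift_bracket_Comp[OF m mX(1) Id_in[OF mX(2)] b] sh_bracket(1)[OF m m X Id_in[OF mX(1)]]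
 tensA_Id[OF m mX(1)] Comp_Id_left[OF b] Comp_Id_right[OF b] ..
qed

lemma st_tensO: assumes m: "m : Obj B" and m': "m' : Obj B" and X: "X : Obj B" shows "st (m ** m') X = st m (m' ** X) o[UG' B] st m' X"
proof -
 have o: "m' ** X : Obj B" "m ** (m' ** X) : Obj B" using m m' X tensO_in_Obj by blast+
 show ?thesis unfolding st_def bracket_Comp[OF m' m X Id_in[OF o(1)] Id_in[OF o(2)]] tensA_Id[OF m o(1)]
 Comp_Id_left[OF Id_in[OF o(2)]] by (simp add: tensO_assoc m m' X)
qed

lemma st_unit: "X : Obj B ==> st (unitO B) X = Id (UG' B) X" by (simp add: st_def UG'_simps tensO_unit_left)

lemma init_st: "X : Obj B ==> init_arr B X = st X (unitO B)" by (simp add: init_arr_def st_def tensO_unit_right)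

text \<open>Initiality of 0: the composite has complement X with P, and f itself is the isomorphism
  connecting it with the bracket of the identity of Q.\<close>

lemma init_natural: assumes ph: "ph : Homs (UG' B) P Q" shows "ph o[UG' B] init_arr B P = init_arr B Q"
proof -
 obtain X f where X: "X : Obj B" and P: "P : Obj B" and Q: "Q : Obj B" and f: "f : Homs B (X ** P) Q" and phe: "ph = bracket B P X f Q"
 using ph unfolding UG'_Homs by blast
 have iP: "Id B P : Homs B (P ** unitO B) P" using Id_in[OF P] by (simp add: tensO_unit_right P)
 have "ph o[UG' B] init_arr B P = bracket B (unitO B) (X ** P) f Q"
 unfolding phe init_arr_def bracket_Comp[OF P X unitO_in_Obj iP f] tensA_Id[OF X P] Comp_Id_right[OF f] ..
 also have "... = bracket B (unitO B) Q (Id B Q) Q"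
 proof (rule bracket_eqI[OF tensO_in_Obj[OF X P] unitO_in_Obj f])
 show "Id B Q : Homs B (Q ** unitO B) Q" using Id_in[OF Q] by (simp add: tensO_unit_right Q)
 show "Id B Q \<bullet> (f ## Id B (unitO B)) = f" using unit_right'[OF f] Comp_Id_left[OF f] by simp qed
 finally show ?thesis by (simp add: init_arr_def)
qed

end

section \<open>The standard objects and cofinality of the powers of 1\<close>

locale lm_setting = long_moody_setting + assumes UG'_cat: "category (UG' B)"
begin

sublocale UG': category "UG' B" by (rule UG'_cat)

lemma i_arr_st: assumes m: "m : Obj B" and X: "X : Obj B" shows "i_arr B m X = st m X"
proof -
 have b: "ibr (unitO B) (unitO B) = Id B (unitO B)" by (rule ibr_unit[OF unitO_in_Obj])
 have i: "Id B m : Homs B (m ** unitO B) m" using Id_in[OF m] by (simp add: tensO_unit_right m)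
 have "Id B m ## Id B (unitO B) ## Id B X = Id B (m ** X)" using unit_left'[OF Id_in[OF X]] tensA_Id[OF m X] by simp
 thus ?thesis unfolding i_arr_def init_arr_def UG'_simps st_def using bracket_tens[OF m unitO_in_Obj unitO_in_Obj X i unit_bracket[OF X Id_in[OF X]]]
 Comp_Id_left[OF Id_in[OF tensO_in_Obj[OF m X]]] by (simp add: b tensA_Id m X tensO_unit_right tensO_unit_left)
qed

lemma UG_cat: "category (UG B)" unfolding UG_def by (rule UG'.category_full)

sublocale U: category "UG B" by (rule UG_cat)

lemma power1_in: "power1 B n : Obj B" by (induction n) (simp_all add: unitO_in_Obj tensO_in_Obj obj1_in_Obj)

lemma uobj_in: "uobj B n : Obj B" unfolding uobj_def by (rule tensO_in_Obj[OF power1_in obj0_in_Obj])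

lemma UG_Obj: "X : Obj (UG B) <-> (EX n. X = uobj B n)" using uobj_in by (auto simp: UG_def UG'_simps)

lemma UG_Obj_B: "X : Obj (UG B) ==> X : Obj B" using uobj_in UG_Obj by auto

lemma UG_Homs: "X : Obj (UG B) ==> Y : Obj (UG B) ==> Homs (UG B) X Y = Homs (UG' B) X Y"
 unfolding UG_def by (rule Homs_full) (auto simp: UG_Obj[unfolded UG_def])

lemma UG_Homs': "ph : Homs (UG B) X Y ==> ph : Homs (UG' B) X Y" using UG_Homs U.ends by blast

lemma UG_simps: "Id (UG B) = Id (UG' B)" "Comp (UG B) = Comp (UG' B)" by (simp_all add: UG_def)

lemma uobj_Suc: "obj1 B ** uobj B n = uobj B (Suc n)" by (simp add: uobj_def tensO_assoc obj1_in_Obj obj0_in_Obj power1_in)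

lemma uobj_power: "power1 B k ** uobj B n = uobj B (k + n)"
 by (induction k) (simp_all add: tensO_unit_left uobj_in uobj_Suc[symmetric] tensO_assoc obj1_in_Obj power1_in)

lemma power1_nat: "power1 B k : Obj_nat B" by (auto simp: Obj_nat_def UG'_simps power1_in uobj_power UG_Obj)

lemma obj1_nat: "obj1 B : Obj_nat B" by (auto simp: Obj_nat_def UG'_simps obj1_in_Obj uobj_Suc UG_Obj)

lemma Obj_natD: "m : Obj_nat B ==> m : Obj B" "m : Obj_nat B ==> X : Obj (UG B) ==> m ** X : Obj (UG B)" by (auto simp: Obj_nat_def UG'_simps UG_Obj)

lemma Obj_nat_tens: assumes "m : Obj_nat B" "m' : Obj_nat B" shows "m ** m' : Obj_nat B"
proof -
 note o = Obj_natD(1)[OF assms(1)] Obj_natD(1)[OF assms(2)]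
 have "(m ** m') ** uobj B n : Obj (UG B)" for n
 proof -
 have "uobj B n : Obj (UG B)" using UG_Obj by blast
 from Obj_natD(2)[OF assms(1) Obj_natD(2)[OF assms(2) this]] show ?thesis by (simp only: tensO_assoc[OF o uobj_in]) qed
 thus ?thesis using tensO_in_Obj[OF o] unfolding Obj_nat_def UG'_simps by blast
qed

lemma sh_UG: "m : Obj_nat B ==> ph : Homs (UG B) X Y ==> sh m ph : Homs (UG B) (m ** X) (m ** Y)"
 using sh_in[OF Obj_natD(1) UG_Homs'] UG_Homs[OF Obj_natD(2) Obj_natD(2)] U.ends by metis

lemma st_UG: "m : Obj_nat B ==> X : Obj (UG B) ==> st m X : Homs (UG B) X (m ** X)" using st_in[OF Obj_natD(1) UG_Obj_B] UG_Homs[OF _ Obj_natD(2)] by metis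

lemma lift_UG: "f : Homs B X Y ==> X : Obj (UG B) ==> Y : Obj (UG B) ==> lift_arr B f : Homs (UG B) X Y" by (simp only: UG_Homs lift_in)

text \<open>By the convention on arrows, ph is a stabilisation by a power of 1 followed by an
  automorphism; undoing the automorphism leaves the stabilisation.\<close>

lemma UG_cofinal: assumes ph: "ph : Homs (UG B) X Y"
 obtains k ps where "ps : Homs (UG B) Y (power1 B k ** X)" "ps o[UG B] ph = st (power1 B k) X"
proof -
 obtain n n' where n: "X = uobj B n" "Y = uobj B n'" using U.ends[OF ph] UG_Obj by blast
 have le: "n <= n'" using UG_arrows[of ph n n'] ph n by blast
 define k where "k = n' - n"
 have Y: "Y = power1 B k ** X" using le by (simp add: n k_def uobj_power)
 have "EX g : Homs B Y Y. ph = bracket B X (power1 B k) g Y" using UG_arrows[of ph n n'] ph unfolding n k_def by blast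
 then obtain g where g: "g : Homs B Y Y" "ph = bracket B X (power1 B k) g Y" by blast
 have X: "X : Obj B" "Y : Obj (UG B)" using n uobj_in UG_Obj by auto
 have g': "g : Homs B (power1 B k ** X) Y" using g Y by simp
 have "lift_arr B (Inv B g) o[UG B] ph = st (power1 B k) X"
 unfolding UG_simps g(2) lift_bracket_Comp[OF power1_in X(1) g' Inv_in[OF g(1)]] Inv_l[OF g(1)] st_def Y[symmetric] ..
 moreover have "lift_arr B (Inv B g) : Homs (UG B) Y (power1 B k ** X)" using lift_UG[OF Inv_in[OF g(1)] X(2) X(2)] Y by simp
 ultimately show thesis using that by blast
qed

lemma Obj_nat_iso: assumes m: "m : Obj_nat B" shows "EX l. EX ps. ps : Homs B (power1 B l) m"
proof -
 have u0: "uobj B 0 : Obj (UG B)" using UG_Obj by blast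
 obtain l where l: "m ** uobj B 0 = uobj B l" using Obj_natD(2)[OF m u0] UG_Obj by blast
 have "st m (uobj B 0) : Homs (UG B) (uobj B 0) (uobj B l)" using st_UG[OF m u0] l by simp
 from UG_arrows[OF this] obtain g where "g : Homs B (uobj B l) (uobj B l)"
 "st m (uobj B 0) = bracket B (uobj B 0) (power1 B (l - 0)) g (uobj B l)" by blast
 hence "(m, Id B (m ** uobj B 0)) : fst (snd (bracket B (uobj B 0) (power1 B l) g (uobj B l)))"
 using bracket_self[OF Obj_natD(1)[OF m] uobj_in Id_in[OF tensO_in_Obj[OF Obj_natD(1)[OF m] uobj_in]], of 0] by (simp add: st_def l)
 from bracket_memD[OF this] show ?thesis by blast
qed

end

section \<open>Functor categories\<close>

lemma category_Fct: assumes "category C" and "category D" shows "category (Fct C D)"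
proof -
 interpret C: category C by fact
 interpret D: category D by fact
 have arr: "(F, \<eta>, G) : Homs (Fct C D) F' G' <-> F' = F & G' = G & F : Obj (Fct C D) & G : Obj (Fct C D) &
 \<eta> : extensional (Obj C) & (ALL X : Obj C. \<eta> X : Homs D (FO F X) (FO G X)) &
 (ALL X : Obj C. ALL Y : Obj C. ALL f : Homs C X Y. FA G f o[D] \<eta> X = \<eta> Y o[D] FA F f)" for F \<eta> G F' G' by (auto simp: Fct_def Homs_def)
 have ob: "cfunctor C D F" if "F : Obj (Fct C D)" for F using that by (simp add: Fct_def)
 have comp: "(G', th, H) o[Fct C D] (F, \<eta>, G) = (F, \<lambda>X \<in> Obj C. th X o[D] \<eta> X, H)" for G' th H F \<eta> G by (simp add: Fct_def)
 show ?thesis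
 proof (unfold_locales, goal_cases)
 case (1 f) thus ?case by (auto simp: Fct_def)
 next
 case (2 f) thus ?case by (auto simp: Fct_def)
 next
 case (3 F)
 interpret F: cfunctor C D F by (rule ob[OF 3])
 have "Id (Fct C D) F = (F, \<lambda>X \<in> Obj C. Id D (FO F X), F)" by (simp add: Fct_def)
 thus ?case using 3 F.FA_in_Homs by (auto simp: arr D.Id_in_Homs F.FO_in_Obj D.Comp_Id_left[OF F.FA_in_Homs] D.Comp_Id_right[OF F.FA_in_Homs])
 next
 case (4 f F G g H)
 obtain \<eta> where f: "f = (F, \<eta>, G)" using 4(1) by (cases f) (auto simp: arr)
 obtain th where g: "g = (G, th, H)" using 4(2) by (cases g) (auto simp: arr)
 note a = 4(1)[unfolded f arr] and b = 4(2)[unfolded g arr]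
 interpret F: cfunctor C D F using a ob by blast
 interpret G: cfunctor C D G using a ob by blast
 interpret H: cfunctor C D H using b ob by blast
 have "FA H k o[D] (th X o[D] \<eta> X) = (th Y o[D] \<eta> Y) o[D] FA F k"
 if X: "X : Obj C" and Y: "Y : Obj C" and k: "k : Homs C X Y" for X Y k
 proof -
 have e: "\<eta> X : Homs D (FO F X) (FO G X)" "\<eta> Y : Homs D (FO F Y) (FO G Y)"
 "th X : Homs D (FO G X) (FO H X)" "th Y : Homs D (FO G Y) (FO H Y)" using a b X Y by blast+
 have n: "FA G k o[D] \<eta> X = \<eta> Y o[D] FA F k" "FA H k o[D] th X = th Y o[D] FA G k" using a b X Y k by blast+
 show ?thesis unfolding D.Comp_assoc[OF e(1) e(3) H.FA_in_Homs[OF k], symmetric] n(2)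
 D.Comp_assoc[OF e(1) G.FA_in_Homs[OF k] e(4)] n(1) D.Comp_assoc[OF F.FA_in_Homs[OF k] e(2) e(4)] .. qed
 thus ?case unfolding f g comp arr using a b D.Comp_in by fastforce
 next
 case (5 f F G g H h K)
 obtain \<eta> where f: "f = (F, \<eta>, G)" using 5(1) by (cases f) (auto simp: arr)
 obtain th where g: "g = (G, th, H)" using 5(2) by (cases g) (auto simp: arr)
 obtain \<xi> where h: "h = (H, \<xi>, K)" using 5(3) by (cases h) (auto simp: arr)
 note a = 5(1)[unfolded f arr] and b = 5(2)[unfolded g arr] and c = 5(3)[unfolded h arr]
 have "(\<xi> X o[D] th X) o[D] \<eta> X = \<xi> X o[D] (th X o[D] \<eta> X)" if X: "X : Obj C" for X
 by (rule D.Comp_assoc[of _ "FO F X" "FO G X" _ "FO H X" _ "FO K X"]) (use a b c X in blast)+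
 thus ?case unfolding f g h comp by (auto intro!: ext)
 next
 case (6 f F G)
 obtain \<eta> where f: "f = (F, \<eta>, G)" using 6 by (cases f) (auto simp: arr)
 note a = 6[unfolded f arr]
 have i: "Id (Fct C D) F = (F, \<lambda>X \<in> Obj C. Id D (FO F X), F)" by (simp add: Fct_def)
 have "(\<lambda>X \<in> Obj C. \<eta> X o[D] (\<lambda>X \<in> Obj C. Id D (FO F X)) X) = \<eta>"
 by (rule extensionalityI[of _ "Obj C"]) (use a D.Comp_Id_right in auto) thus ?case unfolding f i comp by simp
 next
 case (7 f F G)
 obtain \<eta> where f: "f = (F, \<eta>, G)" using 7 by (cases f) (auto simp: arr)
 note a = 7[unfolded f arr]
 have i: "Id (Fct C D) G = (G, \<lambda>X \<in> Obj C. Id D (FO G X), G)" by (simp add: Fct_def)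
 have "(\<lambda>X \<in> Obj C. (\<lambda>X \<in> Obj C. Id D (FO G X)) X o[D] \<eta> X) = \<eta>"
 by (rule extensionalityI[of _ "Obj C"]) (use a D.Comp_Id_left in auto) thus ?case unfolding f i comp by simp qed
qed

lemma RMod_simps:
 "M : Obj (RMod R) <-> module R M"
 "(M, f, N) : Homs (RMod R) M' N' <-> M' = M & N' = N & module R M & module R N & f : linear_maps R M N"
 "(M', g, N) o[RMod R] (M, f, N') = (M, compose (cr M) g f, N)"
 "Id (RMod R) M = (M, \<lambda>x \<in> cr M. x, M)" by (auto simp: RMod_def Homs_def)

lemma linear_maps_compose: fixes R :: "'r ring"
 assumes "module R M" "f : linear_maps R M N" "g : linear_maps R N P" shows "compose (cr M) g f : linear_maps R M P"
 unfolding compose_def using assms lin_comp[of R M N f P g] by (intro restrict_linear_maps) (simp_all add: lmaps_iff)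

lemma category_RMod: "category (RMod (R :: 'r ring))"
proof (unfold_locales, goal_cases)
 case (1 f) thus ?case by (auto simp: RMod_def)
next
 case (2 f) thus ?case by (auto simp: RMod_def)
next
 case (3 X) thus ?case by (auto simp: RMod_simps restrict_linear_maps lin_id)
next
 case (4 f X Y g Z) thus ?case by (cases f; cases g) (auto simp: RMod_simps linear_maps_compose)
next
 case (5 f W X g Y h Z) thus ?case by (cases f; cases g; cases h) (auto simp: RMod_simps compose_def lmaps_iff lin_def fun_eq_iff)
next
 case (6 f X Y) thus ?case by (cases f) (auto simp: RMod_simps compose_def lmaps_iff intro!: extensionalityI[of _ "cr X"])
next
 case (7 f X Y) thus ?case by (cases f) (auto simp: RMod_simps compose_def lmaps_iff lin_def intro!: extensionalityI[of _ "cr X"])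
qed

section \<open>Representations\<close>

definition act :: "('a, 'f, ('r, 'u) module, ('r, 'u) rmod_arr) ftor => 'f => 'u => 'u" where
 "act F ph = arrow_map (FA F ph)"

definition nt :: "'x \<times> ('a => ('r, 'u) rmod_arr) \<times> 'y => 'a => 'u => 'u" where
 "nt al X = arrow_map (fst (snd al) X)"

abbreviation car :: "('a, 'f, ('r, 'u) module, 'h) ftor => 'a => 'u set" where
 "car F X == cr (FO F X)"

locale rep_setting = lm_setting B + R: cring R
 for B :: "('o, 'm) pointed_braided" (structure) and R :: "'r ring" + fixes U :: "'u itself" assumes inf: "infinite (UNIV :: 'u set)"
begin

abbreviation Rep :: "(('o, 'm, 'r, 'u) rep, ('o, 'm, 'r, 'u) rep_arr) cat" where
 "Rep == Reps R B"

abbreviation "UB == UG B"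
abbreviation "Ob == Obj UB"
abbreviation "Hom == Homs UB"
abbreviation "ObR == Obj Rep"
abbreviation "RHom == Homs Rep"

lemma category_Rep: "category Rep" by (rule category_Fct[OF UG_cat category_RMod])

sublocale Rep: category Rep by (rule category_Rep)

lemma rep_iff:
 "F : ObR <-> cfunctor UB (RMod R) F & FO F : extensional (Ob) & FA F : extensional (Arr UB)" by (simp add: Fct_def)

lemma rep_mod: assumes "F : ObR" "X : Ob" shows "module R (FO F X)"
proof -
 interpret F: cfunctor UB "RMod R" F using assms by (simp add: rep_iff)
 show ?thesis using F.FO_in_Obj[OF assms(2)] by (simp add: RMod_simps)
qed

lemma rep_FA: assumes "F : ObR" "ph : Hom X Y" shows "FA F ph = (FO F X, act F ph, FO F Y) & act F ph : linear_maps R (FO F X) (FO F Y)"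
proof -
 interpret F: cfunctor UB "RMod R" F using assms by (simp add: rep_iff)
 show ?thesis using F.FA_in_Homs[OF assms(2)] by (cases "FA F ph") (auto simp: RMod_simps act_def)
qed

lemma act_lin: "F : ObR ==> ph : Hom X Y ==> lin R (FO F X) (FO F Y) (act F ph)" using rep_FA by (simp add: lmaps_iff)

lemma act_cl: "F : ObR ==> ph : Hom X Y ==> x : car F X ==> act F ph x : car F Y" by (rule lin_cl[OF act_lin])

lemma act_Id: assumes "F : ObR" "X : Ob" "x : car F X" shows "act F (Id UB X) x = x"
proof -
 interpret F: cfunctor UB "RMod R" F using assms by (simp add: rep_iff)
 show ?thesis using F.FA_Id[OF assms(2)] assms(3) by (simp add: RMod_simps act_def)
qed

lemma act_Comp: assumes "F : ObR" "ph : Hom X Y" "ps : Hom Y Z" "x : car F X" shows "act F (ps o[UB] ph) x = act F ps (act F ph x)"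
proof -
 interpret F: cfunctor UB "RMod R" F using assms by (simp add: rep_iff)
 have "FA F (ps o[UB] ph) = (FO F X, compose (car F X) (act F ps) (act F ph), FO F Z)"
 using F.FA_Comp[OF assms(2,3)] rep_FA[OF assms(1,2)] rep_FA[OF assms(1,3)] by (simp add: RMod_simps)
 thus ?thesis using assms(4) by (simp add: act_def compose_def)
qed

lemma act_zero: "F : ObR ==> ph : Hom X Y ==> act F ph 0[FO F X] = 0[FO F Y]"
 using rmod.lin_zero[OF rmodI rep_mod act_lin] rep_mod U.ends by metis

definition mk_rep :: "('o => ('r, 'u) module) => (('o, 'm) bracket_arr => 'u => 'u) => ('o, 'm, 'r, 'u) rep" where
 "mk_rep Mo a = \<lparr>FO = (\<lambda>X \<in> Ob. Mo X), FA = (\<lambda>ph \<in> Arr UB. (Mo (Dom UB ph), a ph, Mo (Cod UB ph)))\<rparr>"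

lemma mk_rep_simps:
 "X : Ob ==> FO (mk_rep Mo a) X = Mo X"
 "ph : Hom X Y ==> act (mk_rep Mo a) ph = a ph" by (auto simp: mk_rep_def act_def Homs_def)

lemma mk_rep_in: assumes m: "!!X. X : Ob ==> module R (Mo X)" and l: "!!X Y ph. ph : Hom X Y ==> a ph : linear_maps R (Mo X) (Mo Y)"
 and i: "!!X x. X : Ob ==> x : cr (Mo X) ==> a (Id UB X) x = x" and c: "!!X Y Z ph ps x. [|ph : Hom X Y; ps : Hom Y Z; x : cr (Mo X)|]
 ==> a (ps o[UB] ph) x = a ps (a ph x)" shows "mk_rep Mo a : ObR"
proof -
 have FA: "FA (mk_rep Mo a) ph = (Mo X, a ph, Mo Y)" if "ph : Hom X Y" for X Y ph using that by (auto simp: mk_rep_def Homs_def)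
 have FO: "FO (mk_rep Mo a) X = Mo X" if "X : Ob" for X using that by (simp add: mk_rep_def)
 interpret RM: category "RMod R" by (rule category_RMod)
 have "cfunctor UB (RMod R) (mk_rep Mo a)"
 proof (unfold_locales, goal_cases)
 case (1 X) thus ?case by (simp add: FO RMod_simps m)
 next
 case (2 f X Y) thus ?case using U.ends[OF 2] by (simp add: FA FO RMod_simps m l)
 next
 case (3 X)
 have "a (Id UB X) = (\<lambda>x \<in> cr (Mo X). x)"
 by (rule extensionalityI[of _ "cr (Mo X)"]) (use l[OF U.Id_in_Homs[OF 3]] i[OF 3] in \<open>auto simp: lmaps_iff\<close>)
 thus ?case by (simp add: FA[OF U.Id_in_Homs[OF 3]] FO[OF 3] RMod_simps)
 next
 case (4 f X Y g Z)
 have gf: "g o[UB] f : Hom X Z" using U.Comp_in[OF 4] .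
 have "a (g o[UB] f) = compose (cr (Mo X)) (a g) (a f)"
 by (rule extensionalityI[of _ "cr (Mo X)"]) (use l[OF gf] c[OF 4] in \<open>auto simp: lmaps_iff compose_def\<close>)
 thus ?case by (simp add: FA[OF gf] FA[OF 4(1)] FA[OF 4(2)] RMod_simps) qed thus ?thesis by (simp add: rep_iff mk_rep_def)
qed

lemma rep_eqI: assumes "F : ObR" "G : ObR" "!!X. X : Ob ==> FO F X = FO G X"
 "!!X Y ph. ph : Hom X Y ==> act F ph = act G ph" shows "F = G"
proof -
 have "FO F = FO G" by (rule extensionalityI[of _ "Ob"]) (use assms in \<open>auto simp: rep_iff\<close>) moreover have "FA F = FA G"
 proof (rule extensionalityI[of _ "Arr UB"])
 show "FA F ph = FA G ph" if "ph : Arr UB" for ph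
 using rep_FA[OF assms(1) Arr_Homs[OF that]] rep_FA[OF assms(2) Arr_Homs[OF that]] assms(4)[OF Arr_Homs[OF that]]
 assms(3) U.ends[OF Arr_Homs[OF that]] by simp qed (use assms in \<open>auto simp: rep_iff\<close>)
 ultimately show ?thesis by (cases F; cases G) simp
qed

definition mk_nt :: "('o, 'm, 'r, 'u) rep => ('o => 'u => 'u) => ('o, 'm, 'r, 'u) rep => ('o, 'm, 'r, 'u) rep_arr" where
 "mk_nt F h G = (F, \<lambda>X \<in> Ob. (FO F X, restrict (h X) (car F X), FO G X), G)"

lemma nt_mk_nt [simp]: "X : Ob ==> x : car F X ==> nt (mk_nt F h G) X x = h X x" by (simp add: nt_def mk_nt_def)

lemma Rep_Homs:
 "(F, \<eta>, G) : RHom F' G' <-> F' = F & G' = G & F : ObR & G : ObR &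
 \<eta> : extensional (Ob) & (ALL X : Ob. \<eta> X : Homs (RMod R) (FO F X) (FO G X)) &
 (ALL X : Ob. ALL Y : Ob. ALL f : Hom X Y. FA G f o[RMod R] \<eta> X = \<eta> Y o[RMod R] FA F f)" by (auto simp: Fct_def Homs_def)

lemma mk_nt_in: assumes F: "F : ObR" and G: "G : ObR" and l: "!!X. X : Ob ==> lin R (FO F X) (FO G X) (h X)"
 and n: "!!X Y ph x. [|ph : Hom X Y; x : car F X|] ==> h Y (act F ph x) = act G ph (h X x)" shows "mk_nt F h G : RHom F G" unfolding mk_nt_def Rep_Homs
proof (intro conjI ballI refl F G)
 fix X Y f assume f: "X : Ob" "Y : Ob" "f : Hom X Y"
 show "FA G f o[RMod R] (\<lambda>X \<in> Ob. (FO F X, restrict (h X) (car F X), FO G X)) X =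
 (\<lambda>X \<in> Ob. (FO F X, restrict (h X) (car F X), FO G X)) Y o[RMod R] FA F f"
 using f rep_FA[OF F f(3)] rep_FA[OF G f(3)] n[OF f(3)] act_cl[OF F f(3)] by (auto simp: RMod_simps compose_def)
qed (use l rep_mod[OF F] rep_mod[OF G] in \<open>auto simp: RMod_simps restrict_linear_maps\<close>)

lemma nt_lin: assumes "al : RHom F G" "X : Ob" shows "lin R (FO F X) (FO G X) (nt al X)" "nt al X : extensional (car F X)"
proof -
 obtain \<eta> where a: "al = (F, \<eta>, G)" using assms(1) by (cases al) (auto simp: Rep_Homs)
 have "\<eta> X : Homs (RMod R) (FO F X) (FO G X)" using assms unfolding a Rep_Homs by blast
 hence "nt al X : linear_maps R (FO F X) (FO G X)" by (cases "\<eta> X") (auto simp: a nt_def RMod_simps)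
 thus "lin R (FO F X) (FO G X) (nt al X)" "nt al X : extensional (car F X)" by (simp_all add: lmaps_iff)
qed

lemma nt_cl: "al : RHom F G ==> X : Ob ==> x : car F X ==> nt al X x : car G X" by (rule lin_cl[OF nt_lin(1)])

lemma Rep_arr_form: assumes "al : RHom F G" shows "al = mk_nt F (nt al) G"
proof -
 obtain \<eta> where a: "al = (F, \<eta>, G)" using assms by (cases al) (auto simp: Rep_Homs)
 have h: "\<eta> X : Homs (RMod R) (FO F X) (FO G X)" if "X : Ob" for X using that assms unfolding a Rep_Homs by blast
 have "\<eta> = (\<lambda>X \<in> Ob. (FO F X, restrict (nt al X) (car F X), FO G X))"
 proof (rule extensionalityI[of _ "Ob"])
 show "\<eta> : extensional (Ob)" using assms unfolding a Rep_Homs by blast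
 fix X assume X: "X : Ob"
 have "restrict (nt al X) (car F X) = nt al X" by (rule extensional_restrict[OF nt_lin(2)[OF assms X]])
 thus "\<eta> X = (\<lambda>X \<in> Ob. (FO F X, restrict (nt al X) (car F X), FO G X)) X"
 using h[OF X] X by (cases "\<eta> X") (simp add: RMod_simps nt_def a) qed simp thus ?thesis by (simp add: mk_nt_def a)
qed

lemma nt_nat: assumes "al : RHom F G" "ph : Hom X Y" "x : car F X" shows "nt al Y (act F ph x) = act G ph (nt al X x)"
proof -
 have F: "F : ObR" and G: "G : ObR" using Rep.ends[OF assms(1)] by auto
 have O: "X : Ob" "Y : Ob" using U.ends[OF assms(2)] by auto
 obtain \<eta> where a: "al = (F, \<eta>, G)" using assms(1) by (cases al) (auto simp: Rep_Homs)
 have h: "\<eta> X = (FO F X, nt al X, FO G X)" if "X : Ob" for X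
 proof -
 have "\<eta> X : Homs (RMod R) (FO F X) (FO G X)" using that assms(1) unfolding a Rep_Homs by blast
 thus ?thesis by (cases "\<eta> X") (simp add: RMod_simps nt_def a) qed
 have "FA G ph o[RMod R] \<eta> X = \<eta> Y o[RMod R] FA F ph" using assms(1,2) O unfolding a Rep_Homs by blast
 hence "FA G ph o[RMod R] (FO F X, nt al X, FO G X) = (FO F Y, nt al Y, FO G Y) o[RMod R] FA F ph" unfolding h[OF O(1)] h[OF O(2)] .
 hence "compose (car F X) (act G ph) (nt al X) = compose (car F X) (nt al Y) (act F ph)"
 using rep_FA[OF F assms(2)] rep_FA[OF G assms(2)] by (simp add: RMod_simps)
 from fun_cong[OF this, of x] show ?thesis using assms(3) by (simp add: compose_def)
qed

lemma nt_zero: "al : RHom F G ==> X : Ob ==> nt al X 0[FO F X] = 0[FO G X]"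
 using rmod.lin_zero[OF rmodI rep_mod nt_lin(1)] rep_mod Rep.ends by metis

lemma nt_ext: assumes "al : RHom F G" "be : RHom F G" "!!X x. X : Ob ==> x : car F X ==> nt al X x = nt be X x" shows "al = be"
proof -
 have "mk_nt F (nt al) G = mk_nt F (nt be) G" unfolding mk_nt_def using assms(3) by (auto simp: fun_eq_iff restrict_def)
 thus ?thesis using Rep_arr_form assms(1,2) by metis
qed

lemma nt_Comp: assumes "al : RHom F G" "be : RHom G H" "X : Ob" "x : car F X" shows "nt (be o[Rep] al) X x = nt be X (nt al X x)"
proof -
 have "be o[Rep] al = mk_nt G (nt be) H o[Rep] mk_nt F (nt al) G" using Rep_arr_form assms by metis
 thus ?thesis using assms nt_cl[OF assms(1)] by (simp add: mk_nt_def Fct_def RMod_simps nt_def compose_def)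
qed

lemma nt_Id: "F : ObR ==> X : Ob ==> x : car F X ==> nt (Id Rep F) X x = x" by (simp add: Fct_def RMod_simps nt_def)

subsection \<open>Subrepresentations, quotients and pullbacks\<close>

definition subrep :: "('o, 'm, 'r, 'u) rep => ('o => 'u set) => bool" where
 "subrep F N <-> (ALL X : Ob. submodule (N X) R (FO F X)) &
 (ALL X Y. ALL ph : Hom X Y. ALL x : N X. act F ph x : N Y)"

definition sub_rep :: "('o, 'm, 'r, 'u) rep => ('o => 'u set) => ('o, 'm, 'r, 'u) rep" where
 "sub_rep F N = mk_rep (%X. FO F X\<lparr>carrier := N X\<rparr>) (%ph. restrict (act F ph) (N (Dom UB ph)))"

lemma subrep_subset: "F : ObR ==> subrep F N ==> X : Ob ==> N X <= car F X" using module.submoduleE(1)[OF rep_mod] by (simp add: subrep_def)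

lemma sub_rep: assumes F: "F : ObR" and N: "subrep F N" shows "sub_rep F N : ObR" "mk_nt (sub_rep F N) (%X x. x) F : RHom (sub_rep F N) F"
 "!!X. X : Ob ==> car (sub_rep F N) X = N X"
 "!!X Y ph x. ph : Hom X Y ==> x : N X ==> act (sub_rep F N) ph x = act F ph x"
 "!!X. X : Ob ==> 0[FO (sub_rep F N) X] = 0[FO F X]"
 "!!X M f. X : Ob ==> lin R M (FO (sub_rep F N) X) f <-> lin R M (FO F X) f & (ALL x : cr M. f x : N X)"
proof -
 have sm: "submodule (N X) R (FO F X)" if "X : Ob" for X using N that by (simp add: subrep_def)
 have st: "act F ph x : N Y" if "ph : Hom X Y" "x : N X" for X Y ph x using N that unfolding subrep_def by blast
 have sub: "N X <= car F X" if "X : Ob" for X using subrep_subset[OF F N that] .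
 have m: "module R (FO F X\<lparr>carrier := N X\<rparr>)" if "X : Ob" for X by (rule submodule.submodule_is_module[OF sm[OF that] rep_mod[OF F that]])
 have l: "lin R (FO F X\<lparr>carrier := N X\<rparr>) (FO F Y\<lparr>carrier := N Y\<rparr>) (act F ph)" if "ph : Hom X Y" for X Y ph
 using act_lin[OF F that] st[OF that] sub U.ends[OF that] by (auto simp: lin_def subset_iff)
 show in_Rep: "sub_rep F N : ObR" unfolding sub_rep_def
 proof (rule mk_rep_in[OF m], goal_cases)
 case (2 X Y ph) thus ?case using restrict_linear_maps[OF m l] U.ends[OF 2] HomsD[OF 2] by fastforce
 next
 case (3 X x) thus ?case using HomsD[OF U.Id_in_Homs[OF 3(1)]] act_Id[OF F 3(1)] sub[OF 3(1)] by auto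
 next
 case (4 X Y Z ph ps x) thus ?case using HomsD[OF U.Comp_in[OF 4(1,2)]] HomsD[OF 4(1)] HomsD[OF 4(2)] st[OF 4(1)]
 act_Comp[OF F 4(1,2)] sub U.ends[OF 4(1)] by auto qed simp
 have FO: "FO (sub_rep F N) X = FO F X\<lparr>carrier := N X\<rparr>" if "X : Ob" for X using that by (simp add: sub_rep_def mk_rep_simps)
 show c: "car (sub_rep F N) X = N X" "0[FO (sub_rep F N) X] = 0[FO F X]" if "X : Ob" for X using that by (simp_all add: FO)
 show a: "act (sub_rep F N) ph x = act F ph x" if "ph : Hom X Y" "x : N X" for X Y ph x
 using that HomsD[OF that(1)] by (simp add: sub_rep_def mk_rep_simps(2)[OF that(1)])
 show "lin R M (FO (sub_rep F N) X) f <-> lin R M (FO F X) f & (ALL x : cr M. f x : N X)" if "X : Ob" for X M f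
 using that sub[OF that] by (auto simp: FO lin_def)
 show "mk_nt (sub_rep F N) (%X x. x) F : RHom (sub_rep F N) F"
 proof (rule mk_nt_in[OF in_Rep F], goal_cases)
 case (1 X) thus ?case using sub[OF 1] by (auto simp: FO lin_def)
 next
 case (2 X Y ph x) thus ?case using c U.ends[OF 2(1)] a by simp qed
qed

text \<open>The definite description mirrors that of \<open>delta\<close>, so that
  \<open>delta_eq\<close> is a mere unfolding.\<close>

definition quot_rep :: "('o, 'm, 'r, 'u) rep => ('o => 'u set) => ('o, 'm, 'r, 'u) rep" where
 "quot_rep F N = mk_rep (%X. qmod (FO F X) (N X)) (%ph. THE f.
 f : linear_maps R (qmod (FO F (Dom UB ph)) (N (Dom UB ph))) (qmod (FO F (Cod UB ph)) (N (Cod UB ph))) &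
 (ALL x : car F (Dom UB ph). f (qproj (FO F (Dom UB ph)) (N (Dom UB ph)) x) =
 qproj (FO F (Cod UB ph)) (N (Cod UB ph)) (act F ph x)))"

abbreviation qpr :: "('o, 'm, 'r, 'u) rep => ('o => 'u set) => 'o => 'u => 'u" where
 "qpr F N X == qproj (FO F X) (N X)"

lemma quot_rep: assumes F: "F : ObR" and N: "subrep F N" shows "quot_rep F N : ObR"
 "!!X. X : Ob ==> lin R (FO F X) (FO (quot_rep F N) X) (qpr F N X)"
 "!!X. X : Ob ==> qpr F N X ` car F X = car (quot_rep F N) X"
 "!!X x. X : Ob ==> x : car F X ==> qpr F N X x = 0[FO (quot_rep F N) X] <-> x : N X"
 "!!X Y ph x. ph : Hom X Y ==> x : car F X ==> act (quot_rep F N) ph (qpr F N X x) = qpr F N Y (act F ph x)"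
proof -
 have sm: "submodule (N X) R (FO F X)" if "X : Ob" for X using N that by (simp add: subrep_def)
 have st: "act F ph x : N Y" if "ph : Hom X Y" "x : N X" for X Y ph x using N that unfolding subrep_def by blast
 note q = rmod.qmod[OF rmodI, OF rep_mod[OF F] sm]
 let ?Q = "%X. qmod (FO F X) (N X) :: ('r, 'u) module"
 define a where "a ph = (THE f.
 f : linear_maps R (?Q (Dom UB ph)) (?Q (Cod UB ph)) &
 (ALL x : car F (Dom UB ph). f (qpr F N (Dom UB ph) x) = qpr F N (Cod UB ph) (act F ph x)))" for ph
 have a: "a ph : linear_maps R (?Q X) (?Q Y) & (ALL x : car F X. a ph (qpr F N X x) = qpr F N Y (act F ph x))"
 if ph: "ph : Hom X Y" for X Y ph
 proof -
 have X: "X : Ob" "Y : Ob" using U.ends[OF ph] by auto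
 have "EX! f. f : linear_maps R (?Q X) (?Q Y) & (ALL x : car F X. f (qpr F N X x) = qpr F N Y (act F ph x))"
 proof (rule rmod.lin_factor[OF rmodI[OF rep_mod[OF F X(1)]] q(1)[OF X(1) X(1)] q(1)[OF X(2) X(2)] q(2)[OF X(1) X(1)]
 q(3)[OF X(1) X(1)] lin_comp[OF act_lin[OF F ph] q(2)[OF X(2) X(2)]]])
 fix x assume x: "x : car F X" "qpr F N X x = 0[?Q X]" hence "x : N X" using q(4)[OF X(1) X(1)] by blast
 thus "qpr F N Y (act F ph x) = 0[?Q Y]" using st[OF ph] q(4)[OF X(2) X(2) act_cl[OF F ph x(1)]] by blast qed
 from theI'[OF this] show ?thesis unfolding a_def using HomsD[OF ph] by simp qed
 have Q: "quot_rep F N = mk_rep ?Q a" by (simp add: quot_rep_def a_def[abs_def])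
 have ob: "EX y : car F X. x = qpr F N X y" if "X : Ob" "x : cr (?Q X)" for X x using that(2) unfolding q(3)[OF that(1) that(1), symmetric] by blast
 show "quot_rep F N : ObR" unfolding Q
 proof (rule mk_rep_in)
 show "module R (?Q X)" if "X : Ob" for X using q(1)[OF that that] .
 show "a ph : linear_maps R (?Q X) (?Q Y)" if "ph : Hom X Y" for X Y ph using a[OF that] by blast
 show "a (Id UB X) x = x" if X: "X : Ob" and x: "x : cr (?Q X)" for X x using ob[OF X x] a[OF U.Id_in_Homs[OF X]] act_Id[OF F X] by auto
 show "a (ps o[UB] ph) x = a ps (a ph x)"
 if ph: "ph : Hom X Y" and ps: "ps : Hom Y Z" and x: "x : cr (?Q X)" for X Y Z ph ps x
 proof -
 obtain y where y: "y : car F X" "x = qpr F N X y" using ob[OF _ x] U.ends[OF ph] by blast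
 show ?thesis using y a[OF U.Comp_in[OF ph ps]] a[OF ph] a[OF ps] act_Comp[OF F ph ps y(1)] act_cl[OF F ph y(1)] by simp qed qed
 show "act (quot_rep F N) ph (qpr F N X x) = qpr F N Y (act F ph x)" if "ph : Hom X Y" "x : car F X" for X Y ph x
 using a[OF that(1)] that(2) by (simp add: Q mk_rep_simps(2)[OF that(1)])
 fix X assume X: "X : Ob"
 have FO: "FO (quot_rep F N) X = ?Q X" using X by (simp add: Q mk_rep_simps)
 show "lin R (FO F X) (FO (quot_rep F N) X) (qpr F N X)" "qpr F N X ` car F X = car (quot_rep F N) X" unfolding FO by (rule q(2)[OF X X], rule q(3)[OF X X])
 show "qpr F N X x = 0[FO (quot_rep F N) X] <-> x : N X" if "x : car F X" for x unfolding FO using q(4)[OF X X that] .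
qed

end

context rep_setting
begin

lemma quot_proj_nt: assumes F: "F : ObR" and N: "subrep F N" shows "mk_nt F (qpr F N) (quot_rep F N) : RHom F (quot_rep F N)"
 by (rule mk_nt_in[OF F quot_rep(1)[OF F N] quot_rep(2)[OF F N]]) (simp_all add: quot_rep(5)[OF F N])

lemma quot_arrow: assumes F: "F : ObR" and N: "subrep F N" and G: "G : ObR" and l: "!!X. X : Ob ==> lin R (FO F X) (FO G X) (h X)"
 and k: "!!X x. X : Ob ==> x : N X ==> h X x = 0[FO G X]"
 and n: "!!X Y ph x. [|ph : Hom X Y; x : car F X|] ==> h Y (act F ph x) = act G ph (h X x)"
 obtains al where "al : RHom (quot_rep F N) G"
 "!!X x. X : Ob ==> x : car F X ==> nt al X (qpr F N X x) = h X x"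
proof -
 let ?Q = "quot_rep F N"
 note q = quot_rep[OF F N]
 have "EX g. g : linear_maps R (FO ?Q X) (FO G X) & (ALL x : car F X. g (qpr F N X x) = h X x)" if X: "X : Ob" for X
 by (rule ex1_implies_ex, rule rmod.lin_factor[OF rmodI[OF rep_mod[OF F X]] rep_mod[OF q(1) X] rep_mod[OF G X] q(2,3)[OF X] l[OF X]])
 (use q(4)[OF X] k[OF X] in blast)
 then obtain g where g: "!!X. X : Ob ==> g X : linear_maps R (FO ?Q X) (FO G X)"
 "!!X x. X : Ob ==> x : car F X ==> g X (qpr F N X x) = h X x" by metis
 have gl: "lin R (FO ?Q X) (FO G X) (g X)" if "X : Ob" for X using g(1)[OF that] by (simp add: lmaps_iff)
 have in_Rep: "mk_nt ?Q g G : RHom ?Q G"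
 proof (rule mk_nt_in[OF q(1) G gl])
 fix X Y ph z assume ph: "ph : Hom X Y" and z: "z : car ?Q X"
 have X: "X : Ob" "Y : Ob" using U.ends[OF ph] by auto
 obtain x where "x : car F X" "z = qpr F N X x" using z unfolding q(3)[OF X(1), symmetric] by blast
 thus "g Y (act ?Q ph z) = act G ph (g X z)" using q(5)[OF ph] g(2) X act_cl[OF F ph] n[OF ph] by simp qed
 show thesis
 proof (rule that[OF in_Rep])
 fix X x assume X: "X : Ob" and x: "x : car F X"
 have "qpr F N X x : car ?Q X" using lin_cl[OF q(2)[OF X] x] . thus "nt (mk_nt ?Q g G) X (qpr F N X x) = h X x" using g(2)[OF X x] X by simp
 qed
qed

text \<open>The fibre product inside F x G', characterised by its elements: matching pairs lift, and
  the two projections are jointly injective.\<close>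

lemma pullback: assumes f: "f : RHom F G" and s: "s : RHom G' G"
 obtains P p q where "p : RHom P F" "q : RHom P G'"
 "!!X z. X : Ob ==> z : car P X ==> nt f X (nt p X z) = nt s X (nt q X z)"
 "!!X x y. [|X : Ob; x : car F X; y : car G' X; nt f X x = nt s X y|] ==> EX z : car P X. nt p X z = x & nt q X z = y"
 "!!X z z'. [|X : Ob; z : car P X; z' : car P X; nt p X z = nt p X z'; nt q X z = nt q X z'|] ==> z = z'"
proof -
 have F: "F : ObR" and G: "G : ObR" and G': "G' : ObR" using Rep.ends f s by blast+
 define N where "N X = {(x, y). x : car F X & y : car G' X & nt f X x = nt s X y}" for X
 define M where "M X = prod_module (FO F X) (FO G' X)\<lparr>carrier := N X\<rparr>" for X
 have mods: "rmod R (FO F X)" "rmod R (FO G X)" "rmod R (FO G' X)" if "X : Ob" for X using rmodI rep_mod F G G' that by blast+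
 have M: "module R (M X)" if X: "X : Ob" for X
 proof -
 interpret FX: rmod R "FO F X" by (rule mods[OF X])
 interpret GX: rmod R "FO G X" by (rule mods[OF X])
 interpret GX': rmod R "FO G' X" by (rule mods[OF X])
 have pm: "module R (prod_module (FO F X) (FO G' X))" by (rule FX.module_prod_module[OF GX'.module_axioms])
 interpret P: rmod R "prod_module (FO F X) (FO G' X)" by (rule rmodI[OF pm])
 note fl = nt_lin(1)[OF f X] and sl = nt_lin(1)[OF s X]
 have "N X = {z : cr (prod_module (FO F X) (FO G' X)). nt f X (fst z) -[FO G X] nt s X (snd z) = 0[FO G X]}"
 using lin_cl[OF fl] lin_cl[OF sl] by (auto simp: N_def prod_module_def GX.diff_zero_iff)
 moreover have "lin R (prod_module (FO F X) (FO G' X)) (FO G X) (%z. nt f X (fst z) -[FO G X] nt s X (snd z))"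
 proof (rule linI)
 fix z assume z: "z : cr (prod_module (FO F X) (FO G' X))" hence zc: "fst z : car F X" "snd z : car G' X" by (auto simp: prod_module_def)
 note c = lin_cl[OF fl zc(1)] lin_cl[OF sl zc(2)]
 show "nt f X (fst z) -[FO G X] nt s X (snd z) : cr (FO G X)" using c by simp
 show "nt f X (fst (r .[prod_module (FO F X) (FO G' X)] z)) -[FO G X] nt s X (snd (r .[prod_module (FO F X) (FO G' X)] z)) =
 r .[FO G X] (nt f X (fst z) -[FO G X] nt s X (snd z))" if "r : cr R" for r
 using that zc c by (simp add: prod_module_def case_prod_beta lin_smult[OF fl] lin_smult[OF sl] a_minus_def GX.smult_r_distr GX.smult_r_minus)
 fix w assume w: "w : cr (prod_module (FO F X) (FO G' X))" hence wc: "fst w : car F X" "snd w : car G' X" by (auto simp: prod_module_def)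
 note c' = lin_cl[OF fl wc(1)] lin_cl[OF sl wc(2)]
 show "nt f X (fst (z +[prod_module (FO F X) (FO G' X)] w)) -[FO G X] nt s X (snd (z +[prod_module (FO F X) (FO G' X)] w)) =
 (nt f X (fst z) -[FO G X] nt s X (snd z)) +[FO G X] (nt f X (fst w) -[FO G X] nt s X (snd w))"
 using zc wc c c' by (simp add: prod_module_def case_prod_beta lin_add[OF fl] lin_add[OF sl] a_minus_def GX.M.minus_add GX.M.a_ac) qed
 ultimately have "submodule (N X) R (prod_module (FO F X) (FO G' X))" using P.submodule_kernel[OF GX.module_axioms] by simp
 from submodule.submodule_is_module[OF this pm] show ?thesis by (simp add: M_def) qed
 have Msimps: "cr (M X) = N X" "z +[M X] w = (fst z +[FO F X] fst w, snd z +[FO G' X] snd w)"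
 "r .[M X] z = (r .[FO F X] fst z, r .[FO G' X] snd z)" for X z w r by (simp_all add: M_def prod_module_def case_prod_beta)
 \<comment> \<open>The fibre product consists of pairs; an infinite universe contains a copy of its
   own square.\<close>
 have small: "cr (M X) \<lesssim> (UNIV :: 'u set)" for X using lepoll_trans[OF subset_imp_lepoll[OF subset_UNIV] pairs_lepoll[OF inf]] .
 note re = realise[OF M small] and inj = embed_inj[OF small]
 define e where "e X = (embed (M X) :: 'u \<times> 'u => 'u)" for X
 define dd where "dd X = inv_into (N X) (e X)" for X
 have de: "dd X (e X z) = z" if "z : N X" for X z unfolding dd_def e_def using inv_into_f_f[OF inj] that by (simp add: Msimps)
 have eR: "e X z : cr (realise (M X))" if "z : N X" "X : Ob" for X z using re(3)[OF that(2)] that(1) by (auto simp: e_def Msimps)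
 have ob: "EX z : N X. w = e X z" if "w : cr (realise (M X))" "X : Ob" for X w using re(3)[OF that(2)] that(1) by (auto simp: e_def Msimps)
 have el: "lin R (M X) (realise (M X)) (e X)" if "X : Ob" for X unfolding e_def by (rule re(2)[OF that])
 have dl: "lin R (realise (M X)) (M X) (dd X)" if X: "X : Ob" for X
 proof (rule linI)
 interpret MX: rmod R "M X" by (rule rmodI[OF M[OF X]])
 fix z :: 'u assume "z : cr (realise (M X))"
 then obtain z' where z': "z' : N X" "z = e X z'" using ob X by blast thus "dd X z : cr (M X)" by (simp add: de Msimps)
 show "dd X (r .[realise (M X)] z) = r .[M X] dd X z" if "r : cr R" for r
 proof -
 have "r .[realise (M X)] z = e X (r .[M X] z')" using z' lin_smult[OF el[OF X] that, of z'] by (simp add: Msimps(1))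
 moreover have "r .[M X] z' : N X" using z' MX.smult_closed[OF that, of z'] by (simp only: Msimps(1))
 ultimately show ?thesis using z' de by simp qed
 fix w :: 'u assume "w : cr (realise (M X))"
 then obtain w' where w': "w' : N X" "w = e X w'" using ob X by blast
 show "dd X (z +[realise (M X)] w) = dd X z +[M X] dd X w"
 proof -
 have "z +[realise (M X)] w = e X (z' +[M X] w')" using z' w' lin_add[OF el[OF X], of z' w'] by (simp add: Msimps(1))
 moreover have "z' +[M X] w' : N X" using z' w' MX.M.a_closed[of z' w'] by (simp only: Msimps(1))
 ultimately show ?thesis using z' w' de by simp qed qed
 have act_N: "(act F ph x, act G' ph y) : N Y" if "ph : Hom X Y" "(x, y) : N X" for X Y ph x y
 using that nt_nat[OF f that(1)] nt_nat[OF s that(1)] act_cl[OF F that(1)] act_cl[OF G' that(1)] by (auto simp: N_def)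
 define a where "a ph = (\<lambda>w \<in> cr (realise (M (Dom UB ph)) :: ('r, 'u) module). let z = dd (Dom UB ph) w in e (Cod UB ph) (act F ph (fst z), act G' ph (snd z)))" for ph
 define P where "P = mk_rep (%X. realise (M X)) a"
 have ae: "a ph (e X z) = e Y (act F ph (fst z), act G' ph (snd z))" if "ph : Hom X Y" "z : N X" for X Y ph z
 using that HomsD[OF that(1)] eR[OF that(2)] U.ends[OF that(1)] by (simp add: a_def de Let_def)
 have Pin: "P : ObR" unfolding P_def
 proof (rule mk_rep_in)
 show "module R (realise (M X) :: ('r, 'u) module)" if "X : Ob" for X by (rule re(1)[OF that])
 show "a (Id UB X) w = w" if X: "X : Ob" and w: "w : cr (realise (M X))" for X and w :: 'u
 proof -
 obtain z where z: "z : N X" "w = e X z" using ob[OF w X] by blast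
 thus ?thesis using ae[OF U.Id_in_Homs[OF X] z(1)] act_Id[OF F X] act_Id[OF G' X] by (auto simp: N_def) qed
 fix X Y ph assume ph: "ph : Hom X Y"
 have X: "X : Ob" "Y : Ob" using U.ends[OF ph] by auto
 interpret MX: rmod R "M X" by (rule rmodI[OF M[OF X(1)]])
 interpret RX: rmod R "realise (M X) :: ('r, 'u) module" by (rule rmodI[OF re(1)[OF X(1)]])
 have "lin R (M X) (M Y) (%z. (act F ph (fst z), act G' ph (snd z)))"
 using act_N[OF ph] by (intro linI) (auto simp: Msimps N_def lin_add[OF act_lin[OF F ph]] lin_add[OF act_lin[OF G' ph]]
 lin_smult[OF act_lin[OF F ph]] lin_smult[OF act_lin[OF G' ph]])
 from lin_comp[OF lin_comp[OF dl[OF X(1)] this] el[OF X(2)]]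
 have "lin R (realise (M X)) (realise (M Y)) (%w. e Y (act F ph (fst (dd X w)), act G' ph (snd (dd X w))))" .
 thus "a ph : linear_maps R (realise (M X)) (realise (M Y))"
 unfolding a_def using HomsD[OF ph] restrict_linear_maps[OF RX.module_axioms] by (simp add: Let_def)
 fix Z ps and w :: 'u assume ps: "ps : Hom Y Z" and w: "w : cr (realise (M X))"
 obtain z where z: "z : N X" "w = e X z" using ob[OF w X(1)] by blast
 have zc: "fst z : car F X" "snd z : car G' X" using z(1) by (auto simp: N_def)
 show "a (ps o[UB] ph) w = a ps (a ph w)" using ae[OF U.Comp_in[OF ph ps] z(1)] ae[OF ph z(1)] ae[OF ps act_N[OF ph, of "fst z" "snd z"]] z
 act_Comp[OF F ph ps zc(1)] act_Comp[OF G' ph ps zc(2)] by simp qed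
 have PFO: "FO P X = realise (M X)" if "X : Ob" for X using that by (simp add: P_def mk_rep_simps)
 have Pact: "act P ph = a ph" if "ph : Hom X Y" for X Y ph using mk_rep_simps(2)[OF that] by (simp add: P_def)
 define p where "p = mk_nt P (%X w. fst (dd X w)) F"
 define q where "q = mk_nt P (%X w. snd (dd X w)) G'"
 have pin: "p : RHom P F" unfolding p_def
 proof (rule mk_nt_in[OF Pin F])
 show "lin R (FO P X) (FO F X) (%w. fst (dd X w))" if "X : Ob" for X
 unfolding PFO[OF that] by (rule lin_comp[OF dl[OF that]]) (auto intro!: linI simp: Msimps N_def)
 fix X Y ph w assume ph: "ph : Hom X Y" and w: "w : car P X"
 obtain z where z: "z : N X" "w = e X z" using ob w PFO U.ends[OF ph] by metis
 thus "fst (dd Y (act P ph w)) = act F ph (fst (dd X w))" using ae[OF ph z(1)] act_N[OF ph, of "fst z" "snd z"] by (simp add: Pact[OF ph] de)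
 qed
 have qin: "q : RHom P G'" unfolding q_def
 proof (rule mk_nt_in[OF Pin G'])
 show "lin R (FO P X) (FO G' X) (%w. snd (dd X w))" if "X : Ob" for X
 unfolding PFO[OF that] by (rule lin_comp[OF dl[OF that]]) (auto intro!: linI simp: Msimps N_def)
 fix X Y ph w assume ph: "ph : Hom X Y" and w: "w : car P X"
 obtain z where z: "z : N X" "w = e X z" using ob w PFO U.ends[OF ph] by metis
 thus "snd (dd Y (act P ph w)) = act G' ph (snd (dd X w))" using ae[OF ph z(1)] act_N[OF ph, of "fst z" "snd z"] by (simp add: Pact[OF ph] de)
 qed
 have pq: "nt p X (e X z) = fst z & nt q X (e X z) = snd z & e X z : car P X" if "X : Ob" "z : N X" for X z
 using that eR[OF that(2,1)] by (simp add: p_def q_def PFO de)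
 have obP: "EX z : N X. w = e X z" if "X : Ob" "w : car P X" for X w using ob[OF _ that(1)] that PFO by simp
 show thesis
 proof (rule that[OF pin qin])
 fix X w assume X: "X : Ob" and w: "w : car P X"
 obtain z where z: "z : N X" "w = e X z" using obP[OF X w] by blast
 show "nt f X (nt p X w) = nt s X (nt q X w)" using pq[OF X z(1)] z by (auto simp: N_def)
 fix w' assume w': "w' : car P X" "nt p X w = nt p X w'" "nt q X w = nt q X w'"
 obtain z' where z': "z' : N X" "w' = e X z'" using obP[OF X w'(1)] by blast
 show "w = w'" using pq[OF X z(1)] pq[OF X z'(1)] z z' w'(2,3) by (metis prod.collapse)
 next
 fix X x y assume X: "X : Ob" and "x : car F X" "y : car G' X" "nt f X x = nt s X y" hence "(x, y) : N X" by (simp add: N_def)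
 from pq[OF X this] show "EX z : car P X. nt p X z = x & nt q X z = y" by (intro bexI[of _ "e X (x, y)"]) simp_all qed
qed

definition zero_rep :: "('o, 'm, 'r, 'u) rep" where
 "zero_rep = mk_rep (%X. \<lparr>carrier = {undefined}, monoid.mult = undefined, one = undefined, zero = undefined,
 add = (%_ _. undefined), smult = (%_ _. undefined)\<rparr>) (%ph. \<lambda>x \<in> {undefined}. undefined)"

lemma zero_rep: "zero_rep : ObR" "X : Ob ==> car zero_rep X = {0[FO zero_rep X]}"
proof -
 show "zero_rep : ObR" unfolding zero_rep_def
 proof (rule mk_rep_in, goal_cases)
 case 1
 show "module R \<lparr>carrier = {undefined :: 'u}, monoid.mult = undefined, one = undefined, zero = undefined,
 add = (%_ _. undefined), smult = (%_ _. undefined)\<rparr>" by (rule moduleI[OF R.is_cring abelian_groupI]) auto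
 qed (auto simp: linear_maps_def)
 show "X : Ob ==> car zero_rep X = {0[FO zero_rep X]}" by (simp add: zero_rep_def mk_rep_simps)
qed

section \<open>Stably zero representations\<close>

lemma power1_add: "power1 B k ** power1 B l = power1 B (k + l)" by (induction k) (simp_all add: tensO_unit_left power1_in tensO_assoc obj1_in_Obj)

lemma power1_X: "X : Ob ==> power1 B k ** X : Ob" by (rule Obj_natD(2)[OF power1_nat])

lemma st_power_add: assumes "X : Ob" shows "st (power1 B l) (power1 B k ** X) o[UB] st (power1 B k) X = st (power1 B (l + k)) X"
 using st_tensO[OF power1_in power1_in UG_Obj_B[OF assms], of l k] by (simp add: power1_add UG_simps)

text \<open>Prolong both arrows to stabilisations by k and by l copies of 1; adding l, respectively
  k, more copies makes them equal.\<close>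

lemma UG_Ore: assumes ph: "ph : Hom X Y" and ps: "ps : Hom X Z"
 obtains W ph' ps' where "ph' : Hom Y W" "ps' : Hom Z W" "ph' o[UB] ph = ps' o[UB] ps"
proof -
 have X: "X : Ob" using U.ends[OF ph] by simp
 obtain k al where a: "al : Hom Y (power1 B k ** X)" "al o[UB] ph = st (power1 B k) X" using UG_cofinal[OF ph] .
 obtain l be where b: "be : Hom Z (power1 B l ** X)" "be o[UB] ps = st (power1 B l) X" using UG_cofinal[OF ps] .
 let ?W = "power1 B (k + l) ** X"
 have sa: "st (power1 B l) (power1 B k ** X) : Hom (power1 B k ** X) ?W" using st_UG[OF power1_nat power1_X[OF X], of l k] power1_add[of l k] UG_Obj_B[OF X]
 by (simp add: tensO_assoc[symmetric] power1_in add.commute)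
 have sb: "st (power1 B k) (power1 B l ** X) : Hom (power1 B l ** X) ?W" using st_UG[OF power1_nat power1_X[OF X], of k l] power1_add[of k l] UG_Obj_B[OF X]
 by (simp add: tensO_assoc[symmetric] power1_in)
 show thesis
 proof (rule that[OF U.Comp_in[OF a(1) sa] U.Comp_in[OF b(1) sb]])
 show "(st (power1 B l) (power1 B k ** X) o[UB] al) o[UB] ph = (st (power1 B k) (power1 B l ** X) o[UB] be) o[UB] ps"
 unfolding U.Comp_assoc[OF ph a(1) sa] U.Comp_assoc[OF ps b(1) sb] a(2) b(2) st_power_add[OF X] by (simp add: add.commute) qed
qed

text \<open>Stably zero elements; the proof of \<open>K_objs_eq\<close> shows that they make up
  \<open>kappa\<close>.\<close>

definition dies :: "('o, 'm, 'r, 'u) rep => 'o => 'u => bool" where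
 "dies F X x <-> (EX Y. EX ph : Hom X Y. act F ph x = 0[FO F Y])"

lemma dies_zero: "F : ObR ==> X : Ob ==> dies F X 0[FO F X]" using act_zero U.Id_in_Homs unfolding dies_def by blast

lemma dies_act_iff: assumes F: "F : ObR" and ph: "ph : Hom X Y" and x: "x : car F X" shows "dies F Y (act F ph x) <-> dies F X x"
proof
 assume "dies F Y (act F ph x)"
 then obtain Z ps where "ps : Hom Y Z" "act F ps (act F ph x) = 0[FO F Z]" unfolding dies_def by blast
 thus "dies F X x" using act_Comp[OF F ph _ x] U.Comp_in[OF ph] unfolding dies_def by metis
next
 assume "dies F X x"
 then obtain Z ps where p: "ps : Hom X Z" "act F ps x = 0[FO F Z]" unfolding dies_def by blast
 obtain W ph' ps' where o: "ph' : Hom Y W" "ps' : Hom Z W" "ph' o[UB] ph = ps' o[UB] ps" using UG_Ore[OF ph p(1)] .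
 have "act F ph' (act F ph x) = act F ps' (act F ps x)" using act_Comp[OF F ph o(1) x] act_Comp[OF F p(1) o(2) x] o(3) by simp
 thus "dies F Y (act F ph x)" using p(2) act_zero[OF F o(2)] o(1) unfolding dies_def by auto
qed

text \<open>Along an arrow killing x the sum becomes the image of y, and by the Ore property dying
  is insensitive to having been moved along an arrow.\<close>

lemma dies_add:
 assumes F: "F : ObR" and X: "X : Ob" and x: "x : car F X" "dies F X x" and y: "y : car F X" "dies F X y" shows "dies F X (x +[FO F X] y)"
proof -
 obtain Y ph where p: "ph : Hom X Y" "act F ph x = 0[FO F Y]" using x(2) unfolding dies_def by blast
 interpret FY: rmod R "FO F Y" by (rule rmodI[OF rep_mod[OF F]]) (use U.ends[OF p(1)] in simp)
 have "act F ph (x +[FO F X] y) = act F ph y" using lin_add[OF act_lin[OF F p(1)] x(1) y(1)] p(2) act_cl[OF F p(1) y(1)] by simp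
 hence "dies F Y (act F ph (x +[FO F X] y))" using dies_act_iff[OF F p(1) y(1)] y(2) by simp
 moreover have "x +[FO F X] y : car F X" using abelian_monoid.a_closed[OF abelian_group.axioms(1)[OF module.axioms(2)[OF rep_mod[OF F X]]] x(1) y(1)] .
 ultimately show ?thesis using dies_act_iff[OF F p(1)] x(1) y(1) by simp
qed

lemma subrep_dies: assumes F: "F : ObR" shows "subrep F (%X. {x : car F X. dies F X x})" unfolding subrep_def
proof (intro conjI ballI allI)
 fix X assume X: "X : Ob"
 interpret FX: rmod R "FO F X" by (rule rmodI[OF rep_mod[OF F X]])
 have sm: "dies F X (r .[FO F X] x)" if rx: "r : cr R" "x : car F X" "dies F X x" for r x
 proof -
 obtain Y ph where p: "ph : Hom X Y" "act F ph x = 0[FO F Y]" using rx(3) unfolding dies_def by blast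
 interpret FY: rmod R "FO F Y" by (rule rmodI[OF rep_mod[OF F]]) (use U.ends[OF p(1)] in simp)
 show ?thesis using lin_smult[OF act_lin[OF F p(1)] rx(1,2)] p rx(1) unfolding dies_def by auto qed
 show "submodule {x : car F X. dies F X x} R (FO F X)"
 proof (rule FX.submoduleI)
 show "-[FO F X] a : {x : car F X. dies F X x}" if "a : {x : car F X. dies F X x}" for a
 using that sm[of "-[R] 1[R]" a] FX.neg_smult[of a] by simp qed (auto simp: dies_zero[OF F X] dies_add[OF F X] sm)
next
 fix X Y ph x assume "ph : Hom X Y" "x : {x : car F X. dies F X x}"
 thus "act F ph x : {x : car F Y. dies F Y x}" using dies_act_iff[OF F] act_cl[OF F] by blast
qed

lemma dies_nt: assumes f: "f : RHom F G" and X: "X : Ob" and x: "x : car F X" "dies F X x" shows "dies G X (nt f X x)"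
proof -
 obtain Y ph where p: "ph : Hom X Y" "act F ph x = 0[FO F Y]" using x(2) unfolding dies_def by blast
 hence "act G ph (nt f X x) = 0[FO G Y]" using nt_nat[OF f p(1) x(1)] nt_zero[OF f] U.ends[OF p(1)] by simp
 thus ?thesis using p(1) unfolding dies_def by blast
qed

definition Kset :: "('o, 'm, 'r, 'u) rep set" where
 "Kset = {F : ObR. ALL X : Ob. ALL x : car F X. dies F X x}"

text \<open>The dying elements already form a submodule, so taking the span adds nothing; conversely
  a killing arrow prolongs to a stabilisation by a power of 1, an admissible m.\<close>

lemma K_objs_eq: "K_objs R B = Kset"
proof -
 have "kappa R B F X = {x : car F X. dies F X x}" if F: "F : ObR" and X: "X : Ob" for F X
 proof
 interpret FX: rmod R "FO F X" by (rule rmodI[OF rep_mod[OF F X]])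
 have "(\<Union>m \<in> Obj_nat B. kappa_at B m F X) <= {x : car F X. dies F X x}"
 proof (rule UN_least, rule subsetI)
 fix m x assume m: "m : Obj_nat B" and x: "x : kappa_at B m F X"
 have "x : car F X" "act F (st m X) x = 0[FO F (m ** X)]" using x i_arr_st[OF Obj_natD(1)[OF m] UG_Obj_B[OF X]] by (auto simp: kappa_at_def act_def)
 thus "x : {x : car F X. dies F X x}" using st_UG[OF m X] unfolding dies_def by blast qed
 thus "kappa R B F X <= {x : car F X. dies F X x}" unfolding kappa_def using FX.module_span_least subrep_dies[OF F] X by (simp add: subrep_def)
 show "{x : car F X. dies F X x} <= kappa R B F X"
 proof
 fix x assume "x : {x : car F X. dies F X x}"
 then obtain Y ph where x: "x : car F X" and p: "ph : Hom X Y" "act F ph x = 0[FO F Y]" unfolding dies_def by blast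
 obtain k ps where q: "ps : Hom Y (power1 B k ** X)" "ps o[UB] ph = st (power1 B k) X" using UG_cofinal[OF p(1)] .
 have "act F (st (power1 B k) X) x = 0[FO F (power1 B k ** X)]" using act_Comp[OF F p(1) q(1) x] p(2) q(2) act_zero[OF F q(1)] by simp
 hence "x : kappa_at B (power1 B k) F X" using x i_arr_st[OF power1_in UG_Obj_B[OF X]] by (simp add: kappa_at_def act_def)
 thus "x : kappa R B F X" unfolding kappa_def by (intro subsetD[OF FX.module_span_superset] UN_I[OF power1_nat]) qed qed
 hence "kappa R B F X = car F X <-> (ALL x : car F X. dies F X x)" if "F : ObR" "X : Ob" for F X using that by (simp only:) blast
 thus ?thesis unfolding K_objs_def Kset_def by (intro Collect_cong conj_cong refl ball_cong) blast+
qed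

section \<open>Translations and difference functors\<close>

definition tau :: "'o => ('o, 'm, 'r, 'u) rep => ('o, 'm, 'r, 'u) rep" where
 "tau m F = mk_rep (%X. FO F (m ** X)) (%ph. act F (sh m ph))"

lemma tau: assumes m: "m : Obj_nat B" and F: "F : ObR" shows "tau m F : ObR" "X : Ob ==> FO (tau m F) X = FO F (m ** X)"
 "ph : Hom X Y ==> act (tau m F) ph = act F (sh m ph)"
proof -
 note mB = Obj_natD(1)[OF m] and mX = Obj_natD(2)[OF m]
 show "tau m F : ObR" unfolding tau_def
 proof (rule mk_rep_in, goal_cases)
 case (1 X) thus ?case by (rule rep_mod[OF F mX])
 next
 case (2 X Y ph) thus ?case using rep_FA[OF F sh_UG[OF m 2]] by simp
 next
 case (3 X x)
 have "sh m (Id UB X) = Id UB (m ** X)" using sh_Id[OF mB UG_Obj_B[OF 3(1)]] by (simp add: UG_simps)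
 thus ?case using act_Id[OF F mX[OF 3(1)] 3(2)] by simp
 next
 case (4 X Y Z ph ps x)
 have "sh m (ps o[UB] ph) = sh m ps o[UB] sh m ph" using sh_Comp[OF mB UG_Homs'[OF 4(1)] UG_Homs'[OF 4(2)]] by (simp add: UG_simps)
 thus ?case using act_Comp[OF F sh_UG[OF m 4(1)] sh_UG[OF m 4(2)] 4(3)] by simp qed
 show "X : Ob ==> FO (tau m F) X = FO F (m ** X)" by (simp add: tau_def mk_rep_simps)
 show "ph : Hom X Y ==> act (tau m F) ph = act F (sh m ph)" by (simp add: tau_def mk_rep_simps(2))
qed

abbreviation dp :: "'o => ('o, 'm, 'r, 'u) rep => 'o => 'u => 'u" where
 "dp == delta_proj B"

lemma st_nat: assumes m: "m : Obj_nat B" and F: "F : ObR" and ph: "ph : Hom X Y" and x: "x : car F X"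
 shows "act F (sh m ph) (act F (st m X) x) = act F (st m Y) (act F ph x)"
proof -
 have X: "X : Ob" "Y : Ob" using U.ends[OF ph] by auto
 have "sh m ph o[UB] st m X = st m Y o[UB] ph" using st_natural[OF Obj_natD(1)[OF m] UG_Homs'[OF ph]] by (simp add: UG_simps)
 thus ?thesis using act_Comp[OF F st_UG[OF m X(1)] sh_UG[OF m ph] x] act_Comp[OF F ph st_UG[OF m X(2)] x] by simp
qed

lemma i_image_eq: "m : Obj_nat B ==> X : Ob ==> i_image B m F X = act F (st m X) ` car F X"
 unfolding i_image_def act_def using i_arr_st[OF Obj_natD(1) UG_Obj_B] by metis

lemma subrep_i_image: assumes m: "m : Obj_nat B" and F: "F : ObR" shows "subrep (tau m F) (i_image B m F)" unfolding subrep_def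
proof (intro conjI ballI allI)
 fix X assume X: "X : Ob"
 show "submodule (i_image B m F X) R (FO (tau m F) X)" unfolding i_image_eq[OF m X] tau(2)[OF m F X]
 by (rule rmod.submodule_image[OF rmodI[OF rep_mod[OF F X]] rep_mod[OF F Obj_natD(2)[OF m X]] act_lin[OF F st_UG[OF m X]]])
next
 fix X Y ph x assume ph: "ph : Hom X Y" and x: "x : i_image B m F X"
 have X: "X : Ob" "Y : Ob" using U.ends[OF ph] by auto
 show "act (tau m F) ph x : i_image B m F Y"
 using x st_nat[OF m F ph] act_cl[OF F ph] unfolding i_image_eq[OF m X(1)] i_image_eq[OF m X(2)] tau(3)[OF m F ph] by auto
qed

lemma delta_eq: assumes m: "m : Obj_nat B" and F: "F : ObR" shows "delta R B m F = quot_rep (tau m F) (i_image B m F)"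
proof -
 have o: "Dom UB ph : Ob" "Cod UB ph : Ob" if "ph : Arr UB" for ph using U.ends[OF Arr_Homs[OF that]] by auto
 have t: "act (tau m F) ph = arrow_map (FA F (bracket_tens B (Id (UG' B) m) ph))" if "ph : Arr UB" for ph
 using tau(3)[OF m F Arr_Homs[OF that]] by (simp add: act_def sh_def)
 show ?thesis unfolding delta_def quot_rep_def mk_rep_def delta_module_def delta_proj_def qmod_def[symmetric] qproj_def[symmetric] Let_def
 by (simp add: tau(2)[OF m F] o t cong: restrict_cong)
qed

lemma dp_eq: "m : Obj_nat B ==> F : ObR ==> X : Ob ==> dp m F X = qpr (tau m F) (i_image B m F) X"
 by (simp add: fun_eq_iff delta_proj_def qproj_def Let_def tau(2))

lemma delta: assumes m: "m : Obj_nat B" and F: "F : ObR" shows "delta R B m F : ObR"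
 "X : Ob ==> lin R (FO F (m ** X)) (FO (delta R B m F) X) (dp m F X)"
 "X : Ob ==> dp m F X ` car F (m ** X) = car (delta R B m F) X"
 "X : Ob ==> x : car F (m ** X) ==> dp m F X x = 0[FO (delta R B m F) X] <-> x : act F (st m X) ` car F X"
 "ph : Hom X Y ==> x : car F (m ** X) ==> act (delta R B m F) ph (dp m F X x) = dp m F Y (act F (sh m ph) x)"
proof -
 note q = quot_rep[OF tau(1)[OF m F] subrep_i_image[OF m F], folded delta_eq[OF m F]]
 show "delta R B m F : ObR" by (rule q)
 show "X : Ob ==> lin R (FO F (m ** X)) (FO (delta R B m F) X) (dp m F X)" using q(2) by (simp add: dp_eq[OF m F] tau(2)[OF m F])
 show "X : Ob ==> dp m F X ` car F (m ** X) = car (delta R B m F) X" using q(3) by (simp add: dp_eq[OF m F] tau(2)[OF m F])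
 show "X : Ob ==> x : car F (m ** X) ==> dp m F X x = 0[FO (delta R B m F) X] <-> x : act F (st m X) ` car F X"
 using q(4) by (simp add: dp_eq[OF m F] tau(2)[OF m F] i_image_eq[OF m])
 show "act (delta R B m F) ph (dp m F X x) = dp m F Y (act F (sh m ph) x)" if "ph : Hom X Y" "x : car F (m ** X)"
 using q(5)[OF that(1)] that U.ends[OF that(1)] by (simp add: dp_eq[OF m F] tau(2)[OF m F] tau(3)[OF m F that(1)])
qed

lemma delta_arrow: assumes m: "m : Obj_nat B" and F: "F : ObR" and G: "G : ObR"
 and l: "!!X. X : Ob ==> lin R (FO F (m ** X)) (FO G X) (h X)" and k: "!!X x. X : Ob ==> x : car F X ==> h X (act F (st m X) x) = 0[FO G X]"
 and n: "!!X Y ph x. [|ph : Hom X Y; x : car F (m ** X)|] ==> h Y (act F (sh m ph) x) = act G ph (h X x)"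
 obtains al where "al : RHom (delta R B m F) G"
 "!!X x. X : Ob ==> x : car F (m ** X) ==> nt al X (dp m F X x) = h X x"
proof -
 have h1: "lin R (FO (tau m F) X) (FO G X) (h X)" if "X : Ob" for X using l[OF that] by (simp add: tau(2)[OF m F that])
 have h2: "h X x = 0[FO G X]" if "X : Ob" "x : i_image B m F X" for X x using that k unfolding i_image_eq[OF m that(1)] by blast
 have h3: "h Y (act (tau m F) ph x) = act G ph (h X x)" if "ph : Hom X Y" "x : car (tau m F) X" for X Y ph x
 using n[OF that(1)] that(2) U.ends[OF that(1)] by (simp add: tau(2)[OF m F] tau(3)[OF m F that(1)])
 obtain al where a: "al : RHom (quot_rep (tau m F) (i_image B m F)) G"
 "!!X x. X : Ob ==> x : car (tau m F) X ==> nt al X (qpr (tau m F) (i_image B m F) X x) = h X x"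
 using quot_arrow[OF tau(1)[OF m F] subrep_i_image[OF m F] G h1 h2 h3] by metis
 show thesis using that[of al] a by (simp add: delta_eq[OF m F] dp_eq[OF m F] tau(2)[OF m F])
qed

lemma delta_map: assumes m: "m : Obj_nat B" and f: "f : RHom F G"
 obtains al where "al : RHom (delta R B m F) (delta R B m G)"
 "!!X x. X : Ob ==> x : car F (m ** X) ==> nt al X (dp m F X x) = dp m G X (nt f (m ** X) x)"
proof -
 have F: "F : ObR" and G: "G : ObR" using Rep.ends[OF f] by auto
 note mX = Obj_natD(2)[OF m]
 have h1: "lin R (FO F (m ** X)) (FO (delta R B m G) X) (%x. dp m G X (nt f (m ** X) x))" if "X : Ob" for X
 by (rule lin_comp[OF nt_lin(1)[OF f mX[OF that]] delta(2)[OF m G that]])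
 have h2: "dp m G X (nt f (m ** X) (act F (st m X) x)) = 0[FO (delta R B m G) X]" if "X : Ob" "x : car F X" for X x
 unfolding nt_nat[OF f st_UG[OF m that(1)] that(2)] using delta(4)[OF m G that(1)] act_cl[OF G st_UG[OF m that(1)]] nt_cl[OF f that] by blast
 have h3: "dp m G Y (nt f (m ** Y) (act F (sh m ph) x)) = act (delta R B m G) ph (dp m G X (nt f (m ** X) x))"
 if "ph : Hom X Y" "x : car F (m ** X)" for X Y ph x unfolding nt_nat[OF f sh_UG[OF m that(1)] that(2)]
 using delta(5)[OF m G that(1)] nt_cl[OF f mX that(2)] U.ends[OF that(1)] by simp
 show thesis using delta_arrow[OF m F delta(1)[OF m G] h1 h2 h3] that by metis
qed

end

section \<open>Polynomial representations\<close>

context rep_setting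
begin

abbreviation "one1 == obj1 B"
abbreviation up (\<open>1+_\<close> [75] 75) where "1+X == one1 ** X"

lemma power1_Suc0: "power1 B (Suc 0) = one1" by (simp add: tensO_unit_right obj1_in_Obj)

text \<open>Exchanges the first two copies of 1 by the inverse braiding, the isomorphism occurring
  in the definition of reliability.\<close>

definition swp :: "'o => ('o, 'm) bracket_arr" where
 "swp X = lift_arr B (ibr one1 one1 ## Id B X)"

lemma ibr_UG: "X : Ob ==> ibr one1 one1 ## Id B X : Homs B (1+(1+X)) (1+(1+X))"
 using tensA_in[OF ibr_in[OF obj1_in_Obj obj1_in_Obj] Id_in[OF UG_Obj_B[of X]]] UG_Obj_B[of X] by (simp add: tensO_assoc obj1_in_Obj)

lemma X1: "X : Ob ==> 1+X : Ob" by (rule Obj_natD(2)[OF obj1_nat])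

lemma swp_in: "X : Ob ==> swp X : Hom (1+(1+X)) (1+(1+X))" unfolding swp_def by (rule lift_UG[OF ibr_UG]) (simp_all add: X1)

lemma swp_st: "X : Ob ==> swp X o[UB] st one1 (1+X) = sh one1 (st one1 X)" unfolding swp_def UG_simps using sh_st[OF obj1_in_Obj UG_Obj_B] by simp

lemma sh_Comp_UG:
 "m : Obj_nat B ==> ph : Hom X Y ==> ps : Hom Y Z ==> sh m (ps o[UB] ph) = sh m ps o[UB] sh m ph"
 using sh_Comp[OF Obj_natD(1) UG_Homs' UG_Homs'] by (simp add: UG_simps)

lemma st_nat_UG:
 "m : Obj_nat B ==> ph : Hom X Y ==> sh m ph o[UB] st m X = st m Y o[UB] ph" using st_natural[OF Obj_natD(1) UG_Homs'] by (simp add: UG_simps)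

text \<open>A stabilisation adds new copies of 1 in front, but they can be braided behind the first
  copy, after which the arrow leaves that copy alone. Hence arrows of the form
  \<open>sh one1 ph\<close> are cofinal below 1 + X.\<close>

lemma sh_cofinal: assumes ps: "ps : Hom (1+X) Y" and X: "X : Ob"
 obtains Z ph \<chi> where "ph : Hom X Z" "\<chi> : Hom Y (1+Z)" "\<chi> o[UB] ps = sh one1 ph"
proof -
 note o = obj1_nat
 have main: "EX Z ph \<chi>. ph : Hom X Z & \<chi> : Hom (power1 B k ** (1+X)) (1+Z) &
 \<chi> o[UB] st (power1 B k) (1+X) = sh one1 ph" for k
 proof (induction k)
 case 0
 have "st (unitO B) (1+X) = Id UB (1+X)" using st_unit[OF UG_Obj_B[OF X1[OF X]]] by (simp add: UG_simps)
 moreover have "sh one1 (Id UB X) = Id UB (1+X)" using sh_Id[OF obj1_in_Obj UG_Obj_B[OF X]] by (simp add: UG_simps)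
 moreover note i = U.Id_in_Homs[OF X] U.Id_in_Homs[OF X1[OF X]] ultimately show ?case using U.Comp_Id_left[OF i(2)]
 by (intro exI[of _ X] exI[of _ "Id UB X"] exI[of _ "Id UB (1+X)"]) (simp add: tensO_unit_left UG_Obj_B[OF X1[OF X]])
 next
 case (Suc k)
 obtain Z ph \<chi> where i: "ph : Hom X Z" "\<chi> : Hom (power1 B k ** (1+X)) (1+Z)"
 "\<chi> o[UB] st (power1 B k) (1+X) = sh one1 ph" using Suc by blast
 let ?Y = "power1 B k ** (1+X)"
 have Z: "Z : Ob" and Y: "?Y : Ob" using U.ends[OF i(1)] U.ends[OF i(2)] by auto
 have e: "power1 B (Suc k) ** (1+X) = 1+?Y" by (simp add: tensO_assoc obj1_in_Obj power1_in UG_Obj_B[OF X1[OF X]])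
 have s0: "st (power1 B k) (1+X) : Hom (1+X) ?Y" by (rule st_UG[OF power1_nat X1[OF X]])
 have sY: "st one1 ?Y : Hom ?Y (1+?Y)" by (rule st_UG[OF o Y])
 have sS: "st (power1 B (Suc k)) (1+X) = st one1 ?Y o[UB] st (power1 B k) (1+X)"
 using st_power_add[OF X1[OF X], of "Suc 0" k] by (simp only: power1_Suc0 add_Suc add_0)
 have sc: "sh one1 \<chi> : Hom (1+?Y) (1+(1+Z))" by (rule sh_UG[OF o i(2)])
 note sw = swp_in[OF Z] and stZ = st_UG[OF o Z] and st1Z = st_UG[OF o X1[OF Z]] and shp = sh_UG[OF o i(1)]
 \<comment> \<open>One more copy of 1 in front: naturality carries it over \<chi>, and
   \<open>swp_st\<close> turns it into a copy in second place.\<close>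
 have "(swp Z o[UB] sh one1 \<chi>) o[UB] st (power1 B (Suc k)) (1+X)
 = swp Z o[UB] (sh one1 \<chi> o[UB] (st one1 ?Y o[UB] st (power1 B k) (1+X)))" unfolding sS by (rule U.Comp_assoc[OF U.Comp_in[OF s0 sY] sc sw])
 also have "sh one1 \<chi> o[UB] (st one1 ?Y o[UB] st (power1 B k) (1+X)) = st one1 (1+Z) o[UB] sh one1 ph"
 unfolding U.Comp_assoc[OF s0 sY sc, symmetric] st_nat_UG[OF o i(2)] U.Comp_assoc[OF s0 i(2) st1Z] i(3) ..
 also have "swp Z o[UB] (st one1 (1+Z) o[UB] sh one1 ph) = sh one1 (st one1 Z o[UB] ph)"
 unfolding U.Comp_assoc[OF shp st1Z sw, symmetric] swp_st[OF Z] sh_Comp_UG[OF o i(1) stZ] ..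
 finally show ?case using U.Comp_in[OF i(1) stZ] U.Comp_in[OF sc sw] unfolding e by blast qed
 obtain k al where a: "al : Hom Y (power1 B k ** (1+X))" "al o[UB] ps = st (power1 B k) (1+X)" using UG_cofinal[OF ps] .
 obtain Z ph \<chi> where i: "ph : Hom X Z" "\<chi> : Hom (power1 B k ** (1+X)) (1+Z)"
 "\<chi> o[UB] st (power1 B k) (1+X) = sh one1 ph" using main by blast
 show thesis by (rule that[OF i(1) U.Comp_in[OF a(1) i(2)]]) (simp only: U.Comp_assoc[OF ps a(1) i(2)] a(2) i(3))
qed

text \<open>An element over 1 + X that is killed at all is killed by a translated arrow; this lets
  death of elements of F be used in the translation, the difference and \<open>LM\<close> of
  F.\<close>

lemma dies_sh: assumes F: "F : ObR" and X: "X : Ob" and x: "x : car F (1+X)" "dies F (1+X) x"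
 obtains Z ph where "ph : Hom X Z" "act F (sh one1 ph) x = 0[FO F (1+Z)]"
proof -
 obtain Y ps where p: "ps : Hom (1+X) Y" "act F ps x = 0[FO F Y]" using x(2) unfolding dies_def by blast
 obtain Z ph \<chi> where c: "ph : Hom X Z" "\<chi> : Hom Y (1+Z)" "\<chi> o[UB] ps = sh one1 ph" using sh_cofinal[OF p(1) X] .
 show thesis using that[OF c(1)] act_Comp[OF F p(1) c(2) x(1)] c(3) p(2) act_zero[OF F c(2)] by simp
qed

abbreviation dl :: "('o, 'm, 'r, 'u) rep => ('o, 'm, 'r, 'u) rep" where
 "dl F == delta R B one1 F"

text \<open>Polynomials of degree n - 1, tested with m = 1 only. The shift of the index turns the
  negative degrees into the base case; \<open>polp_Suc_iff\<close> and \<open>Pol_eq\<close> recover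
  the definition with all m.\<close>

primrec polp :: "nat => ('o, 'm, 'r, 'u) rep set" where
 "polp 0 = Kset"
| "polp (Suc n) = {F : ObR. dl F : polp n}"

lemma polp_Obj: "F : polp n ==> F : ObR" by (cases n) (auto simp: Kset_def)

definition gens :: "('o, 'm, 'r, 'u) rep_arr set => 'o => 'u set" where
 "gens A Y = (\<Union>f \<in> A. nt f Y ` car (Dom Rep f) Y)"

lemma gens_closed: assumes "A <= Arr Rep" "!!f. f : A ==> Cod Rep f = P" "Y : Ob" shows "gens A Y <= car P Y"
proof -
 have "nt f Y x : car P Y" if "f : A" "x : car (Dom Rep f) Y" for f x using nt_cl[OF Arr_Homs, of f Y x] assms that by auto
 thus ?thesis by (auto simp: gens_def)
qed

lemma aspan_act: assumes P: "P : ObR" and A: "A <= Arr Rep" "!!f. f : A ==> Cod Rep f = P"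
 and \<chi>: "\<chi> : Hom Y Z" and y: "y : aspan (FO P Y) (gens A Y)" shows "act P \<chi> y : aspan (FO P Z) (gens A Z)"
proof -
 have Y: "Y : Ob" and Z: "Z : Ob" using U.ends[OF \<chi>] by auto
 have "act P \<chi> (nt f Y x) : gens A Z" if f: "f : A" and x: "x : car (Dom Rep f) Y" for f x
 proof -
 have fH: "f : RHom (Dom Rep f) P" using Arr_Homs[of f Rep] A f by auto
 have "act P \<chi> (nt f Y x) = nt f Z (act (Dom Rep f) \<chi> x)" using nt_nat[OF fH \<chi> x] by simp
 moreover have "act (Dom Rep f) \<chi> x : car (Dom Rep f) Z" using act_cl[OF _ \<chi> x] Rep.ends[OF fH] by simp
 ultimately show ?thesis using f unfolding gens_def by blast qed hence "act P \<chi> ` gens A Y <= gens A Z" by (auto simp: gens_def)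
 thus ?thesis using rmod.aspan_lin_image[OF rmodI[OF rep_mod[OF P Y]] gens_closed[OF A Y] rep_mod[OF P Z] act_lin[OF P \<chi>] y] by blast
qed

text \<open>Replaces a quotient of a direct sum of the sources of A, with generation only required
  after moving along an arrow. The property descends to differences: by \<open>sh_cofinal\<close>
  the moving arrow can be taken to be a translated one.\<close>

lemma polp_joint: assumes "P : ObR" "A <= Arr Rep" "!!f. f : A ==> Cod Rep f = P" "!!f. f : A ==> Dom Rep f : polp n"
 "!!X y. X : Ob ==> y : car P X ==> EX Y. EX ph : Hom X Y. act P ph y : aspan (FO P Y) (gens A Y)" shows "P : polp n" using assms
proof (induction n arbitrary: P A)
 case 0
 note P = 0(1) and A = 0(2,3)
 have "dies P X y" if X: "X : Ob" and y: "y : car P X" for X y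
 proof -
 obtain Y ph where p: "ph : Hom X Y" "act P ph y : aspan (FO P Y) (gens A Y)" using 0(5)[OF X y] by blast
 have Y: "Y : Ob" using U.ends[OF p(1)] by simp
 interpret PY: rmod R "FO P Y" by (rule rmodI[OF rep_mod[OF P Y]])
 have "nt f Y x : {z : car P Y. dies P Y z}" if f: "f : A" and x: "x : car (Dom Rep f) Y" for f x
 proof -
 have fH: "f : RHom (Dom Rep f) P" using Arr_Homs[of f Rep] A f by auto
 have "dies (Dom Rep f) Y x" using 0(4)[OF f] x Y by (simp add: Kset_def) thus ?thesis using dies_nt[OF fH Y x] nt_cl[OF fH Y x] by simp qed
 hence "gens A Y <= {z : car P Y. dies P Y z}" unfolding gens_def by blast
 hence "aspan (FO P Y) (gens A Y) <= {z : car P Y. dies P Y z}" by (rule PY.aspan_subset) (auto simp: dies_zero[OF P Y] dies_add[OF P Y])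
 thus ?thesis using p(2) dies_act_iff[OF P p(1) y] by blast qed thus ?case using P by (simp add: Kset_def)
next
 case (Suc n)
 note P = Suc.prems(1) and A = Suc.prems(2,3)
 note o = obj1_nat
 \<comment> \<open>All maps between the differences of the sources and of P; among them are those
   induced by A, whose images are the needed ones.\<close>
 define A' where "A' = {g : Arr Rep. EX f : A. g : RHom (dl (Dom Rep f)) (dl P)}"
 have dp: "dl P : ObR" by (rule delta(1)[OF o P])
 have "dl P : polp n"
 proof (rule Suc.IH[OF dp, of A'])
 show "A' <= Arr Rep" by (auto simp: A'_def)
 show "Cod Rep g = dl P" if "g : A'" for g using that by (auto simp: A'_def Homs_def)
 show "Dom Rep g : polp n" if "g : A'" for g using that Suc.prems(4) by (auto simp: A'_def Homs_def)
 fix X z assume X: "X : Ob" and z: "z : car (dl P) X"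
 obtain y where y: "y : car P (1+X)" "z = dp one1 P X y" using z unfolding delta(3)[OF o P X, symmetric] by blast
 obtain Y ps where p: "ps : Hom (1+X) Y" "act P ps y : aspan (FO P Y) (gens A Y)" using Suc.prems(5)[OF X1[OF X] y(1)] by blast
 obtain Z ph \<chi> where c: "ph : Hom X Z" "\<chi> : Hom Y (1+Z)" "\<chi> o[UB] ps = sh one1 ph" using sh_cofinal[OF p(1) X] .
 have Z: "Z : Ob" using U.ends[OF c(1)] by simp
 have s: "act P (sh one1 ph) y : aspan (FO P (1+Z)) (gens A (1+Z))" using aspan_act[OF P A c(2) p(2)] act_Comp[OF P p(1) c(2) y(1)] c(3) by simp
 have sub: "dp one1 P Z ` gens A (1+Z) <= gens A' Z"
 proof
 fix w assume "w : dp one1 P Z ` gens A (1+Z)"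
 then obtain f x where f: "f : A" and x: "x : car (Dom Rep f) (1+Z)" and w: "w = dp one1 P Z (nt f (1+Z) x)" by (auto simp: gens_def)
 have fH: "f : RHom (Dom Rep f) P" using Arr_Homs[of f Rep] A f by auto
 obtain g where g: "g : RHom (dl (Dom Rep f)) (dl P)"
 "!!X x. X : Ob ==> x : car (Dom Rep f) (1+X) ==> nt g X (dp one1 (Dom Rep f) X x) = dp one1 P X (nt f (1+X) x)" using delta_map[OF o fH] by metis
 have "g : A'" using g(1) f by (auto simp: A'_def Homs_def)
 moreover have "dp one1 (Dom Rep f) Z x : car (Dom Rep g) Z" using lin_cl[OF delta(2)[OF o _ Z] x] Rep.ends[OF fH] g(1) by (simp add: Homs_def)
 moreover have "w = nt g Z (dp one1 (Dom Rep f) Z x)" using g(2)[OF Z x] w by simp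
 ultimately show "w : gens A' Z" unfolding gens_def by blast qed
 have e: "act (dl P) ph z = dp one1 P Z (act P (sh one1 ph) y)" using delta(5)[OF o P c(1) y(1)] y(2) by simp
 have "act (dl P) ph z : aspan (FO (dl P) Z) (gens A' Z)"
 unfolding e by (rule rmod.aspan_lin_image[OF rmodI[OF rep_mod[OF P X1[OF Z]]] gens_closed[OF A X1[OF Z]] rep_mod[OF dp Z] delta(2)[OF o P Z] s sub])
 thus "EX Y. EX ph : Hom X Y. act (dl P) ph z : aspan (FO (dl P) Y) (gens A' Y)" using c(1) by blast qed thus ?case using P by simp
qed

lemma polp_quot: assumes f: "f : RHom F G" and F: "F : polp n"
 and s: "!!X y. X : Ob ==> y : car G X ==> EX Y. EX ph : Hom X Y. act G ph y : nt f Y ` car F Y" shows "G : polp n"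
proof (rule polp_joint[of G "{f}"])
 show "G : ObR" using Rep.ends[OF f] by simp
 show "{f} <= Arr Rep" using f by (simp add: Homs_def)
 show "Cod Rep g = G" "Dom Rep g : polp n" if "g : {f}" for g using that f F by (auto simp: Homs_def)
 fix X y assume X: "X : Ob" and y: "y : car G X"
 obtain Y ph where p: "ph : Hom X Y" "act G ph y : nt f Y ` car F Y" using s[OF X y] by blast
 have Y: "Y : Ob" using U.ends[OF p(1)] by simp
 have g: "gens {f} Y = nt f Y ` car F Y" using f by (simp add: gens_def Homs_def)
 have "nt f Y ` car F Y <= car G Y" using nt_cl[OF f Y] by blast
 hence "act G ph y : aspan (FO G Y) (gens {f} Y)" unfolding g using rmod.aspan_base[OF rmodI[OF rep_mod[OF _ Y]] _ p(2)] Rep.ends[OF f] by blast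
 thus "EX Y. EX ph : Hom X Y. act G ph y : aspan (FO G Y) (gens {f} Y)" using p(1) by blast
qed

lemma polp_quot_surj: assumes f: "f : RHom F G" and F: "F : polp n" and s: "!!X. X : Ob ==> nt f X ` car F X = car G X" shows "G : polp n"
proof (rule polp_quot[OF f F])
 fix X y assume X: "X : Ob" and y: "y : car G X" thus "EX Y. EX ph : Hom X Y. act G ph y : nt f Y ` car F Y"
 using s[OF X] act_Id[OF _ X y] Rep.ends[OF f] by (intro exI[of _ X] bexI[OF _ U.Id_in_Homs[OF X]]) simp
qed

text \<open>Differences do not preserve injectivity, so the induction runs with the weaker
  hypothesis that elements of the kernel die, which the difference does preserve.\<close>

lemma polp_sub: assumes "f : RHom F' F" "F : polp n"
 "!!X x. X : Ob ==> x : car F' X ==> nt f X x = 0[FO F X] ==> dies F' X x" shows "F' : polp n" using assms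
proof (induction n arbitrary: F' F f)
 case 0
 note f = 0(1)
 have F': "F' : ObR" and F: "F : ObR" using Rep.ends[OF f] by auto
 have "dies F' X x" if X: "X : Ob" and x: "x : car F' X" for X x
 proof -
 have "dies F X (nt f X x)" using 0(2) nt_cl[OF f X x] X by (simp add: Kset_def)
 then obtain Y ph where p: "ph : Hom X Y" "act F ph (nt f X x) = 0[FO F Y]" unfolding dies_def by blast
 have "dies F' Y (act F' ph x)" using 0(3)[OF _ act_cl[OF F' p(1) x]] nt_nat[OF f p(1) x] p U.ends[OF p(1)] by simp
 thus ?thesis using dies_act_iff[OF F' p(1) x] by blast qed thus ?case using F' by (simp add: Kset_def)
next
 case (Suc n)
 note f = Suc.prems(1) and o = obj1_nat
 have F': "F' : ObR" and F: "F : ObR" using Rep.ends[OF f] by auto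
 obtain g where g: "g : RHom (dl F') (dl F)"
 "!!X x. X : Ob ==> x : car F' (1+X) ==> nt g X (dp one1 F' X x) = dp one1 F X (nt f (1+X) x)" using delta_map[OF o f] by metis
 have "dl F' : polp n"
 proof (rule Suc.IH[OF g(1)])
 show "dl F : polp n" using Suc.prems(2) by simp
 fix X z assume X: "X : Ob" and z: "z : car (dl F') X" and gz: "nt g X z = 0[FO (dl F) X]"
 obtain x where x: "x : car F' (1+X)" "z = dp one1 F' X x" using z unfolding delta(3)[OF o F' X, symmetric] by blast
 let ?X1 = "1+X" and ?X2 = "1+(1+X)"
 note oX = X1[OF X]
 note oX2 = X1[OF oX]
 note s = st_UG[OF o X] and s1 = st_UG[OF o oX]
 note ss = sh_UG[OF o s]
 have "dp one1 F X (nt f ?X1 x) = 0[FO (dl F) X]" using g(2)[OF X x(1)] gz x(2) by simp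
 then obtain y where y: "y : car F X" "nt f ?X1 x = act F (st one1 X) y" using delta(4)[OF o F X nt_cl[OF f oX x(1)]] by blast
 interpret M: rmod R "FO F' ?X2" by (rule rmodI[OF rep_mod[OF F' oX2]])
 \<comment> \<open>The image of x under f comes from X by stabilisation, and on such elements the
   two ways of adding a further 1 agree. So w is killed by f and dies; past that point x is itself a
   stabilised element, hence zero in the difference.\<close>
 define w where "w = act F' (sh one1 (st one1 X)) x -[FO F' ?X2] act F' (st one1 ?X1) x"
 have xc: "act F' (sh one1 (st one1 X)) x : car F' ?X2" "act F' (st one1 ?X1) x : car F' ?X2" using act_cl[OF F' ss x(1)] act_cl[OF F' s1 x(1)] by auto
 have wc: "w : car F' ?X2" using xc by (simp add: w_def)
 interpret N: rmod R "FO F ?X2" by (rule rmodI[OF rep_mod[OF F oX2]])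
 have "act F (sh one1 (st one1 X)) (nt f ?X1 x) = act F (st one1 ?X1) (nt f ?X1 x)" unfolding y(2) by (rule st_nat[OF o F s y(1)])
 hence "nt f ?X2 w = 0[FO F ?X2]" unfolding w_def M.lin_diff[OF N.module_axioms nt_lin(1)[OF f oX2] xc] nt_nat[OF f ss x(1)] nt_nat[OF f s1 x(1)]
 using act_cl[OF F s1 nt_cl[OF f oX x(1)]] by (simp add: N.diff_zero_iff) hence "dies F' ?X2 w" using Suc.prems(3)[OF oX2 wc] by blast
 then obtain Z ph where p: "ph : Hom ?X1 Z" "act F' (sh one1 ph) w = 0[FO F' (1+Z)]" using dies_sh[OF F' oX wc] by blast
 have Z: "Z : Ob" using U.ends[OF p(1)] by simp
 note sp = sh_UG[OF o p(1)]
 have "act F' (sh one1 ph) (act F' (sh one1 (st one1 X)) x) = act F' (sh one1 ph) (act F' (st one1 ?X1) x)"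
 using p(2) M.lin_diff[OF rep_mod[OF F' X1[OF Z]] act_lin[OF F' sp] xc] act_cl[OF F' sp]
 rmod.diff_zero_iff[OF rmodI[OF rep_mod[OF F' X1[OF Z]]]] xc by (simp add: w_def)
 also have "... = act F' (st one1 Z) (act F' ph x)" by (rule st_nat[OF o F' p(1) x(1)])
 finally have e: "act F' (sh one1 ph) (act F' (sh one1 (st one1 X)) x) = act F' (st one1 Z) (act F' ph x)" .
 note ps = U.Comp_in[OF s p(1)]
 have "act (dl F') (ph o[UB] st one1 X) z = dp one1 F' Z (act F' (st one1 Z) (act F' ph x))"
 unfolding x(2) delta(5)[OF o F' ps x(1)] sh_Comp_UG[OF o s p(1)] act_Comp[OF F' ss sp x(1)] e ..
 also have "... = 0[FO (dl F') Z]" using delta(4)[OF o F' Z act_cl[OF F' st_UG[OF o Z] act_cl[OF F' p(1) x(1)]]] act_cl[OF F' p(1) x(1)] by blast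
 finally show "dies (dl F') X z" using ps unfolding dies_def by blast qed thus ?case using F' by simp
qed

text \<open>Exactness in the middle and surjectivity on the right pass to the differences, so the
  induction can carry them along; injectivity on the left would not survive.\<close>

lemma polp_ext: assumes "f : RHom F' F" "g : RHom F F''" "F' : polp n" "F'' : polp n"
 "!!X x. X : Ob ==> x : car F X ==> nt g X x = 0[FO F'' X] ==> x : nt f X ` car F' X"
 "!!X. X : Ob ==> nt g X ` car F X = car F'' X" shows "F : polp n" using assms
proof (induction n arbitrary: F' F F'' f g)
 case 0
 note f = 0(1) and g = 0(2)
 have F': "F' : ObR" and F: "F : ObR" using Rep.ends[OF f] by auto
 have "dies F X x" if X: "X : Ob" and x: "x : car F X" for X x
 proof -
 have "dies F'' X (nt g X x)" using 0(4) nt_cl[OF g X x] X by (simp add: Kset_def)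
 then obtain Y ph where p: "ph : Hom X Y" "act F'' ph (nt g X x) = 0[FO F'' Y]" unfolding dies_def by blast
 have Y: "Y : Ob" using U.ends[OF p(1)] by simp
 obtain w where w: "w : car F' Y" "act F ph x = nt f Y w" using 0(5)[OF Y act_cl[OF F p(1) x]] nt_nat[OF g p(1) x] p(2) by auto
 have "dies F' Y w" using 0(3) w(1) Y by (simp add: Kset_def) hence "dies F Y (act F ph x)" using dies_nt[OF f Y w(1)] w(2) by simp
 thus ?thesis using dies_act_iff[OF F p(1) x] by blast qed thus ?case using F by (simp add: Kset_def)
next
 case (Suc n)
 note f = Suc.prems(1) and g = Suc.prems(2) and o = obj1_nat
 have F': "F' : ObR" and F: "F : ObR" and F'': "F'' : ObR" using Rep.ends[OF f] Rep.ends[OF g] by auto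
 obtain df where df: "df : RHom (dl F') (dl F)"
 "!!X x. X : Ob ==> x : car F' (1+X) ==> nt df X (dp one1 F' X x) = dp one1 F X (nt f (1+X) x)" using delta_map[OF o f] by metis
 obtain dg where dg: "dg : RHom (dl F) (dl F'')"
 "!!X x. X : Ob ==> x : car F (1+X) ==> nt dg X (dp one1 F X x) = dp one1 F'' X (nt g (1+X) x)" using delta_map[OF o g] by metis
 have "dl F : polp n"
 proof (rule Suc.IH[OF df(1) dg(1)])
 show "dl F' : polp n" "dl F'' : polp n" using Suc.prems(3,4) by simp_all
 fix X assume X: "X : Ob"
 note oX = X1[OF X] and s = st_UG[OF o X]
 show "nt dg X ` car (dl F) X = car (dl F'') X"
 unfolding delta(3)[OF o F X, symmetric] delta(3)[OF o F'' X, symmetric] Suc.prems(6)[OF oX, symmetric] image_image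
 by (rule image_cong[OF refl]) (rule dg(2)[OF X])
 fix z assume z: "z : car (dl F) X" and gz: "nt dg X z = 0[FO (dl F'') X]"
 obtain x where x: "x : car F (1+X)" "z = dp one1 F X x" using z unfolding delta(3)[OF o F X, symmetric] by blast
 have "dp one1 F'' X (nt g (1+X) x) = 0[FO (dl F'') X]" using dg(2)[OF X x(1)] gz x(2) by simp
 then obtain w where w: "w : car F'' X" "nt g (1+X) x = act F'' (st one1 X) w" using delta(4)[OF o F'' X nt_cl[OF g oX x(1)]] by blast
 obtain v where v: "v : car F X" "w = nt g X v" using w(1) unfolding Suc.prems(6)[OF X, symmetric] by blast
 interpret M: rmod R "FO F (1+X)" by (rule rmodI[OF rep_mod[OF F oX]])
 interpret M'': rmod R "FO F'' (1+X)" by (rule rmodI[OF rep_mod[OF F'' oX]])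
 note sv = act_cl[OF F s v(1)]
 have "nt g (1+X) (x -[FO F (1+X)] act F (st one1 X) v) = 0[FO F'' (1+X)]"
 unfolding M.lin_diff[OF M''.module_axioms nt_lin(1)[OF g oX] x(1) sv] nt_nat[OF g s v(1)] w(2) v(2)
 using act_cl[OF F'' s nt_cl[OF g X v(1)]] by (simp add: M''.diff_zero_iff)
 then obtain u where u: "u : car F' (1+X)" "x -[FO F (1+X)] act F (st one1 X) v = nt f (1+X) u"
 using Suc.prems(5)[OF oX, of "x -[FO F (1+X)] act F (st one1 X) v"] x(1) sv by auto
 have "x = nt f (1+X) u +[FO F (1+X)] act F (st one1 X) v" using M.diff_add[OF x(1) sv] u(2) by simp
 hence "z = dp one1 F X (nt f (1+X) u) +[FO (dl F) X] dp one1 F X (act F (st one1 X) v)"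
 using lin_add[OF delta(2)[OF o F X] nt_cl[OF f oX u(1)] sv] x(2) by simp
 also have "dp one1 F X (act F (st one1 X) v) = 0[FO (dl F) X]" using delta(4)[OF o F X sv] v(1) by blast
 also have "dp one1 F X (nt f (1+X) u) +[FO (dl F) X] 0[FO (dl F) X] = dp one1 F X (nt f (1+X) u)"
 proof -
 interpret D: rmod R "FO (dl F) X" by (rule rmodI[OF rep_mod[OF delta(1)[OF o F] X]])
 show ?thesis using lin_cl[OF delta(2)[OF o F X] nt_cl[OF f oX u(1)]] by simp qed
 also have "... = nt df X (dp one1 F' X u)" using df(2)[OF X u(1)] by simp
 finally show "z : nt df X ` car (dl F') X" using lin_cl[OF delta(2)[OF o F' X] u(1)] by blast qed thus ?case using F by simp
qed

lemma polp_mono: "polp n <= polp (Suc n)"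
proof (induction n)
 case 0
 show ?case
 proof
 fix F assume F0: "F : polp 0" hence F: "F : ObR" by (rule polp_Obj)
 note o = obj1_nat
 have "dies (dl F) X z" if X: "X : Ob" and z: "z : car (dl F) X" for X z
 proof -
 obtain x where x: "x : car F (1+X)" "z = dp one1 F X x" using z unfolding delta(3)[OF o F X, symmetric] by blast
 have "dies F (1+X) x" using F0 x(1) X1[OF X] by (simp add: Kset_def)
 then obtain Z ph where p: "ph : Hom X Z" "act F (sh one1 ph) x = 0[FO F (1+Z)]" using dies_sh[OF F X x(1)] by blast
 have Z: "Z : Ob" using U.ends[OF p(1)] by simp
 have "act (dl F) ph z = 0[FO (dl F) Z]" unfolding x(2) delta(5)[OF o F p(1) x(1)] p(2)
 by (rule rmod.lin_zero[OF rmodI[OF rep_mod[OF F X1[OF Z]]] rep_mod[OF delta(1)[OF o F] Z] delta(2)[OF o F Z]])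
 thus ?thesis using p(1) unfolding dies_def by blast qed thus "F : polp (Suc 0)" using F delta(1)[OF o F] by (simp add: Kset_def) qed
next
 case (Suc n) thus ?case by auto
qed

lemma polp_mono_le: "n <= n' ==> polp n <= polp n'" by (rule lift_Suc_mono_le[of polp]) (use polp_mono in auto)

text \<open>The translation is an extension of the difference of F by the image of F. In the stably
  zero case, translated arrows kill its elements.\<close>

lemma polp_tau1: assumes "F : polp n" shows "tau one1 F : polp n"
proof (cases n)
 case 0
 have F: "F : ObR" by (rule polp_Obj[OF assms])
 note o = obj1_nat
 have "dies (tau one1 F) X x" if X: "X : Ob" and x: "x : car (tau one1 F) X" for X x
 proof -
 have x': "x : car F (1+X)" using x by (simp add: tau(2)[OF o F X])
 have "dies F (1+X) x" using assms 0 x' X1[OF X] by (simp add: Kset_def)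
 then obtain Z ph where p: "ph : Hom X Z" "act F (sh one1 ph) x = 0[FO F (1+Z)]" using dies_sh[OF F X x'] by blast
 hence "act (tau one1 F) ph x = 0[FO (tau one1 F) Z]" using tau(3)[OF o F p(1)] tau(2)[OF o F, of Z] U.ends[OF p(1)] by simp
 thus ?thesis using p(1) unfolding dies_def by blast qed thus ?thesis using 0 tau(1)[OF o F] by (simp add: Kset_def)
next
 case (Suc k)
 have F: "F : ObR" by (rule polp_Obj[OF assms])
 note o = obj1_nat
 let ?i = "mk_nt F (%X. act F (st one1 X)) (tau one1 F)"
 let ?p = "mk_nt (tau one1 F) (dp one1 F) (dl F)"
 have i: "?i : RHom F (tau one1 F)"
 proof (rule mk_nt_in[OF F tau(1)[OF o F]])
 show "lin R (FO F X) (FO (tau one1 F) X) (act F (st one1 X))" if "X : Ob" for X using act_lin[OF F st_UG[OF o that]] by (simp add: tau(2)[OF o F that])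
 show "act F (st one1 Y) (act F ph x) = act (tau one1 F) ph (act F (st one1 X) x)" if "ph : Hom X Y" "x : car F X" for X Y ph x
 using st_nat[OF o F that] by (simp add: tau(3)[OF o F that(1)]) qed
 have p: "?p : RHom (tau one1 F) (dl F)"
 proof (rule mk_nt_in[OF tau(1)[OF o F] delta(1)[OF o F]])
 show "lin R (FO (tau one1 F) X) (FO (dl F) X) (dp one1 F X)" if "X : Ob" for X using delta(2)[OF o F that] by (simp add: tau(2)[OF o F that])
 show "dp one1 F Y (act (tau one1 F) ph x) = act (dl F) ph (dp one1 F X x)" if "ph : Hom X Y" "x : car (tau one1 F) X" for X Y ph x
 using that U.ends[OF that(1)] delta(5)[OF o F that(1)] by (simp add: tau(2)[OF o F] tau(3)[OF o F that(1)]) qed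
 have "dl F : polp n" using assms Suc polp_mono[of k] by auto
 show ?thesis
 proof (rule polp_ext[OF i p assms \<open>dl F : polp n\<close>])
 fix X assume X: "X : Ob"
 show "nt ?p X ` car (tau one1 F) X = car (dl F) X" unfolding delta(3)[OF o F X, symmetric] tau(2)[OF o F X]
 by (rule image_cong[OF refl]) (use X in \<open>simp add: tau(2)[OF o F X]\<close>)
 fix x assume x: "x : car (tau one1 F) X" "nt ?p X x = 0[FO (dl F) X]"
 hence "x : act F (st one1 X) ` car F X" using delta(4)[OF o F X, of x] X by (auto simp: tau(2)[OF o F X])
 also have "... = nt ?i X ` car F X" by (rule image_cong[OF refl]) (use X in simp) finally show "x : nt ?i X ` car F X" . qed
qed

lemma tau_tens: assumes m: "m : Obj_nat B" and F: "F : ObR" shows "tau (1+m) F = tau m (tau one1 F)"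
proof (rule rep_eqI)
 note o = obj1_nat
 note om = Obj_nat_tens[OF o m] and t1 = tau(1)[OF o F]
 show "tau (1+m) F : ObR" "tau m (tau one1 F) : ObR" by (rule tau(1)[OF om F], rule tau(1)[OF m t1])
 show "FO (tau (1+m) F) X = FO (tau m (tau one1 F)) X" if "X : Ob" for X
 using Obj_natD[OF m] that by (simp add: tau(2)[OF om F] tau(2)[OF m t1] tau(2)[OF o F] tensO_assoc obj1_in_Obj UG_Obj_B)
 show "act (tau (1+m) F) ph = act (tau m (tau one1 F)) ph" if "ph : Hom X Y" for X Y ph using sh_tensO[OF obj1_in_Obj Obj_natD(1)[OF m] UG_Homs'[OF that]]
 by (simp add: tau(3)[OF om F that] tau(3)[OF m t1 that] tau(3)[OF o F sh_UG[OF m that]])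
qed

lemma polp_tau: "F : polp n ==> tau (power1 B l) F : polp n"
proof (induction l arbitrary: F)
 case 0
 have F: "F : ObR" by (rule polp_Obj[OF 0])
 have u: "unitO B : Obj_nat B" using power1_nat[of 0] by simp
 have "tau (unitO B) F = F"
 proof (rule rep_eqI[OF tau(1)[OF u F] F])
 show "FO (tau (unitO B) F) X = FO F X" if "X : Ob" for X using that by (simp add: tau(2)[OF u F] tensO_unit_left UG_Obj_B)
 show "act (tau (unitO B) F) ph = act F ph" if ph: "ph : Hom X Y" for X Y ph
 proof -
 obtain Z f where Z: "Z : Obj B" "X : Obj B" "f : Homs B (Z ** X) Y" "ph = bracket B X Z f Y" using UG'_Homs UG_Homs'[OF ph] by blast
 have O: "Y : Obj B" using ends[OF Z(3)] by simp
 have b: "ibr (unitO B) Z = Id B Z"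
 proof -
 have i: "ibr (unitO B) Z : Homs B Z Z" using ibr_in[OF unitO_in_Obj Z(1)] by (simp add: tensO_unit_left tensO_unit_right Z(1))
 have "ibr (unitO B ** unitO B) Z = (Id B (unitO B) ## ibr (unitO B) Z) \<bullet> (ibr (unitO B) Z ## Id B (unitO B))"
 by (rule ibr_hex_left[OF unitO_in_Obj unitO_in_Obj Z(1)])
 hence "ibr (unitO B) Z \<bullet> Id B Z = ibr (unitO B) Z \<bullet> ibr (unitO B) Z"
 using unit_left'[OF i] unit_right'[OF i] Comp_Id_right[OF i] by (simp add: tensO_unit_left unitO_in_Obj)
 from invertible_cancel_left[OF inv_arr[OF i] i Id_in[OF Z(1)] i this] show ?thesis .. qed
 have "sh (unitO B) ph = ph" unfolding Z(4) sh_bracket(1)[OF unitO_in_Obj Z(1-3)] unit_left'[OF Z(3)] b tensA_Id[OF Z(1,2)] Comp_Id_right[OF Z(3)]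
 by (simp add: tensO_unit_left Z(2) O) thus ?thesis by (simp add: tau(3)[OF u F ph]) qed qed thus ?case using 0 by simp
next
 case (Suc l)
 show ?case using Suc.IH[OF polp_tau1[OF Suc.prems]] tau_tens[OF power1_nat polp_Obj[OF Suc.prems]] by simp
qed

text \<open>Induction on l through the sequence from the difference for m, to that for 1 + m, to the
  m-translate of the difference for 1: it is exact in the middle and onto at the end.\<close>

lemma polp_delta_power: "F : polp (Suc n) ==> delta R B (power1 B l) F : polp n"
proof (induction l)
 case 0
 have F: "F : ObR" by (rule polp_Obj[OF 0])
 have u: "unitO B : Obj_nat B" using power1_nat[of 0] by simp
 have "dies (delta R B (unitO B) F) X z" if X: "X : Ob" and z: "z : car (delta R B (unitO B) F) X" for X z
 proof -
 obtain x where x: "x : car F (unitO B ** X)" "z = dp (unitO B) F X x" using z unfolding delta(3)[OF u F X, symmetric] by blast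
 have "x : car F X" using x(1) by (simp add: tensO_unit_left UG_Obj_B[OF X])
 hence "x = act F (st (unitO B) X) x" using act_Id[OF F X] st_unit[OF UG_Obj_B[OF X]] by (simp add: UG_simps)
 hence "z = 0[FO (delta R B (unitO B) F) X]" using delta(4)[OF u F X x(1)] x(2) \<open>x : car F X\<close> by blast
 thus ?thesis using dies_zero[OF delta(1)[OF u F] X] by simp qed
 hence "delta R B (unitO B) F : polp 0" using delta(1)[OF u F] by (simp add: Kset_def) thus ?case using polp_mono_le[of 0 n] by auto
next
 case (Suc l)
 let ?m = "power1 B l"
 note o = obj1_nat and m = power1_nat[of l]
 note om = Obj_nat_tens[OF o m]
 have F: "F : ObR" by (rule polp_Obj[OF Suc.prems])
 note D = delta(1)[OF o F]
 have mB: "?m : Obj B" by (rule power1_in)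
 have assoc: "(1+?m) ** X = 1+(?m ** X)" if "X : Ob" for X by (rule tensO_assoc[OF obj1_in_Obj mB UG_Obj_B[OF that]])
 have stt: "act F (st (1+?m) X) x = act F (st one1 (?m ** X)) (act F (st ?m X) x)" if "X : Ob" "x : car F X" for X x
 using act_Comp[OF F st_UG[OF m that(1)] st_UG[OF o Obj_natD(2)[OF m that(1)]] that(2)]
 st_tensO[OF obj1_in_Obj mB UG_Obj_B[OF that(1)]] by (simp add: UG_simps)
 have sht: "sh (1+?m) ph = sh one1 (sh ?m ph)" if "ph : Hom X Y" for X Y ph by (rule sh_tensO[OF obj1_in_Obj mB UG_Homs'[OF that]])
 obtain a where a: "a : RHom (delta R B ?m F) (delta R B (1+?m) F)"
 "!!X x. X : Ob ==> x : car F (?m ** X) ==> nt a X (dp ?m F X x) = dp (1+?m) F X (act F (st one1 (?m ** X)) x)"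
 proof -
 have h1: "lin R (FO F (?m ** X)) (FO (delta R B (1+?m) F) X) (%x. dp (1+?m) F X (act F (st one1 (?m ** X)) x))"
 if X: "X : Ob" for X using lin_comp[OF act_lin[OF F st_UG[OF o Obj_natD(2)[OF m X]]] delta(2)[OF om F X, unfolded assoc[OF X]]] .
 have h2: "dp (1+?m) F X (act F (st one1 (?m ** X)) (act F (st ?m X) x)) = 0[FO (delta R B (1+?m) F) X]"
 if X: "X : Ob" and x: "x : car F X" for X x unfolding stt[OF X x, symmetric] using delta(4)[OF om F X act_cl[OF F st_UG[OF om X] x]] x by blast
 have h3: "dp (1+?m) F Y (act F (st one1 (?m ** Y)) (act F (sh ?m ph) x)) =
 act (delta R B (1+?m) F) ph (dp (1+?m) F X (act F (st one1 (?m ** X)) x))"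
 if ph: "ph : Hom X Y" and x: "x : car F (?m ** X)" for X Y ph x
 proof -
 have X: "X : Ob" using U.ends[OF ph] by simp
 have c: "act F (st one1 (?m ** X)) x : car F ((1+?m) ** X)" unfolding assoc[OF X] by (rule act_cl[OF F st_UG[OF o Obj_natD(2)[OF m X]] x])
 show ?thesis unfolding delta(5)[OF om F ph c] sht[OF ph] st_nat[OF o F sh_UG[OF m ph] x] .. qed
 show thesis using delta_arrow[OF m F delta(1)[OF om F] h1 h2 h3] that by metis qed
 \<comment> \<open>The projection that forgets only the elements coming from m + X, with m added but
   not the outer 1.\<close>
 obtain b where b: "b : RHom (delta R B (1+?m) F) (tau ?m (dl F))"
 "!!X x. X : Ob ==> x : car F ((1+?m) ** X) ==> nt b X (dp (1+?m) F X x) = dp one1 F (?m ** X) x"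
 proof -
 have h1: "lin R (FO F ((1+?m) ** X)) (FO (tau ?m (dl F)) X) (dp one1 F (?m ** X))" if X: "X : Ob" for X
 unfolding assoc[OF X] tau(2)[OF m D X] by (rule delta(2)[OF o F Obj_natD(2)[OF m X]])
 have h2: "dp one1 F (?m ** X) (act F (st (1+?m) X) x) = 0[FO (tau ?m (dl F)) X]" if X: "X : Ob" and x: "x : car F X" for X x
 proof -
 have mX: "?m ** X : Ob" by (rule Obj_natD(2)[OF m X])
 have c: "act F (st ?m X) x : car F (?m ** X)" by (rule act_cl[OF F st_UG[OF m X] x])
 show ?thesis unfolding tau(2)[OF m D X] stt[OF X x] using delta(4)[OF o F mX act_cl[OF F st_UG[OF o mX] c]] c by blast qed
 have h3: "dp one1 F (?m ** Y) (act F (sh (1+?m) ph) x) = act (tau ?m (dl F)) ph (dp one1 F (?m ** X) x)"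
 if ph: "ph : Hom X Y" and x: "x : car F ((1+?m) ** X)" for X Y ph x
 proof -
 have X: "X : Ob" using U.ends[OF ph] by simp
 show ?thesis unfolding sht[OF ph] tau(3)[OF m D ph] using delta(5)[OF o F sh_UG[OF m ph], of x] x by (simp add: assoc[OF X]) qed
 show thesis using delta_arrow[OF om F tau(1)[OF m D] h1 h2 h3] that by metis qed
 have t: "tau ?m (dl F) : polp n" by (rule polp_tau) (use Suc.prems in simp)
 have "delta R B (1+?m) F : polp n"
 proof (rule polp_ext[OF a(1) b(1) Suc.IH[OF Suc.prems] t])
 fix X assume X: "X : Ob"
 note mX = Obj_natD(2)[OF m X]
 show "nt b X ` car (delta R B (1+?m) F) X = car (tau ?m (dl F)) X"
 unfolding delta(3)[OF om F X, symmetric] tau(2)[OF m D X] delta(3)[OF o F mX, symmetric] image_image assoc[OF X]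
 by (rule image_cong[OF refl]) (use b(2)[OF X] in \<open>simp add: assoc[OF X]\<close>)
 fix z assume z: "z : car (delta R B (1+?m) F) X" "nt b X z = 0[FO (tau ?m (dl F)) X]"
 obtain y where y: "y : car F (1+(?m ** X))" "z = dp (1+?m) F X y" using z(1) unfolding delta(3)[OF om F X, symmetric] assoc[OF X] by blast
 have "dp one1 F (?m ** X) y = 0[FO (dl F) (?m ** X)]" using b(2)[OF X, of y] y z(2) by (simp add: assoc[OF X] tau(2)[OF m D X])
 then obtain x where x: "x : car F (?m ** X)" "y = act F (st one1 (?m ** X)) x" using delta(4)[OF o F mX y(1)] by blast
 have "z = nt a X (dp ?m F X x)" using a(2)[OF X x(1)] y(2) x(2) by simp
 thus "z : nt a X ` car (delta R B ?m F) X" using lin_cl[OF delta(2)[OF m F X] x(1)] by blast qed thus ?case by simp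
qed

text \<open>An isomorphism of m with a power of 1 presents the difference for m as a quotient of the
  difference for that power.\<close>

lemma polp_delta: assumes F: "F : polp (Suc n)" and m: "m : Obj_nat B" shows "delta R B m F : polp n"
proof -
 obtain l ps where ps: "ps : Homs B (power1 B l) m" using Obj_nat_iso[OF m] by blast
 have FR: "F : ObR" by (rule polp_Obj[OF F])
 let ?p = "power1 B l"
 note p = power1_nat[of l]
 let ?c = "%X. lift_arr B (ps ## Id B X)"
 let ?d = "%X. lift_arr B (Inv B ps ## Id B X)"
 have c: "?c X : Hom (?p ** X) (m ** X)" if "X : Ob" for X
 by (rule lift_UG[OF tensA_in[OF ps Id_in[OF UG_Obj_B[OF that]]]]) (use Obj_natD(2) p m that in auto)
 have d: "?d X : Hom (m ** X) (?p ** X)" if "X : Ob" for X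
 by (rule lift_UG[OF tensA_in[OF Inv_in[OF ps] Id_in[OF UG_Obj_B[OF that]]]]) (use Obj_natD(2) p m that in auto)
 have cd: "?c X o[UB] ?d X = Id UB (m ** X)" if X: "X : Ob" for X
 proof -
 note XB = UG_Obj_B[OF X]
 have "(ps ## Id B X) \<bullet> (Inv B ps ## Id B X) = Id B (m ** X)"
 unfolding whisk_right[OF XB Inv_in[OF ps] ps, symmetric] Inv_r[OF ps] by (rule tensA_Id[OF Obj_natD(1)[OF m] XB])
 thus ?thesis using lift_Comp[OF tensA_in[OF Inv_in[OF ps] Id_in[OF XB]] tensA_in[OF ps Id_in[OF XB]]]
 lift_Id[OF tensO_in_Obj[OF Obj_natD(1)[OF m] XB]] by (simp add: UG_simps) qed
 obtain a where a: "a : RHom (delta R B ?p F) (delta R B m F)"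
 "!!X x. X : Ob ==> x : car F (?p ** X) ==> nt a X (dp ?p F X x) = dp m F X (act F (?c X) x)"
 proof -
 have h1: "lin R (FO F (?p ** X)) (FO (delta R B m F) X) (%x. dp m F X (act F (?c X) x))" if X: "X : Ob" for X
 by (rule lin_comp[OF act_lin[OF FR c[OF X]] delta(2)[OF m FR X]])
 have h2: "dp m F X (act F (?c X) (act F (st ?p X) x)) = 0[FO (delta R B m F) X]" if X: "X : Ob" and x: "x : car F X" for X x
 proof -
 have "?c X o[UB] st ?p X = st m X" using lift_st[OF ps UG_Obj_B[OF X]] by (simp add: UG_simps)
 hence "act F (?c X) (act F (st ?p X) x) = act F (st m X) x" using act_Comp[OF FR st_UG[OF p X] c[OF X] x] by simp
 thus ?thesis using delta(4)[OF m FR X act_cl[OF FR st_UG[OF m X] x]] x by simp qed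
 have h3: "dp m F Y (act F (?c Y) (act F (sh ?p ph) x)) = act (delta R B m F) ph (dp m F X (act F (?c X) x))"
 if ph: "ph : Hom X Y" and x: "x : car F (?p ** X)" for X Y ph x
 proof -
 have X: "X : Ob" "Y : Ob" using U.ends[OF ph] by auto
 have "?c Y o[UB] sh ?p ph = sh m ph o[UB] ?c X" using lift_natural[OF ps UG_Homs'[OF ph]] by (simp add: UG_simps)
 hence "act F (?c Y) (act F (sh ?p ph) x) = act F (sh m ph) (act F (?c X) x)"
 using act_Comp[OF FR sh_UG[OF p ph] c[OF X(2)] x] act_Comp[OF FR c[OF X(1)] sh_UG[OF m ph] x] by simp
 thus ?thesis using delta(5)[OF m FR ph act_cl[OF FR c[OF X(1)] x]] by simp qed
 show thesis using delta_arrow[OF p FR delta(1)[OF m FR] h1 h2 h3] that by metis qed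
 show ?thesis
 proof (rule polp_quot_surj[OF a(1) polp_delta_power[OF F]])
 fix X assume X: "X : Ob"
 show "nt a X ` car (delta R B ?p F) X = car (delta R B m F) X"
 proof
 show "nt a X ` car (delta R B ?p F) X <= car (delta R B m F) X" using nt_cl[OF a(1) X] by blast
 show "car (delta R B m F) X <= nt a X ` car (delta R B ?p F) X"
 proof
 fix z assume "z : car (delta R B m F) X"
 then obtain x where x: "x : car F (m ** X)" "z = dp m F X x" unfolding delta(3)[OF m FR X, symmetric] by blast
 have dx: "act F (?d X) x : car F (?p ** X)" by (rule act_cl[OF FR d[OF X] x(1)])
 have "act F (?c X) (act F (?d X) x) = x" using act_Comp[OF FR d[OF X] c[OF X] x(1)] cd[OF X] act_Id[OF FR Obj_natD(2)[OF m X] x(1)] by simp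
 hence "z = nt a X (dp ?p F X (act F (?d X) x))" using a(2)[OF X dx] x(2) by simp
 thus "z : nt a X ` car (delta R B ?p F) X" using lin_cl[OF delta(2)[OF p FR X] dx] by blast qed qed qed
qed

lemma polp_Suc_iff: "F : polp (Suc n) <-> F : ObR & (ALL m : Obj_nat B. delta R B m F : polp n)" using polp_delta polp_Obj obj1_nat by auto

end

section \<open>Partial equivalence relations as a category\<close>

text \<open>Sets with a partial equivalence relation, and relations that are saturated, total and
  single-valued up to equivalence. It models maps between quotient sets without forming quotients.
  \<open>O\<close> composes from left to right, hence the order in \<open>Comp\<close>.\<close>

definition per_cat :: "'o set => ('o => 'x rel) => ('o, 'o \<times> 'x rel \<times> 'o) cat" where
 "per_cat Ob E = \<lparr>Obj = Ob,
 Arr = {(X, r, Y). X : Ob & Y : Ob & E X O r = r & r O E Y = r & E X <= r O r\<inverse> & r\<inverse> O r <= E Y},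
 Dom = (%(X, r, Y). X), Cod = (%(X, r, Y). Y), Id = (%X. (X, E X, X)),
 Comp = (%(_, s, Z) (X, r, _). (X, r O s, Z))\<rparr>"

lemma pc_simps:
 "Obj (per_cat Ob E) = Ob"
 "(X, r, Y) : Homs (per_cat Ob E) X' Y' <-> X' = X & Y' = Y & X : Ob & Y : Ob & E X O r = r & r O E Y = r &
 E X <= r O r\<inverse> & r\<inverse> O r <= E Y"
 "Id (per_cat Ob E) X = (X, E X, X)"
 "(Y', s, Z) o[per_cat Ob E] (X, r, Y) = (X, r O s, Z)" by (auto simp: per_cat_def Homs_def)

lemma per_cat_form: "f : Homs (per_cat Ob E) X Y ==> EX r. f = (X, r, Y)" by (cases f) (simp only: pc_simps, blast)

lemma category_per_cat: assumes "!!X. X : Ob ==> sym (E X) & trans (E X)" shows "category (per_cat Ob E)"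
proof (unfold_locales, goal_cases)
 case (1 f) thus ?case by (auto simp: per_cat_def)
next
 case (2 f) thus ?case by (auto simp: per_cat_def)
next
 case (3 X) hence X: "X : Ob" and E: "sym (E X)" "trans (E X)" using assms by (auto simp: pc_simps)
 have c: "(E X)\<inverse> = E X" using E(1) by (auto dest: symD)
 have "E X <= E X O E X"
 proof (rule subrelI)
 fix x y assume xy: "(x, y) : E X"
 have "(x, x) : E X" by (rule transD[OF E(2) xy symD[OF E(1) xy]]) thus "(x, y) : E X O E X" using xy by (rule relcompI) qed
 from subset_antisym[OF trans_O_subset[OF E(2)] this] have e: "E X O E X = E X" .
 show ?case unfolding pc_simps using X by (simp only: c e) simp
next
 case (4 f X Y g Z)
 obtain r s where f: "f = (X, r, Y)" and g: "g = (Y, s, Z)" using per_cat_form[OF 4(1)] per_cat_form[OF 4(2)] by blast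
 note a = 4(1)[unfolded f pc_simps] and b = 4(2)[unfolded g pc_simps]
 have a: "E X O r = r" "r O E Y = r" "E X <= r O r\<inverse>" "r\<inverse> O r <= E Y" "X : Ob" using a by - ((elim conjE, assumption)+)
 have b: "E Y O s = s" "s O E Z = s" "E Y <= s O s\<inverse>" "s\<inverse> O s <= E Z" "Z : Ob" using b by - ((elim conjE, assumption)+)
 have "r O r\<inverse> = (r O E Y) O r\<inverse>" by (simp only: a(2))
 also have "... <= (r O (s O s\<inverse>)) O r\<inverse>" by (intro relcomp_mono subset_refl b(3))
 finally have 1: "E X <= (r O s) O (r O s)\<inverse>" using a(3) by (simp only: converse_relcomp O_assoc)
 have "(r O s)\<inverse> O (r O s) = s\<inverse> O ((r\<inverse> O r) O s)" by (simp only: converse_relcomp O_assoc)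
 also have "... <= s\<inverse> O (E Y O s)" by (intro relcomp_mono subset_refl a(4))
 finally have 2: "(r O s)\<inverse> O (r O s) <= E Z" using b(1,4) by blast
 show ?case unfolding f g pc_simps using 1 2 a(5) b(2,5) O_assoc[of r s "E Z"] O_assoc[of "E X" r s, symmetric] a(1) by simp
next
 case (5 f W X g Y h Z) thus ?case by (cases f; cases g; cases h) (simp add: pc_simps O_assoc)
next
 case (6 f X Y) thus ?case by (cases f) (simp add: pc_simps)
next
 case (7 f X Y) thus ?case by (cases f) (simp add: pc_simps)
qed

text \<open>When the relation is also injective and onto up to equivalence, its converse is an arrow
  and the inverse.\<close>

lemma per_cat_invertible: assumes E: "!!X. X : Ob ==> sym (E X) & trans (E X)" and f: "(X, r, Y) : Homs (per_cat Ob E) X Y"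
 and i: "r O r\<inverse> <= E X" and s: "E Y <= r\<inverse> O r" shows "invble (per_cat Ob E) (X, r, Y)"
proof -
 interpret category "per_cat Ob E" by (rule category_per_cat[OF E])
 have a: "X : Ob" "Y : Ob" "E X O r = r" "r O E Y = r" "E X <= r O r\<inverse>" "r\<inverse> O r <= E Y" using f unfolding pc_simps by blast+
 have c: "(E X)\<inverse> = E X" "(E Y)\<inverse> = E Y" using E a(1,2) by (auto dest: symD)
 have e: "r O r\<inverse> = E X" "r\<inverse> O r = E Y" using a(5,6) i s by blast+
 have "E Y O r\<inverse> = (r O E Y)\<inverse>" "r\<inverse> O E X = (E X O r)\<inverse>" by (simp_all only: converse_relcomp c)
 hence "inverse_arrows (per_cat Ob E) (X, r, Y) (Y, r\<inverse>, X)" unfolding inverse_iff[OF f] pc_simps using a e by simp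
 thus ?thesis unfolding invble_def by blast
qed

section \<open>Kernels, cokernels and stable isomorphisms\<close>

lemma is_kernelD:
 "[|is_kernel C f k; g : Arr C; Cod C g = Dom C f; zero_arrow C (f o[C] g)|]
 ==> EX u : Homs C (Dom C g) (Dom C k). k o[C] u = g" unfolding is_kernel_def by blast

lemma is_cokernelD:
 "[|is_cokernel C f c; g : Arr C; Dom C g = Cod C f; zero_arrow C (g o[C] f)|]
 ==> EX u : Homs C (Cod C c) (Cod C g). u o[C] c = g" unfolding is_cokernel_def by blast

context rep_setting
begin

abbreviation ob :: "nat => 'o" where "ob == uobj B"

lemma ob_in: "ob n : Ob" unfolding UG_Obj by blast

abbreviation incl :: "('o, 'm, 'r, 'u) rep => ('o => 'u set) => ('o, 'm, 'r, 'u) rep_arr" where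
 "incl F N == mk_nt (sub_rep F N) (%X x. x) F"

abbreviation proj :: "('o, 'm, 'r, 'u) rep => ('o => 'u set) => ('o, 'm, 'r, 'u) rep_arr" where
 "proj F N == mk_nt F (qpr F N) (quot_rep F N)"

abbreviation zmap :: "('o, 'm, 'r, 'u) rep => ('o, 'm, 'r, 'u) rep => ('o, 'm, 'r, 'u) rep_arr" where
 "zmap F G == mk_nt F (%X x. 0[FO G X]) G"

lemma zmap_in: "F : ObR ==> G : ObR ==> zmap F G : RHom F G" using act_zero by (intro mk_nt_in) (auto intro: rmod.lin_const_zero[OF rmodI] rep_mod)

lemma nt_incl: "F : ObR ==> subrep F N ==> X : Ob ==> x : N X ==> nt (incl F N) X x = x" by (simp add: sub_rep(3))

lemma sub_factor: assumes F: "F : ObR" and N: "subrep F N" and g: "g : RHom P F" and c: "!!X x. X : Ob ==> x : car P X ==> nt g X x : N X"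
 obtains u where "u : RHom P (sub_rep F N)" "incl F N o[Rep] u = g"
proof -
 let ?u = "mk_nt P (nt g) (sub_rep F N)"
 have P: "P : ObR" using Rep.ends[OF g] by simp
 have u: "?u : RHom P (sub_rep F N)"
 proof (rule mk_nt_in[OF P sub_rep(1)[OF F N]])
 show "lin R (FO P X) (FO (sub_rep F N) X) (nt g X)" if "X : Ob" for X using sub_rep(6)[OF F N that] nt_lin(1)[OF g that] c[OF that] by blast
 show "nt g Y (act P ph x) = act (sub_rep F N) ph (nt g X x)" if "ph : Hom X Y" "x : car P X" for X Y ph x
 using nt_nat[OF g that] sub_rep(4)[OF F N that(1)] c that(2) U.ends[OF that(1)] by simp qed
 moreover have "incl F N o[Rep] ?u = g" by (rule nt_ext[OF Rep.Comp_in[OF u sub_rep(2)[OF F N]] g])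
 (simp add: nt_Comp[OF u sub_rep(2)[OF F N]] c sub_rep(3)[OF F N]) ultimately show thesis by (rule that)
qed

lemma quot_factor: assumes F: "F : ObR" and N: "subrep F N" and g: "g : RHom F P"
 and c: "!!X x. X : Ob ==> x : N X ==> nt g X x = 0[FO P X]"
 obtains u where "u : RHom (quot_rep F N) P" "u o[Rep] proj F N = g"
proof -
 have P: "P : ObR" using Rep.ends[OF g] by simp
 obtain u where u: "u : RHom (quot_rep F N) P" "!!X x. X : Ob ==> x : car F X ==> nt u X (qpr F N X x) = nt g X x"
 using quot_arrow[OF F N P nt_lin(1)[OF g] c nt_nat[OF g]] by metis
 note p = quot_proj_nt[OF F N]
 have "u o[Rep] proj F N = g" by (rule nt_ext[OF Rep.Comp_in[OF p u(1)] g]) (simp add: nt_Comp[OF p u(1)] u(2))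
 thus thesis using that u(1) by blast
qed

definition kr :: "('o, 'm, 'r, 'u) rep_arr => 'o => 'u set" where
 "kr f X = {x : car (Dom Rep f) X. nt f X x = 0[FO (Cod Rep f) X]}"

definition im :: "('o, 'm, 'r, 'u) rep_arr => 'o => 'u set" where
 "im f X = nt f X ` car (Dom Rep f) X"

lemma kr_im: "f : RHom F G ==> kr f X = {x : car F X. nt f X x = 0[FO G X]} & im f X = nt f X ` car F X" by (auto simp: kr_def im_def Homs_def)

lemma subrep_kr: assumes f: "f : RHom F G" shows "subrep F (kr f)" unfolding subrep_def kr_im[OF f, THEN conjunct1]
proof (intro conjI ballI allI)
 have FG: "F : ObR" "G : ObR" using Rep.ends[OF f] by auto
 show "submodule {x : car F X. nt f X x = 0[FO G X]} R (FO F X)" if "X : Ob" for X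
 using rmod.submodule_kernel[OF rmodI[OF rep_mod[OF FG(1) that]] rep_mod[OF FG(2) that] nt_lin(1)[OF f that]] .
 show "act F ph x : {x : car F Y. nt f Y x = 0[FO G Y]}" if "ph : Hom X Y" "x : {x : car F X. nt f X x = 0[FO G X]}" for X Y ph x
 using that act_cl[OF FG(1) that(1)] nt_nat[OF f that(1)] act_zero[OF FG(2) that(1)] by auto
qed

lemma subrep_im: assumes f: "f : RHom F G" shows "subrep G (im f)" unfolding subrep_def kr_im[OF f, THEN conjunct2]
proof (intro conjI ballI allI)
 have FG: "F : ObR" "G : ObR" using Rep.ends[OF f] by auto
 show "submodule (nt f X ` car F X) R (FO G X)" if "X : Ob" for X
 using rmod.submodule_image[OF rmodI[OF rep_mod[OF FG(1) that]] rep_mod[OF FG(2) that] nt_lin(1)[OF f that]] .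
 show "act G ph y : nt f Y ` car F Y" if "ph : Hom X Y" "y : nt f X ` car F X" for X Y ph y
 using that(2) act_cl[OF FG(1) that(1)] nt_nat[OF f that(1), symmetric] by auto
qed

abbreviation "Ker f == sub_rep (Dom Rep f) (kr f)"
abbreviation "Coker f == quot_rep (Cod Rep f) (im f)"
abbreviation "ker_in f == incl (Dom Rep f) (kr f)"
abbreviation "coker_pr f == proj (Cod Rep f) (im f)"

lemma ker_in_Homs: "f : RHom F G ==> ker_in f : RHom (Ker f) F"
 using sub_rep(2)[of F "kr f"] subrep_kr[of f F G] Rep.ends[of f F G] HomsD[of f Rep F G] by simp

lemma coker_in: "f : RHom F G ==> coker_pr f : RHom G (Coker f)"
 using quot_proj_nt[of G "im f"] subrep_im[of f F G] Rep.ends[of f F G] HomsD[of f Rep F G] by simp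

lemma ker_coker:
 assumes f: "f : RHom F G" and X: "X : Ob" shows "car (Ker f) X = {x : car F X. nt f X x = 0[FO G X]}" "x : car (Ker f) X ==> nt (ker_in f) X x = x"
 "nt (coker_pr f) X ` car G X = car (Coker f) X"
 "y : car G X ==> nt (coker_pr f) X y = 0[FO (Coker f) X] <-> y : nt f X ` car F X"
proof -
 have F: "Dom Rep f : ObR" "subrep (Dom Rep f) (kr f)" and G: "Cod Rep f : ObR" "subrep (Cod Rep f) (im f)" and e: "Dom Rep f = F" "Cod Rep f = G"
 using Rep.ends[OF f] subrep_kr[OF f] subrep_im[OF f] HomsD[OF f] by simp_all
 show "car (Ker f) X = {x : car F X. nt f X x = 0[FO G X]}" using sub_rep(3)[OF F X] kr_im[OF f] by simp
 show "nt (ker_in f) X x = x" if "x : car (Ker f) X" using that X by simp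
 have "nt (coker_pr f) X ` car G X = qpr (Cod Rep f) (im f) X ` car G X" by (rule image_cong[OF refl]) (use X e in simp)
 thus "nt (coker_pr f) X ` car G X = car (Coker f) X" using quot_rep(3)[OF G X] e by simp
 show "nt (coker_pr f) X y = 0[FO (Coker f) X] <-> y : nt f X ` car F X" if "y : car G X" using quot_rep(4)[OF G X, of y] that e X kr_im[OF f] by simp
qed

lemma zero_object_Rep: assumes "zero_object Rep Z" "X : Ob" "x : car Z X" shows "x = 0[FO Z X]"
proof -
 have Z: "Z : ObR" "EX! f. f : RHom Z Z" using assms(1) unfolding zero_object_def by blast+
 have "Id Rep Z = zmap Z Z" using Z(2) Rep.Id_in_Homs[OF Z(1)] zmap_in[OF Z(1) Z(1)] by blast
 hence "nt (Id Rep Z) X x = nt (zmap Z Z) X x" by simp thus ?thesis using assms nt_Id[OF Z(1)] by simp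
qed

lemma zmap_unique: assumes f: "f : RHom F G" and "!!X x. X : Ob ==> x : car F X ==> nt f X x = 0[FO G X]" shows "f = zmap F G"
 by (rule nt_ext[OF f zmap_in]) (use assms Rep.ends[OF f] in auto)

lemma zmap_Comp: assumes "f : RHom F G" "H : ObR" shows "f o[Rep] zmap H F = zmap H G" "zmap G H o[Rep] f = zmap F H"
proof -
 have z: "zmap H F : RHom H F" "zmap G H : RHom G H" using zmap_in assms Rep.ends by blast+
 show "f o[Rep] zmap H F = zmap H G" by (rule zmap_unique[OF Rep.Comp_in[OF z(1) assms(1)]]) (simp add: nt_Comp[OF z(1) assms(1)] nt_zero[OF assms(1)])
 show "zmap G H o[Rep] f = zmap F H" by (rule zmap_unique[OF Rep.Comp_in[OF assms(1) z(2)]]) (simp add: nt_Comp[OF assms(1) z(2)] nt_cl[OF assms(1)])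
qed

lemma zero_object_zero_rep: "zero_object Rep zero_rep" unfolding zero_object_def
proof (intro conjI ballI zero_rep(1))
 fix F assume F: "F : ObR"
 have "f = zmap F zero_rep" if f: "f : RHom F zero_rep" for f using zmap_unique[OF f] nt_cl[OF f] zero_rep(2) by blast
 thus "EX! f. f : RHom F zero_rep" using zmap_in[OF F zero_rep(1)] by blast
 have "f = zmap zero_rep F" if f: "f : RHom zero_rep F" for f by (rule zmap_unique[OF f]) (use nt_zero[OF f] zero_rep(2) in simp)
 thus "EX! f. f : RHom zero_rep F" using zmap_in[OF zero_rep(1) F] by blast
qed

lemma zero_arrow_Rep: assumes f: "f : RHom F G" shows "zero_arrow Rep f <-> f = zmap F G"
proof
 have FG: "F : ObR" "G : ObR" using Rep.ends[OF f] by auto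
 assume "zero_arrow Rep f"
 then obtain Z u v where z: "zero_object Rep Z" "u : RHom F Z" "v : RHom Z G" "f = v o[Rep] u" unfolding zero_arrow_def using HomsD[OF f] by auto
 have "u = zmap F Z" using zmap_unique[OF z(2)] zero_object_Rep[OF z(1)] nt_cl[OF z(2)] by blast
 thus "f = zmap F G" using zmap_Comp(1)[OF z(3) FG(1)] z(4) by simp
next
 have FG: "F : ObR" "G : ObR" using Rep.ends[OF f] by auto
 assume "f = zmap F G" hence "f = zmap zero_rep G o[Rep] zmap F zero_rep" using zmap_Comp(1)[OF zmap_in[OF zero_rep(1) FG(2)] FG(1)] by simp
 thus "zero_arrow Rep f" unfolding zero_arrow_def HomsD[OF f, THEN conjunct2, THEN conjunct1] HomsD[OF f, THEN conjunct2, THEN conjunct2]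
 by (intro exI conjI) (rule zero_object_zero_rep zmap_in zero_rep(1) FG | assumption)+
qed

lemma zero_kc: assumes f: "f : RHom F G" shows "f o[Rep] ker_in f = zmap (Ker f) G" "coker_pr f o[Rep] f = zmap F (Coker f)"
proof -
 note k = ker_in_Homs[OF f] and c = coker_in[OF f]
 show "f o[Rep] ker_in f = zmap (Ker f) G" by (rule zmap_unique[OF Rep.Comp_in[OF k f]])
 (simp only: nt_Comp[OF k f] ker_coker(2)[OF f], simp add: ker_coker(1)[OF f])
 show "coker_pr f o[Rep] f = zmap F (Coker f)"
 proof (rule zmap_unique[OF Rep.Comp_in[OF f c]])
 fix X x assume X: "X : Ob" and x: "x : car F X"
 thus "nt (coker_pr f o[Rep] f) X x = 0[FO (Coker f) X]" unfolding nt_Comp[OF f c X x] ker_coker(4)[OF f X nt_cl[OF f X x]] by blast qed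
qed

lemma ker_factor: assumes f: "f : RHom F G" and g: "g : RHom P F" and z: "f o[Rep] g = zmap P G"
 obtains u where "u : RHom P (Ker f)" "ker_in f o[Rep] u = g"
proof -
 have F: "Dom Rep f : ObR" "subrep (Dom Rep f) (kr f)" "g : RHom P (Dom Rep f)" using Rep.ends[OF f] subrep_kr[OF f] HomsD[OF f] g by simp_all
 have e: "nt g X x : kr f X" if "X : Ob" "x : car P X" for X x using nt_Comp[OF g f that] z that nt_cl[OF g that] kr_im[OF f] by simp
 show thesis by (rule sub_factor[OF F e]) (assumption | rule that)+
qed

lemma coker_factor: assumes f: "f : RHom F G" and g: "g : RHom G P" and z: "g o[Rep] f = zmap F P"
 obtains u where "u : RHom (Coker f) P" "u o[Rep] coker_pr f = g"
proof -
 have G: "Cod Rep f : ObR" "subrep (Cod Rep f) (im f)" "g : RHom (Cod Rep f) P" using Rep.ends[OF f] subrep_im[OF f] HomsD[OF f] g by simp_all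
 have e: "nt g X y = 0[FO P X]" if X: "X : Ob" and y: "y : im f X" for X y
 proof -
 obtain x where x: "x : car F X" "y = nt f X x" using y kr_im[OF f] by blast
 have "nt g X y = nt (zmap F P) X x" unfolding x(2) z[symmetric] nt_Comp[OF f g X x(1)] .. thus ?thesis using X x(1) by simp qed
 show thesis by (rule quot_factor[OF G e]) (assumption | rule that)+
qed

lemma ker_mono: assumes f: "f : RHom F G" and u: "u : RHom P (Ker f)" "u' : RHom P (Ker f)"
 and "ker_in f o[Rep] u = ker_in f o[Rep] u'" shows "u = u'"
proof (rule nt_ext[OF u])
 note k = ker_in_Homs[OF f]
 fix X x assume X: "X : Ob" and x: "x : car P X"
 show "nt u X x = nt u' X x" using nt_Comp[OF u(1) k X x] nt_Comp[OF u(2) k X x] assms(4)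
 by (simp only: ker_coker(2)[OF f X nt_cl[OF u(1) X x]] ker_coker(2)[OF f X nt_cl[OF u(2) X x]])
qed

lemma coker_epi: assumes f: "f : RHom F G" and u: "u : RHom (Coker f) P" "u' : RHom (Coker f) P"
 and "u o[Rep] coker_pr f = u' o[Rep] coker_pr f" shows "u = u'"
proof (rule nt_ext[OF u])
 note c = coker_in[OF f]
 fix X z assume X: "X : Ob" and z: "z : car (Coker f) X"
 then obtain y where y: "y : car G X" "z = nt (coker_pr f) X y" using ker_coker(3)[OF f X] by blast
 show "nt u X z = nt u' X z" unfolding y(2) nt_Comp[OF c u(1) X y(1), symmetric] nt_Comp[OF c u(2) X y(1), symmetric] assms(4) ..
qed

lemma is_kernel_Rep: assumes f: "f : RHom F G" shows "is_kernel Rep f (ker_in f)"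
proof -
 note k = ker_in_Homs[OF f]
 have "EX! u. u : RHom (Dom Rep g) (Ker f) & ker_in f o[Rep] u = g"
 if g: "g : Arr Rep" "Cod Rep g = F" "zero_arrow Rep (f o[Rep] g)" for g
 proof -
 have gH: "g : RHom (Dom Rep g) F" using g by (simp add: Homs_def)
 have "f o[Rep] g = zmap (Dom Rep g) G" using g(3) zero_arrow_Rep[OF Rep.Comp_in[OF gH f]] by simp
 from ker_factor[OF f gH this] obtain u where u: "u : RHom (Dom Rep g) (Ker f)" "ker_in f o[Rep] u = g" .
 show ?thesis by (rule ex1I[of _ u], rule conjI[OF u]) (rule ker_mono[OF f conjunct1 u(1) trans[OF conjunct2 u(2)[symmetric]]], assumption+)
 qed moreover have "zero_arrow Rep (f o[Rep] ker_in f)" using zero_arrow_Rep[OF Rep.Comp_in[OF k f]] zero_kc(1)[OF f] by simp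
 ultimately show ?thesis unfolding is_kernel_def using HomsD[OF k] HomsD[OF f] by simp
qed

lemma is_cokernel_Rep: assumes f: "f : RHom F G" shows "is_cokernel Rep f (coker_pr f)"
proof -
 note c = coker_in[OF f]
 have "EX! u. u : RHom (Coker f) (Cod Rep g) & u o[Rep] coker_pr f = g"
 if g: "g : Arr Rep" "Dom Rep g = G" "zero_arrow Rep (g o[Rep] f)" for g
 proof -
 have gH: "g : RHom G (Cod Rep g)" using g by (simp add: Homs_def)
 have "g o[Rep] f = zmap F (Cod Rep g)" using g(3) zero_arrow_Rep[OF Rep.Comp_in[OF f gH]] by simp
 from coker_factor[OF f gH this] obtain u where u: "u : RHom (Coker f) (Cod Rep g)" "u o[Rep] coker_pr f = g" .
 show ?thesis by (rule ex1I[of _ u], rule conjI[OF u]) (rule coker_epi[OF f conjunct1 u(1) trans[OF conjunct2 u(2)[symmetric]]], assumption+)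
 qed moreover have "zero_arrow Rep (coker_pr f o[Rep] f)" using zero_arrow_Rep[OF Rep.Comp_in[OF f c]] zero_kc(2)[OF f] by simp
 ultimately show ?thesis unfolding is_cokernel_def using HomsD[OF c] HomsD[OF f] by simp
qed

definition ker_dies :: "('o, 'm, 'r, 'u) rep_arr => bool" where
 "ker_dies f <-> (ALL X : Ob. ALL x : car (Dom Rep f) X. nt f X x = 0[FO (Cod Rep f) X] --> dies (Dom Rep f) X x)"

definition coker_dies :: "('o, 'm, 'r, 'u) rep_arr => bool" where
 "coker_dies f <-> (ALL X : Ob. ALL y : car (Cod Rep f) X. EX Y. EX ph : Hom X Y.
 act (Cod Rep f) ph y : nt f Y ` car (Dom Rep f) Y)"

text \<open>The arrows inverted in the stable category, in terms of elements.\<close>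

definition Wset :: "('o, 'm, 'r, 'u) rep_arr set" where
 "Wset = {f : Arr Rep. ker_dies f & coker_dies f}"

lemma ker_Kset: assumes f: "f : RHom F G" shows "Ker f : Kset <-> ker_dies f"
proof -
 have K: "Ker f : ObR" and F: "F : ObR" using Rep.ends[OF ker_in_Homs[OF f]] Rep.ends[OF f] by auto
 have "dies (Ker f) X x <-> dies F X x" if X: "X : Ob" and x: "x : car (Ker f) X" for X x
 proof
 show "dies F X x" if "dies (Ker f) X x" using dies_nt[OF ker_in_Homs[OF f] X x that] ker_coker(2)[OF f X x] by simp
 assume "dies F X x"
 then obtain Y ph where p: "ph : Hom X Y" "act F ph x = 0[FO F Y]" unfolding dies_def by blast
 have Y: "Y : Ob" using U.ends[OF p(1)] by simp
 have a: "act (Ker f) ph x : car (Ker f) Y" by (rule act_cl[OF K p(1) x])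
 have "act (Ker f) ph x = 0[FO F Y]" using nt_nat[OF ker_in_Homs[OF f] p(1) x] ker_coker(2)[OF f Y a] ker_coker(2)[OF f X x] p(2) by simp
 moreover have "0[FO (Ker f) Y] = 0[FO F Y]" using sub_rep(5)[OF _ _ Y, of F "kr f"] subrep_kr[OF f] F HomsD[OF f] by simp
 ultimately show "dies (Ker f) X x" using p(1) unfolding dies_def by metis qed
 thus ?thesis using K HomsD[OF f] ker_coker(1)[OF f] by (auto simp: Kset_def ker_dies_def)
qed

lemma coker_Kset: assumes f: "f : RHom F G" shows "Coker f : Kset <-> coker_dies f"
proof -
 note c = coker_in[OF f]
 have C: "Coker f : ObR" and G: "G : ObR" using Rep.ends[OF c] by auto
 have e: "dies (Coker f) X (nt (coker_pr f) X y) <-> (EX Y. EX ph : Hom X Y. act G ph y : nt f Y ` car F Y)"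
 if X: "X : Ob" and y: "y : car G X" for X y
 proof -
 have "act (Coker f) ph (nt (coker_pr f) X y) = 0[FO (Coker f) Y] <-> act G ph y : nt f Y ` car F Y"
 if p: "ph : Hom X Y" for ph Y unfolding nt_nat[OF c p y, symmetric] using ker_coker(4)[OF f _ act_cl[OF G p y]] U.ends[OF p] by blast
 thus ?thesis unfolding dies_def by (intro ex_cong1 bex_cong[OF refl]) qed
 have "(ALL z : car (Coker f) X. dies (Coker f) X z) <-> (ALL y : car G X. EX Y. EX ph : Hom X Y. act G ph y : nt f Y ` car F Y)"
 if X: "X : Ob" for X unfolding ker_coker(3)[OF f X, symmetric] ball_simps using e[OF X] by blast
 thus ?thesis using C HomsD[OF f] by (simp add: Kset_def coker_dies_def)
qed

text \<open>\<open>isos_mod\<close> allows any kernel and cokernel. The concrete kernel maps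
  injectively to any other, the concrete cokernel is a quotient of any other, and
  \<open>polp 0\<close>, the class of stably zero representations, is closed under both.\<close>

lemma isos_mod_eq: "isos_mod Rep (K_objs R B) = Wset"
proof
 show "Wset <= isos_mod Rep (K_objs R B)"
 proof
 fix f assume f: "f : Wset" hence fH: "f : RHom (Dom Rep f) (Cod Rep f)" by (simp add: Wset_def Homs_def)
 show "f : isos_mod Rep (K_objs R B)" unfolding isos_mod_def K_objs_eq
 proof (intro CollectI conjI exI)
 show "Dom Rep (ker_in f) : Kset" "Cod Rep (coker_pr f) : Kset"
 using f ker_Kset[OF fH] coker_Kset[OF fH] HomsD[OF ker_in_Homs[OF fH]] HomsD[OF coker_in[OF fH]] by (simp_all add: Wset_def)
 qed (use f is_kernel_Rep[OF fH] is_cokernel_Rep[OF fH] in \<open>simp_all add: Wset_def\<close>) qed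
 show "isos_mod Rep (K_objs R B) <= Wset"
 proof
 fix f assume "f : isos_mod Rep (K_objs R B)"
 then obtain k c where f: "f : Arr Rep" and k: "is_kernel Rep f k" "Dom Rep k : Kset" and c: "is_cokernel Rep f c" "Cod Rep c : Kset"
 unfolding isos_mod_def K_objs_eq by blast
 have fH: "f : RHom (Dom Rep f) (Cod Rep f)" by (rule Arr_Homs[OF f])
 note ki = ker_in_Homs[OF fH] and cp = coker_in[OF fH]
 have kH: "k : RHom (Dom Rep k) (Dom Rep f)" and cH: "c : RHom (Cod Rep f) (Cod Rep c)" using k(1) c(1) by (auto simp: is_kernel_def is_cokernel_def Homs_def)
 obtain u where u: "u : RHom (Ker f) (Dom Rep k)" "k o[Rep] u = ker_in f"
 using is_kernelD[OF k(1), of "ker_in f"] is_kernel_Rep[OF fH] HomsD[OF ki] unfolding is_kernel_def by auto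
 have "Ker f : polp 0"
 proof (rule polp_sub[OF u(1)])
 show "Dom Rep k : polp 0" using k(2) by simp
 fix X x assume X: "X : Ob" and x: "x : car (Ker f) X" and z: "nt u X x = 0[FO (Dom Rep k) X]"
 have F: "Dom Rep f : ObR" "subrep (Dom Rep f) (kr f)" using Rep.ends[OF fH] subrep_kr[OF fH] by auto
 have "x = nt k X (nt u X x)" using nt_Comp[OF u(1) kH X x] u(2) ker_coker(2)[OF fH X x] by simp
 hence "x = 0[FO (Ker f) X]" unfolding z nt_zero[OF kH X] sub_rep(5)[OF F X] .
 thus "dies (Ker f) X x" using dies_zero[OF sub_rep(1)[OF F] X] by simp qed
 obtain v where v: "v : RHom (Cod Rep c) (Coker f)" "v o[Rep] c = coker_pr f"
 using is_cokernelD[OF c(1), of "coker_pr f"] is_cokernel_Rep[OF fH] HomsD[OF cp] unfolding is_cokernel_def by auto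
 have "Coker f : polp 0"
 proof (rule polp_quot_surj[OF v(1)])
 show "Cod Rep c : polp 0" using c(2) by simp
 fix X assume X: "X : Ob"
 have "nt (coker_pr f) X y = nt v X (nt c X y)" if "y : car (Cod Rep f) X" for y using nt_Comp[OF cH v(1) X that] v(2) by simp
 thus "nt v X ` car (Cod Rep c) X = car (Coker f) X" using nt_cl[OF v(1) X] nt_cl[OF cH X] unfolding ker_coker(3)[OF fH X, symmetric] by force
 qed thus "f : Wset" using f \<open>Ker f : polp 0\<close> ker_Kset[OF fH] coker_Kset[OF fH] by (simp add: Wset_def) qed
qed

end

section \<open>Germs\<close>

context rep_setting
begin

definition sbt :: "nat => nat => ('o, 'm) bracket_arr" where
 "sbt n k = st (power1 B (k - n)) (ob n)"

lemma sbt_in: "n <= k ==> sbt n k : Hom (ob n) (ob k)" using st_UG[OF power1_nat ob_in, of "k - n" n] by (simp add: sbt_def uobj_power)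

lemma sbt_Comp: "n <= k ==> k <= l ==> sbt k l o[UB] sbt n k = sbt n l" using st_power_add[OF ob_in, of "l - k" "k - n" n] by (simp add: sbt_def uobj_power)

lemma sbt_Id: "sbt n n = Id UB (ob n)" using st_unit[OF UG_Obj_B[OF ob_in[of n]]] by (simp add: sbt_def UG_simps)

lemma sbt_cofinal: assumes "ph : Hom (ob n) Y" obtains k ps where "n <= k" "ps : Hom Y (ob k)" "ps o[UB] ph = sbt n k"
proof -
 obtain k ps where "ps : Hom Y (power1 B k ** ob n)" "ps o[UB] ph = st (power1 B k) (ob n)" using UG_cofinal[OF assms] .
 thus thesis using that[of "k + n" ps] by (simp add: uobj_power sbt_def)
qed

definition sb :: "('o, 'm, 'r, 'u) rep => nat => nat => 'u => 'u" where
 "sb F n k = act F (sbt n k)"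

lemma sb_closed: "F : ObR ==> n <= k ==> x : car F (ob n) ==> sb F n k x : car F (ob k)" unfolding sb_def by (rule act_cl[OF _ sbt_in])

lemma sb_sb: assumes F: "F : ObR" and n: "n <= k" and k: "k <= l" and x: "x : car F (ob n)" shows "sb F k l (sb F n k x) = sb F n l x"
 unfolding sb_def act_Comp[OF F sbt_in[OF n] sbt_in[OF k] x, symmetric] sbt_Comp[OF n k] ..

lemma sb_Id: "F : ObR ==> x : car F (ob n) ==> sb F n n x = x" unfolding sb_def sbt_Id using act_Id[OF _ ob_in] .

lemma sb_nt: "f : RHom F G ==> n <= k ==> x : car F (ob n) ==> nt f (ob k) (sb F n k x) = sb G n k (nt f (ob n) x)"
 unfolding sb_def by (rule nt_nat[OF _ sbt_in])

lemma dies_sb: assumes F: "F : ObR" and x: "x : car F (ob n)" shows "dies F (ob n) x <-> (EX k >= n. sb F n k x = 0[FO F (ob k)])"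
proof
 assume "dies F (ob n) x"
 then obtain Y ph where p: "ph : Hom (ob n) Y" "act F ph x = 0[FO F Y]" unfolding dies_def by blast
 obtain k ps where k: "n <= k" "ps : Hom Y (ob k)" "ps o[UB] ph = sbt n k" using sbt_cofinal[OF p(1)] .
 have "sb F n k x = 0[FO F (ob k)]" using act_Comp[OF F p(1) k(2) x] act_zero[OF F k(2)] p(2) k(3) by (simp add: sb_def)
 thus "EX k >= n. sb F n k x = 0[FO F (ob k)]" using k(1) by blast
next
 assume "EX k >= n. sb F n k x = 0[FO F (ob k)]" thus "dies F (ob n) x" unfolding dies_def sb_def using sbt_in by blast
qed

text \<open>The graph of the map induced by f on the colimit of the F(n) along stabilisation.
  Elements remain pairs of a level and a vector and are compared at a common higher level.\<close>

definition gr :: "('o, 'm, 'r, 'u) rep_arr => (nat \<times> 'u) rel" where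
 "gr f = {((n, x), (m, y)). x : car (Dom Rep f) (ob n) & y : car (Cod Rep f) (ob m) &
 (EX k. n <= k & m <= k & nt f (ob k) (sb (Dom Rep f) n k x) = sb (Cod Rep f) m k y)}"

lemma gr_iff: assumes f: "f : RHom F G" shows "((n, x), (m, y)) : gr f <-> x : car F (ob n) & y : car G (ob m) &
 (EX k. n <= k & m <= k & nt f (ob k) (sb F n k x) = sb G m k y)" using HomsD[OF f] by (simp add: gr_def)

lemma gr_raise: assumes f: "f : RHom F G" and "n <= k" "m <= k" "k <= l" "x : car F (ob n)" "y : car G (ob m)"
 "nt f (ob k) (sb F n k x) = sb G m k y" shows "nt f (ob l) (sb F n l x) = sb G m l y"
proof -
 have FG: "F : ObR" "G : ObR" using Rep.ends[OF f] by auto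
 show ?thesis using sb_nt[OF f assms(4) sb_closed[OF FG(1) assms(2,5)]] sb_sb[OF FG(1) assms(2,4,5)] sb_sb[OF FG(2) assms(3,4,6)] assms(7) by simp
qed

lemma gr_image: assumes f: "f : RHom F G" and n: "n <= k" and x: "x : car F (ob n)" shows "((n, x), (k, nt f (ob k) (sb F n k x))) : gr f"
proof -
 have FG: "F : ObR" "G : ObR" using Rep.ends[OF f] by auto
 have c: "nt f (ob k) (sb F n k x) : car G (ob k)" by (rule nt_cl[OF f ob_in sb_closed[OF FG(1) n x]])
 show ?thesis unfolding gr_iff[OF f] using n x c sb_Id[OF FG(2) c] by (intro conjI exI[of _ k]) simp_all
qed

lemma gr_Comp: assumes f: "f : RHom F G" and g: "g : RHom G H" shows "gr (g o[Rep] f) = gr f O gr g"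
proof -
 have FG: "F : ObR" "G : ObR" "H : ObR" using Rep.ends[OF f] Rep.ends[OF g] by auto
 note gf = Rep.Comp_in[OF f g]
 have "(a, c) : gr (g o[Rep] f) <-> (a, c) : gr f O gr g" for a c
 proof -
 obtain n x l z where a: "a = (n, x)" "c = (l, z)" by (cases a; cases c)
 show ?thesis unfolding a
 proof
 assume "((n, x), (l, z)) : gr (g o[Rep] f)"
 then obtain k where k: "x : car F (ob n)" "z : car H (ob l)" "n <= k" "l <= k"
 "nt (g o[Rep] f) (ob k) (sb F n k x) = sb H l k z" using gr_iff[OF gf] by blast
 let ?y = "nt f (ob k) (sb F n k x)"
 have y: "?y : car G (ob k)" by (rule nt_cl[OF f ob_in sb_closed[OF FG(1) k(3,1)]])
 have "((k, ?y), (l, z)) : gr g" unfolding gr_iff[OF g] using k y sb_Id[OF FG(2) y] nt_Comp[OF f g ob_in sb_closed[OF FG(1) k(3,1)]]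
 by (intro conjI exI[of _ k]) simp_all thus "((n, x), (l, z)) : gr f O gr g" using gr_image[OF f k(3,1)] by (rule relcompI[rotated])
 next
 assume "((n, x), (l, z)) : gr f O gr g"
 then obtain m y where 1: "((n, x), (m, y)) : gr f" and 2: "((m, y), (l, z)) : gr g" by auto
 obtain k where k: "x : car F (ob n)" "y : car G (ob m)" "n <= k" "m <= k" "nt f (ob k) (sb F n k x) = sb G m k y" using 1 gr_iff[OF f] by blast
 obtain j where j: "z : car H (ob l)" "m <= j" "l <= j" "nt g (ob j) (sb G m j y) = sb H l j z" using 2 gr_iff[OF g] by blast
 let ?i = "max j k"
 have le: "n <= ?i" "l <= ?i" using k j by auto
 have "nt (g o[Rep] f) (ob ?i) (sb F n ?i x) = sb H l ?i z"
 unfolding nt_Comp[OF f g ob_in sb_closed[OF FG(1) le(1) k(1)]] gr_raise[OF f k(3,4) max.cobounded2 k(1,2,5)]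
 by (rule gr_raise[OF g j(2,3) max.cobounded1 k(2) j(1,4)])
 thus "((n, x), (l, z)) : gr (g o[Rep] f)" unfolding gr_iff[OF gf] using k(1) j(1) le by blast qed qed
 thus ?thesis by (auto simp only: set_eq_iff split_paired_all)
qed

text \<open>Equality of germs, obtained as the graph of the identity.\<close>

definition El :: "('o, 'm, 'r, 'u) rep => (nat \<times> 'u) rel" where
 "El F = gr (Id Rep F)"

lemma El_iff:
 assumes F: "F : ObR" shows "((n, x), (m, y)) : El F <-> x : car F (ob n) & y : car F (ob m) & (EX k. n <= k & m <= k & sb F n k x = sb F m k y)"
 unfolding El_def gr_iff[OF Rep.Id_in_Homs[OF F]] using nt_Id[OF F ob_in sb_closed[OF F]] by metis

lemma El_per: assumes F: "F : ObR" shows "sym (El F) & trans (El F)"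
proof
 show "sym (El F)"
 proof (rule symI)
 fix a b assume "(a, b) : El F" thus "(b, a) : El F" by (cases a; cases b) (auto simp: El_iff[OF F] eq_commute) qed
 show "trans (El F)" using gr_Comp[OF Rep.Id_in_Homs[OF F] Rep.Id_in_Homs[OF F]]
 unfolding El_def Rep.Comp_Id_right[OF Rep.Id_in_Homs[OF F]] by (auto intro!: transI)
qed

definition germ_functor :: "(('o, 'm, 'r, 'u) rep, ('o, 'm, 'r, 'u) rep_arr, ('o, 'm, 'r, 'u) rep,
 ('o, 'm, 'r, 'u) rep \<times> (nat \<times> 'u) rel \<times> ('o, 'm, 'r, 'u) rep) ftor" where
 "germ_functor = \<lparr>FO = (%F. F), FA = (%f. (Dom Rep f, gr f, Cod Rep f))\<rparr>"

abbreviation PC where "PC == per_cat (ObR) El"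

lemma category_PC: "category PC" by (rule category_per_cat[OF El_per])

lemma gr_functional:
 assumes f: "f : RHom F G" shows "El F O gr f = gr f" "gr f O El G = gr f" "El F <= gr f O (gr f)\<inverse>" "(gr f)\<inverse> O gr f <= El G"
proof -
 have FG: "F : ObR" "G : ObR" using Rep.ends[OF f] by auto
 show "El F O gr f = gr f" unfolding El_def gr_Comp[OF Rep.Id_in_Homs[OF FG(1)] f, symmetric] Rep.Comp_Id_right[OF f] ..
 show "gr f O El G = gr f" unfolding El_def gr_Comp[OF f Rep.Id_in_Homs[OF FG(2)], symmetric] Rep.Comp_Id_left[OF f] ..
 show "El F <= gr f O (gr f)\<inverse>"
 proof
 fix p assume p: "p : El F"
 obtain n x m y where e: "p = ((n, x), (m, y))" by (metis surj_pair)
 then obtain k where k: "x : car F (ob n)" "y : car F (ob m)" "n <= k" "m <= k" "sb F n k x = sb F m k y" using p El_iff[OF FG(1)] by blast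
 from gr_image[OF f k(3,1)] gr_image[OF f k(4,2)] show "p : gr f O (gr f)\<inverse>" unfolding e k(5) by (intro relcompI converseI) qed
 show "(gr f)\<inverse> O gr f <= El G"
 proof
 fix p assume p: "p : (gr f)\<inverse> O gr f"
 obtain m y m' y' where e: "p = ((m, y), (m', y'))" by (metis surj_pair)
 then obtain n x where 1: "((n, x), (m, y)) : gr f" and 2: "((n, x), (m', y')) : gr f" using p by auto
 obtain k where k: "x : car F (ob n)" "y : car G (ob m)" "n <= k" "m <= k" "nt f (ob k) (sb F n k x) = sb G m k y" using 1 gr_iff[OF f] by blast
 obtain j where j: "y' : car G (ob m')" "n <= j" "m' <= j" "nt f (ob j) (sb F n j x) = sb G m' j y'" using 2 gr_iff[OF f] by blast
 have "sb G m (max j k) y = sb G m' (max j k) y'"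
 using gr_raise[OF f k(3,4) max.cobounded2 k(1,2,5), of j] gr_raise[OF f j(2,3) max.cobounded1 k(1) j(1,4), of k] by simp
 thus "p : El G" unfolding e El_iff[OF FG(2)] using k(2,4) j(1,3) by (intro conjI exI[of _ "max j k"]) auto qed
qed

lemma cfunctor_germ: "cfunctor Rep PC germ_functor"
proof -
 interpret PC: category PC by (rule category_PC)
 have FA: "FA germ_functor f = (F, gr f, G)" if "f : RHom F G" for f F G using HomsD[OF that] by (simp add: germ_functor_def)
 have FO: "FO germ_functor F = F" for F by (simp add: germ_functor_def)
 show ?thesis
 proof (unfold_locales, goal_cases)
 case (1 F) thus ?case by (simp add: FO pc_simps)
 next
 case (2 f F G) thus ?case unfolding FA[OF 2] FO pc_simps using gr_functional[OF 2] Rep.ends[OF 2] by (intro conjI) simp_all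
 next
 case (3 F) show ?case unfolding FA[OF Rep.Id_in_Homs[OF 3]] FO pc_simps El_def ..
 next
 case (4 f F G g H) show ?case unfolding FA[OF Rep.Comp_in[OF 4]] FA[OF 4(1)] FA[OF 4(2)] pc_simps gr_Comp[OF 4] .. qed
qed

text \<open>Two elements with equal germs of images differ, at a high level, by an element of the
  kernel; conversely an element of the kernel has the same image as zero.\<close>

lemma gr_inj_iff: assumes f: "f : RHom F G" shows "gr f O (gr f)\<inverse> <= El F <-> ker_dies f"
proof
 have FG: "F : ObR" "G : ObR" using Rep.ends[OF f] by auto
 assume k: "ker_dies f"
 show "gr f O (gr f)\<inverse> <= El F"
 proof
 fix p assume p: "p : gr f O (gr f)\<inverse>"
 obtain n x n' x' where e: "p = ((n, x), (n', x'))" by (metis surj_pair)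
 then obtain m y where 1: "((n, x), (m, y)) : gr f" and 2: "((n', x'), (m, y)) : gr f" using p by auto
 obtain k where k1: "x : car F (ob n)" "y : car G (ob m)" "n <= k" "m <= k" "nt f (ob k) (sb F n k x) = sb G m k y" using 1 gr_iff[OF f] by blast
 obtain j where j: "x' : car F (ob n')" "n' <= j" "m <= j" "nt f (ob j) (sb F n' j x') = sb G m j y" using 2 gr_iff[OF f] by blast
 let ?i = "max j k"
 have le: "n <= ?i" "n' <= ?i" using k1 j by auto
 interpret M: rmod R "FO F (ob ?i)" by (rule rmodI[OF rep_mod[OF FG(1) ob_in]])
 interpret N: rmod R "FO G (ob ?i)" by (rule rmodI[OF rep_mod[OF FG(2) ob_in]])
 note c = sb_closed[OF FG(1) le(1) k1(1)] sb_closed[OF FG(1) le(2) j(1)]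
 let ?d = "sb F n ?i x -[FO F (ob ?i)] sb F n' ?i x'"
 have d: "?d : car F (ob ?i)" using c by simp
 have "nt f (ob ?i) (sb F n ?i x) = nt f (ob ?i) (sb F n' ?i x')"
 using gr_raise[OF f k1(3,4) max.cobounded2 k1(1,2,5), of j] gr_raise[OF f j(2,3) max.cobounded1 j(1) k1(2) j(4), of k] by simp
 hence "nt f (ob ?i) ?d = 0[FO G (ob ?i)]"
 using M.lin_diff[OF N.module_axioms nt_lin(1)[OF f ob_in] c] N.diff_zero_iff nt_cl[OF f ob_in c(1)] nt_cl[OF f ob_in c(2)] by simp
 hence "dies F (ob ?i) ?d" using k d ob_in HomsD[OF f] unfolding ker_dies_def by auto
 then obtain l where l: "?i <= l" "sb F ?i l ?d = 0[FO F (ob l)]" using dies_sb[OF FG(1) d] by blast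
 interpret L: rmod R "FO F (ob l)" by (rule rmodI[OF rep_mod[OF FG(1) ob_in]])
 have "sb F ?i l (sb F n ?i x) = sb F ?i l (sb F n' ?i x')"
 using M.lin_diff[OF L.module_axioms act_lin[OF FG(1) sbt_in[OF l(1)]] c] l(2) L.diff_zero_iff sb_closed[OF FG(1) l(1) c(1)] sb_closed[OF FG(1) l(1) c(2)]
 by (simp add: sb_def) hence "sb F n l x = sb F n' l x'" using sb_sb[OF FG(1) le(1) l(1) k1(1)] sb_sb[OF FG(1) le(2) l(1) j(1)] by simp
 thus "p : El F" unfolding e El_iff[OF FG(1)] using k1(1) j(1) le l(1) order_trans by blast qed
next
 have FG: "F : ObR" "G : ObR" using Rep.ends[OF f] by auto
 assume i: "gr f O (gr f)\<inverse> <= El F"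
 have "dies F (ob n) x" if x: "x : car F (ob n)" and z: "nt f (ob n) x = 0[FO G (ob n)]" for n x
 proof -
 interpret M: rmod R "FO F (ob n)" by (rule rmodI[OF rep_mod[OF FG(1) ob_in]])
 have "((n, x), (n, 0[FO G (ob n)])) : gr f" using gr_image[OF f order_refl x] by (simp add: sb_Id[OF FG(1) x] z)
 moreover have "((n, 0[FO F (ob n)]), (n, 0[FO G (ob n)])) : gr f"
 using gr_image[OF f order_refl M.zero_closed] by (simp add: sb_Id[OF FG(1) M.zero_closed] nt_zero[OF f ob_in])
 ultimately have "((n, x), (n, 0[FO F (ob n)])) : El F" using i by blast
 then obtain k where "n <= k" "sb F n k x = sb F n k 0[FO F (ob n)]" unfolding El_iff[OF FG(1)] by blast
 thus ?thesis using dies_sb[OF FG(1) x] act_zero[OF FG(1) sbt_in] by (auto simp: sb_def) qed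
 thus "ker_dies f" using HomsD[OF f] UG_Obj by (auto simp: ker_dies_def)
qed

text \<open>Cofinality of stabilisations: if some arrow moves y into the image of f, then so does a
  stabilisation, and this says that the germ of y is hit.\<close>

lemma gr_surj_iff: assumes f: "f : RHom F G" shows "El G <= (gr f)\<inverse> O gr f <-> coker_dies f"
proof
 have FG: "F : ObR" "G : ObR" using Rep.ends[OF f] by auto
 assume s: "coker_dies f"
 show "El G <= (gr f)\<inverse> O gr f"
 proof
 fix p assume p: "p : El G"
 obtain m y m' y' where e: "p = ((m, y), (m', y'))" by (metis surj_pair) hence y: "y : car G (ob m)" using p El_iff[OF FG(2)] by blast
 obtain Y ph where "ph : Hom (ob m) Y" "act G ph y : nt f Y ` car F Y" using s ob_in y HomsD[OF f] unfolding coker_dies_def by metis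
 then obtain x where x: "ph : Hom (ob m) Y" "x : car F Y" "act G ph y = nt f Y x" by blast
 obtain k ps where k: "m <= k" "ps : Hom Y (ob k)" "ps o[UB] ph = sbt m k" using sbt_cofinal[OF x(1)] .
 have c: "act F ps x : car F (ob k)" by (rule act_cl[OF FG(1) k(2) x(2)])
 have "nt f (ob k) (act F ps x) = sb G m k y" unfolding nt_nat[OF f k(2) x(2)] sb_def k(3)[symmetric] act_Comp[OF FG(2) x(1) k(2) y] x(3) ..
 hence 1: "((k, act F ps x), (m, y)) : gr f" unfolding gr_iff[OF f] using c y k(1) sb_Id[OF FG(1) c] by (intro conjI exI[of _ k]) simp_all
 hence "((k, act F ps x), (m', y')) : gr f" using p gr_functional(2)[OF f] unfolding e by blast
 thus "p : (gr f)\<inverse> O gr f" using 1 unfolding e by blast qed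
next
 have FG: "F : ObR" "G : ObR" using Rep.ends[OF f] by auto
 assume s: "El G <= (gr f)\<inverse> O gr f"
 have "EX Y. EX ph : Hom (ob m) Y. act G ph y : nt f Y ` car F Y" if y: "y : car G (ob m)" for m y
 proof -
 have "((m, y), (m, y)) : El G" unfolding El_iff[OF FG(2)] using y by blast
 then obtain n x where "((n, x), (m, y)) : gr f" using s by auto
 then obtain k where k: "x : car F (ob n)" "n <= k" "m <= k" "nt f (ob k) (sb F n k x) = sb G m k y" using gr_iff[OF f] by blast
 hence "sb G m k y : nt f (ob k) ` car F (ob k)" using sb_closed[OF FG(1) k(2,1)] by (metis imageI)
 thus ?thesis using sbt_in[OF k(3)] unfolding sb_def by blast qed
 thus "coker_dies f" using HomsD[OF f] UG_Obj by (auto simp: coker_dies_def)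
qed

end

section \<open>The stable category\<close>

lemma zero_objectD: "zero_object C Z ==> X : Obj C ==> EX! f. f : Homs C X Z" by (simp add: zero_object_def)

context rep_setting
begin

lemma ker_dies_iff: "f : RHom F G ==> ker_dies f <-> (ALL X : Ob. ALL x : car F X. nt f X x = 0[FO G X] --> dies F X x)" by (simp add: ker_dies_def Homs_def)

lemma coker_dies_iff: "f : RHom F G ==> coker_dies f <->
 (ALL X : Ob. ALL y : car G X. EX Y. EX ph : Hom X Y. act G ph y : nt f Y ` car F Y)" by (simp add: coker_dies_def Homs_def)

abbreviation "LS == localisation Rep Wset"
abbreviation "SHom == Homs LS"

abbreviation "qf f == FA (localisation_functor Rep Wset) f"

lemma St_eq: "St R B = LS" by (simp add: quotient_cat_def isos_mod_eq)

sublocale LS: category LS by (rule category_loc[OF category_Rep])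

lemma cfunctor_q: "cfunctor Rep LS (localisation_functor Rep Wset)" by (rule cfunctor_localisation_functor[OF category_Rep])

lemma qf_in: "f : RHom F G ==> qf f : SHom F G" using cfunctor.FA_in_Homs[OF cfunctor_q] by simp

lemma qf_Comp: "f : RHom F G ==> g : RHom G H ==> qf (g o[Rep] f) = qf g o[LS] qf f" by (rule cfunctor.FA_Comp[OF cfunctor_q])

lemma qf_Id: "F : ObR ==> qf (Id Rep F) = Id LS F" using cfunctor.FA_Id[OF cfunctor_q] by simp

lemma W_Arr: "Wset <= Arr Rep" by (auto simp: Wset_def)

lemma W_iff: "f : RHom F G ==> f : Wset <-> ker_dies f & coker_dies f" by (simp add: Wset_def Homs_def)

lemma qf_inv: "f : Wset ==> invble LS (qf f)" by (rule localisation_invertible[OF category_Rep _ W_Arr])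

lemma Obj_LS: "Obj LS = ObR" by (simp add: loc_simps)

lemma W_extend: assumes t: "t : RHom P F" "t : Wset" and w: "w : SHom P E"
 obtains u where "u : SHom F E" "u o[LS] qf t = w"
proof -
 note i = LS.Inv_Homs[OF qf_inv[OF t(2)] qf_in[OF t(1)]]
 have "(w o[LS] Inv LS (qf t)) o[LS] qf t = w"
 unfolding LS.Comp_assoc[OF qf_in[OF t(1)] i w] LS.Inv_left[OF qf_inv[OF t(2)] qf_in[OF t(1)]] by (rule LS.Comp_Id_right[OF w])
 thus thesis using that LS.Comp_in[OF i w] by blast
qed

lemma W_cancel: "[|t : RHom P F; t : Wset; u : SHom F E; v : SHom F E; u o[LS] qf t = v o[LS] qf t|] ==> u = v"
 by (rule LS.invertible_cancel_right[OF qf_inv qf_in])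

text \<open>The germ functor inverts \<open>Wset\<close>, hence extends to the stable category; any
  extension provided by the universal property will do.\<close>

definition Tl :: "(('o, 'm, 'r, 'u) rep, ('o, 'm, 'r, 'u) rep \<times> (('o, 'm, 'r, 'u) rep_arr + ('o, 'm, 'r, 'u) rep_arr) list set \<times> ('o, 'm, 'r, 'u) rep,
 ('o, 'm, 'r, 'u) rep, ('o, 'm, 'r, 'u) rep \<times> (nat \<times> 'u) rel \<times> ('o, 'm, 'r, 'u) rep) ftor" where
 "Tl = (SOME \<Phi>. cfunctor LS PC \<Phi> & agree_on Rep (ftor_comp \<Phi> (localisation_functor Rep Wset)) germ_functor)"

definition rl where "rl al = arrow_map (FA Tl al)"

lemma Tl: "cfunctor LS PC Tl" "agree_on Rep (ftor_comp Tl (localisation_functor Rep Wset)) germ_functor"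
proof -
 have "invble PC (FA germ_functor s)" if "s : Wset" for s
 proof -
 have s: "s : RHom (Dom Rep s) (Cod Rep s)" using that W_Arr by (auto intro: Arr_Homs)
 have f: "FA germ_functor s = (Dom Rep s, gr s, Cod Rep s)" by (simp add: germ_functor_def)
 have "FA germ_functor s : Homs PC (FO germ_functor (Dom Rep s)) (FO germ_functor (Cod Rep s))" by (rule cfunctor.FA_in_Homs[OF cfunctor_germ s])
 hence h: "(Dom Rep s, gr s, Cod Rep s) : Homs PC (Dom Rep s) (Cod Rep s)" unfolding f by (simp only: germ_functor_def ftor.simps)
 show ?thesis unfolding f by (rule per_cat_invertible[OF El_per h]) (use that gr_inj_iff[OF s] gr_surj_iff[OF s] in \<open>simp_all add: Wset_def\<close>)
 qed
 from someI_ex[OF cfunctor.loc_universal[OF cfunctor_germ this W_Arr]]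
 show "cfunctor LS PC Tl" "agree_on Rep (ftor_comp Tl (localisation_functor Rep Wset)) germ_functor" unfolding Tl_def by blast+
qed

lemma FO_Tl: "F : ObR ==> FO Tl F = F" using Tl(2) by (simp add: agree_on_def germ_functor_def)

lemma FA_Tl: assumes "al : SHom F G" shows "FA Tl al = (F, rl al, G) & (F, rl al, G) : Homs PC F G"
proof -
 have "F : ObR" "G : ObR" using LS.ends[OF assms] unfolding Obj_LS by auto
 hence "FA Tl al : Homs PC F G" using cfunctor.FA_in_Homs[OF Tl(1) assms] by (simp add: FO_Tl)
 thus ?thesis using per_cat_form[of "FA Tl al"] unfolding rl_def by fastforce
qed

lemma rl:
 assumes "al : SHom F G" shows "El F O rl al = rl al" "rl al O El G = rl al" "El F <= rl al O (rl al)\<inverse>" "(rl al)\<inverse> O rl al <= El G"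
 using FA_Tl[OF assms, THEN conjunct2] unfolding pc_simps by - ((elim conjE, assumption)+)

lemma rl_Comp: assumes a: "al : SHom F G" and b: "be : SHom G H" shows "rl (be o[LS] al) = rl al O rl be"
proof -
 have "(F, rl (be o[LS] al), H) = (F, rl al O rl be, H)" using cfunctor.FA_Comp[OF Tl(1) a b] unfolding FA_Tl[OF a, THEN conjunct1] FA_Tl[OF b, THEN conjunct1]
 FA_Tl[OF LS.Comp_in[OF a b], THEN conjunct1] pc_simps . thus ?thesis by simp
qed

lemma rl_qf: "f : RHom F G ==> rl (qf f) = gr f" using Tl(2) HomsD[of f Rep F G] by (simp add: agree_on_def germ_functor_def rl_def)

lemma converse_El: "F : ObR ==> (El F)\<inverse> = El F" using El_per by (auto dest: symD)

text \<open>Injectivity on germs; \<open>LS_mono\<close> shows that it makes a stable arrow left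
  cancellable.\<close>

definition "linj al F <-> rl al O (rl al)\<inverse> <= El F"

definition "lsurj al G <-> El G <= (rl al)\<inverse> O rl al"

lemma linj_qf: "f : RHom F G ==> linj (qf f) F <-> ker_dies f" by (simp add: linj_def rl_qf gr_inj_iff)

lemma lsurj_qf: "f : RHom F G ==> lsurj (qf f) G <-> coker_dies f" by (simp add: lsurj_def rl_qf gr_surj_iff)

lemma linj_lsurj_Comp: assumes a: "al : SHom F G" and b: "be : SHom G H"
 shows "linj al F ==> linj be G ==> linj (be o[LS] al) F" "lsurj al G ==> lsurj be H ==> lsurj (be o[LS] al) H"
 "linj (be o[LS] al) F ==> linj al F" "lsurj (be o[LS] al) H ==> lsurj be H"
proof -
 note ra = rl[OF a] and rb = rl[OF b]
 have 1: "rl al O (rl be O (rl be)\<inverse>) O (rl al)\<inverse> <= rl al O El G O (rl al)\<inverse>" if "linj be G"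
 using that unfolding linj_def by (intro relcomp_mono subset_refl)
 show "linj (be o[LS] al) F" if "linj al F" "linj be G"
 proof -
 have "rl al O El G O (rl al)\<inverse> = rl al O (rl al)\<inverse>" by (simp only: O_assoc[symmetric] ra(2))
 thus ?thesis using 1[OF that(2)] that(1) unfolding linj_def rl_Comp[OF a b] converse_relcomp O_assoc by (simp only:) qed
 have 2: "(rl be)\<inverse> O El G O rl be <= (rl be)\<inverse> O ((rl al)\<inverse> O rl al) O rl be" if "lsurj al G"
 using that unfolding lsurj_def by (intro relcomp_mono subset_refl)
 show "lsurj (be o[LS] al) H" if "lsurj al G" "lsurj be H"
 using 2[OF that(1)] that(2) unfolding lsurj_def rl_Comp[OF a b] converse_relcomp rb(1) O_assoc by (rule order_trans[rotated])
 have 3: "rl al O El G O (rl al)\<inverse> <= rl al O (rl be O (rl be)\<inverse>) O (rl al)\<inverse>" by (intro relcomp_mono subset_refl rb(3))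
 show "linj al F" if "linj (be o[LS] al) F"
 proof -
 have "rl al O El G O (rl al)\<inverse> = rl al O (rl al)\<inverse>" by (simp only: O_assoc[symmetric] ra(2))
 thus ?thesis using 3 that unfolding linj_def rl_Comp[OF a b] converse_relcomp O_assoc by (simp only:) qed
 have 4: "(rl be)\<inverse> O ((rl al)\<inverse> O rl al) O rl be <= (rl be)\<inverse> O El G O rl be" by (intro relcomp_mono subset_refl ra(4))
 show "lsurj be H" if "lsurj (be o[LS] al) H" using 4 that unfolding lsurj_def rl_Comp[OF a b] converse_relcomp rb(1) O_assoc by (rule order_trans[rotated])
qed

section \<open>Calculus of right fractions in the stable category\<close>

lemma W_Comp: "[|f : RHom F G; g : RHom G H; f : Wset; g : Wset|] ==> g o[Rep] f : Wset"
 using linj_lsurj_Comp[OF qf_in[of f F G] qf_in[of g G H]] linj_qf[of f F G] linj_qf[of g G H] lsurj_qf[of f F G] lsurj_qf[of g G H]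
 linj_qf[OF Rep.Comp_in[of f F G g H]] lsurj_qf[OF Rep.Comp_in[of f F G g H]] W_iff[of f F G] W_iff[of g G H]
 W_iff[OF Rep.Comp_in[of f F G g H]] qf_Comp[of f F G g H] by simp

lemma W_Id: assumes F: "F : ObR" shows "Id Rep F : Wset"
 unfolding W_iff[OF Rep.Id_in_Homs[OF F]] gr_inj_iff[OF Rep.Id_in_Homs[OF F], symmetric] gr_surj_iff[OF Rep.Id_in_Homs[OF F], symmetric]
proof
 have "El F O El F = El F" using gr_functional(1)[OF Rep.Id_in_Homs[OF F]] by (simp add: El_def)
 thus "gr (Id Rep F) O (gr (Id Rep F))\<inverse> <= El F" "El F <= (gr (Id Rep F))\<inverse> O gr (Id Rep F)"
 unfolding El_def[symmetric] converse_El[OF F] by simp_all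
qed

text \<open>The Ore condition. In the fibre product, an element killed by p is determined by its
  image under q, which dies; and the elements of F lift once their images in G have moved into the
  image of s.\<close>

lemma W_pullback: assumes f: "f : RHom F G" and s: "s : RHom G' G" "s : Wset"
 obtains P p q where "p : RHom P F" "p : Wset" "q : RHom P G'" "f o[Rep] p = s o[Rep] q"
proof -
 obtain P p q where p: "p : RHom P F" and q: "q : RHom P G'"
 and e: "!!X z. X : Ob ==> z : car P X ==> nt f X (nt p X z) = nt s X (nt q X z)"
 and ex: "!!X x y. [|X : Ob; x : car F X; y : car G' X; nt f X x = nt s X y|] ==> EX z : car P X. nt p X z = x & nt q X z = y"
 and un: "!!X z z'. [|X : Ob; z : car P X; z' : car P X; nt p X z = nt p X z'; nt q X z = nt q X z'|] ==> z = z'" by (rule pullback[OF f s(1)]) blast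
 have O: "P : ObR" "F : ObR" "G : ObR" "G' : ObR" using Rep.ends f s p q by blast+
 note sW = s(2)[unfolded W_iff[OF s(1)]]
 have "ker_dies p" unfolding ker_dies_iff[OF p]
 proof (intro ballI impI)
 fix X z assume X: "X : Ob" and z: "z : car P X" and pz: "nt p X z = 0[FO F X]"
 have "nt s X (nt q X z) = 0[FO G X]" using e[OF X z] pz nt_zero[OF f X] by simp
 hence "dies G' X (nt q X z)" using sW X nt_cl[OF q X z] ker_dies_iff[OF s(1)] by blast
 then obtain Y ph where y: "ph : Hom X Y" "act G' ph (nt q X z) = 0[FO G' Y]" unfolding dies_def by blast
 have Y: "Y : Ob" using U.ends[OF y(1)] by simp
 interpret M: rmod R "FO P Y" by (rule rmodI[OF rep_mod[OF O(1) Y]])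
 have "act P ph z = 0[FO P Y]" by (rule un[OF Y act_cl[OF O(1) y(1) z] M.zero_closed])
 (simp_all add: nt_nat[OF p y(1) z] nt_nat[OF q y(1) z] pz y(2) act_zero[OF O(2) y(1)] nt_zero[OF p Y] nt_zero[OF q Y])
 thus "dies P X z" using y(1) unfolding dies_def by blast qed moreover have "coker_dies p" unfolding coker_dies_iff[OF p]
 proof (intro ballI)
 fix X x assume X: "X : Ob" and x: "x : car F X"
 obtain Y ph y where y: "ph : Hom X Y" "y : car G' Y" "act G ph (nt f X x) = nt s Y y" using sW X nt_cl[OF f X x] coker_dies_iff[OF s(1)] by blast
 have Y: "Y : Ob" using U.ends[OF y(1)] by simp
 have "nt f Y (act F ph x) = nt s Y y" using nt_nat[OF f y(1) x] y(3) by simp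
 from ex[OF Y act_cl[OF O(2) y(1) x] y(2) this] have "act F ph x : nt p Y ` car P Y" by (metis imageI)
 thus "EX Y. EX ph : Hom X Y. act F ph x : nt p Y ` car P Y" using y(1) by blast qed moreover have "f o[Rep] p = s o[Rep] q"
 by (rule nt_ext[OF Rep.Comp_in[OF p f] Rep.Comp_in[OF q s(1)]]) (simp only: nt_Comp[OF p f] nt_Comp[OF q s(1)] e)
 ultimately show thesis using that p q W_iff[OF p] by blast
qed

text \<open>Equal germs mean that every x reaches, after stabilising, the equaliser of f and g. Its
  inclusion is therefore inverted in the stable category and can be cancelled.\<close>

lemma qf_eqI: assumes f: "f : RHom F G" and g: "g : RHom F G" and e: "gr f = gr g" shows "qf f = qf g"
proof -
 have O: "F : ObR" "G : ObR" using Rep.ends[OF f] by auto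
 define N where "N X = {x : car F X. nt f X x = nt g X x}" for X
 have N: "subrep F N" unfolding subrep_def
 proof (intro conjI ballI allI)
 fix X assume X: "X : Ob"
 interpret M: rmod R "FO F X" by (rule rmodI[OF rep_mod[OF O(1) X]])
 interpret N: rmod R "FO G X" by (rule rmodI[OF rep_mod[OF O(2) X]])
 show "submodule (N X) R (FO F X)"
 by (rule M.submoduleI) (auto simp: N_def nt_zero[OF f X] nt_zero[OF g X] lin_add[OF nt_lin(1)[OF f X]] lin_add[OF nt_lin(1)[OF g X]]
 lin_smult[OF nt_lin(1)[OF f X]] lin_smult[OF nt_lin(1)[OF g X]] M.lin_neg[OF N.module_axioms nt_lin(1)[OF f X]] M.lin_neg[OF N.module_axioms nt_lin(1)[OF g X]])
 next
 fix X Y ph x assume ph: "ph : Hom X Y" "x : N X"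
 thus "act F ph x : N Y" using nt_nat[OF f ph(1)] nt_nat[OF g ph(1)] act_cl[OF O(1) ph(1)] by (simp add: N_def) qed
 note i = sub_rep(2)[OF O(1) N]
 have i_eq: "nt (incl F N) X x = x" if "X : Ob" "x : N X" for X x using nt_incl[OF O(1) N that] .
 have "ker_dies (incl F N)" unfolding ker_dies_iff[OF i]
 using i_eq dies_zero[OF sub_rep(1)[OF O(1) N]] by (auto simp: sub_rep(3)[OF O(1) N] sub_rep(5)[OF O(1) N])
 moreover have "coker_dies (incl F N)" unfolding coker_dies_iff[OF i]
 proof (intro ballI)
 fix X x assume X: "X : Ob" and x: "x : car F X"
 obtain n where n: "X = ob n" using X UG_Obj by blast
 note xn = x[unfolded n]
 have "((n, x), (n, nt f (ob n) x)) : gr g" using gr_image[OF f order_refl xn] by (simp add: sb_Id[OF O(1) xn] e)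
 then obtain k where k: "n <= k" "nt g (ob k) (sb F n k x) = sb G n k (nt f (ob n) x)" unfolding gr_iff[OF g] by blast
 hence "sb F n k x : N (ob k)" using sb_closed[OF O(1) k(1) xn] sb_nt[OF f k(1) xn] by (simp add: N_def)
 hence "act F (sbt n k) x : nt (incl F N) (ob k) ` car (sub_rep F N) (ob k)"
 using i_eq[OF ob_in, of _ k] sub_rep(3)[OF O(1) N ob_in, of k] by (metis imageI sb_def)
 thus "EX Y. EX ph : Hom X Y. act F ph x : nt (incl F N) Y ` car (sub_rep F N) Y" using sbt_in[OF k(1)] n by blast qed
 ultimately have W: "incl F N : Wset" using W_iff[OF i] by blast
 have "f o[Rep] incl F N = g o[Rep] incl F N"
 proof (rule nt_ext[OF Rep.Comp_in[OF i f] Rep.Comp_in[OF i g]])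
 fix X x assume X: "X : Ob" and x: "x : car (sub_rep F N) X" hence xN: "x : N X" using sub_rep(3)[OF O(1) N X] by simp
 show "nt (f o[Rep] incl F N) X x = nt (g o[Rep] incl F N) X x" unfolding nt_Comp[OF i f X x] nt_Comp[OF i g X x] i_eq[OF X xN] using xN by (simp add: N_def)
 qed hence "qf f o[LS] qf (incl F N) = qf g o[LS] qf (incl F N)" using qf_Comp[OF i f] qf_Comp[OF i g] by simp
 thus ?thesis by (rule W_cancel[OF i W qf_in[OF f] qf_in[OF g]])
qed

text \<open>Letter by letter along a zigzag: a forward arrow is moved past t by a pullback, a formal
  inverse is absorbed into t by composition. The equation form avoids mentioning the inverse of
  t.\<close>

lemma fraction: assumes "al : SHom F G"
 obtains P t a where "t : RHom P F" "t : Wset" "a : RHom P G" "al o[LS] qf t = qf a"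
proof -
 have "EX P t a. t : RHom P F & t : Wset & a : RHom P G & al o[LS] qf t = qf a" using category_Rep assms
 proof (induction rule: localisation_induct)
 case (id F)
 note i = Rep.Id_in_Homs[OF id]
 show ?case using i W_Id[OF id] LS.Comp_Id_left[OF qf_in[OF i]] by blast
 next
 case (fwd F' F G f al)
 then obtain P t a where t: "t : RHom P F" "t : Wset" "a : RHom P G" "al o[LS] qf t = qf a" by blast
 obtain P' p r where p: "p : RHom P' F'" "p : Wset" "r : RHom P' P" "f o[Rep] p = t o[Rep] r" using W_pullback[OF fwd(1) t(1,2)] .
 have "(al o[LS] qf f) o[LS] qf p = al o[LS] (qf t o[LS] qf r)"
 unfolding LS.Comp_assoc[OF qf_in[OF p(1)] qf_in[OF fwd(1)] fwd(2)] qf_Comp[OF p(1) fwd(1), symmetric] p(4) qf_Comp[OF p(3) t(1)] ..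
 also have "... = qf (a o[Rep] r)" unfolding LS.Comp_assoc[OF qf_in[OF p(3)] qf_in[OF t(1)] fwd(2), symmetric] t(4) qf_Comp[OF p(3) t(3)] ..
 finally show ?case using p(1,2) Rep.Comp_in[OF p(3) t(3)] by blast
 next
 case (bwd F' F G s al)
 then obtain P t a where t: "t : RHom P F" "t : Wset" "a : RHom P G" "al o[LS] qf t = qf a" by blast
 note i = LS.Inv_Homs[OF qf_inv[OF bwd(1)] qf_in[OF bwd(2)]]
 note st = LS.Comp_in[OF qf_in[OF t(1)] qf_in[OF bwd(2)]]
 have "Inv LS (qf s) o[LS] (qf s o[LS] qf t) = qf t"
 unfolding LS.Comp_assoc[OF qf_in[OF t(1)] qf_in[OF bwd(2)] i, symmetric] LS.Inv_left[OF qf_inv[OF bwd(1)] qf_in[OF bwd(2)]]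
 by (rule LS.Comp_Id_left[OF qf_in[OF t(1)]])
 hence "(al o[LS] Inv LS (qf s)) o[LS] qf (s o[Rep] t) = qf a" unfolding qf_Comp[OF t(1) bwd(2)] LS.Comp_assoc[OF st i bwd(3)] using t(4) by simp
 thus ?case using Rep.Comp_in[OF t(1) bwd(2)] W_Comp[OF t(1) bwd(2) t(2) bwd(1)] t(3) by blast qed thus thesis using that by blast
qed

lemma rl_mono: assumes a: "al : SHom F G" "al' : SHom F G" and b: "be : SHom G H" "linj be G"
 and e: "be o[LS] al = be o[LS] al'" shows "rl al = rl al'"
proof -
 have E: "rl be O (rl be)\<inverse> = El G" using rl(3)[OF b(1)] b(2) unfolding linj_def by (rule subset_antisym[rotated])
 have "rl al O rl be = rl al' O rl be" using e rl_Comp[OF a(1) b(1)] rl_Comp[OF a(2) b(1)] by simp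
 hence "rl al O (rl be O (rl be)\<inverse>) = rl al' O (rl be O (rl be)\<inverse>)" by (simp only: O_assoc[symmetric])
 thus ?thesis unfolding E rl(2)[OF a(1)] rl(2)[OF a(2)] .
qed

lemma rl_epi: assumes a: "al : SHom F G" "lsurj al G" and b: "be : SHom G H" "be' : SHom G H"
 and e: "rl al O rl be = rl al O rl be'" shows "rl be = rl be'"
proof -
 have E: "(rl al)\<inverse> O rl al = El G" using rl(4)[OF a(1)] a(2) unfolding lsurj_def by (rule subset_antisym)
 have "((rl al)\<inverse> O rl al) O rl be = ((rl al)\<inverse> O rl al) O rl be'" by (simp only: O_assoc e)
 thus ?thesis unfolding E rl(1)[OF b(1)] rl(1)[OF b(2)] .
qed

text \<open>Precomposing with inverted arrows clears the denominators of both arrows; what remains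
  is \<open>qf_eqI\<close> for honest maps.\<close>

lemma rl_faithful: assumes a: "al : SHom F G" and b: "be : SHom F G" and e: "rl al = rl be" shows "al = be"
proof -
 obtain P t f where t: "t : RHom P F" "t : Wset" "f : RHom P G" "al o[LS] qf t = qf f" using fraction[OF a] .
 note qt = qf_in[OF t(1)]
 note bt = LS.Comp_in[OF qt b]
 obtain P' t' g where t': "t' : RHom P' P" "t' : Wset" "g : RHom P' G" "(be o[LS] qf t) o[LS] qf t' = qf g" using fraction[OF bt] .
 note qt' = qf_in[OF t'(1)] and ft = Rep.Comp_in[OF t'(1) t(3)]
 have "gr (f o[Rep] t') = gr g" unfolding rl_qf[OF ft, symmetric] rl_qf[OF t'(3), symmetric] qf_Comp[OF t'(1) t(3)] t(4)[symmetric] t'(4)[symmetric]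
 rl_Comp[OF qt' LS.Comp_in[OF qt a]] rl_Comp[OF qt' bt] rl_Comp[OF qt a] rl_Comp[OF qt b] e ..
 from qf_eqI[OF ft t'(3) this] have "qf f o[LS] qf t' = (be o[LS] qf t) o[LS] qf t'" unfolding qf_Comp[OF t'(1) t(3)] t'(4) .
 hence "al o[LS] qf t = be o[LS] qf t" unfolding t(4) by (rule W_cancel[OF t'(1,2) qf_in[OF t(3)] bt])
 thus ?thesis by (rule W_cancel[OF t(1,2) a b])
qed

lemma LS_mono: assumes a: "al : SHom F G" "al' : SHom F G" and b: "be : SHom G H" "linj be G"
 and e: "be o[LS] al = be o[LS] al'" shows "al = al'" by (rule rl_faithful[OF a rl_mono[OF a b e]])

lemma LS_epi: assumes a: "al : SHom F G" "lsurj al G" and b: "be : SHom G H" "be' : SHom G H"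
 and e: "be o[LS] al = be' o[LS] al" shows "be = be'"
 by (rule rl_faithful[OF b rl_epi[OF a b]]) (simp only: rl_Comp[OF a(1) b(1), symmetric] rl_Comp[OF a(1) b(2), symmetric] e)

abbreviation "qz F G == qf (zmap F G)"

lemma qz_Comp: assumes b: "be : SHom F G" and H: "H : ObR" shows "be o[LS] qz H F = qz H G" "qz G H o[LS] be = qz F H"
proof -
 obtain P t a where t: "t : RHom P F" "t : Wset" "a : RHom P G" "be o[LS] qf t = qf a" using fraction[OF b] .
 have O: "P : ObR" "F : ObR" "G : ObR" using Rep.ends[OF t(1)] Rep.ends[OF t(3)] by auto
 note zP = zmap_in[OF H O(1)] and zG = zmap_in[OF O(3) H] and zF = zmap_in[OF O(2) H]
 show "be o[LS] qz H F = qz H G"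
 unfolding zmap_Comp(1)[OF t(1) H, symmetric] qf_Comp[OF zP t(1)] LS.Comp_assoc[OF qf_in[OF zP] qf_in[OF t(1)] b, symmetric] t(4)
 qf_Comp[OF zP t(3), symmetric] zmap_Comp(1)[OF t(3) H] ..
 have "(qz G H o[LS] be) o[LS] qf t = qz F H o[LS] qf t"
 unfolding LS.Comp_assoc[OF qf_in[OF t(1)] b qf_in[OF zG]] t(4) qf_Comp[OF t(3) zG, symmetric] qf_Comp[OF t(1) zF, symmetric]
 zmap_Comp(2)[OF t(3) H] zmap_Comp(2)[OF t(1) H] ..
 thus "qz G H o[LS] be = qz F H" by (rule W_cancel[OF t(1,2) LS.Comp_in[OF b qf_in[OF zG]] qf_in[OF zF]])
qed

text \<open>The set P lets the criterion serve both for the whole stable category (P = UNIV) and for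
  its polynomial subcategories.\<close>

lemma zero_object_LS: assumes Z: "Z : ObR" "Z : P" shows "zero_object (full LS P) Z <-> Id LS Z = qz Z Z"
proof
 assume "zero_object (full LS P) Z" hence "EX! f. f : Homs (full LS P) Z Z" by (rule zero_objectD) (simp add: Obj_LS Z)
 hence "EX! f. f : SHom Z Z" unfolding Homs_full[OF Z(2) Z(2)] .
 moreover have "Id LS Z : SHom Z Z" by (rule LS.Id_in_Homs) (simp add: Obj_LS Z) moreover note qf_in[OF zmap_in[OF Z(1) Z(1)]]
 ultimately show "Id LS Z = qz Z Z" by (elim ex1E) (rule trans[OF _ sym], (erule allE, erule mp, assumption)+)
next
 assume e: "Id LS Z = qz Z Z"
 show "zero_object (full LS P) Z" unfolding zero_object_def
 proof (intro conjI ballI)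
 show "Z : Obj (full LS P)" using Z by (simp add: Obj_LS)
 fix X assume "X : Obj (full LS P)" hence X: "X : ObR" "X : P" by (simp_all add: Obj_LS)
 have "f = qz X Z" if f: "f : SHom X Z" for f using LS.Comp_Id_left[OF f] qz_Comp(2)[OF f Z(1)] e by simp
 thus "EX! f. f : Homs (full LS P) X Z" unfolding Homs_full[OF X(2) Z(2)] using qf_in[OF zmap_in[OF X(1) Z(1)]] by blast
 have "f = qz Z X" if f: "f : SHom Z X" for f using LS.Comp_Id_right[OF f] qz_Comp(1)[OF f Z(1)] e by simp
 thus "EX! f. f : Homs (full LS P) Z X" unfolding Homs_full[OF Z(2) X(2)] using qf_in[OF zmap_in[OF Z(1) X(1)]] by blast qed
qed

text \<open>The germ of x is related to its image by the graph of f, hence by that of the zero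
  map.\<close>

lemma zmap_dies: assumes f: "f : RHom F G" and e: "qf f = qz F G" and X: "X : Ob" and x: "x : car F X" shows "dies G X (nt f X x)"
proof -
 have O: "F : ObR" "G : ObR" using Rep.ends[OF f] by auto
 note z = zmap_in[OF O]
 obtain n where n: "X = ob n" using X UG_Obj by blast
 note xn = x[unfolded n]
 have "gr f = gr (zmap F G)" using rl_qf[OF f] rl_qf[OF z] e by simp
 hence "((n, x), (n, nt f (ob n) x)) : gr (zmap F G)" using gr_image[OF f order_refl xn] by (simp add: sb_Id[OF O(1) xn])
 then obtain k where "n <= k" "nt (zmap F G) (ob k) (sb F n k x) = sb G n k (nt f (ob n) x)" unfolding gr_iff[OF z] by blast
 thus ?thesis unfolding n using dies_sb[OF O(2) nt_cl[OF f ob_in xn]] sb_closed[OF O(1) _ xn] ob_in by auto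
qed

text \<open>For a stably zero Z the inclusion of the zero representation lies in
  \<open>Wset\<close>; the identity and the zero map agree after precomposition with it.\<close>

lemma Id_zero_iff: assumes Z: "Z : ObR" shows "Id LS Z = qz Z Z <-> Z : Kset"
proof
 assume "Id LS Z = qz Z Z"
 hence "dies Z X x" if "X : Ob" "x : car Z X" for X x using zmap_dies[OF Rep.Id_in_Homs[OF Z] _ that] nt_Id[OF Z that] qf_Id[OF Z] by simp
 thus "Z : Kset" using Z by (simp add: Kset_def)
next
 assume K: "Z : Kset"
 note i = zmap_in[OF zero_rep(1) Z] and zz = zmap_in[OF Z Z]
 have k: "ker_dies (zmap zero_rep Z)" unfolding ker_dies_iff[OF i] using zero_rep(2) dies_zero[OF zero_rep(1)] by auto
 have c: "coker_dies (zmap zero_rep Z)" unfolding coker_dies_iff[OF i]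
 proof (intro ballI)
 fix X y assume X: "X : Ob" and y: "y : car Z X"
 then obtain Y ph where p: "ph : Hom X Y" "act Z ph y = 0[FO Z Y]" using K unfolding Kset_def dies_def by blast
 have Y: "Y : Ob" using U.ends[OF p(1)] by simp
 have "act Z ph y : nt (zmap zero_rep Z) Y ` car zero_rep Y" using zero_rep(2)[OF Y] Y p(2) by simp
 thus "EX Y. EX ph : Hom X Y. act Z ph y : nt (zmap zero_rep Z) Y ` car zero_rep Y" using p(1) by blast qed
 have W: "zmap zero_rep Z : Wset" using W_iff[OF i] k c by blast
 have "Id LS Z o[LS] qz zero_rep Z = qz Z Z o[LS] qz zero_rep Z" unfolding LS.Comp_Id_left[OF qf_in[OF i]] qz_Comp(2)[OF qf_in[OF i] Z] ..
 thus "Id LS Z = qz Z Z" by (rule W_cancel[OF i W LS.Id_in_Homs[of Z] qf_in[OF zz], rotated]) (use Z in \<open>simp add: Obj_LS\<close>)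
qed

lemma zero_object_St: "zero_object (St R B) F <-> F : Kset"
proof -
 have f: "full LS UNIV = LS" by (simp add: full_def localisation_def)
 have "F : ObR" if "zero_object LS F" using that by (simp add: zero_object_def Obj_LS)
 moreover have "F : ObR" if "F : Kset" using that by (simp add: Kset_def)
 ultimately show ?thesis unfolding St_eq using zero_object_LS[of F UNIV] Id_zero_iff[of F] unfolding f by blast
qed

text \<open>The successor step needs differences for all admissible m, which
  \<open>polp_Suc_iff\<close> derives from m = 1.\<close>

lemma Pol_eq: "Pol R B (int n - 1) = polp n"
proof (induction n)
 case 0
 have "{F. zero_object (St R B) F} = Kset" using zero_object_St by blast thus ?case by (subst Pol.simps) simp
next
 case (Suc n)
 have "Obj (St R B) = ObR" unfolding St_eq by (rule Obj_LS)
 hence "Pol R B (int n) = {F : ObR. ALL m : Obj_nat B. delta R B m F : polp n}" by (subst Pol.simps) (simp add: Suc)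
 also have "... = polp (Suc n)" using polp_Suc_iff by blast finally show ?case by simp
qed

lemma zero_rep_polp: "zero_rep : polp n"
proof -
 have "zero_rep : polp 0" using zero_rep(2) dies_zero[OF zero_rep(1)] zero_rep(1) by (simp add: Kset_def)
 thus ?thesis using polp_mono_le[of 0 n] by blast
qed

lemma zero_arrow_LS:
 assumes a: "al : SHom F G" and F: "F : polp n" and G: "G : polp n" shows "zero_arrow (full LS (polp n)) al <-> al = qz F G"
proof
 have e: "Dom LS al = F" "Cod LS al = G" using HomsD[OF a] by auto
 note O = polp_Obj[OF F] polp_Obj[OF G]
 { assume "zero_arrow (full LS (polp n)) al"
 then obtain Z u v where z: "zero_object (full LS (polp n)) Z" "u : Homs (full LS (polp n)) F Z"
 "v : Homs (full LS (polp n)) Z G" "al = v o[LS] u" unfolding zero_arrow_def Comp_full Dom_full Cod_full e by blast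
 have Z: "Z : ObR" "Z : polp n" using z(1) by (simp_all add: zero_object_def Obj_LS)
 have uv: "u : SHom F Z" "v : SHom Z G" using z(2,3) unfolding Homs_full[OF F Z(2)] Homs_full[OF Z(2) G] .
 have "u = Id LS Z o[LS] u" by (rule LS.Comp_Id_left[OF uv(1), symmetric])
 also have "... = qz F Z" using zero_object_LS[OF Z] z(1) qz_Comp(2)[OF uv(1) Z(1)] by simp
 finally show "al = qz F G" using z(4) qz_Comp(1)[OF uv(2) O(1)] by simp }
 assume al: "al = qz F G"
 have "zero_rep : Kset" using zero_rep_polp[of 0] by simp
 hence "zero_object (full LS (polp n)) zero_rep" using zero_object_LS[OF zero_rep(1) zero_rep_polp] Id_zero_iff[OF zero_rep(1)] by blast
 moreover have "al = qz zero_rep G o[LS] qz F zero_rep" unfolding al by (rule qz_Comp(1)[OF qf_in[OF zmap_in[OF zero_rep(1) O(2)]] O(1), symmetric])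
 ultimately show "zero_arrow (full LS (polp n)) al" unfolding zero_arrow_def Comp_full Dom_full Cod_full e
 using qf_in[OF zmap_in[OF O(1) zero_rep(1)]] qf_in[OF zmap_in[OF zero_rep(1) O(2)]]
 unfolding Homs_full[OF F zero_rep_polp, of LS, symmetric] Homs_full[OF zero_rep_polp G, of LS, symmetric] by blast
qed

end

section \<open>Kernels, cokernels and inverted arrows in the polynomial subcategories\<close>

context rep_setting
begin

text \<open>Closure under stable subobjects: a fraction replaces u by an honest map whose kernel
  dies, and its source maps to F by an arrow of \<open>Wset\<close>.\<close>

lemma polp_linj: assumes u: "u : SHom F G" "linj u F" and G: "G : polp n" shows "F : polp n"
proof -
 obtain P t b where t: "t : RHom P F" "t : Wset" "b : RHom P G" "u o[LS] qf t = qf b" using fraction[OF u(1)] .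
 note tW = t(2)[unfolded W_iff[OF t(1)]]
 have "linj (qf b) P" unfolding t(4)[symmetric] using linj_lsurj_Comp(1)[OF qf_in[OF t(1)] u(1)] linj_qf[OF t(1)] tW u(2) by simp
 hence "ker_dies b" by (simp add: linj_qf[OF t(3)]) hence "P : polp n" using polp_sub[OF t(3) G] unfolding ker_dies_iff[OF t(3)] by blast
 thus ?thesis using polp_quot[OF t(1)] tW unfolding coker_dies_iff[OF t(1)] by blast
qed

lemma polp_W: assumes t: "t : RHom P F" "t : Wset" and F: "F : polp n" shows "P : polp n"
 using polp_sub[OF t(1) F] t(2)[unfolded W_iff[OF t(1)]] ker_dies_iff[OF t(1)] by blast

lemma polp_lsurj: assumes u: "u : SHom F G" "lsurj u G" and F: "F : polp n" shows "G : polp n"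
proof -
 obtain P t b where t: "t : RHom P F" "t : Wset" "b : RHom P G" "u o[LS] qf t = qf b" using fraction[OF u(1)] .
 note tW = t(2)[unfolded W_iff[OF t(1)]]
 have "lsurj (qf b) G" unfolding t(4)[symmetric] using linj_lsurj_Comp(2)[OF qf_in[OF t(1)] u(1)] lsurj_qf[OF t(1)] tW u(2) by simp
 hence "coker_dies b" by (simp add: lsurj_qf[OF t(3)])
 thus ?thesis using polp_quot[OF t(3) polp_W[OF t(1,2) F]] unfolding coker_dies_iff[OF t(3)] by blast
qed

lemma Ker_polp: assumes f: "f : RHom F G" and F: "F : polp n" shows "Ker f : polp n"
proof (rule polp_sub[OF ker_in_Homs[OF f] F])
 fix X x assume X: "X : Ob" and x: "x : car (Ker f) X" "nt (ker_in f) X x = 0[FO F X]"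
 have "subrep F (kr f)" "F : ObR" "Dom Rep f = F" using subrep_kr[OF f] Rep.ends[OF f] HomsD[OF f] by simp_all
 hence "x = 0[FO (Ker f) X]" using x(2) ker_coker(2)[OF f X x(1)] sub_rep(5)[of F "kr f" X] X by simp
 thus "dies (Ker f) X x" using dies_zero[OF _ X] Rep.ends[OF ker_in_Homs[OF f]] by simp
qed

lemma Coker_polp: assumes f: "f : RHom F G" and G: "G : polp n" shows "Coker f : polp n" by (rule polp_quot_surj[OF coker_in[OF f] G ker_coker(3)[OF f]])

lemma linj_ker_in: assumes f: "f : RHom F G" shows "linj (qf (ker_in f)) (Ker f)" unfolding linj_qf[OF ker_in_Homs[OF f]] ker_dies_iff[OF ker_in_Homs[OF f]]
proof (intro ballI impI)
 fix X x assume X: "X : Ob" and x: "x : car (Ker f) X" "nt (ker_in f) X x = 0[FO F X]"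
 have "subrep F (kr f)" "F : ObR" "Dom Rep f = F" using subrep_kr[OF f] Rep.ends[OF f] HomsD[OF f] by simp_all
 hence "x = 0[FO (Ker f) X]" using x(2) ker_coker(2)[OF f X x(1)] sub_rep(5)[of F "kr f" X] X by simp
 thus "dies (Ker f) X x" using dies_zero[OF _ X] Rep.ends[OF ker_in_Homs[OF f]] by simp
qed

lemma coker_dies_surj:
 assumes f: "f : RHom F G" and s: "!!X. X : Ob ==> nt f X ` car F X = car G X" shows "coker_dies f" unfolding coker_dies_iff[OF f]
proof (intro ballI)
 fix X y assume X: "X : Ob" and y: "y : car G X"
 have "act G (Id UB X) y : nt f X ` car F X" using act_Id[OF _ X y] Rep.ends[OF f] s[OF X] y by simp
 thus "EX Y. EX ph : Hom X Y. act G ph y : nt f Y ` car F Y" using U.Id_in_Homs[OF X] by blast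
qed

lemma lsurj_coker_pr: assumes f: "f : RHom F G" shows "lsurj (qf (coker_pr f)) (Coker f)"
 unfolding lsurj_qf[OF coker_in[OF f]] by (rule coker_dies_surj[OF coker_in[OF f] ker_coker(3)[OF f]])

text \<open>If f becomes zero stably, every image under f dies, so every x moves into the
  kernel.\<close>

lemma ker_in_W: assumes f: "f : RHom F G" and e: "qf f = qz F G" shows "ker_in f : Wset"
proof -
 note k = ker_in_Homs[OF f]
 have F: "F : ObR" using Rep.ends[OF f] by simp
 have "ker_dies (ker_in f)" using linj_ker_in[OF f] unfolding linj_qf[OF k] .
 moreover have "coker_dies (ker_in f)" unfolding coker_dies_iff[OF k]
 proof (intro ballI)
 fix X x assume X: "X : Ob" and x: "x : car F X"
 obtain Y ph where p: "ph : Hom X Y" "act G ph (nt f X x) = 0[FO G Y]" using zmap_dies[OF f e X x] unfolding dies_def by blast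
 have Y: "Y : Ob" using U.ends[OF p(1)] by simp
 have k': "act F ph x : car (Ker f) Y" using ker_coker(1)[OF f Y] act_cl[OF F p(1) x] nt_nat[OF f p(1) x] p(2) by simp
 have "act F ph x : nt (ker_in f) Y ` car (Ker f) Y" using imageI[OF k', of "nt (ker_in f) Y"] unfolding ker_coker(2)[OF f Y k'] .
 thus "EX Y. EX ph : Hom X Y. act F ph x : nt (ker_in f) Y ` car (Ker f) Y" using p(1) by blast qed
 ultimately show ?thesis using W_iff[OF k] by blast
qed

text \<open>Write g as a fraction b over t. The composite of a and b is only stably zero, but on its
  own kernel, which is stably all of P, it vanishes and b factors honestly.\<close>

lemma LS_ker_factor: assumes a: "a : RHom F G" and g: "g : SHom D F" and z: "qf a o[LS] g = qz D G"
 obtains u where "u : SHom D (Ker a)" "qf (ker_in a) o[LS] u = g"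
proof -
 obtain P t b where t: "t : RHom P D" "t : Wset" "b : RHom P F" "g o[LS] qf t = qf b" using fraction[OF g] .
 have O: "G : ObR" "D : ObR" "P : ObR" using Rep.ends[OF a] Rep.ends[OF t(1)] by auto
 note ab = Rep.Comp_in[OF t(3) a] and k = ker_in_Homs[OF a]
 have "qf (a o[Rep] b) = qz P G" unfolding qf_Comp[OF t(3) a] t(4)[symmetric] LS.Comp_assoc[OF qf_in[OF t(1)] g qf_in[OF a], symmetric] z
 by (rule qz_Comp(2)[OF qf_in[OF t(1)] O(1)])
 note jW = ker_in_W[OF ab this] and j = ker_in_Homs[OF ab]
 let ?j = "ker_in (a o[Rep] b)"
 note bj = Rep.Comp_in[OF j t(3)] and tj = Rep.Comp_in[OF j t(1)]
 have "a o[Rep] (b o[Rep] ?j) = zmap (Ker (a o[Rep] b)) G" unfolding Rep.Comp_assoc[OF j t(3) a, symmetric] by (rule zero_kc(1)[OF ab])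
 then obtain u' where u': "u' : RHom (Ker (a o[Rep] b)) (Ker a)" "ker_in a o[Rep] u' = b o[Rep] ?j" using ker_factor[OF a bj] by blast
 note W = W_Comp[OF j t(1) jW t(2)]
 obtain u where u: "u : SHom D (Ker a)" "u o[LS] qf (t o[Rep] ?j) = qf u'" using W_extend[OF tj W qf_in[OF u'(1)]] .
 have "(qf (ker_in a) o[LS] u) o[LS] qf (t o[Rep] ?j) = qf (ker_in a) o[LS] qf u'" unfolding LS.Comp_assoc[OF qf_in[OF tj] u(1) qf_in[OF k]] u(2) ..
 also have "... = g o[LS] qf (t o[Rep] ?j)" unfolding qf_Comp[OF u'(1) k, symmetric] u'(2) qf_Comp[OF j t(3)] t(4)[symmetric] qf_Comp[OF j t(1)]
 by (rule LS.Comp_assoc[OF qf_in[OF j] qf_in[OF t(1)] g])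
 finally have "qf (ker_in a) o[LS] u = g" by (rule W_cancel[OF tj W LS.Comp_in[OF u(1) qf_in[OF k]] g]) thus thesis using that u(1) by blast
qed

text \<open>The denominator t ends at G, so b lives on P and not on G. The cokernel of a is
  therefore replaced by a quotient of P on which b is defined and which has the same image in the
  stable category.\<close>

lemma LS_coker_factor: assumes a: "a : RHom F G" and g: "g : SHom G D" and z: "g o[LS] qf a = qz F D"
 obtains u where "u : SHom (Coker a) D" "u o[LS] qf (coker_pr a) = g"
proof -
 obtain P t b where t: "t : RHom P G" "t : Wset" "b : RHom P D" "g o[LS] qf t = qf b" using fraction[OF g] .
 have O: "F : ObR" "D : ObR" "P : ObR" using Rep.ends[OF a] Rep.ends[OF t(3)] by auto
 note p = coker_in[OF a]
 let ?p = "coker_pr a" and ?c = "coker_pr a o[Rep] t"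
 note c = Rep.Comp_in[OF t(1) p]
 let ?j = "ker_in ?c" let ?K = "Ker ?c"
 note j = ker_in_Homs[OF c]
 note bj = Rep.Comp_in[OF j t(3)] and tj = Rep.Comp_in[OF j t(1)]
 have K: "?K : ObR" using Rep.ends[OF j] by simp
 \<comment> \<open>The part of P that t sends into the image of a is covered by the pullback E with
   F; there b becomes g after a, which vanishes, and a surjection can be cancelled on the
   right.\<close>
 have bj0: "qf (b o[Rep] ?j) = qz ?K D"
 proof -
 obtain E e w where e: "e : RHom E ?K" "w : RHom E F"
 and ee: "!!X z. X : Ob ==> z : car E X ==> nt (t o[Rep] ?j) X (nt e X z) = nt a X (nt w X z)"
 and ex: "!!X x y. [|X : Ob; x : car ?K X; y : car F X; nt (t o[Rep] ?j) X x = nt a X y|] ==> EX z : car E X. nt e X z = x & nt w X z = y"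
 by (rule pullback[OF tj a]) blast
 have E: "E : ObR" using Rep.ends[OF e(1)] by simp
 have surj: "nt e X ` car E X = car ?K X" if X: "X : Ob" for X
 proof
 show "nt e X ` car E X <= car ?K X" using nt_cl[OF e(1) X] by blast
 show "car ?K X <= nt e X ` car E X"
 proof
 fix x assume x: "x : car ?K X"
 have xP: "x : car P X" "nt ?c X x = 0[FO (Coker a) X]" using x ker_coker(1)[OF c X] by auto
 have "nt t X x : nt a X ` car F X" using xP(2) ker_coker(4)[OF a X nt_cl[OF t(1) X xP(1)]] nt_Comp[OF t(1) p X xP(1)] by simp
 then obtain y where y: "y : car F X" "nt t X x = nt a X y" by blast
 have "nt (t o[Rep] ?j) X x = nt a X y" using nt_Comp[OF j t(1) X x] ker_coker(2)[OF c X x] y(2) by simp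
 from ex[OF X x y(1) this] obtain z where z: "z : car E X" "nt e X z = x" by blast
 thus "x : nt e X ` car E X" by (intro image_eqI[of _ _ z]) simp_all qed qed
 have ls: "lsurj (qf e) ?K" unfolding lsurj_qf[OF e(1)] by (rule coker_dies_surj[OF e(1) surj])
 have te: "(t o[Rep] ?j) o[Rep] e = a o[Rep] w"
 by (rule nt_ext[OF Rep.Comp_in[OF e(1) tj] Rep.Comp_in[OF e(2) a]]) (simp only: nt_Comp[OF e(1) tj] nt_Comp[OF e(2) a] ee)
 have bjg: "qf (b o[Rep] ?j) = g o[LS] qf (t o[Rep] ?j)"
 unfolding qf_Comp[OF j t(3)] t(4)[symmetric] qf_Comp[OF j t(1)] by (rule LS.Comp_assoc[OF qf_in[OF j] qf_in[OF t(1)] g])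
 have "qf (b o[Rep] ?j) o[LS] qf e = g o[LS] qf ((t o[Rep] ?j) o[Rep] e)"
 unfolding bjg qf_Comp[OF e(1) tj] by (rule LS.Comp_assoc[OF qf_in[OF e(1)] qf_in[OF tj] g]) also have "... = qz E D"
 unfolding te qf_Comp[OF e(2) a] LS.Comp_assoc[OF qf_in[OF e(2)] qf_in[OF a] g, symmetric] z by (rule qz_Comp(2)[OF qf_in[OF e(2)] O(2)])
 also have "... = qz ?K D o[LS] qf e" by (rule qz_Comp(2)[OF qf_in[OF e(1)] O(2), symmetric])
 finally show ?thesis by (rule LS_epi[OF qf_in[OF e(1)] ls qf_in[OF bj] qf_in[OF zmap_in[OF K O(2)]]]) qed
 \<comment> \<open>b vanishes on the preimage K of the image of a only stably; L is the part of K
   where it vanishes honestly, and L is stably all of K.\<close>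
 let ?i = "ker_in (b o[Rep] ?j)" let ?h = "?j o[Rep] ker_in (b o[Rep] ?j)" let ?L = "Ker (b o[Rep] ?j)"
 note i = ker_in_Homs[OF bj] and iW = ker_in_W[OF bj bj0]
 note h = Rep.Comp_in[OF i j] and r = coker_in[OF Rep.Comp_in[OF i j]]
 let ?r = "coker_pr ?h"
 have "b o[Rep] ?h = zmap ?L D" unfolding Rep.Comp_assoc[OF i j t(3), symmetric] by (rule zero_kc(1)[OF bj])
 then obtain b' where b': "b' : RHom (Coker ?h) D" "b' o[Rep] ?r = b" using coker_factor[OF h t(3)] by blast
 have "?c o[Rep] ?h = zmap ?L (Coker a)"
 unfolding Rep.Comp_assoc[OF i j c, symmetric] zero_kc(1)[OF c] using zmap_Comp(2)[OF i] Rep.ends[OF c] by blast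
 then obtain m where m: "m : RHom (Coker ?h) (Coker a)" "m o[Rep] ?r = ?c" using coker_factor[OF h c] by blast
 have Ch: "Coker ?h : ObR" using Rep.ends[OF r] by simp
 \<comment> \<open>The kernel of the map from P/L to the cokernel of a is K/L, which dies.\<close>
 have "ker_dies m" unfolding ker_dies_iff[OF m(1)]
 proof (intro ballI impI)
 fix X z assume X: "X : Ob" and z: "z : car (Coker ?h) X" and mz: "nt m X z = 0[FO (Coker a) X]"
 obtain x where x: "x : car P X" "z = nt ?r X x" using z ker_coker(3)[OF h X] by blast
 have "nt ?c X x = 0[FO (Coker a) X]" using nt_Comp[OF r m(1) X x(1)] m(2) mz x(2) by simp
 hence xK: "x : car ?K X" using x(1) ker_coker(1)[OF c X] by simp
 obtain Y ph where "ph : Hom X Y" "act ?K ph x : nt ?i Y ` car ?L Y" using iW[unfolded W_iff[OF i]] X xK unfolding coker_dies_iff[OF i] by blast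
 then obtain w where w: "ph : Hom X Y" "w : car ?L Y" "act ?K ph x = nt ?i Y w" by blast
 have Y: "Y : Ob" using U.ends[OF w(1)] by simp
 have "act P ph x = nt ?h Y w" using nt_nat[OF j w(1) xK] ker_coker(2)[OF c X xK] w(3) nt_Comp[OF i j Y w(2)] by simp
 hence "nt ?r Y (act P ph x) = 0[FO (Coker ?h) Y]" using ker_coker(4)[OF h Y act_cl[OF O(3) w(1) x(1)]] w(2) by blast
 thus "dies (Coker ?h) X z" using nt_nat[OF r w(1) x(1)] w(1) x(2) unfolding dies_def by auto qed moreover have "coker_dies m"
 proof -
 have "lsurj (qf t) G" using t(2)[unfolded W_iff[OF t(1)]] lsurj_qf[OF t(1)] by blast
 hence "lsurj (qf ?c) (Coker a)" unfolding qf_Comp[OF t(1) p] by (rule linj_lsurj_Comp(2)[OF qf_in[OF t(1)] qf_in[OF p] _ lsurj_coker_pr[OF a]])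
 hence "lsurj (qf (m o[Rep] ?r)) (Coker a)" unfolding m(2) .
 hence "lsurj (qf m) (Coker a)" unfolding qf_Comp[OF r m(1)] by (rule linj_lsurj_Comp(4)[OF qf_in[OF r] qf_in[OF m(1)]])
 thus ?thesis unfolding lsurj_qf[OF m(1)] . qed ultimately have mW: "m : Wset" using W_iff[OF m(1)] by blast
 obtain u where u: "u : SHom (Coker a) D" "u o[LS] qf m = qf b'" using W_extend[OF m(1) mW qf_in[OF b'(1)]] .
 note up = LS.Comp_in[OF qf_in[OF p] u(1)]
 have "(u o[LS] qf ?p) o[LS] qf t = u o[LS] qf (m o[Rep] ?r)" unfolding m(2) qf_Comp[OF t(1) p] by (rule LS.Comp_assoc[OF qf_in[OF t(1)] qf_in[OF p] u(1)])
 also have "... = (u o[LS] qf m) o[LS] qf ?r" unfolding qf_Comp[OF r m(1)] by (rule LS.Comp_assoc[OF qf_in[OF r] qf_in[OF m(1)] u(1), symmetric])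
 also have "... = g o[LS] qf t" unfolding u(2) t(4) using qf_Comp[OF r b'(1)] b'(2) by simp
 finally have "u o[LS] qf ?p = g" by (rule W_cancel[OF t(1,2) up g]) thus thesis using that u(1) by blast
qed

lemma full_Homs_iff: "g : Arr (full LS P) ==> g : SHom (Dom LS g) (Cod LS g) & Dom LS g : P & Cod LS g : P" by (auto simp: Arr_full_iff Homs_def)

lemma full_ArrI: "f : SHom F G ==> F : P ==> G : P ==> f : Arr (full LS P)" by (auto simp: Arr_full_iff Homs_def)

lemma is_kernel_LS:
 assumes a: "a : RHom F G" and F: "F : polp n" and G: "G : polp n" shows "is_kernel (full LS (polp n)) (qf a) (qf (ker_in a))"
proof -
 note k = ker_in_Homs[OF a] and K = Ker_polp[OF a F]
 have O: "Ker a : ObR" "G : ObR" using polp_Obj K G by auto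
 have z: "qf a o[LS] qf (ker_in a) = qz (Ker a) G" unfolding qf_Comp[OF k a, symmetric] zero_kc(1)[OF a] ..
 have "EX! u. u : Homs (full LS (polp n)) (Dom LS g) (Ker a) & qf (ker_in a) o[LS] u = g"
 if g: "g : Arr (full LS (polp n))" "Cod LS g = F" "zero_arrow (full LS (polp n)) (qf a o[LS] g)" for g
 proof -
 have gH: "g : SHom (Dom LS g) F" "Dom LS g : polp n" using full_Homs_iff[OF g(1)] g(2) by auto
 have "qf a o[LS] g = qz (Dom LS g) G" using g(3) zero_arrow_LS[OF LS.Comp_in[OF gH(1) qf_in[OF a]] gH(2) G] by blast
 from LS_ker_factor[OF a gH(1) this] obtain u where u: "u : SHom (Dom LS g) (Ker a)" "qf (ker_in a) o[LS] u = g" .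
 show ?thesis unfolding Homs_full[OF gH(2) K]
 by (rule ex1I[of _ u], rule conjI[OF u]) (rule LS_mono[OF conjunct1 u(1) qf_in[OF k] linj_ker_in[OF a] trans[OF conjunct2 u(2)[symmetric]]], assumption+)
 qed
 moreover have "zero_arrow (full LS (polp n)) (qf a o[LS] qf (ker_in a))" using zero_arrow_LS[OF LS.Comp_in[OF qf_in[OF k] qf_in[OF a]] K G] z by blast
 ultimately show ?thesis unfolding is_kernel_def using full_ArrI[OF qf_in[OF k] K F] HomsD[OF qf_in[OF k]] HomsD[OF qf_in[OF a]] by simp
qed

lemma is_cokernel_LS:
 assumes a: "a : RHom F G" and F: "F : polp n" and G: "G : polp n" shows "is_cokernel (full LS (polp n)) (qf a) (qf (coker_pr a))"
proof -
 note c = coker_in[OF a] and K = Coker_polp[OF a G]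
 have z: "qf (coker_pr a) o[LS] qf a = qz F (Coker a)" unfolding qf_Comp[OF a c, symmetric] zero_kc(2)[OF a] ..
 have "EX! u. u : Homs (full LS (polp n)) (Coker a) (Cod LS g) & u o[LS] qf (coker_pr a) = g"
 if g: "g : Arr (full LS (polp n))" "Dom LS g = G" "zero_arrow (full LS (polp n)) (g o[LS] qf a)" for g
 proof -
 have gH: "g : SHom G (Cod LS g)" "Cod LS g : polp n" using full_Homs_iff[OF g(1)] g(2) by auto
 have "g o[LS] qf a = qz F (Cod LS g)" using g(3) zero_arrow_LS[OF LS.Comp_in[OF qf_in[OF a] gH(1)] F gH(2)] by blast
 from LS_coker_factor[OF a gH(1) this] obtain u where u: "u : SHom (Coker a) (Cod LS g)" "u o[LS] qf (coker_pr a) = g" .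
 show ?thesis unfolding Homs_full[OF K gH(2)]
 by (rule ex1I[of _ u], rule conjI[OF u]) (rule LS_epi[OF qf_in[OF c] lsurj_coker_pr[OF a] conjunct1 u(1) trans[OF conjunct2 u(2)[symmetric]]], assumption+)
 qed
 moreover have "zero_arrow (full LS (polp n)) (qf (coker_pr a) o[LS] qf a)" using zero_arrow_LS[OF LS.Comp_in[OF qf_in[OF a] qf_in[OF c]] F K] z by blast
 ultimately show ?thesis unfolding is_cokernel_def using full_ArrI[OF qf_in[OF c] G K] HomsD[OF qf_in[OF c]] HomsD[OF qf_in[OF a]] by simp
qed

text \<open>For an honest map between polynomial representations, its kernel and cokernel as
  representations remain kernel and cokernel in the polynomial subcategory, so they decide
  membership.\<close>

lemma qf_isos_mod: assumes a: "a : RHom F G" and F: "F : polp n" and G: "G : polp n" and K: "Ker a : polp m" and C: "Coker a : polp m"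
 shows "qf a : isos_mod (full LS (polp n)) (polp m)" unfolding isos_mod_def using full_ArrI[OF qf_in[OF a] F G] is_kernel_LS[OF a F G] is_cokernel_LS[OF a F G]
 HomsD[OF qf_in[OF ker_in_Homs[OF a]]] HomsD[OF qf_in[OF coker_in[OF a]]] K C
 by (intro CollectI conjI exI[of _ "qf (ker_in a)"] exI[of _ "qf (coker_pr a)"]) simp_all

text \<open>Up to a denominator in \<open>Wset\<close>, s is an honest map a. Its kernel embeds on
  germs into the given kernel of s and its cokernel is hit by the given cokernel, so both inherit
  the degree bound. Honest maps are what the exactness of \<open>LM\<close> can act on.\<close>

lemma isos_mod_fraction: assumes s: "s : isos_mod (full LS (polp n)) (polp m)"
 obtains F G P t a where "s : SHom F G" "F : polp n" "G : polp n" "t : RHom P F" "t : Wset" "a : RHom P G"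
 "s o[LS] qf t = qf a" "P : polp n" "Ker a : polp m" "Coker a : polp m"
proof -
 let ?C = "full LS (polp n)"
 define F G where "F = Dom LS s" and "G = Cod LS s"
 obtain k c where s': "s : Arr ?C" and k: "is_kernel ?C s k" "Dom ?C k : polp m" and c: "is_cokernel ?C s c" "Cod ?C c : polp m"
 using s unfolding isos_mod_def by blast
 have sH: "s : SHom F G" and F: "F : polp n" and G: "G : polp n" using full_Homs_iff[OF s'] by (auto simp: F_def G_def)
 obtain P t a where t: "t : RHom P F" "t : Wset" "a : RHom P G" "s o[LS] qf t = qf a" using fraction[OF sH] .
 have P: "P : polp n" by (rule polp_W[OF t(1,2) F])
 note K = Ker_polp[OF t(3) P] and Q = Coker_polp[OF t(3) G]
 note ki = qf_in[OF ker_in_Homs[OF t(3)]] and cp = qf_in[OF coker_in[OF t(3)]]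
 note qt = qf_in[OF t(1)]
 note g = LS.Comp_in[OF ki qt]
 have O: "Ker a : ObR" "G : ObR" "Coker a : ObR" using polp_Obj K G Q by auto
 have "s o[LS] (qf t o[LS] qf (ker_in a)) = qz (Ker a) G"
 unfolding LS.Comp_assoc[OF ki qt sH, symmetric] t(4) qf_Comp[OF ker_in_Homs[OF t(3)] t(3), symmetric] zero_kc(1)[OF t(3)] ..
 hence "zero_arrow ?C (s o[?C] (qf t o[LS] qf (ker_in a)))" using zero_arrow_LS[OF LS.Comp_in[OF g sH] K G] by simp
 then obtain u where u: "u : Homs ?C (Ker a) (Dom ?C k)" "k o[LS] u = qf t o[LS] qf (ker_in a)"
 using is_kernelD[OF k(1) full_ArrI[OF g K F]] HomsD[OF g] by (auto simp: F_def)
 have kH: "k : SHom (Dom LS k) F" "Dom LS k : polp n" using k(1) full_Homs_iff[of k] by (auto simp: is_kernel_def F_def)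
 have uH: "u : SHom (Ker a) (Dom LS k)" using u(1) Homs_full[OF K kH(2), of LS] by simp
 have "linj (qf t o[LS] qf (ker_in a)) (Ker a)"
 by (rule linj_lsurj_Comp(1)[OF ki qt linj_ker_in[OF t(3)]]) (use t(2)[unfolded W_iff[OF t(1)]] linj_qf[OF t(1)] in blast)
 hence "linj u (Ker a)" unfolding u(2)[symmetric] by (rule linj_lsurj_Comp(3)[OF uH kH(1)])
 hence Km: "Ker a : polp m" using polp_linj[OF uH] k(2) by simp
 have "(qf (coker_pr a) o[LS] s) o[LS] qf t = qz F (Coker a) o[LS] qf t"
 unfolding LS.Comp_assoc[OF qt sH cp] t(4) qf_Comp[OF t(3) coker_in[OF t(3)], symmetric] zero_kc(2)[OF t(3)]
 by (rule qz_Comp(2)[OF qt O(3), symmetric])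
 hence "qf (coker_pr a) o[LS] s = qz F (Coker a)" by (rule W_cancel[OF t(1,2) LS.Comp_in[OF sH cp] qf_in[OF zmap_in[OF polp_Obj[OF F] O(3)]]])
 hence "zero_arrow ?C (qf (coker_pr a) o[?C] s)" using zero_arrow_LS[OF LS.Comp_in[OF sH cp] F Q] by simp
 then obtain v where v: "v : Homs ?C (Cod ?C c) (Coker a)" "v o[LS] c = qf (coker_pr a)"
 using is_cokernelD[OF c(1) full_ArrI[OF cp G Q]] HomsD[OF cp] by (auto simp: G_def)
 have cH: "c : SHom G (Cod LS c)" "Cod LS c : polp n" using c(1) full_Homs_iff[of c] by (auto simp: is_cokernel_def G_def)
 have vH: "v : SHom (Cod LS c) (Coker a)" using v(1) Homs_full[OF cH(2) Q, of LS] by simp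
 have "lsurj v (Coker a)" using lsurj_coker_pr[OF t(3)] unfolding v(2)[symmetric] by (rule linj_lsurj_Comp(4)[OF cH(1) vH])
 hence Qm: "Coker a : polp m" using polp_lsurj[OF vH] c(2) by simp
 show thesis by (rule that[OF sH F G t P Km Qm])
qed

end

section \<open>The Long-Moody functor\<close>

locale lm_system = rep_setting B R U
 for B :: "('o, 'm) pointed_braided" (structure) and R :: "'r ring" and U :: "'u itself" +
 fixes \<A> :: "('o, 'm, 'g) group_ftor" and \<chi> :: "('o, 'g \<times> 'm, 'o, 'm) ftor" and H H0 :: "'g monoid"
 assumes reliable: "reliable B \<A> \<chi> H H0" and free: "free_group H" "free_group H0"
 and small: "cr (FO \<A> (uobj B n)) \<lesssim> (UNIV :: 'u set)"
begin

definition Am :: "('o, 'm) bracket_arr => 'g => 'g" where "Am ph = arrow_map (FA \<A> ph)"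

definition cl :: "'o => 'g => ('o, 'm) bracket_arr" where "cl X h = lift_arr B (chi_at B \<chi> X h)"

abbreviation "GA X == FO \<A> X"

lemma coherent: "coherent_long_moody_system B \<A> \<chi>" using reliable by (simp add: reliable_def)

lemma cfunctor_A: "cfunctor UB Gr \<A>" using coherent by (simp add: coherent_long_moody_system_def)

lemma GA_group: "X : Ob ==> group (GA X)" using cfunctor.FO_in_Obj[OF cfunctor_A] by (simp add: Gr_def)

lemma GA_small: "X : Ob ==> cr (GA X) \<lesssim> (UNIV :: 'u set)" using small UG_Obj by auto

lemma Am_hom: assumes "ph : Hom X Y" shows "FA \<A> ph = (GA X, Am ph, GA Y) & Am ph : hom (GA X) (GA Y)"
 using cfunctor.FA_in_Homs[OF cfunctor_A assms] by (cases "FA \<A> ph") (auto simp: Gr_def Homs_def Am_def)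

lemma Am_closed: "ph : Hom X Y ==> h : cr (GA X) ==> Am ph h : cr (GA Y)" using Am_hom[of ph X Y] by (auto simp: hom_def)

lemma Am_Id: "X : Ob ==> h : cr (GA X) ==> Am (Id UB X) h = h" using cfunctor.FA_Id[OF cfunctor_A] by (simp add: Gr_def Am_def)

lemma Am_Comp: assumes "ph : Hom X Y" "ps : Hom Y Z" "h : cr (GA X)" shows "Am (ps o[UB] ph) h = Am ps (Am ph h)"
proof -
 have "FA \<A> (ps o[UB] ph) = (GA X, compose (cr (GA X)) (Am ps) (Am ph), GA Z)"
 using cfunctor.FA_Comp[OF cfunctor_A assms(1,2)] Am_hom[OF assms(1)] Am_hom[OF assms(2)] by (simp add: Gr_def)
 thus ?thesis using assms(3) by (simp add: Am_def compose_def)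
qed

lemma GG_facts:
 assumes "X : Ob" shows "X : Obj (GG B)" "Id B X : Arr (GG B)" "Dom (GG B) (Id B X) = X" "Cod (GG B) (Id B X) = X" "lift_arr B (Id B X) = Id UB X"
 using assms HomsD[OF Id_in[OF UG_Obj_B[OF assms]]] lift_Id[OF UG_Obj_B[OF assms]] UG_Obj UG_Obj_B[OF assms] by (auto simp: GG_def Arr_full_iff UG_simps)

lemma chi_at_in: assumes X: "X : Ob" and h: "h : cr (GA X)" shows "chi_at B \<chi> X h : Homs B (1+X) (1+X)"
proof -
 let ?A = "ftor_comp \<A> (GG_to_UG B)"
 have c: "cfunctor (grothendieck (GG B) ?A) (GG B) \<chi>"
 and a: "agree_on (GG B) (ftor_comp \<chi> (grothendieck_section (GG B) ?A)) (shift_GG B)"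
 using coherent by (simp_all add: coherent_long_moody_system_def Let_def)
 have "FO \<chi> X = 1+X" using a GG_facts(1)[OF X] by (simp add: agree_on_def grothendieck_section_def shift_GG_def)
 moreover have "(h, Id B X) : Homs (grothendieck (GG B) ?A) X X" using GG_facts[OF X] h by (simp add: grothendieck_def Homs_def GG_to_UG_def)
 ultimately have "chi_at B \<chi> X h : Homs (GG B) (1+X) (1+X)" using cfunctor.FA_in_Homs[OF c] unfolding chi_at_def by fastforce
 thus ?thesis by (auto simp: GG_def full_def Homs_def)
qed

text \<open>All four come from functoriality of the extension of \<chi> to the Grothendieck
  construction over \<open>UG B\<close>. The last one compares two factorisations of the arrow
  (\<A>(ph) h, ph): first h and then ph, or first ph and then \<A>(ph) h.\<close>

lemma chi_facts: shows "X : Ob ==> h : cr (GA X) ==> cl X h : Hom (1+X) (1+X)"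
 "X : Ob ==> cl X 1[GA X] = Id UB (1+X)"
 "X : Ob ==> g : cr (GA X) ==> h : cr (GA X) ==> cl X (g *[GA X] h) = cl X g o[UB] cl X h"
 "ph : Hom X Y ==> h : cr (GA X) ==> sh one1 ph o[UB] cl X h = cl Y (Am ph h) o[UB] sh one1 ph"
proof -
 let ?G = "grothendieck UB \<A>"
 obtain \<chi>U where c: "cfunctor ?G UB \<chi>U" and a: "agree_on UB (ftor_comp \<chi>U (grothendieck_section UB \<A>)) (shift_UG B)"
 and l: "ALL (h, ph) : Arr (grothendieck (GG B) (ftor_comp \<A> (GG_to_UG B))). FA \<chi>U (h, lift_arr B ph) = lift_arr B (FA \<chi> (h, ph))"
 using coherent by (auto simp: coherent_long_moody_system_def Let_def)
 have FO: "FO \<chi>U X = 1+X" if "X : Ob" for X using a that by (simp add: agree_on_def grothendieck_section_def shift_UG_def)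
 have FA: "FA \<chi>U (1[GA Y], ph) = sh one1 ph" if "ph : Hom X Y" for X Y ph
 using a HomsD[OF that] by (auto simp: agree_on_def grothendieck_section_def shift_UG_def sh_def)
 have cl: "cl X h = FA \<chi>U (h, Id UB X)" if "X : Ob" "h : cr (GA X)" for X h
 proof -
 have "(h, Id B X) : Arr (grothendieck (GG B) (ftor_comp \<A> (GG_to_UG B)))" using GG_facts[OF that(1)] that(2) by (simp add: grothendieck_def GG_to_UG_def)
 thus ?thesis using l GG_facts(5)[OF that(1)] by (auto simp: cl_def chi_at_def) qed
 have gH: "(h, ph) : Homs ?G X Y" if "ph : Hom X Y" "h : cr (GA Y)" for X Y ph h using that by (auto simp: grothendieck_def Homs_def)
 have gC: "(h', ps) o[?G] (h, ph) = (h' *[GA Z] Am ps h, ps o[UB] ph)" if "ps : Hom Y Z" for Y Z ps ph h h'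
 using HomsD[OF that] by (simp add: grothendieck_def Am_def)
 note iH = U.Id_in_Homs
 show "cl X h : Hom (1+X) (1+X)" if "X : Ob" "h : cr (GA X)" for X h using cfunctor.FA_in_Homs[OF c gH[OF iH[OF that(1)] that(2)]] FO that cl by simp
 show "cl X 1[GA X] = Id UB (1+X)" if X: "X : Ob" for X
 proof -
 interpret G: group "GA X" by (rule GA_group[OF X])
 have "sh one1 (Id UB X) = Id UB (1+X)" using sh_Id[OF obj1_in_Obj UG_Obj_B[OF X]] by (simp add: UG_simps)
 thus ?thesis using cl[OF X G.one_closed] FA[OF iH[OF X]] by simp qed
 show "cl X (g *[GA X] h) = cl X g o[UB] cl X h" if X: "X : Ob" and g: "g : cr (GA X)" and h: "h : cr (GA X)" for X g h
 proof -
 interpret G: group "GA X" by (rule GA_group[OF X])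
 show ?thesis unfolding cl[OF X g] cl[OF X h] cl[OF X G.m_closed[OF g h]]
 cfunctor.FA_Comp[OF c gH[OF iH[OF X] h] gH[OF iH[OF X] g], symmetric] gC[OF iH[OF X]] Am_Id[OF X h] U.Comp_Id_left[OF iH[OF X]] .. qed
 show "sh one1 ph o[UB] cl X h = cl Y (Am ph h) o[UB] sh one1 ph" if ph: "ph : Hom X Y" and h: "h : cr (GA X)" for X Y ph h
 proof -
 have X: "X : Ob" "Y : Ob" using U.ends[OF ph] by auto
 interpret G: group "GA Y" by (rule GA_group[OF X(2)])
 note k = Am_closed[OF ph h]
 show ?thesis unfolding cl[OF X(1) h] cl[OF X(2) k] FA[OF ph, symmetric]
 cfunctor.FA_Comp[OF c gH[OF iH[OF X(1)] h] gH[OF ph G.one_closed], symmetric]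
 cfunctor.FA_Comp[OF c gH[OF ph G.one_closed] gH[OF iH[OF X(2)] k], symmetric] gC[OF ph] gC[OF iH[OF X(2)]]
 Am_Id[OF X(2) G.one_closed] G.l_one[OF k] G.r_one[OF k] U.Comp_Id_left[OF ph] U.Comp_Id_right[OF ph] .. qed
qed

text \<open>The last condition of reliability, carried from the groupoid to
  \<open>UG B\<close>.\<close>

lemma swp_cl: assumes X: "X : Ob" and h: "h : cr (GA X)" shows "swp X o[UB] sh one1 (cl X h) = cl (1+X) (Am (st one1 X) h) o[UB] swp X"
proof -
 obtain n where n: "X = ob n" using X UG_Obj by blast
 let ?b = "ibr one1 one1 ## Id B X" and ?k = "chi_at B \<chi> (1+X) (Am (st one1 X) h)"
 note x = chi_at_in[OF X h] and XB = UG_Obj_B[OF X]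
 have k: "Am (st one1 X) h : cr (GA (1+X))" by (rule Am_closed[OF st_UG[OF obj1_nat X] h])
 note kx = chi_at_in[OF X1[OF X] k]
 have x1: "Id B one1 ## chi_at B \<chi> X h : Homs B (1+(1+X)) (1+(1+X))" by (rule tensA_in[OF Id_in[OF obj1_in_Obj] x])
 have "?b \<bullet> (Id B one1 ## chi_at B \<chi> X h) = ?k \<bullet> ?b"
 using reliable h i_arr_st[OF obj1_in_Obj XB] unfolding reliable_def Let_def n uobj_Suc[symmetric] i_arr_def Am_def by simp
 hence "lift_arr B (?b \<bullet> (Id B one1 ## chi_at B \<chi> X h)) = lift_arr B (?k \<bullet> ?b)" by simp
 thus ?thesis unfolding lift_Comp[OF x1 ibr_UG[OF X]] lift_Comp[OF ibr_UG[OF X] kx] swp_def cl_def sh_lift[OF obj1_in_Obj x] by (simp add: UG_simps)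
qed

text \<open>Induction on n: the group over \<open>uobj B (Suc n)\<close> is the free product of H
  with the group over \<open>uobj B n\<close>, starting from \<open>H0\<close>.\<close>

lemma fox: assumes "X : Ob" shows "EX S. free_basis TYPE('u \<times> 'u => 'u \<times> 'u) (GA X) S"
proof -
 obtain \<B> where b: "cfunctor (UG' B) Gr \<B>" "agree_on UB \<A> \<B>" "FO \<B> one1 = H" "FO \<B> (obj0 B) = H0"
 "!!X Y. X : monoidal_words B ==> Y : monoidal_words B ==> EX i j. is_free_product (FO \<B> X) (FO \<B> Y) (FO \<B> (X ** Y)) i j"
 using reliable unfolding reliable_def by blast
 have grp: "group (FO \<B> X)" if "X : Obj B" for X using cfunctor.FO_in_Obj[OF b(1), of X] that by (simp add: UG'_simps Gr_def)
 have w: "ob n : monoidal_words B" for n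
 proof (induction n)
 case 0 show ?case by (simp add: uobj_def tensO_unit_left obj0_in_Obj monoidal_words.intros)
 next
 case (Suc n) thus ?case unfolding uobj_Suc[symmetric] by (intro monoidal_words.intros) qed
 have "EX S. free_basis TYPE('u \<times> 'u => 'u \<times> 'u) (FO \<B> (ob n)) S" for n
 proof (induction n)
 case 0
 have "FO \<B> (ob 0) = H0" using b(4) by (simp add: uobj_def tensO_unit_left obj0_in_Obj)
 thus ?case using free_basis_free_group[OF free(2)] by simp
 next
 case (Suc n)
 obtain S where S: "free_basis TYPE('u \<times> 'u => 'u \<times> 'u) (FO \<B> (ob n)) S" using Suc ..
 obtain S1 where S1: "free_basis TYPE('u \<times> 'u => 'u \<times> 'u) (FO \<B> one1) S1" unfolding b(3) using free_basis_free_group[OF free(1)] ..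
 obtain i j where "is_free_product (FO \<B> one1) (FO \<B> (ob n)) (FO \<B> (1+ob n)) i j" using b(5)[OF monoidal_words.intros(3) w] by blast
 from free_basis_free_product[OF grp[OF obj1_in_Obj] grp[OF uobj_in] grp[OF tensO_in_Obj[OF obj1_in_Obj uobj_in]] this S1 S]
 show ?case unfolding uobj_Suc by blast qed moreover obtain n where "X = ob n" using assms UG_Obj by blast
 ultimately show ?thesis using b(2) assms by (simp add: agree_on_def)
qed

abbreviation "ca F X == chi_action B \<chi> F X"

lemma ca_eq: "ca F X h = act F (cl X h)" by (simp add: chi_action_def act_def cl_def)

lemma sga: assumes F: "F : ObR" and X: "X : Ob" shows "sgaction R (FO F (1+X)) (GA X) (ca F X)"
proof -
 interpret M: rmod R "FO F (1+X)" by (rule rmodI[OF rep_mod[OF F X1[OF X]]])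
 interpret G: group "GA X" by (rule GA_group[OF X])
 show ?thesis
 proof (unfold_locales, goal_cases)
 case (1 g) show ?case unfolding ca_eq by (rule act_lin[OF F chi_facts(1)[OF X 1]])
 next
 case (2 v) thus ?case unfolding ca_eq chi_facts(2)[OF X] by (rule act_Id[OF F X1[OF X]])
 next
 case (3 g h v) show ?case unfolding ca_eq chi_facts(3)[OF X 3(1,2)] by (rule act_Comp[OF F chi_facts(1)[OF X 3(2)] chi_facts(1)[OF X 3(1)] 3(3)])
 qed (use inf GA_small[OF X] in auto)
qed

abbreviation "LMm F X == LM_module R B \<A> \<chi> F X"

abbreviation "LO F == LM_obj R B \<A> \<chi> F"

text \<open>The element (h - 1) tensor v of \<open>LM F\<close> at X.\<close>

definition bk :: "('o, 'm, 'r, 'u) rep => 'o => 'g => 'u => 'u" where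
 "bk F X = sgaction.br R (FO F (1+X)) (GA X) (ca F X)"

lemma LMm_eq: "LMm F X = tensor_module R (GA X) (FO F (1+X)) (ca F X)" by (simp add: LM_module_def)

lemma LO_FO: "X : Ob ==> FO (LO F) X = LMm F X" by (simp add: LM_obj_def)

lemma bk:
 assumes F: "F : ObR" and X: "X : Ob" shows "module R (FO (LO F) X)" "!!g. g : cr (GA X) ==> lin R (FO F (1+X)) (FO (LO F) X) (bk F X g)"
 "!!g h v. g : cr (GA X) ==> h : cr (GA X) ==> v : car F (1+X) ==>
 bk F X (g *[GA X] h) v = bk F X g (act F (cl X h) v) +[FO (LO F) X] bk F X h v"
 "!!v. v : car F (1+X) ==> bk F X 1[GA X] v = 0[FO (LO F) X]"
 "{bk F X g v | g v. g : cr (GA X) & v : car F (1+X)} <= cr (FO (LO F) X)"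
 "cr (FO (LO F) X) = aspan (FO (LO F) X) {bk F X g v | g v. g : cr (GA X) & v : car F (1+X)}"
proof -
 interpret S: sgaction R "FO F (1+X)" "GA X" "ca F X" by (rule sga[OF F X])
 note d = LO_FO[OF X] LMm_eq bk_def
 show "module R (FO (LO F) X)" unfolding d by (rule S.tens_facts(1))
 show "lin R (FO F (1+X)) (FO (LO F) X) (bk F X g)" if "g : cr (GA X)" for g unfolding d by (rule S.lin_br[OF that])
 show "bk F X 1[GA X] v = 0[FO (LO F) X]" if "v : car F (1+X)" for v unfolding d by (rule S.br_one[OF that])
 show "{bk F X g v | g v. g : cr (GA X) & v : car F (1+X)} <= cr (FO (LO F) X)" using S.brs_closed unfolding d S.brs_def .
 show "cr (FO (LO F) X) = aspan (FO (LO F) X) {bk F X g v | g v. g : cr (GA X) & v : car F (1+X)}" using S.tens_aspan unfolding d S.brs_def .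
 show "bk F X (g *[GA X] h) v = bk F X g (act F (cl X h) v) +[FO (LO F) X] bk F X h v"
 if "g : cr (GA X)" "h : cr (GA X)" "v : car F (1+X)" for g h v unfolding d ca_eq[symmetric] by (rule S.br_mult[OF that])
qed

lemma LM_lin_eq: assumes F: "F : ObR" and X: "X : Ob" and N: "module R N" and f: "lin R (FO (LO F) X) N f" and g: "lin R (FO (LO F) X) N g"
 and e: "!!h v. h : cr (GA X) ==> v : car F (1+X) ==> f (bk F X h v) = g (bk F X h v)" and x: "x : car (LO F) X" shows "f x = g x"
proof (rule rmod.lin_eq_on_aspan[OF rmodI[OF bk(1)[OF F X]] bk(5)[OF F X] N f g])
 show "x : aspan (FO (LO F) X) {bk F X g v |g v. g : cr (GA X) & v : car F (1+X)}" using x bk(6)[OF F X] by simp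
qed (use e in blast)

lemma bk_closed: "F : ObR ==> X : Ob ==> h : cr (GA X) ==> v : car F (1+X) ==> bk F X h v : car (LO F) X" using lin_cl[OF bk(2)] by blast

text \<open>The description of arrows in \<open>LM_obj\<close>, phrased by
  \<open>tens_map_spec\<close> so that existence and uniqueness come from
  \<open>tens_map\<close>.\<close>

definition la :: "('o, 'm, 'r, 'u) rep => ('o, 'm) bracket_arr => 'u => 'u" where
 "la F ph = (let X = Dom UB ph; Y = Cod UB ph in THE f. tens_map_spec R (GA X) (FO F (1+X)) (ca F X)
 (GA Y) (FO F (1+Y)) (ca F Y) (group_ring_map R (Am ph)) (act F (sh one1 ph)) f)"

lemma LO_eq: "LO F = mk_rep (LMm F) (la F)"
 by (simp add: LM_obj_def mk_rep_def la_def tens_map_spec_def LM_module_def LM_tensor_def Am_def act_def sh_def shift_UG_def Let_def)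

lemma la: assumes F: "F : ObR" and ph: "ph : Hom X Y" shows "la F ph : linear_maps R (LMm F X) (LMm F Y)"
 "!!h v. h : cr (GA X) ==> v : car F (1+X) ==> la F ph (bk F X h v) = bk F Y (Am ph h) (act F (sh one1 ph) v)"
proof -
 have X: "X : Ob" "Y : Ob" using U.ends[OF ph] by auto
 note s = sh_UG[OF obj1_nat ph]
 have eq: "act F (sh one1 ph) (ca F X g v) = ca F Y (Am ph g) (act F (sh one1 ph) v)" if g: "g : cr (GA X)" and v: "v : car F (1+X)" for g v
 unfolding ca_eq act_Comp[OF F chi_facts(1)[OF X(1) g] s v, symmetric] chi_facts(4)[OF ph g]
 by (rule act_Comp[OF F s chi_facts(1)[OF X(2) Am_closed[OF ph g]] v])
 note t = tens_map[where ph = "Am ph" and ps = "act F (sh one1 ph)" and \<kappa> = "group_ring_map R (Am ph)" and rh = "ca F X" and rh' = "ca F Y",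
 OF sga[OF F X(1)] sga[OF F X(2)] Am_hom[OF ph, THEN conjunct2] act_lin[OF F s] eq refl]
 have sp: "tens_map_spec R (GA X) (FO F (1+X)) (ca F X) (GA Y) (FO F (1+Y)) (ca F Y) (group_ring_map R (Am ph)) (act F (sh one1 ph)) (la F ph)"
 unfolding la_def Let_def HomsD[OF ph, THEN conjunct2, THEN conjunct1] HomsD[OF ph, THEN conjunct2, THEN conjunct2] by (rule theI'[OF t(1)])
 thus "la F ph : linear_maps R (LMm F X) (LMm F Y)" unfolding LMm_eq tens_map_spec_def by blast
 show "la F ph (bk F X h v) = bk F Y (Am ph h) (act F (sh one1 ph) v)" if "h : cr (GA X)" "v : car F (1+X)" for h v
 unfolding bk_def by (rule t(2)[OF _ _ sp that])
qed

lemma sh_Id_UG: "X : Ob ==> sh one1 (Id UB X) = Id UB (1+X)" using sh_Id[OF obj1_in_Obj UG_Obj_B] by (simp add: UG_simps)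

lemma LO_in: assumes F: "F : ObR" shows "LO F : ObR" unfolding LO_eq
proof (rule mk_rep_in)
 note bk' = bk(1)[OF F] la(1)[OF F]
 have ll: "lin R (FO (LO F) X) (FO (LO F) Y) (la F ph)" if "ph : Hom X Y" for X Y ph
 using la(1)[OF F that] U.ends[OF that] by (simp add: lmaps_iff LO_FO)
 show "module R (LMm F X)" if X: "X : Ob" for X using bk(1)[OF F X] unfolding LO_FO[OF X] .
 show "la F ph : linear_maps R (LMm F X) (LMm F Y)" if "ph : Hom X Y" for X Y ph by (rule la(1)[OF F that])
 show "la F (Id UB X) x = x" if X: "X : Ob" and x: "x : cr (LMm F X)" for X x
 proof (rule LM_lin_eq[OF F X bk(1)[OF F X] ll[OF U.Id_in_Homs[OF X]] lin_id])
 show "la F (Id UB X) (bk F X h v) = bk F X h v" if h: "h : cr (GA X)" and v: "v : car F (1+X)" for h v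
 unfolding la(2)[OF F U.Id_in_Homs[OF X] h v] Am_Id[OF X h] sh_Id_UG[OF X] act_Id[OF F X1[OF X] v] ..
 show "x : car (LO F) X" using x unfolding LO_FO[OF X] . qed
 show "la F (ps o[UB] ph) x = la F ps (la F ph x)"
 if ph: "ph : Hom X Y" and ps: "ps : Hom Y Z" and x: "x : cr (LMm F X)" for X Y Z ph ps x
 proof -
 have O: "X : Ob" "Y : Ob" "Z : Ob" using U.ends[OF ph] U.ends[OF ps] by auto
 note c = U.Comp_in[OF ph ps] and o = obj1_nat
 show ?thesis
 proof (rule LM_lin_eq[OF F O(1) bk(1)[OF F O(3)] ll[OF c] lin_comp[OF ll[OF ph] ll[OF ps]]])
 show "la F (ps o[UB] ph) (bk F X h v) = la F ps (la F ph (bk F X h v))" if h: "h : cr (GA X)" and v: "v : car F (1+X)" for h v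
 unfolding la(2)[OF F c h v] la(2)[OF F ph h v] la(2)[OF F ps Am_closed[OF ph h] act_cl[OF F sh_UG[OF o ph] v]]
 Am_Comp[OF ph ps h] sh_Comp_UG[OF o ph ps] act_Comp[OF F sh_UG[OF o ph] sh_UG[OF o ps] v] ..
 show "x : car (LO F) X" using x unfolding LO_FO[OF O(1)] . qed qed
qed

lemma LO_act:
 assumes "F : ObR" "ph : Hom X Y" "h : cr (GA X)" "v : car F (1+X)" shows "act (LO F) ph (bk F X h v) = bk F Y (Am ph h) (act F (sh one1 ph) v)"
 using la(2)[OF assms] mk_rep_simps(2)[OF assms(2)] by (simp add: LO_eq)

abbreviation "LA al == FA (LM R B \<A> \<chi>) al"

lemma LA: assumes a: "al : RHom F G" shows "LA al : RHom (LO F) (LO G)"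
 "!!X h v. X : Ob ==> h : cr (GA X) ==> v : car F (1+X) ==> nt (LA al) X (bk F X h v) = bk G X h (nt al (1+X) v)"
proof -
 have FG: "F : ObR" "G : ObR" using Rep.ends[OF a] by auto
 define lf where "lf X = (THE f. tens_map_spec R (GA X) (FO F (1+X)) (ca F X) (GA X) (FO G (1+X)) (ca G X)
 (%i. i) (nt al (1+X)) f)" for X
 have lf: "lf X : linear_maps R (LMm F X) (LMm G X) &
 (ALL h : cr (GA X). ALL v : car F (1+X). lf X (bk F X h v) = bk G X h (nt al (1+X) v))" if X: "X : Ob" for X
 proof -
 interpret S: sgaction R "FO F (1+X)" "GA X" "ca F X" by (rule sga[OF FG(1) X])
 have eq: "nt al (1+X) (ca F X g v) = ca G X g (nt al (1+X) v)" if g: "g : cr (GA X)" and v: "v : car F (1+X)" for g v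
 unfolding ca_eq by (rule nt_nat[OF a chi_facts(1)[OF X g] v])
 have hom: "(%x. x) : hom (GA X) (GA X)" by (auto simp: hom_def)
 have k: "i = group_ring_map R (%x. x) i" if "i : augmentation_ideal R (GA X)" for i using S.R.group_ring_map_id[OF S.aideal_free[OF that]] by simp
 note t = tens_map[where ph = "%x. x" and ps = "nt al (1+X)" and \<kappa> = "%i. i" and rh = "ca F X" and rh' = "ca G X",
 OF sga[OF FG(1) X] sga[OF FG(2) X] hom nt_lin(1)[OF a X1[OF X]] eq k]
 have sp: "tens_map_spec R (GA X) (FO F (1+X)) (ca F X) (GA X) (FO G (1+X)) (ca G X) (%i. i) (nt al (1+X)) (lf X)" unfolding lf_def by (rule theI'[OF t(1)])
 hence "lf X : linear_maps R (LMm F X) (LMm G X)" unfolding LMm_eq tens_map_spec_def by blast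
 moreover have "lf X (bk F X h v) = bk G X h (nt al (1+X) v)" if "h : cr (GA X)" "v : car F (1+X)" for h v
 unfolding bk_def by (rule t(2)[OF _ _ _ sp that]) ultimately show ?thesis by blast qed
 obtain \<eta> where e: "al = (F, \<eta>, G)" using a by (cases al) (auto simp: Rep_Homs)
 have "LA al = (LO F, \<lambda>X \<in> Ob. (LMm F X, lf X, LMm G X), LO G)" by (simp add: LM_def e lf_def tens_map_spec_def LM_module_def LM_tensor_def nt_def)
 also have "... = mk_nt (LO F) lf (LO G)" unfolding mk_nt_def using lf by (auto simp: LO_FO lmaps_iff extensional_restrict intro!: restrict_ext)
 finally have LAe: "LA al = mk_nt (LO F) lf (LO G)" .
 have ll: "lin R (FO (LO F) X) (FO (LO G) X) (lf X)" if "X : Ob" for X using lf[OF that] by (simp add: lmaps_iff LO_FO that)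
 have lb: "lf X (bk F X h v) = bk G X h (nt al (1+X) v)" if "X : Ob" "h : cr (GA X)" "v : car F (1+X)" for X h v using lf[OF that(1)] that by blast
 show "LA al : RHom (LO F) (LO G)" unfolding LAe
 proof (rule mk_nt_in[OF LO_in[OF FG(1)] LO_in[OF FG(2)] ll])
 fix X Y ph x assume ph: "ph : Hom X Y" and x: "x : car (LO F) X"
 have X: "X : Ob" "Y : Ob" using U.ends[OF ph] by auto
 note o = obj1_nat
 show "lf Y (act (LO F) ph x) = act (LO G) ph (lf X x)"
 proof (rule LM_lin_eq[OF FG(1) X(1) bk(1)[OF FG(2) X(2)] lin_comp[OF act_lin[OF LO_in[OF FG(1)] ph] ll[OF X(2)]]
 lin_comp[OF ll[OF X(1)] act_lin[OF LO_in[OF FG(2)] ph]] _ x])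
 show "lf Y (act (LO F) ph (bk F X h v)) = act (LO G) ph (lf X (bk F X h v))" if h: "h : cr (GA X)" and v: "v : car F (1+X)" for h v
 unfolding LO_act[OF FG(1) ph h v] lb[OF X(1) h v] lb[OF X(2) Am_closed[OF ph h] act_cl[OF FG(1) sh_UG[OF o ph] v]]
 LO_act[OF FG(2) ph h nt_cl[OF a X1[OF X(1)] v]] nt_nat[OF a sh_UG[OF o ph] v] .. qed qed
 show "nt (LA al) X (bk F X h v) = bk G X h (nt al (1+X) v)" if "X : Ob" "h : cr (GA X)" "v : car F (1+X)" for X h v
 unfolding LAe nt_mk_nt[OF that(1) bk_closed[OF FG(1) that]] by (rule lb[OF that])
qed

lemma LA_eqI: assumes F: "F : ObR" and a: "al : RHom (LO F) P" and b: "be : RHom (LO F) P"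
 and e: "!!X h v. X : Ob ==> h : cr (GA X) ==> v : car F (1+X) ==> nt al X (bk F X h v) = nt be X (bk F X h v)" shows "al = be"
proof (rule nt_ext[OF a b])
 fix X x assume X: "X : Ob" and x: "x : car (LO F) X"
 have P: "P : ObR" using Rep.ends[OF a] by simp
 show "nt al X x = nt be X x" by (rule LM_lin_eq[OF F X rep_mod[OF P X] nt_lin(1)[OF a X] nt_lin(1)[OF b X] e[OF X] x])
qed

lemma FO_LM: "FO (LM R B \<A> \<chi>) F = LO F" by (simp add: LM_def)

lemma LA_Comp: assumes f: "f : RHom F G" and g: "g : RHom G H'" shows "LA (g o[Rep] f) = LA g o[Rep] LA f"
proof -
 have F: "F : ObR" using Rep.ends[OF f] by simp
 note gf = Rep.Comp_in[OF f g]
 show ?thesis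
 proof (rule LA_eqI[OF F LA(1)[OF gf] Rep.Comp_in[OF LA(1)[OF f] LA(1)[OF g]]])
 fix X h v assume X: "X : Ob" and h: "h : cr (GA X)" and v: "v : car F (1+X)"
 show "nt (LA (g o[Rep] f)) X (bk F X h v) = nt (LA g o[Rep] LA f) X (bk F X h v)"
 unfolding nt_Comp[OF LA(1)[OF f] LA(1)[OF g] X bk_closed[OF F X h v]] LA(2)[OF gf X h v] LA(2)[OF f X h v]
 LA(2)[OF g X h nt_cl[OF f X1[OF X] v]] nt_Comp[OF f g X1[OF X] v] .. qed
qed

lemma cfunctor_LM: "cfunctor Rep Rep (LM R B \<A> \<chi>)"
proof (unfold_locales, goal_cases)
 case (1 F) thus ?case unfolding FO_LM by (rule LO_in)
next
 case (2 f F G) thus ?case unfolding FO_LM by (rule LA(1))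
next
 case (3 F)
 note i = Rep.Id_in_Homs[OF 3]
 show ?case unfolding FO_LM
 proof (rule LA_eqI[OF 3 LA(1)[OF i] Rep.Id_in_Homs[OF LO_in[OF 3]]])
 fix X h v assume X: "X : Ob" and h: "h : cr (GA X)" and v: "v : car F (1+X)"
 show "nt (LA (Id Rep F)) X (bk F X h v) = nt (Id Rep (LO F)) X (bk F X h v)"
 unfolding LA(2)[OF i X h v] nt_Id[OF 3 X1[OF X] v] nt_Id[OF LO_in[OF 3] X bk_closed[OF 3 X h v]] .. qed
next
 case (4 f F G g H') show ?case by (rule LA_Comp[OF 4])
qed

lemma LA_zmap: assumes F: "F : ObR" and G: "G : ObR" shows "LA (zmap F G) = zmap (LO F) (LO G)"
proof (rule LA_eqI[OF F LA(1)[OF zmap_in[OF F G]] zmap_in[OF LO_in[OF F] LO_in[OF G]]])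
 fix X h v assume X: "X : Ob" and h: "h : cr (GA X)" and v: "v : car F (1+X)"
 have "bk G X h 0[FO G (1+X)] = 0[FO (LO G) X]" by (rule rmod.lin_zero[OF rmodI[OF rep_mod[OF G X1[OF X]]] bk(1)[OF G X] bk(2)[OF G X h]])
 thus "nt (LA (zmap F G)) X (bk F X h v) = nt (zmap (LO F) (LO G)) X (bk F X h v)"
 unfolding LA(2)[OF zmap_in[OF F G] X h v] nt_mk_nt[OF X1[OF X] v] nt_mk_nt[OF X bk_closed[OF F X h v]] .
qed

text \<open>Pointwise an instance of \<open>tens_exact\<close>: the sequence for \<open>LM\<close>
  at X is the original one at 1 + X tensored with an augmentation ideal that is free on the Fox
  basis.\<close>

lemma LM_exact: assumes f: "f : RHom F' F" and g: "g : RHom F F''"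
 and ex: "!!X x. X : Ob ==> x : car F X ==> nt g X x = 0[FO F'' X] ==> x : nt f X ` car F' X"
 and X: "X : Ob" and x: "x : car (LO F) X" "nt (LA g) X x = 0[FO (LO F'') X]" shows "x : nt (LA f) X ` car (LO F') X"
proof -
 have O: "F' : ObR" "F : ObR" "F'' : ObR" using Rep.ends[OF f] Rep.ends[OF g] by auto
 obtain S where S: "free_basis TYPE('u \<times> 'u => 'u \<times> 'u) (GA X) S" using fox[OF X] ..
 interpret S: sgaction R "FO F' (1+X)" "GA X" "ca F' X" by (rule sga[OF O(1) X])
 note e = LO_FO[OF X] LMm_eq
 show ?thesis unfolding e by (rule S.tens_exact[OF sga[OF O(2) X] sga[OF O(3) X] nt_lin(1)[OF f X1[OF X]] nt_lin(1)[OF g X1[OF X]] ex[OF X1[OF X]] S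
 nt_lin(1)[OF LA(1)[OF f] X, unfolded e] LA(2)[OF f X, unfolded bk_def] nt_lin(1)[OF LA(1)[OF g] X, unfolded e]
 LA(2)[OF g X, unfolded bk_def] x[unfolded e]])
qed

text \<open>It suffices to kill (h - 1) tensor v. Since v dies over 1 + X, a translated arrow kills
  it, and translated arrows are what acts on the second tensor factor.\<close>

lemma LM_Kset: assumes K: "F : Kset" shows "LO F : Kset"
proof -
 have F: "F : ObR" using K by (simp add: Kset_def)
 note L = LO_in[OF F] and o = obj1_nat
 have "dies (LO F) X x" if X: "X : Ob" and x: "x : car (LO F) X" for X x
 proof -
 interpret M: rmod R "FO (LO F) X" by (rule rmodI[OF bk(1)[OF F X]])
 have d: "dies (LO F) X (bk F X h v)" if h: "h : cr (GA X)" and v: "v : car F (1+X)" for h v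
 proof -
 have "dies F (1+X) v" using K v X1[OF X] by (simp add: Kset_def)
 then obtain Z ph where p: "ph : Hom X Z" "act F (sh one1 ph) v = 0[FO F (1+Z)]" using dies_sh[OF F X v] by blast
 have Z: "Z : Ob" using U.ends[OF p(1)] by simp
 have "act (LO F) ph (bk F X h v) = 0[FO (LO F) Z]" unfolding LO_act[OF F p(1) h v] p(2)
 by (rule rmod.lin_zero[OF rmodI[OF rep_mod[OF F X1[OF Z]]] bk(1)[OF F Z] bk(2)[OF F Z Am_closed[OF p(1) h]]])
 thus ?thesis using p(1) unfolding dies_def by blast qed
 have "aspan (FO (LO F) X) {bk F X g v |g v. g : cr (GA X) & v : car F (1+X)} <= {z : car (LO F) X. dies (LO F) X z}"
 by (rule M.aspan_subset) (use d bk_closed[OF F X] dies_zero[OF L X] dies_add[OF L X] in auto) thus ?thesis using x bk(6)[OF F X] by blast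
 qed thus ?thesis using L by (simp add: Kset_def)
qed

text \<open>Exactness makes the comparison map from \<open>LM\<close> of the kernel onto the kernel
  of \<open>LM f\<close>, and degree passes to quotients.\<close>

lemma LM_Ker: assumes f: "f : RHom F G" and K: "LO (Ker f) : polp n" shows "Ker (LA f) : polp n"
proof -
 note k = ker_in_Homs[OF f] and L = LA(1)[OF f]
 note lk = LA(1)[OF k]
 have O: "Ker f : ObR" "G : ObR" using Rep.ends[OF k] Rep.ends[OF f] by auto
 have "LA f o[Rep] LA (ker_in f) = zmap (LO (Ker f)) (LO G)" unfolding LA_Comp[OF k f, symmetric] zero_kc(1)[OF f] by (rule LA_zmap[OF O])
 then obtain u where u: "u : RHom (LO (Ker f)) (Ker (LA f))" "ker_in (LA f) o[Rep] u = LA (ker_in f)" using ker_factor[OF L lk] by blast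
 show ?thesis
 proof (rule polp_quot_surj[OF u(1) K])
 fix X assume X: "X : Ob"
 have e: "x : nt (ker_in f) X ` car (Ker f) X" if "X : Ob" "x : car F X" "nt f X x = 0[FO G X]" for X x
 proof -
 have x: "x : car (Ker f) X" using ker_coker(1)[OF f that(1)] that by simp
 show ?thesis using imageI[OF x, of "nt (ker_in f) X"] unfolding ker_coker(2)[OF f that(1) x] . qed
 show "nt u X ` car (LO (Ker f)) X = car (Ker (LA f)) X"
 proof
 show "nt u X ` car (LO (Ker f)) X <= car (Ker (LA f)) X" using nt_cl[OF u(1) X] by blast
 show "car (Ker (LA f)) X <= nt u X ` car (LO (Ker f)) X"
 proof
 fix z assume z: "z : car (Ker (LA f)) X"
 have "z : car (LO F) X" "nt (LA f) X z = 0[FO (LO G) X]" using z ker_coker(1)[OF L X] by auto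
 from LM_exact[OF k f e X this] obtain w where w: "w : car (LO (Ker f)) X" "z = nt (LA (ker_in f)) X w" by blast
 have "nt (LA (ker_in f)) X w = nt (ker_in (LA f)) X (nt u X w)" using nt_Comp[OF u(1) ker_in_Homs[OF L] X w(1)] unfolding u(2) .
 also have "... = nt u X w" by (rule ker_coker(2)[OF L X nt_cl[OF u(1) X w(1)]])
 finally show "z : nt u X ` car (LO (Ker f)) X" using w by blast qed qed qed
qed

text \<open>Exactness makes the comparison map from the cokernel of \<open>LM f\<close> into
  \<open>LM F''\<close> injective, and degree passes to subobjects.\<close>

lemma LM_Coker_mono: assumes f: "f : RHom F' F" and g: "g : RHom F F''" and z: "g o[Rep] f = zmap F' F''"
 and ex: "!!X x. X : Ob ==> x : car F X ==> nt g X x = 0[FO F'' X] ==> x : nt f X ` car F' X"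
 and K: "LO F'' : polp n" shows "Coker (LA f) : polp n"
proof -
 note lf = LA(1)[OF f] and lg = LA(1)[OF g]
 note c = coker_in[OF lf]
 have O: "F' : ObR" "F'' : ObR" using Rep.ends[OF f] Rep.ends[OF g] by auto
 have "LA g o[Rep] LA f = zmap (LO F') (LO F'')" unfolding LA_Comp[OF f g, symmetric] z by (rule LA_zmap[OF O])
 then obtain v where v: "v : RHom (Coker (LA f)) (LO F'')" "v o[Rep] coker_pr (LA f) = LA g" using coker_factor[OF lf lg] by blast
 show ?thesis
 proof (rule polp_sub[OF v(1) K])
 fix X z assume X: "X : Ob" and zc: "z : car (Coker (LA f)) X" and vz: "nt v X z = 0[FO (LO F'') X]"
 obtain y where y: "y : car (LO F) X" "z = nt (coker_pr (LA f)) X y" using zc ker_coker(3)[OF lf X] by blast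
 have "nt (LA g) X y = nt v X z" using nt_Comp[OF c v(1) X y(1)] unfolding v(2) y(2) .
 from LM_exact[OF f g ex X y(1) trans[OF this vz]] have "y : nt (LA f) X ` car (LO F') X" .
 hence "z = 0[FO (Coker (LA f)) X]" using ker_coker(4)[OF lf X y(1)] y(2) by simp
 thus "dies (Coker (LA f)) X z" using dies_zero[OF _ X] Rep.ends[OF c] by simp qed
qed

lemma LM_Coker: assumes f: "f : RHom F G" and K: "LO (Coker f) : polp n" shows "Coker (LA f) : polp n"
proof (rule LM_Coker_mono[OF f coker_in[OF f] zero_kc(2)[OF f] _ K])
 show "x : nt f X ` car F X" if "X : Ob" "x : car G X" "nt (coker_pr f) X x = 0[FO (Coker f) X]" for X x using ker_coker(4)[OF f that(1,2)] that(3) by blast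
qed

lemma LM_Wset: assumes f: "f : Wset" shows "LA f : Wset"
proof -
 have fH: "f : RHom (Dom Rep f) (Cod Rep f)" using f W_Arr by (auto intro: Arr_Homs)
 have "Ker f : Kset" "Coker f : Kset" using f ker_Kset[OF fH] coker_Kset[OF fH] by (simp_all add: Wset_def)
 hence "LO (Ker f) : polp 0" "LO (Coker f) : polp 0" using LM_Kset by simp_all
 hence "Ker (LA f) : Kset" "Coker (LA f) : Kset" using LM_Ker[OF fH, of 0] LM_Coker[OF fH, of 0] by simp_all
 thus ?thesis using ker_Kset[OF LA(1)[OF fH]] coker_Kset[OF LA(1)[OF fH]] W_iff[OF LA(1)[OF fH]] by blast
qed

end

section \<open>The degree bound for the Long-Moody functor and the induced functors\<close>

context lm_system
begin

text \<open>\<open>jm X\<close> is the inclusion of the free factor H, namely \<A> of the identity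
  of 1 tensored with \<iota>. Initiality of 0 makes it natural in X, so a fixed element of H gives a
  compatible family of letters.\<close>

lemma letters:
 obtains jm where "!!X a. X : Ob ==> a : cr H ==> jm X a : cr (GA (1+X))"
 "!!X Y ph a. ph : Hom X Y ==> a : cr H ==> Am (sh one1 ph) (jm X a) = jm Y a"
 "!!X. X : Ob ==> is_free_product H (GA X) (GA (1+X)) (jm X) (Am (st one1 X))"
proof -
 obtain \<B> where b: "cfunctor (UG' B) Gr \<B>" "agree_on UB \<A> \<B>" "FO \<B> one1 = H"
 and fp: "!!X Y. X : monoidal_words B ==> Y : monoidal_words B ==> is_free_product (FO \<B> X) (FO \<B> Y) (FO \<B> (X ** Y))
 (arrow_map (FA \<B> (bracket_tens B (Id (UG' B) X) (init_arr B Y)))) (arrow_map (FA \<B> (bracket_tens B (init_arr B X) (Id (UG' B) Y))))"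
 using reliable unfolding reliable_def by blast
 define jm where "jm X = arrow_map (FA \<B> (sh one1 (init_arr B X)))" for X
 have w: "X : monoidal_words B" if X: "X : Ob" for X
 proof -
 obtain n where n: "X = ob n" using X UG_Obj by blast
 show ?thesis unfolding n
 proof (induction n)
 case 0 show ?case by (simp add: uobj_def tensO_unit_left obj0_in_Obj monoidal_words.intros)
 next
 case (Suc n) thus ?case unfolding uobj_Suc[symmetric] by (intro monoidal_words.intros) qed qed
 have FO: "FO \<B> X = GA X" if "X : Ob" for X using b(2) that by (simp add: agree_on_def)
 have FA: "FA \<B> ph = FA \<A> ph" if "ph : Hom X Y" for X Y ph using b(2) HomsD[OF that] by (simp add: agree_on_def)
 have free_prod: "is_free_product H (GA X) (GA (1+X)) (jm X) (Am (st one1 X))" if X: "X : Ob" for X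
 using fp[OF monoidal_words.intros(3) w[OF X]] i_arr_st[OF obj1_in_Obj UG_Obj_B[OF X]] FA[OF st_UG[OF obj1_nat X]]
 unfolding b(3) FO[OF X] FO[OF X1[OF X]] jm_def sh_def Am_def i_arr_def by simp
 have closed: "jm X a : cr (GA (1+X))" if "X : Ob" "a : cr H" for X a using free_prod[OF that(1)] that(2) by (auto simp: is_free_product_def hom_def)
 have nat: "Am (sh one1 ph) (jm X a) = jm Y a" if ph: "ph : Hom X Y" and a: "a : cr H" for X Y ph a
 proof -
 have X: "X : Ob" "Y : Ob" using U.ends[OF ph] by auto
 have i: "init_arr B Z : Homs (UG' B) (unitO B) Z" if "Z : Ob" for Z
 using st_in[OF UG_Obj_B[OF that] unitO_in_Obj] init_st[OF UG_Obj_B[OF that]] by (simp add: tensO_unit_right UG_Obj_B[OF that])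
 have u: "sh one1 (init_arr B Z) : Homs (UG' B) one1 (1+Z)" if "Z : Ob" for Z
 using sh_in[OF obj1_in_Obj i[OF that]] by (simp add: tensO_unit_right obj1_in_Obj)
 have form: "FA \<B> (sh one1 (init_arr B Z)) = (H, jm Z, GA (1+Z))" if "Z : Ob" for Z
 using cfunctor.FA_in_Homs[OF b(1) u[OF that]] unfolding b(3) FO[OF X1[OF that]] jm_def
 by (cases "FA \<B> (sh one1 (init_arr B Z))") (auto simp: Gr_def Homs_def)
 note s = sh_UG[OF obj1_nat ph]
 have "sh one1 ph o[UG' B] sh one1 (init_arr B X) = sh one1 (init_arr B Y)"
 using sh_Comp[OF obj1_in_Obj i[OF X(1)] UG_Homs'[OF ph]] init_natural[OF UG_Homs'[OF ph]] by simp
 hence "FA \<A> (sh one1 ph) o[Gr] FA \<B> (sh one1 (init_arr B X)) = FA \<B> (sh one1 (init_arr B Y))"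
 using cfunctor.FA_Comp[OF b(1) u[OF X(1)] UG_Homs'[OF s]] FA[OF s] by simp
 hence "compose (cr H) (Am (sh one1 ph)) (jm X) = jm Y" unfolding form[OF X(1)] form[OF X(2)] Am_hom[OF s, THEN conjunct1] by (simp add: Gr_def)
 from fun_cong[OF this, of a] show ?thesis using a by (simp add: compose_def) qed
 show thesis by (rule that[OF closed nat free_prod])
qed

lemma swp_inv: assumes X: "X : Ob" obtains ps where "ps : Hom (1+(1+X)) (1+(1+X))"
 "swp X o[UB] ps = Id UB (1+(1+X))"
proof -
 let ?b = "ibr one1 one1 ## Id B X" and ?Y = "1+(1+X)"
 note b = ibr_UG[OF X] and Y = X1[OF X1[OF X]]
 have "swp X o[UB] lift_arr B (Inv B ?b) = Id UB ?Y" using lift_Comp[OF Inv_in[OF b] b] Inv_r[OF b] lift_Id[OF UG_Obj_B[OF Y]] by (simp add: swp_def UG_simps)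
 thus thesis using that lift_UG[OF Inv_in[OF b] Y Y] by blast
qed

lemma swp_nat: assumes ph: "ph : Hom X Y" shows "swp Y o[UB] sh one1 (sh one1 ph) = sh one1 (sh one1 ph) o[UB] swp X"
 using lift_natural[OF ibr_in[OF obj1_in_Obj obj1_in_Obj] UG_Homs'[OF ph]] sh_tensO[OF obj1_in_Obj obj1_in_Obj UG_Homs'[OF ph]] by (simp add: swp_def UG_simps)

lemma tau_seq: assumes F: "F : ObR"
 obtains i p where "i : RHom F (tau one1 F)" "p : RHom (tau one1 F) (dl F)" "p o[Rep] i = zmap F (dl F)"
 "!!X x. X : Ob ==> x : car F X ==> nt i X x = act F (st one1 X) x"
 "!!X x. X : Ob ==> x : car (tau one1 F) X ==> nt p X x = 0[FO (dl F) X] ==> x : nt i X ` car F X"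
 "!!X. X : Ob ==> nt p X ` car (tau one1 F) X = car (dl F) X"
proof -
 note o = obj1_nat
 note T = tau(1)[OF o F] and D = delta(1)[OF o F]
 let ?i = "mk_nt F (%X. act F (st one1 X)) (tau one1 F)"
 let ?p = "mk_nt (tau one1 F) (dp one1 F) (dl F)"
 have i: "?i : RHom F (tau one1 F)"
 proof (rule mk_nt_in[OF F T])
 show "lin R (FO F X) (FO (tau one1 F) X) (act F (st one1 X))" if "X : Ob" for X using act_lin[OF F st_UG[OF o that]] by (simp add: tau(2)[OF o F that])
 show "act F (st one1 Y) (act F ph x) = act (tau one1 F) ph (act F (st one1 X) x)" if "ph : Hom X Y" "x : car F X" for X Y ph x
 using st_nat[OF o F that] by (simp add: tau(3)[OF o F that(1)]) qed
 have p: "?p : RHom (tau one1 F) (dl F)"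
 proof (rule mk_nt_in[OF T D])
 show "lin R (FO (tau one1 F) X) (FO (dl F) X) (dp one1 F X)" if "X : Ob" for X using delta(2)[OF o F that] by (simp add: tau(2)[OF o F that])
 show "dp one1 F Y (act (tau one1 F) ph x) = act (dl F) ph (dp one1 F X x)" if "ph : Hom X Y" "x : car (tau one1 F) X" for X Y ph x
 using that U.ends[OF that(1)] delta(5)[OF o F that(1)] by (simp add: tau(2)[OF o F] tau(3)[OF o F that(1)]) qed
 have ni: "nt ?i X x = act F (st one1 X) x" if "X : Ob" "x : car F X" for X x using that by simp
 have np: "nt ?p X x = dp one1 F X x" if "X : Ob" "x : car F (1+X)" for X x using that tau(2)[OF o F that(1)] by simp
 have ex: "x : nt ?i X ` car F X" if X: "X : Ob" and x: "x : car (tau one1 F) X" "nt ?p X x = 0[FO (dl F) X]" for X x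
 proof -
 have "x : act F (st one1 X) ` car F X" using delta(4)[OF o F X, of x] X x by (auto simp: tau(2)[OF o F X])
 also have "... = nt ?i X ` car F X" by (rule image_cong[OF refl]) (use X in simp) finally show ?thesis . qed
 have su: "nt ?p X ` car (tau one1 F) X = car (dl F) X" if X: "X : Ob" for X
 unfolding delta(3)[OF o F X, symmetric] tau(2)[OF o F X] by (rule image_cong[OF refl]) (rule np[OF X])
 have z: "?p o[Rep] ?i = zmap F (dl F)"
 proof (rule zmap_unique[OF Rep.Comp_in[OF i p]])
 fix X x assume X: "X : Ob" and x: "x : car F X"
 note c = act_cl[OF F st_UG[OF o X] x]
 show "nt (?p o[Rep] ?i) X x = 0[FO (dl F) X]" unfolding nt_Comp[OF i p X x] ni[OF X x] np[OF X c] using delta(4)[OF o F X c] x by blast qed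
 show thesis by (rule that[OF i p z ni ex su])
qed

text \<open>The terms of \<open>LM F\<close> at 1 + X whose group element comes from X. The
  translation of F acts through the second copy of 1, \<open>LM F\<close> at 1 + X through the
  first; \<open>swp\<close> exchanges them and makes the map well defined on tensors.\<close>

lemma LM_tau: assumes F: "F : ObR"
 obtains h where "h : RHom (LO (tau one1 F)) (dl (LO F))"
 "!!X a v. X : Ob ==> a : cr (GA X) ==> v : car F (1+(1+X)) ==>
 nt h X (bk (tau one1 F) X a v) = dp one1 (LO F) X (bk F (1+X) (Am (st one1 X) a) (act F (swp X) v))"
proof -
 note o = obj1_nat
 let ?T = "tau one1 F"
 note T = tau(1)[OF o F] and L = LO_in[OF F]
 note D = delta(1)[OF o L]
 have TF: "FO ?T (1+X) = FO F (1+(1+X))" if "X : Ob" for X using tau(2)[OF o F X1[OF that]] .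
 have "EX f. f : linear_maps R (FO (LO ?T) X) (FO (LO F) (1+X)) & (ALL a : cr (GA X). ALL v : car F (1+(1+X)).
 f (bk ?T X a v) = bk F (1+X) (Am (st one1 X) a) (act F (swp X) v))" if X: "X : Ob" for X
 proof -
 note s = st_UG[OF o X] and w = swp_in[OF X]
 have sl: "lin R (FO ?T (1+X)) (FO F (1+(1+X))) (act F (swp X))" unfolding TF[OF X] by (rule act_lin[OF F w])
 \<comment> \<open>Reliability in action: \<open>swp\<close> intertwines the two actions of
   a.\<close>
 have eq: "act F (swp X) (ca ?T X a v) = ca F (1+X) (Am (st one1 X) a) (act F (swp X) v)"
 if a: "a : cr (GA X)" and v: "v : car ?T (1+X)" for a v
 proof -
 note c = chi_facts(1)[OF X a] and v' = v[unfolded TF[OF X]]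
 note c' = chi_facts(1)[OF X1[OF X] Am_closed[OF s a]]
 show ?thesis unfolding ca_eq tau(3)[OF o F c] act_Comp[OF F sh_UG[OF o c] w v', symmetric] swp_cl[OF X a] by (rule act_Comp[OF F w c' v'])
 qed
 note t = tens_map[where ph = "Am (st one1 X)" and ps = "act F (swp X)" and \<kappa> = "group_ring_map R (Am (st one1 X))"
 and rh = "ca ?T X" and rh' = "ca F (1+X)", OF sga[OF T X] sga[OF F X1[OF X]] Am_hom[OF s, THEN conjunct2] sl eq refl]
 obtain f where f: "tens_map_spec R (GA X) (FO ?T (1+X)) (ca ?T X) (GA (1+X)) (FO F (1+(1+X))) (ca F (1+X))
 (group_ring_map R (Am (st one1 X))) (act F (swp X)) f" using ex1_implies_ex[OF t(1)] by blast
 have "f : linear_maps R (FO (LO ?T) X) (FO (LO F) (1+X))" using f unfolding tens_map_spec_def LO_FO[OF X] LO_FO[OF X1[OF X]] LMm_eq by blast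
 moreover have "f (bk ?T X a v) = bk F (1+X) (Am (st one1 X) a) (act F (swp X) v)"
 if a: "a : cr (GA X)" and v: "v : car F (1+(1+X))" for a v unfolding bk_def by (rule t(2)[OF _ _ f a v[folded TF[OF X]]])
 ultimately show ?thesis by blast qed
 then obtain f where f: "!!X. X : Ob ==> f X : linear_maps R (FO (LO ?T) X) (FO (LO F) (1+X))"
 and fb: "!!X a v. X : Ob ==> a : cr (GA X) ==> v : car F (1+(1+X)) ==>
 f X (bk ?T X a v) = bk F (1+X) (Am (st one1 X) a) (act F (swp X) v)" by metis
 have fl: "lin R (FO (LO ?T) X) (FO (LO F) (1+X)) (f X)" if "X : Ob" for X using f[OF that] by (simp add: lmaps_iff)
 let ?h = "mk_nt (LO ?T) (%X x. dp one1 (LO F) X (f X x)) (dl (LO F))"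
 have h: "?h : RHom (LO ?T) (dl (LO F))"
 proof (rule mk_nt_in[OF LO_in[OF T] D])
 show dl: "lin R (FO (LO ?T) X) (FO (dl (LO F)) X) (%x. dp one1 (LO F) X (f X x))" if "X : Ob" for X by (rule lin_comp[OF fl[OF that] delta(2)[OF o L that]])
 fix X Y ph x assume ph: "ph : Hom X Y" and x: "x : car (LO ?T) X"
 have X: "X : Ob" "Y : Ob" using U.ends[OF ph] by auto
 note s = sh_UG[OF o ph]
 note ss = sh_UG[OF o s]
 have "f Y (act (LO ?T) ph x) = act (LO F) (sh one1 ph) (f X x)"
 proof (rule LM_lin_eq[OF T X(1) rep_mod[OF L X1[OF X(2)]] lin_comp[OF act_lin[OF LO_in[OF T] ph] fl[OF X(2)]]
 lin_comp[OF fl[OF X(1)] act_lin[OF L s]] _ x])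
 fix a v assume a: "a : cr (GA X)" and v: "v : car ?T (1+X)"
 note v' = v[unfolded TF[OF X(1)]]
 have e1: "act (LO ?T) ph (bk ?T X a v) = bk ?T Y (Am ph a) (act F (sh one1 (sh one1 ph)) v)" unfolding LO_act[OF T ph a v] tau(3)[OF o F s] ..
 have e2: "act F (swp Y) (act F (sh one1 (sh one1 ph)) v) = act F (sh one1 (sh one1 ph)) (act F (swp X) v)"
 unfolding act_Comp[OF F ss swp_in[OF X(2)] v', symmetric] swp_nat[OF ph] by (rule act_Comp[OF F swp_in[OF X(1)] ss v'])
 have e3: "Am (st one1 Y) (Am ph a) = Am (sh one1 ph) (Am (st one1 X) a)"
 unfolding Am_Comp[OF ph st_UG[OF o X(2)] a, symmetric] st_nat_UG[OF o ph, symmetric] by (rule Am_Comp[OF st_UG[OF o X(1)] s a])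
 show "f Y (act (LO ?T) ph (bk ?T X a v)) = act (LO F) (sh one1 ph) (f X (bk ?T X a v))"
 unfolding e1 fb[OF X(2) Am_closed[OF ph a] act_cl[OF F ss v']] e2 e3 fb[OF X(1) a v']
 by (rule LO_act[OF F s Am_closed[OF st_UG[OF o X(1)] a] act_cl[OF F swp_in[OF X(1)] v'], symmetric]) qed
 thus "dp one1 (LO F) Y (f Y (act (LO ?T) ph x)) = act (dl (LO F)) ph (dp one1 (LO F) X (f X x))"
 using delta(5)[OF o L ph lin_cl[OF fl[OF X(1)] x]] by simp qed
 have "nt ?h X (bk ?T X a v) = dp one1 (LO F) X (bk F (1+X) (Am (st one1 X) a) (act F (swp X) v))"
 if "X : Ob" "a : cr (GA X)" "v : car F (1+(1+X))" for X a v
 unfolding fb[OF that, symmetric] by (rule nt_mk_nt[OF that(1) bk_closed[OF T that(1,2) that(3)[folded TF[OF that(1)]]]])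
 with h show thesis by (rule that)
qed

text \<open>For a compatible family of group elements j, v goes to the class of (j - 1) tensor v. As
  j is fixed under translated arrows, this is natural on the double translation, with no tensor
  product in the source.\<close>

lemma LM_letter: assumes F: "F : ObR" and j: "!!X. X : Ob ==> j X : cr (GA (1+X))" "!!X Y ph. ph : Hom X Y ==> Am (sh one1 ph) (j X) = j Y"
 shows "mk_nt (tau one1 (tau one1 F)) (%X v. dp one1 (LO F) X (bk F (1+X) (j X) v)) (dl (LO F)) : RHom (tau one1 (tau one1 F)) (dl (LO F))"
proof -
 note o = obj1_nat
 note T = tau(1)[OF o F] and L = LO_in[OF F]
 have TF: "FO (tau one1 (tau one1 F)) X = FO F (1+(1+X))" if "X : Ob" for X using tau(2)[OF o T that] tau(2)[OF o F X1[OF that]] by simp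
 show ?thesis
 proof (rule mk_nt_in[OF tau(1)[OF o T] delta(1)[OF o L]])
 show "lin R (FO (tau one1 (tau one1 F)) X) (FO (dl (LO F)) X) (%v. dp one1 (LO F) X (bk F (1+X) (j X) v))" if X: "X : Ob" for X
 unfolding TF[OF X] by (rule lin_comp[OF bk(2)[OF F X1[OF X] j(1)[OF X]] delta(2)[OF o L X]])
 fix X Y ph v assume ph: "ph : Hom X Y" and v: "v : car (tau one1 (tau one1 F)) X"
 have X: "X : Ob" "Y : Ob" using U.ends[OF ph] by auto
 note s = sh_UG[OF o ph] and v' = v[unfolded TF[OF X(1)]]
 have a: "act (tau one1 (tau one1 F)) ph v = act F (sh one1 (sh one1 ph)) v" unfolding tau(3)[OF o T ph] tau(3)[OF o F s] ..
 show "dp one1 (LO F) Y (bk F (1+Y) (j Y) (act (tau one1 (tau one1 F)) ph v)) =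
 act (dl (LO F)) ph (dp one1 (LO F) X (bk F (1+X) (j X) v))"
 unfolding a delta(5)[OF o L ph bk_closed[OF F X1[OF X(1)] j(1)[OF X(1)] v']] LO_act[OF F s j(1)[OF X(1)] v'] j(2)[OF ph] .. qed
qed

text \<open>Induction on the degree of F. The difference of \<open>LM F\<close> is generated by
  letters of H, which contribute double translations of F, and by elements coming from X, which
  contribute \<open>LM\<close> of the translation modulo \<open>LM F\<close>, a subobject of
  \<open>LM\<close> of the difference.\<close>

lemma LM_polp: "F : polp n ==> LO F : polp (Suc n)"
proof (induction n arbitrary: F)
 case 0 hence "LO F : polp 0" using LM_Kset by simp thus ?case using polp_mono by blast
next
 case (Suc n)
 have F: "F : ObR" by (rule polp_Obj[OF Suc.prems])
 note o = obj1_nat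
 let ?T = "tau one1 F" and ?L = "LO F"
 note T = tau(1)[OF o F] and L = LO_in[OF F]
 note D = delta(1)[OF o L]
 have TT: "tau one1 ?T : polp (Suc n)" by (rule polp_tau1[OF polp_tau1[OF Suc.prems]])
 have TTF: "FO (tau one1 ?T) X = FO F (1+(1+X))" if "X : Ob" for X using tau(2)[OF o T that] tau(2)[OF o F X1[OF that]] by simp
 have LD: "LO (dl F) : polp (Suc n)" using Suc by simp
 obtain i p where ip: "i : RHom F ?T" "p : RHom ?T (dl F)" "p o[Rep] i = zmap F (dl F)"
 "!!X x. X : Ob ==> x : car F X ==> nt i X x = act F (st one1 X) x"
 "!!X x. X : Ob ==> x : car ?T X ==> nt p X x = 0[FO (dl F) X] ==> x : nt i X ` car F X" by (rule tau_seq[OF F]) blast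
 note li = LA(1)[OF ip(1)]
 \<comment> \<open>This cokernel embeds into \<open>LM\<close> of the difference of F, to which the
   induction hypothesis applies.\<close>
 have C: "Coker (LA i) : polp (Suc n)" by (rule LM_Coker_mono[OF ip(1,2,3,5) LD])
 obtain h where h: "h : RHom (LO ?T) (dl ?L)" and hb: "!!X a v. X : Ob ==> a : cr (GA X) ==> v : car F (1+(1+X)) ==>
 nt h X (bk ?T X a v) = dp one1 ?L X (bk F (1+X) (Am (st one1 X) a) (act F (swp X) v))" by (rule LM_tau[OF F]) blast
 \<comment> \<open>On elements coming from F, \<open>swp\<close> turns the front stabilisation into
   the translated one, and the result is a stabilised element of \<open>LM F\<close>, zero in the
   difference. So h descends to the cokernel of \<open>LA i\<close>.\<close>
 have "h o[Rep] LA i = zmap ?L (dl ?L)"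
 proof (rule LA_eqI[OF F Rep.Comp_in[OF li h] zmap_in[OF L D]])
 fix X a v assume X: "X : Ob" and a: "a : cr (GA X)" and v: "v : car F (1+X)"
 note X' = X1[OF X] and s = st_UG[OF o X] and b = bk_closed[OF F X a v]
 note s1 = act_cl[OF F st_UG[OF o X'] v]
 have sw: "act F (swp X) (act F (st one1 (1+X)) v) = act F (sh one1 (st one1 X)) v"
 unfolding act_Comp[OF F st_UG[OF o X'] swp_in[OF X] v, symmetric] swp_st[OF X] ..
 have "nt (h o[Rep] LA i) X (bk F X a v) = dp one1 ?L X (act ?L (st one1 X) (bk F X a v))"
 unfolding nt_Comp[OF li h X b] LA(2)[OF ip(1) X a v] ip(4)[OF X' v] hb[OF X a s1] sw LO_act[OF F s a v] ..
 also have "... = 0[FO (dl ?L) X]" using delta(4)[OF o L X act_cl[OF L s b]] b by blast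
 finally show "nt (h o[Rep] LA i) X (bk F X a v) = nt (zmap ?L (dl ?L)) X (bk F X a v)" using nt_mk_nt[OF X b] by simp qed
 then obtain g where g: "g : RHom (Coker (LA i)) (dl ?L)" "g o[Rep] coker_pr (LA i) = h" using coker_factor[OF li h] by blast
 note cp = coker_in[OF li]
 obtain jm where j: "!!X a. X : Ob ==> a : cr H ==> jm X a : cr (GA (1+X))"
 "!!X Y ph a. ph : Hom X Y ==> a : cr H ==> Am (sh one1 ph) (jm X a) = jm Y a"
 "!!X. X : Ob ==> is_free_product H (GA X) (GA (1+X)) (jm X) (Am (st one1 X))" by (rule letters) blast
 define k where "k a = mk_nt (tau one1 ?T) (%X v. dp one1 ?L X (bk F (1+X) (jm X a) v)) (dl ?L)" for a
 have k: "k a : RHom (tau one1 ?T) (dl ?L)" if "a : cr H" for a unfolding k_def by (rule LM_letter[OF F j(1)[OF _ that] j(2)[OF _ that]])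
 have kn: "nt (k a) X v = dp one1 ?L X (bk F (1+X) (jm X a) v)" if "X : Ob" "v : car F (1+(1+X))" for a X v
 unfolding k_def by (rule nt_mk_nt[OF that(1) that(2)[folded TTF[OF that(1)]]])
 \<comment> \<open>One map from the cokernel, and one from the double translation for each element
   of H.\<close>
 let ?A = "insert g (k ` cr H)"
 have A: "f : RHom (Dom Rep f) (dl ?L) & Dom Rep f : polp (Suc n)" if "f : ?A" for f using that HomsD[OF g(1)] g(1) C HomsD[OF k] k TT by auto
 have "dl ?L : polp (Suc n)"
 proof (rule polp_joint[OF D, of ?A])
 have A1: "f : Arr Rep" "Cod Rep f = dl ?L" if f: "f : ?A" for f using HomsD[OF conjunct1[OF A[OF f]]] by simp_all
 show AA: "?A <= Arr Rep" by (rule subsetI) (rule A1(1))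
 show "Cod Rep f = dl ?L" "Dom Rep f : polp (Suc n)" if f: "f : ?A" for f using A1(2)[OF f] A[OF f] by simp_all
 fix X y assume X: "X : Ob" and y: "y : car (dl ?L) X"
 note X' = X1[OF X]
 let ?G = "gens ?A X"
 interpret G: group "GA (1+X)" by (rule GA_group[OF X'])
 interpret P: rmod R "FO (dl ?L) X" by (rule rmodI[OF rep_mod[OF D X]])
 interpret M: rmod R "FO ?L (1+X)" by (rule rmodI[OF rep_mod[OF L X']])
 have Gc: "?G <= car (dl ?L) X" by (rule gens_closed[OF AA A1(2) X])
 have gen: "nt f X z : aspan (FO (dl ?L) X) ?G" if "f : ?A" "z : car (Dom Rep f) X" for f z
 by (rule P.aspan_base[OF Gc]) (use that in \<open>auto simp only: gens_def\<close>)
 note dpl = delta(2)[OF o L X]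
 \<comment> \<open>Since cx - 1 = (c - 1)x + (x - 1), the set of c whose terms are generated is
   closed under products, so it is enough to treat the two free factors.\<close>
 have br: "ALL v : car F (1+(1+X)). dp one1 ?L X (bk F (1+X) c v) : aspan (FO (dl ?L) X) ?G" (is "?P c")
 if c: "c : cr (GA (1+X))" for c
 proof (rule free_product_gen[OF j(3)[OF X] G.group_axioms c, of ?P])
 show "?P 1[GA (1+X)]" using bk(4)[OF F X'] M.lin_zero[OF P.module_axioms dpl] aspan_zero[of "FO (dl ?L) X" ?G] by simp
 have step: "?P (b *[GA (1+X)] x)" if b: "b : cr (GA (1+X))" "?P b" and x: "x : cr (GA (1+X))" "?P x" for b x
 proof
 fix v assume v: "v : car F (1+(1+X))"
 note v' = act_cl[OF F chi_facts(1)[OF X' x(1)] v]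
 show "dp one1 ?L X (bk F (1+X) (b *[GA (1+X)] x) v) : aspan (FO (dl ?L) X) ?G"
 unfolding bk(3)[OF F X' b(1) x(1) v] lin_add[OF dpl bk_closed[OF F X' b(1) v'] bk_closed[OF F X' x(1) v]]
 by (rule P.aspan_plus[OF Gc]) (use b(2) x(2) v v' in blast)+ qed
 show "?P (jm X a *[GA (1+X)] x)" if a: "a : cr H" and x: "x : cr (GA (1+X))" "?P x" for a x
 proof (rule step[OF j(1)[OF X a] _ x])
 show "?P (jm X a)"
 proof
 fix v assume v: "v : car F (1+(1+X))"
 show "dp one1 ?L X (bk F (1+X) (jm X a) v) : aspan (FO (dl ?L) X) ?G"
 unfolding kn[OF X v, symmetric] by (rule gen) (use a v HomsD[OF k[OF a]] TTF[OF X] in simp_all) qed qed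
 show "?P (Am (st one1 X) b *[GA (1+X)] x)" if b: "b : cr (GA X)" and x: "x : cr (GA (1+X))" "?P x" for b x
 proof (rule step[OF Am_closed[OF st_UG[OF o X] b] _ x])
 show "?P (Am (st one1 X) b)"
 proof
 fix v assume v: "v : car F (1+(1+X))"
 \<comment> \<open>\<open>swp\<close> is invertible, so every v occurs as the second factor in the
   formula for h.\<close>
 obtain ps where s: "ps : Hom (1+(1+X)) (1+(1+X))" "swp X o[UB] ps = Id UB (1+(1+X))" using swp_inv[OF X] .
 note w = act_cl[OF F s(1) v]
 have "act F (swp X) (act F ps v) = v" unfolding act_Comp[OF F s(1) swp_in[OF X] v, symmetric] s(2) by (rule act_Id[OF F X1[OF X'] v])
 hence e: "dp one1 ?L X (bk F (1+X) (Am (st one1 X) b) v) = nt h X (bk ?T X b (act F ps v))" using hb[OF X b w] by simp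
 have b': "bk ?T X b (act F ps v) : car (LO ?T) X" by (rule bk_closed[OF T X b]) (use w tau(2)[OF o F X'] in simp)
 show "dp one1 ?L X (bk F (1+X) (Am (st one1 X) b) v) : aspan (FO (dl ?L) X) ?G"
 unfolding e g(2)[symmetric] nt_Comp[OF cp g(1) X b'] by (rule gen) (use nt_cl[OF cp X b'] HomsD[OF g(1)] in simp_all) qed qed qed
 have "aspan (FO ?L (1+X)) {bk F (1+X) c v |c v. c : cr (GA (1+X)) & v : car F (1+(1+X))}
 <= {z : car ?L (1+X). dp one1 ?L X z : aspan (FO (dl ?L) X) ?G}"
 proof (rule M.aspan_subset)
 show "{bk F (1+X) c v |c v. c : cr (GA (1+X)) & v : car F (1+(1+X))}
 <= {z : car ?L (1+X). dp one1 ?L X z : aspan (FO (dl ?L) X) ?G}" using br bk_closed[OF F X'] by blast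
 show "0[FO ?L (1+X)] : {z : car ?L (1+X). dp one1 ?L X z : aspan (FO (dl ?L) X) ?G}"
 using M.lin_zero[OF P.module_axioms dpl] aspan_zero[of "FO (dl ?L) X" ?G] by simp
 show "z +[FO ?L (1+X)] z' : {z : car ?L (1+X). dp one1 ?L X z : aspan (FO (dl ?L) X) ?G}"
 if "z : {z : car ?L (1+X). dp one1 ?L X z : aspan (FO (dl ?L) X) ?G}" "z' : {z : car ?L (1+X). dp one1 ?L X z : aspan (FO (dl ?L) X) ?G}" for z z'
 using that lin_add[OF dpl, of z z'] P.aspan_plus[OF Gc] by simp qed
 moreover obtain z where z: "z : car ?L (1+X)" "y = dp one1 ?L X z" using y unfolding delta(3)[OF o L X, symmetric] by blast
 ultimately have "y : aspan (FO (dl ?L) X) ?G" using bk(6)[OF F X'] by blast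
 thus "EX Y. EX ph : Hom X Y. act (dl ?L) ph y : aspan (FO (dl ?L) Y) (gens ?A Y)"
 using act_Id[OF D X y] by (intro exI[of _ X] bexI[OF _ U.Id_in_Homs[OF X]]) simp qed thus ?case using L by simp
qed

text \<open>Each induced functor comes from a universal property of a localisation, once
  \<open>LM\<close> is seen to send inverted arrows to inverted ones: first \<open>Wset\<close>,
  then the arrows inverted modulo the lower degree.\<close>

lemma LM_induces:
 "FO (LM R B \<A> \<chi>) ` (K_objs R B :: ('o, 'm, 'r, 'u) rep set) <= K_objs R B
 & (EX LSt. cfunctor (St R B) (St R B) LSt
 & agree_on Rep (ftor_comp LSt (quotient_functor Rep (K_objs R B))) (ftor_comp (quotient_functor Rep (K_objs R B)) (LM R B \<A> \<chi>))
 & cfunctor (Pol_cat R B (int d)) (Pol_cat R B (int d + 1)) LSt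
 & (EX \<Phi>. cfunctor (Pol_quotient R B (int d)) (Pol_quotient R B (int d + 1)) \<Phi>
 & agree_on (Pol_cat R B (int d)) (ftor_comp \<Phi> (Pol_quotient_functor R B (int d)))
 (ftor_comp (Pol_quotient_functor R B (int d + 1)) LSt)))"
proof -
 let ?q = "localisation_functor Rep Wset" and ?C = "full LS (polp (Suc d))" and ?C' = "full LS (polp (Suc (Suc d)))"
 let ?S = "isos_mod ?C (polp d)" and ?S' = "isos_mod ?C' (polp (Suc d))"
 let ?q' = "localisation_functor ?C' ?S'" and ?D = "localisation ?C' ?S'"
 have K: "FO (LM R B \<A> \<chi>) ` (K_objs R B :: ('o, 'm, 'r, 'u) rep set) <= K_objs R B" unfolding K_objs_eq FO_LM using LM_Kset by blast
 have F0: "cfunctor Rep LS (ftor_comp ?q (LM R B \<A> \<chi>))" by (rule cfunctor_ftor_comp[OF cfunctor_LM cfunctor_q])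
 obtain LSt where LSt: "cfunctor LS LS LSt" "agree_on Rep (ftor_comp LSt ?q) (ftor_comp ?q (LM R B \<A> \<chi>))"
 using cfunctor.loc_universal[OF F0 _ W_Arr] qf_inv[OF LM_Wset] by auto
 interpret LSt: cfunctor LS LS LSt by fact
 have LO: "FO LSt F = LO F" if "F : ObR" for F using LSt(2) that by (simp add: agree_on_def FO_LM)
 have LA': "FA LSt (qf f) = qf (LA f)" if "f : RHom F G" for f F G using LSt(2) HomsD[OF that] by (simp add: agree_on_def)
 have CC: "cfunctor ?C ?C' LSt"
 proof (rule LSt.cfunctor_full)
 fix F assume F: "F : polp (Suc d)" "F : Obj LS"
 thus "FO LSt F : polp (Suc (Suc d))" using LM_polp[OF F(1)] LO[of F] unfolding Obj_LS by simp qed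
 have cC': "category ?C'" by (rule LS.category_full)
 have q': "cfunctor ?C' ?D ?q'" by (rule cfunctor_localisation_functor[OF cC'])
 interpret q': cfunctor ?C' ?D ?q' by fact
 have S': "?S' <= Arr ?C'" by (auto simp: isos_mod_def)
 have G0: "cfunctor ?C ?D (ftor_comp ?q' LSt)" by (rule cfunctor_ftor_comp[OF CC q'])
 \<comment> \<open>s is a quotient of an honest a by t. \<open>LM\<close> keeps t invertible, and by
   exactness and the degree bound the kernel and cokernel of \<open>LM a\<close> have degree one
   higher than those of a.\<close>
 have inv: "invble ?D (FA (ftor_comp ?q' LSt) s)" if s: "s : ?S" for s
 proof -
 obtain F G P t a where st: "s : SHom F G" "F : polp (Suc d)" "G : polp (Suc d)" "t : RHom P F" "t : Wset" "a : RHom P G"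
 "s o[LS] qf t = qf a" "P : polp (Suc d)" "Ker a : polp d" "Coker a : polp d" using isos_mod_fraction[OF s] .
 note L = LM_polp[OF st(2)] LM_polp[OF st(3)] LM_polp[OF st(8)]
 note t = LA(1)[OF st(4)] and a = LA(1)[OF st(6)]
 have qa: "qf (LA a) : ?S'" by (rule qf_isos_mod[OF a L(3,2) LM_Ker[OF st(6) LM_polp[OF st(9)]] LM_Coker[OF st(6) LM_polp[OF st(10)]]])
 have ia: "invble ?D (FA ?q' (qf (LA a)))" by (rule localisation_invertible[OF cC' qa S'])
 have tH: "qf (LA t) : Homs ?C' (LO P) (LO F)" unfolding Homs_full[OF L(3,1)] by (rule qf_in[OF t])
 have "invble ?C' (qf (LA t))"
 using qf_inv[OF LM_Wset[OF st(5)]] inverse_arrows_full[OF full_ArrI[OF qf_in[OF t] L(3,1)]] unfolding invble_def by blast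
 hence it: "invble ?D (FA ?q' (qf (LA t)))" by (rule q'.FA_invertible)
 have sH: "FA LSt s : SHom (LO F) (LO G)" using LSt.FA_in_Homs[OF st(1)] by (simp add: LO polp_Obj[OF st(2)] polp_Obj[OF st(3)])
 have sH': "FA LSt s : Homs ?C' (LO F) (LO G)" unfolding Homs_full[OF L(1,2)] by (rule sH)
 have "FA LSt s o[LS] qf (LA t) = qf (LA a)"
 unfolding LA'[OF st(4), symmetric] LA'[OF st(6), symmetric] LSt.FA_Comp[OF qf_in[OF st(4)] st(1), symmetric] st(7) ..
 hence e: "FA ?q' (FA LSt s) o[?D] FA ?q' (qf (LA t)) = FA ?q' (qf (LA a))" using q'.FA_Comp[OF tH sH'] by simp
 note qt = q'.FA_in_Homs[OF tH] and qs = q'.FA_in_Homs[OF sH']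
 note i = q'.target.Inv_Homs[OF it qt]
 have "FA ?q' (FA LSt s) = FA ?q' (qf (LA a)) o[?D] Inv ?D (FA ?q' (qf (LA t)))"
 unfolding e[symmetric] q'.target.Comp_assoc[OF i qt qs] q'.target.Inv_right[OF it qt] by (rule q'.target.Comp_Id_right[OF qs, symmetric])
 moreover have "invble ?D (FA ?q' (qf (LA a)) o[?D] Inv ?D (FA ?q' (qf (LA t))))"
 using q'.target.invertible_Comp[OF i _ q'.target.invertible_Inv_invertible[OF it] ia] q'.target.Comp_in[OF qt qs] unfolding e by blast
 ultimately show ?thesis by simp qed
 have "?S <= Arr ?C" by (auto simp: isos_mod_def)
 from cfunctor.loc_universal[OF G0 inv this]
 obtain \<Phi> where Phi: "cfunctor (localisation ?C ?S) ?D \<Phi>" "agree_on ?C (ftor_comp \<Phi> (localisation_functor ?C ?S)) (ftor_comp ?q' LSt)" by blast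
 \<comment> \<open>The degrees d + 1, d and d - 1 become the indices d + 2, d + 1 and d of
   \<open>polp\<close>.\<close>
 have P: "Pol R B (int d) = polp (Suc d)" "Pol R B (int d + 1) = polp (Suc (Suc d))" "Pol R B (int d - 1) = polp d" "Pol R B (int d + 1 - 1) = polp (Suc d)"
 using Pol_eq[of "Suc d"] Pol_eq[of "Suc (Suc d)"] Pol_eq[of d] by (simp_all del: polp.simps add: add.commute)
 show ?thesis unfolding quotient_functor_eq P St_eq isos_mod_eq unfolding quotient_cat_def using K LSt CC Phi by blast
qed

end

theorem proposition6p6:
  fixes R :: "'r ring"
    and B :: "('o, 'm) pointed_braided"
    and \<A> :: "('o, 'm, 'g) group_ftor"
    and \<chi> :: "('o, 'g \<times> 'm, 'o, 'm) ftor"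
    and H H0 :: "'g monoid"
    and d :: nat
  defines "L \<equiv> (LM R B \<A> \<chi> :: (('o, 'm, 'r, 'u) rep, ('o, 'm, 'r, 'u) rep_arr,
                                ('o, 'm, 'r, 'u) rep, ('o, 'm, 'r, 'u) rep_arr) ftor)"
  assumes "cring R" and "\<one>\<^bsub>R\<^esub> \<noteq> \<zero>\<^bsub>R\<^esub>"
    and "long_moody_setting B"
    and "reliable B \<A> \<chi> H H0"
    and "free_group H" and "free_group H0"
    and "infinite (UNIV :: 'u set)"
    and "carrier R \<lesssim> (UNIV :: 'u set)"
    and "\<And>n. carrier (FO \<A> (uobj B n)) \<lesssim> (UNIV :: 'u set)"
  shows "cfunctor (Reps R B) (Reps R B) L
    \<and> FO L ` K_objs R B \<subseteq> K_objs R B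
    \<and> (\<exists>LSt. cfunctor (St R B) (St R B) LSt
        \<and> agree_on (Reps R B)
            (ftor_comp LSt (quotient_functor (Reps R B) (K_objs R B)))
            (ftor_comp (quotient_functor (Reps R B) (K_objs R B)) L)
        \<and> cfunctor (Pol_cat R B (int d)) (Pol_cat R B (int d + 1)) LSt
        \<and> (\<exists>\<Phi>. cfunctor (Pol_quotient R B (int d)) (Pol_quotient R B (int d + 1)) \<Phi>
            \<and> agree_on (Pol_cat R B (int d))
                (ftor_comp \<Phi> (Pol_quotient_functor R B (int d)))
                (ftor_comp (Pol_quotient_functor R B (int d + 1)) LSt)))"
proof -
  \<comment> \<open>Reliability provides a functor defined on \<open>UG' B\<close>, and being a
    functor includes that its source is a category.\<close>
  have "category (UG' B)" using assms(5) by (auto simp: reliable_def cfunctor_def)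
  then interpret lm_system B R "TYPE('u)" \<A> \<chi> H H0
    using assms unfolding lm_setting_axioms_def lm_system_def lm_system_axioms_def rep_setting_def rep_setting_axioms_def lm_setting_def by blast
  show ?thesis unfolding L_def using cfunctor_LM LM_induces by blast
qed

end
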